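(* Let $T_K$ be a bi-parameter Calderón-Zygmund operator on $\mathbb{R}^n\times\mathbb{R}^m$. Let $\alpha\in\mathbb{R}$, $1<p_0<p,q<\infty$ (that is, $1<p_0<p<\infty$ and $p_0<q<\infty$), $0<\lambda<\min\{\alpha+n/p,\alpha+m/p\}$, and $$\max\left\{-\frac np,-\frac mp\right\}<\alpha<\min\left\{n\left(\frac1{p_0}-\frac1p\right),m\left(\frac1{p_0}-\frac1p\right)\right\}.$$ Then $T_K$ can be extended to a bounded (linear) operator on $M\vec{\dot K}_{p,q}^{\alpha,\lambda}(\mathbb{R}^n\times\mathbb{R}^m)$. Furthermore, there is a constant $C>0$ such that, for this extension, still denoted $T_K$, and all sequences $(f_i)_{i\in\mathbb{N}}$ in $M\vec{\dot K}_{p,q}^{\alpha,\lambda}(\mathbb{R}^n\times\mathbb{R}^m)$, $$\left\|\Big(\sum_{i\in\mathbb{N}}|T_Kf_i|^{p_0}\Big)^{1/p_0}\right\|_{M\vec{\dot K}_{p,q}^{\alpha,\lambda}(\mathbb{R}^n\times\mathbb{R}^m)}\le C\left\|\Big(\sum_{i\in\mathbb{N}}|f_i|^{p_0}\Big)^{1/p_0}\right\|_{M\vec{\dot K}_{p,q}^{\alpha,\lambda}(\mathbb{R}^n\times\mathbb{R}^m)}.$$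
   Context: $n,m$ are positive integers. A bi-parameter Calderón-Zygmund operator is $T_Kf=f*K$ (convolution on $\mathbb{R}^n\times\mathbb{R}^m$, understood in the principal value sense, initially for smooth compactly supported $f$: $T_Kf(x,y)=\lim_{\varepsilon_1,\varepsilon_2\to0}\int_{|x'|>\varepsilon_1,|y'|>\varepsilon_2}f(x-x',y-y')K(x',y')\,dx'dy'$), where the kernel $K$ satisfies: (a) for each $y\in\mathbb{R}^m\setminus\{0\}$ and $0<a<b$, $\int_{a<|x|<b}K(x,y)\,dx=0$; and for each $x\in\mathbb{R}^n\setminus\{0\}$ and $0<a<b$, $\int_{a<|y|<b}K(x,y)\,dy=0$; (b) $|K(x,y)|\le C|x|^{-n}|y|^{-m}$ for $x\in\mathbb{R}^n\setminus\{0\}$, $y\in\mathbb{R}^m\setminus\{0\}$; (c) there is $\eta>0$ such that for $|x|>2|h|$, $y\ne0$: $|K(x+h,y)-K(x,y)|\le C|y|^{-m}(|h|/|x|)^\eta|x|^{-n}$; and for $|y|>2|k|$, $x\neq0$: $|K(x,y+k)-K(x,y)|\le C|x|^{-n}(|k|/|y|)^\eta|y|^{-m}$; (d) for $|x|>2|h|$ and $|y|>2|k|$, with $\Delta_h^1K(x,y)=K(x+h,y)-K(x,y)$ and $\Delta_k^2K(x,y)=K(x,y+k)-K(x,y)$: $|\Delta_k^2\Delta_h^1K(x,y)|\le C|x|^{-n}|y|^{-m}\left(\frac{|h|}{|x|}\frac{|k|}{|y|}\right)^\eta$ with the same $\eta$ as in (c). For $k\in\mathbb{Z}$, $Q_k$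 is the cube (in $\mathbb{R}^n$ or $\mathbb{R}^m$) centered at the origin with side length $2^k$; $R_{i,j}=Q_i\times Q_j$; $I_i=Q_i\setminus Q_{i-1}\subset\mathbb{R}^n$, $J_j=Q_j\setminus Q_{j-1}\subset\mathbb{R}^m$; $\chi_{i,j}$ is the characteristic function of $I_i\times J_j$. For measurable $f$ (norms may be $+\infty$), $$\|f\|_{\vec{\dot K}_{p,q}^{\alpha}}=\Big(\sum_{i,j\in\mathbb{Z}}2^{(i+j)q\alpha}\|f\chi_{i,j}\|_{L^p(\mathbb{R}^n\times\mathbb{R}^m)}^q\Big)^{1/q},\qquad \|f\|_{M\vec{\dot K}_{p,q}^{\alpha,\lambda}}=\sup_{L_1,L_2\in\mathbb{Z}}2^{-(L_1+L_2)\lambda}\|f\chi_{R_{L_1,L_2}}\|_{\vec{\dot K}_{p,q}^{\alpha}}.$$ The product Morrey-Herz space $M\vec{\dot K}_{p,q}^{\alpha,\lambda}$ consists of all $f\in L^p_{\mathrm{loc}}((\mathbb{R}^n\setminus\{0\})\times(\mathbb{R}^m\setminus\{0\}))$ with $\|f\|_{M\vec{\dot K}_{p,q}^{\alpha,\lambda}}<\infty$. *)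

theory Defs
  imports "HOL-Analysis.Analysis"
begin

section \<open>Test functions\<close>

fun Ck :: "nat \<Rightarrow> ('a::euclidean_space \<Rightarrow> 'b::real_normed_vector) \<Rightarrow> bool" where
  "Ck 0 f = continuous_on UNIV f"
| "Ck (Suc k) f \<longleftrightarrow>
     (\<forall>x. f differentiable (at x)) \<and> (\<forall>v. Ck k (\<lambda>x. frechet_derivative f (at x) v))"

definition smooth_compact :: "('a::euclidean_space \<Rightarrow> 'b::real_normed_vector) \<Rightarrow> bool" where
  "smooth_compact f \<longleftrightarrow> (\<forall>k. Ck k f) \<and> compact (closure {x. f x \<noteq> 0})"


section \<open>Bi-parameter Calderon-Zygmund operators\<close>

text \<open>
  The values of \<open>K\<close> on the axes \<open>x = 0\<close> and \<open>y = 0\<close> never matter. The pointwise conditions force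
  \<open>K\<close> to be continuous off the axes, so the Bochner integrals below are over integrable functions
  and no measurability hypothesis is needed.
\<close>

definition bi_CZ_kernel :: "(real^'n \<Rightarrow> real^'m \<Rightarrow> complex) \<Rightarrow> bool" where
  "bi_CZ_kernel K \<longleftrightarrow>
     (\<forall>y a b. y \<noteq> 0 \<longrightarrow> 0 < a \<longrightarrow> a < b \<longrightarrow>
        (LINT x:{x. a < norm x \<and> norm x < b}|lborel. K x y) = 0) \<and>
     (\<forall>x a b. x \<noteq> 0 \<longrightarrow> 0 < a \<longrightarrow> a < b \<longrightarrow>
        (LINT y:{y. a < norm y \<and> norm y < b}|lborel. K x y) = 0) \<and>
     (\<exists>C \<eta>. \<eta> > 0 \<and>
        (\<forall>x y. x \<noteq> 0 \<longrightarrow> y \<noteq> 0 \<longrightarrow>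
           norm (K x y) \<le> C / (norm x ^ CARD('n) * norm y ^ CARD('m))) \<and>
        (\<forall>x h y. norm x > 2 * norm h \<longrightarrow> y \<noteq> 0 \<longrightarrow>
           norm (K (x + h) y - K x y)
             \<le> C * (norm h / norm x) powr \<eta> / (norm x ^ CARD('n) * norm y ^ CARD('m))) \<and>
        (\<forall>x y k. norm y > 2 * norm k \<longrightarrow> x \<noteq> 0 \<longrightarrow>
           norm (K x (y + k) - K x y)
             \<le> C * (norm k / norm y) powr \<eta> / (norm x ^ CARD('n) * norm y ^ CARD('m))) \<and>
        (\<forall>x h y k. norm x > 2 * norm h \<longrightarrow> norm y > 2 * norm k \<longrightarrow>
           norm ((K (x + h) (y + k) - K x (y + k)) - (K (x + h) y - K x y))
             \<le> C * (norm h / norm x * (norm k / norm y)) powr \<eta>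
                 / (norm x ^ CARD('n) * norm y ^ CARD('m))))"

definition truncated_conv ::
  "(real^'n \<Rightarrow> real^'m \<Rightarrow> complex) \<Rightarrow> real \<Rightarrow> real
     \<Rightarrow> ((real^'n) \<times> (real^'m) \<Rightarrow> complex) \<Rightarrow> (real^'n) \<times> (real^'m) \<Rightarrow> complex" where
  "truncated_conv K \<epsilon>\<^sub>1 \<epsilon>\<^sub>2 f z =
     (LINT w:{w. norm (fst w) > \<epsilon>\<^sub>1 \<and> norm (snd w) > \<epsilon>\<^sub>2}|lborel. f (z - w) * K (fst w) (snd w))"

text \<open>
  \<open>T\<close> extends the principal value operator with kernel \<open>K\<close>: on test functions the principal value,
  with the two truncation parameters tending to \<open>0\<close> independently, exists and equals \<open>T f\<close>
  almost everywhere.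
\<close>

definition extends_pv ::
  "(((real^'n) \<times> (real^'m) \<Rightarrow> complex) \<Rightarrow> ((real^'n) \<times> (real^'m) \<Rightarrow> complex))
     \<Rightarrow> (real^'n \<Rightarrow> real^'m \<Rightarrow> complex) \<Rightarrow> bool" where
  "extends_pv T K \<longleftrightarrow>
     (\<forall>f. smooth_compact f \<longrightarrow>
        (AE z in lebesgue.
           ((\<lambda>(\<epsilon>\<^sub>1, \<epsilon>\<^sub>2). truncated_conv K \<epsilon>\<^sub>1 \<epsilon>\<^sub>2 f z) \<longlongrightarrow> T f z) (at_right 0 \<times>\<^sub>F at_right 0)))"


section \<open>Product Morrey-Herz spaces\<close>

definition epowr :: "ennreal \<Rightarrow> real \<Rightarrow> ennreal" where \<comment> \<open>meant for positive exponents\<close>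
  "epowr x s = (if x = \<infinity> then \<infinity> else ennreal (enn2real x powr s))"

text \<open>
  The norms are taken of \<open>[0, \<infinity>]\<close>-valued functions, because the \<open>\<ell>\<^sup>p\<close>-sum of a sequence of functions
  may be infinite at some points; the norm of a complex-valued \<open>f\<close> is that of \<open>\<lambda>z. ennreal (norm (f z))\<close>.
\<close>

definition Lp_norm :: "real \<Rightarrow> ('a::euclidean_space \<Rightarrow> ennreal) \<Rightarrow> ennreal" where
  "Lp_norm p F = epowr (\<integral>\<^sup>+ z. epowr (F z) p \<partial>lebesgue) (1 / p)"

definition cube :: "int \<Rightarrow> (real^'n) set" where
  "cube k = {x. \<forall>l. \<bar>x $ l\<bar> \<le> 2 powi k / 2}"

definition shell :: "int \<Rightarrow> (real^'n) set" where
  "shell k = cube k - cube (k - 1)"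

definition herz_norm ::
  "real \<Rightarrow> real \<Rightarrow> real \<Rightarrow> ((real^'n) \<times> (real^'m) \<Rightarrow> ennreal) \<Rightarrow> ennreal" where
  "herz_norm \<alpha> p q F =
     epowr (\<Sum>\<^sub>\<infinity>(i, j)\<in>UNIV.
              ennreal (2 powr (real_of_int (i + j) * q * \<alpha>)) *
              epowr (Lp_norm p (\<lambda>z. F z * indicator (shell i \<times> shell j) z)) q)
           (1 / q)"

definition morrey_herz_norm ::
  "real \<Rightarrow> real \<Rightarrow> real \<Rightarrow> real \<Rightarrow> ((real^'n) \<times> (real^'m) \<Rightarrow> ennreal) \<Rightarrow> ennreal" where
  "morrey_herz_norm \<alpha> lam p q F =
     (SUP (L\<^sub>1, L\<^sub>2)\<in>UNIV.
        ennreal (2 powr (- (real_of_int (L\<^sub>1 + L\<^sub>2) * lam))) *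
        herz_norm \<alpha> p q (\<lambda>z. F z * indicator (cube L\<^sub>1 \<times> cube L\<^sub>2) z))"

definition Lp_loc_off_axes :: "real \<Rightarrow> ((real^'n) \<times> (real^'m) \<Rightarrow> complex) set" where
  "Lp_loc_off_axes p =
     {f. f \<in> borel_measurable lebesgue \<and>
         (\<forall>S. compact S \<longrightarrow> S \<subseteq> (- {0}) \<times> (- {0}) \<longrightarrow>
            Lp_norm p (\<lambda>z. ennreal (norm (f z)) * indicator S z) < \<infinity>)}"

definition morrey_herz ::
  "real \<Rightarrow> real \<Rightarrow> real \<Rightarrow> real \<Rightarrow> ((real^'n) \<times> (real^'m) \<Rightarrow> complex) set" where
  "morrey_herz \<alpha> lam p q =
     {f \<in> Lp_loc_off_axes p. morrey_herz_norm \<alpha> lam p q (\<lambda>z. ennreal (norm (f z))) < \<infinity>}"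

text \<open>
  Elements of the space are functions rather than classes modulo null sets, so an operator on it
  is a map on functions that respects equality almost everywhere and is linear almost everywhere.
\<close>

definition bounded_linear_operator_on_morrey_herz ::
  "real \<Rightarrow> real \<Rightarrow> real \<Rightarrow> real
     \<Rightarrow> (((real^'n) \<times> (real^'m) \<Rightarrow> complex) \<Rightarrow> ((real^'n) \<times> (real^'m) \<Rightarrow> complex)) \<Rightarrow> bool" where
  "bounded_linear_operator_on_morrey_herz \<alpha> lam p q T \<longleftrightarrow>
     (\<forall>f\<in>morrey_herz \<alpha> lam p q. T f \<in> morrey_herz \<alpha> lam p q) \<and>
     (\<forall>f\<in>morrey_herz \<alpha> lam p q. \<forall>g\<in>morrey_herz \<alpha> lam p q.
        (AE z in lebesgue. f z = g z) \<longrightarrow> (AE z in lebesgue. T f z = T g z)) \<and>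
     (\<forall>f\<in>morrey_herz \<alpha> lam p q. \<forall>g\<in>morrey_herz \<alpha> lam p q. \<forall>a b :: complex.
        AE z in lebesgue. T (\<lambda>z. a * f z + b * g z) z = a * T f z + b * T g z) \<and>
     (\<exists>C::real. \<forall>f\<in>morrey_herz \<alpha> lam p q.
        morrey_herz_norm \<alpha> lam p q (\<lambda>z. ennreal (norm (T f z)))
          \<le> ennreal C * morrey_herz_norm \<alpha> lam p q (\<lambda>z. ennreal (norm (f z))))"

definition lp_sum :: "real \<Rightarrow> (nat \<Rightarrow> 'a \<Rightarrow> complex) \<Rightarrow> 'a \<Rightarrow> ennreal" where
  "lp_sum r f z = epowr (\<Sum>i. ennreal (norm (f i z) powr r)) (1 / r)"

end

theory Submission
	imports Defs
begin

text \<open>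
	Split the kernel smoothly into pieces \<open>K\<^sub>j\<^sub>k\<close> living at scale \<open>2\<^sup>j\<close> in \<open>x\<close> and \<open>2\<^sup>k\<close> in \<open>y\<close>; each
	has mean zero and is Hoelder continuous in both variables. Expanding the identity twice into product
	Littlewood-Paley differences, almost orthogonality in the scales reduces the bilinear form of a finite sum
	of pieces to averages and product square functions, which are bounded on \<open>L\<^sup>p(\<ell>\<^sup>r)\<close> by
	Calderon-Zygmund theory in each variable. This gives \<open>L\<^sup>p(\<ell>\<^sup>r)\<close> bounds uniform in the truncation.

	Between dyadic blocks whose scales differ by \<open>u\<close> in one variable, the size of the kernel yields in addition
	the gain \<open>dec n p u\<close>. Summing over blocks, \<open>T\<close> maps \<open>L\<^sup>p\<close> with the weight \<open>wt k l\<close> into \<open>L\<^sup>p\<close> of the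
	block \<open>(k, l)\<close>; \<open>T\<close> is therefore defined by density on the space weighted by \<open>wt 0 0\<close>, and the
	principal values of Lipschitz functions exist because the kernel annihilates functions of one variable.

	Finally, as \<open>lam > 0\<close>, the Morrey-Herz norm is comparable to the supremum over the blocks of
	\<open>2 powr ((i + j) * (\<alpha> - lam))\<close> times the \<open>L\<^sup>p\<close> norm on the block, whatever \<open>q\<close> is: a single summand bounds it
	below, and a geometric series above. So the block estimates are all that is needed.
\<close>

text \<open>Test functions need not be dense for a norm that is a supremum over boxes, so the
  operator cannot be extended by density inside the Morrey-Herz space; the space weighted by
  \<open>wt 0 0\<close> contains it, and there Lipschitz functions are dense. The hard estimates
  concern finite index sets, bounded functions of bounded support and finitely many kernel pieces:
  all quantities are finite, so terms can be absorbed, and every constant is fixed before the finite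
  data, so the truncation can be removed at the end. In each variable three differences are inserted
  in front of the input function: one falls on the kernel and pays for the distance of the scales,
  the other two fall on the two functions that are paired and form their square functions.
  Localising in one variable needs the slices of the kernel in the other to be bounded operators,
  uniformly; this one-parameter fact is drawn from the two-parameter theorem by tensoring with a
  bump on the line. With \<open>tw = (lam-\<alpha>)*p\<close>, the p-th powers of the block norms
  may grow like \<open>2 powr (tw*(i+j))\<close>; the ranges of \<open>\<alpha>\<close> and
  \<open>lam\<close> are what makes \<open>dec\<close> beat this growth in both directions.\<close>

no_notation (ASCII) disj (infixr \<open>|\<close> 30)
notation abs (\<open>|_|\<close>)

abbreviation (input) BM :: "('a::topological_space => 'b::topological_space) set" where "BM == borel_measurable borel"

abbreviation (input) nint :: "('a::euclidean_space => ennreal) => ennreal" (binder "NN " 10) where "nint f == integral\<^sup>N lborel f"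

abbreviation (input) LIMSEQ_ascii :: "(nat => 'a::topological_space) => 'a => bool" (infixr \<open>---->\<close> 60)
  where "f ----> l == f \<longlonglongrightarrow> l"

section \<open>Bounded functions of bounded support and convolution\<close>

text \<open>The class in which all finite computations take place. It contains indicators of bounded
  Borel sets and is closed under products, convolutions, sections and partial integrals, so that
  integrability and Fubini become structural side conditions.\<close>

definition nice :: "('a::euclidean_space => real) => bool" where
	"nice f \<longleftrightarrow> f \<in> BM & (EX B. ALL x. |f x| <= B) & (EX R. ALL x. f x ~= 0 --> norm x <= R)"

lemma niceI:
	"f \<in> BM ==> (!!x. |f x| <= B) ==> (!!x. f x ~= 0 ==> norm x <= R) ==> nice f"
	unfolding nice_def by blast

lemma niceE:
	assumes "nice f"
	obtains B R where "f \<in> BM" "!!x. |f x| <= B" "!!x. f x ~= 0 ==> norm x <= R" "B > 0" "R > 0"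
proof -
	from assms obtain B R where *: "f \<in> BM" "!!x. |f x| <= B" "!!x. f x ~= 0 ==> norm x <= R"
		unfolding nice_def by blast
	have "|f x| <= max B 1" "f x ~= 0 ==> norm x <= max R 1" for x
		using *(2,3)[of x] by auto
	then show thesis using *(1) that[of "max B 1" "max R 1"] by simp
qed

lemma nice_meas[measurable_dest]: "nice f ==> f \<in> BM"
	by (simp add: nice_def)

lemma borel_measurable_fst[measurable]:
		"(fst :: 'a::euclidean_space \<times> 'b::euclidean_space => 'a) \<in> BM"
	and borel_measurable_snd[measurable]:
		"(snd :: 'a::euclidean_space \<times> 'b::euclidean_space => 'b) \<in> BM"
	by (intro borel_measurable_continuous_onI continuous_intros)+

lemma nice_int: assumes "nice f" shows "integrable lborel f"
proof -
	from assms obtain B R where *: "f \<in> BM" "!!x. |f x| <= B" "!!x. f x ~= 0 ==> norm x <= R"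
		unfolding nice_def by blast
	have "integrable lborel (%x::'a. B*indicator (cball 0 R) x)"
		using emeasure_lborel_cball_finite[of "0::'a" R]
		by (intro integrable_mult_right integrable_real_indicator) auto
	then show ?thesis
	proof (rule Bochner_Integration.integrable_bound)
		show "AE x in lborel. norm (f x) <= norm (B*indicator (cball 0 R) x)"
		proof (rule AE_I2)
			fix x
			show "norm (f x) <= norm (B*indicator (cball 0 R) x)"
				using *(2)[of x] *(3)[of x] by (cases "f x = 0") (auto simp: indicator_def)
		qed
	qed (use * in simp)
qed

lemma nice_dom:
	assumes "nice h" "g \<in> BM" "!!x. |g x| <= h x"
	shows "nice g"
proof -
	from assms(1) obtain B R where *: "!!x. |h x| <= B" "!!x. h x ~= 0 ==> norm x <= R"
		by (metis niceE)
	show ?thesis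
	proof (rule niceI[of _ B R])
		show "|g x| <= B" for x using assms(3)[of x] *(1)[of x] by linarith
		show "norm x <= R" if "g x ~= 0" for x
			using assms(3)[of x] *(2)[of x] that by (metis abs_le_zero_iff)
	qed fact
qed

lemma nice_zero[simp]: "nice (%x. 0)"
	by (rule niceI[of _ 0 0]) auto

lemma nice_add: assumes "nice f" "nice g" shows "nice (%x. f x + g x)"
proof -
	from assms obtain B R B' R' where *: "!!x. |f x| <= B" "!!x. f x ~= 0 ==> norm x <= R"
		"!!x. |g x| <= B'" "!!x. g x ~= 0 ==> norm x <= R'" by (metis niceE)
	have [measurable]: "f \<in> BM" "g \<in> BM" using assms by (auto dest: nice_meas)
	show ?thesis
	proof (rule niceI[of _ "B + B'" "max R R'"])
		show "|f x + g x| <= B + B'" for x using *(1)[of x] *(3)[of x] by linarith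
		show "norm x <= max R R'" if "f x + g x ~= 0" for x
			using *(2,4)[of x] that by fastforce
	qed measurable
qed

lemma nice_bmult:
	assumes "nice f" "g \<in> BM" "!!x. f x ~= 0 ==> |g x| <= B"
	shows "nice (%x. g x*f x)"
proof -
	from assms(1) obtain B' R' where *: "!!x. |f x| <= B'" "!!x. f x ~= 0 ==> norm x <= R'" "B' > 0"
		by (metis niceE)
	have [measurable]: "f \<in> BM" using assms by (auto dest: nice_meas)
	note assms(2)[measurable]
	show ?thesis
	proof (rule niceI[of _ "|B|*B'" R'])
		show "|g x*f x| <= |B|*B'" for x
		proof (cases "f x = 0")
			case True then show ?thesis using *(3) by simp
		next
			case False
			then have "|g x| <= |B|" using assms(3)[of x] by linarith
			then show ?thesis using *(1)[of x] by (simp add: abs_mult mult_mono)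
		qed
		show "norm x <= R'" if "g x*f x ~= 0" for x
			using *(2)[of x] that by simp
	qed measurable
qed

lemma nice_cmult: "nice f ==> nice (%x. c*f x)"
	by (rule nice_bmult[where B="|c|"]) auto

lemma nice_minus: "nice f ==> nice (%x. - f x)"
	using nice_cmult[of f "-1"] by simp

lemma nice_diff: "nice f ==> nice g ==> nice (%x. f x-g x)"
	using nice_add[of f "%x. - g x"] nice_minus[of g] by simp

lemma nice_mult: assumes "nice f" "nice g" shows "nice (%x. f x*g x)"
proof -
	from assms(1) obtain B where "!!x. |f x| <= B" by (metis niceE)
	then show ?thesis using nice_bmult[of g f B] assms by (auto dest: nice_meas)
qed

lemma nice_sum: "(!!i. i \<in> I ==> nice (f i)) ==> nice (%x. \<Sum>i\<in>I. f i x)"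
	by (induction I rule: infinite_finite_induct) (auto intro!: nice_add)

lemma nice_abs: assumes "nice f" shows "nice (%x. |f x| )"
proof -
	from assms obtain B R where *: "!!x. |f x| <= B" "!!x. f x ~= 0 ==> norm x <= R" by (metis niceE)
	have [measurable]: "f \<in> BM" using assms by (auto dest: nice_meas)
	show ?thesis by (rule niceI[of _ B R]) (use * in auto)
qed

lemma nice_powr: assumes "nice f" "s > 0" "!!x. 0 <= f x" shows "nice (%x. f x powr s)"
proof -
	from assms obtain B R where *: "!!x. |f x| <= B" "!!x. f x ~= 0 ==> norm x <= R" by (metis niceE)
	have [measurable]: "f \<in> BM" using assms by (auto dest: nice_meas)
	show ?thesis
	proof (rule niceI[of _ "B powr s" R])
		show "|f x powr s| <= B powr s" for x
			using *(1)[of x] assms(2,3) by (auto intro!: powr_mono2)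
		show "norm x <= R" if "f x powr s ~= 0" for x
			using *(2)[of x] that by auto
	qed measurable
qed

lemma lborel_affine_nn:
	fixes a :: "'a::euclidean_space"
	assumes [measurable]: "h \<in> BM" and "c ~= 0"
	shows "(NN x. h x) = ennreal ( |c|^DIM('a))*(NN x. h (a + c *\<^sub>R x))"
	by (subst lborel_affine[OF assms(2), of a])
		(simp add: nn_integral_density nn_integral_distr nn_integral_cmult)

lemma lborel_affine_integral:
	fixes a :: "'a::euclidean_space" and h :: "'a => 'b::{banach,second_countable_topology}"
	assumes [measurable]: "h \<in> BM" and "c ~= 0"
	shows "(LBINT x. h x) = ( |c|^DIM('a)) *\<^sub>R (LBINT x. h (a + c *\<^sub>R x))"
	by (subst lborel_affine[OF assms(2), of a])
		(simp add: integral_density integral_distr)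

lemma lborel_reflect:
	fixes a :: "'a::euclidean_space" and h :: "'a => 'b::{banach,second_countable_topology}"
	assumes "h \<in> BM"
	shows "(LBINT x. h (a-x)) = (LBINT x. h x)"
	using lborel_affine_integral[OF assms, of "-1" a] by simp

lemma lborel_shift:
	fixes a :: "'a::euclidean_space" and h :: "'a => 'b::{banach,second_countable_topology}"
	assumes "h \<in> BM"
	shows "(LBINT x. h (x-a)) = (LBINT x. h x)"
	using lborel_affine_integral[OF assms, of "1" "-a"] by (simp add: add.commute)

lemma nice_reflect: assumes "nice f" shows "nice (%t. f (a-t))"
proof -
	from assms obtain B R where *: "!!x. |f x| <= B" "!!x. f x ~= 0 ==> norm x <= R" by (metis niceE)
	have [measurable]: "f \<in> BM" using assms by (auto dest: nice_meas)
	show ?thesis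
	proof (rule niceI[of _ B "R + norm a"])
		show "norm x <= R + norm a" if "f (a-x) ~= 0" for x
			using *(2)[OF that] norm_triangle_sub[of x a] by (simp add: norm_minus_commute)
	qed (use * in auto)
qed

lemma nice_uminus: "nice f ==> nice (%t. f (- t))"
	using nice_reflect[of f 0] by simp

lemma nice_shift: "nice f ==> nice (%t. f (t-a))"
	using nice_reflect[OF nice_uminus, of f a] by simp

lemma nice_Fubini:
	fixes f :: "'a::euclidean_space => 'b::euclidean_space => real"
	assumes "nice (%z. f (fst z) (snd z))"
	shows "(LBINT x. LBINT y. f x y) = (LBINT y. LBINT x. f x y)"
		and "(LBINT x. LBINT y. f x y) = (LBINT z. f (fst z) (snd z))"
proof -
	have *: "integrable (lborel \<Otimes>\<^sub>M lborel) (case_prod f)"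
		using nice_int[OF assms] by (simp add: lborel_prod case_prod_beta')
	show "(LBINT x. LBINT y. f x y) = (LBINT y. LBINT x. f x y)"
		using lborel_pair.Fubini_integral[OF *] by simp
	show "(LBINT x. LBINT y. f x y) = (LBINT z. f (fst z) (snd z))"
		using lborel_pair.integral_fst[OF *] by (simp add: lborel_prod case_prod_beta')
qed

lemma nice_tensor:
	assumes "nice u" "nice v" shows "nice (%z. u (fst z) * v (snd z))"
proof -
	from assms obtain B R B' R' where *: "!!x. |u x| <= B" "!!x. u x ~= 0 ==> norm x <= R" "B > 0"
		"!!x. |v x| <= B'" "!!x. v x ~= 0 ==> norm x <= R'" by (metis niceE)
	have [measurable]: "u \<in> BM" "v \<in> BM" using assms by (auto dest: nice_meas)
	show ?thesis
	proof (rule niceI[of _ "B*B'" "R + R'"])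
		show "|u (fst z) * v (snd z)| <= B*B'" for z
			using *(1)[of "fst z"] *(3) *(4)[of "snd z"] by (auto simp: abs_mult intro!: mult_mono)
		show "norm z <= R + R'" if "u (fst z) * v (snd z) ~= 0" for z
			using *(2)[of "fst z"] *(5)[of "snd z"] that norm_triangle_ineq[of "(fst z, 0)" "(0, snd z)"]
			by (cases z) (simp add: norm_Pair)
	qed measurable
qed

lemma nice_swap: assumes "nice f" shows "nice (%z. f (snd z, fst z))"
proof -
	from assms obtain B R where *: "!!x. |f x| <= B" "!!x. f x ~= 0 ==> norm x <= R" by (metis niceE)
	have [measurable]: "f \<in> BM" using assms by (auto dest: nice_meas)
	show ?thesis
	proof (rule niceI[of _ B R])
		show "norm z <= R" if "f (snd z, fst z) ~= 0" for z
			using *(2)[OF that] by (cases z) (simp add: norm_Pair add.commute)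
	qed (use * in \<open>auto\<close>)
qed

lemma nice_section1: assumes "nice f" shows "nice (%x. f (x, y))"
proof -
	from assms obtain B R where *: "!!x. |f x| <= B" "!!x. f x ~= 0 ==> norm x <= R" by (metis niceE)
	have [measurable]: "f \<in> BM" using assms by (auto dest: nice_meas)
	show ?thesis
	proof (rule niceI[of _ B R])
		show "norm x <= R" if "f (x, y) ~= 0" for x
			using *(2)[OF that] norm_fst_le[of x y] by linarith
	qed (use * in \<open>auto\<close>)
qed

lemma nice_section2: assumes "nice f" shows "nice (%y. f (x, y))"
	using nice_section1[OF nice_swap[OF assms], of x] by simp

lemma integral_bounded_on_ball:
	fixes h :: "'a::euclidean_space => real"
	assumes "!!t. |h t| <= B" "!!t. h t ~= 0 ==> norm t <= R" "B >= 0"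
	shows "|LBINT t. h t| <= B*measure lborel (cball (0::'a) R)"
proof -
	have "integrable lborel (%x::'a. B*indicator (cball 0 R) x)"
		using emeasure_lborel_cball_finite[of "0::'a" R]
		by (intro integrable_mult_right integrable_real_indicator) auto
	then have "(LBINT t. |h t| ) <= (LBINT t. B*indicator (cball (0::'a) R) t)"
		using assms by (intro integral_mono') (auto simp: indicator_def)
	also have "... = B*measure lborel (cball (0::'a) R)" by simp
	finally show ?thesis using integral_abs_bound[of lborel h] by linarith
qed

section \<open>The commutative algebra of convolutions of nice functions\<close>

definition conv :: "('a::euclidean_space => real) => ('a => real) => 'a => real" where
	"conv f g x = (LBINT t. f (x-t)*g t)"

lemma nice_partial_integral:
	fixes h :: "'a::euclidean_space \<times> 'b::euclidean_space => real"
	assumes "nice h" shows "nice (%x. LBINT y. h (x, y))"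
proof -
	from assms obtain B R where *: "!!x. |h x| <= B" "!!x. h x ~= 0 ==> norm x <= R" "B > 0" by (metis niceE)
	have [measurable]: "h \<in> BM" using assms by (auto dest: nice_meas)
	show ?thesis
	proof (rule niceI[of _ "B*measure lborel (cball (0::'b) R)" R])
		fix x
		have "h (x, y) ~= 0 ==> norm x <= R & norm y <= R" for y
			using *(2)[of "(x,y)"] norm_fst_le[of x y] norm_snd_le[of y x] by linarith
		then show "|LBINT y. h (x, y)| <= B*measure lborel (cball (0::'b) R)"
			using * by (intro integral_bounded_on_ball) auto
		show "norm x <= R" if "(LBINT y. h (x, y)) ~= 0"
		proof (rule ccontr)
			assume "\<not> norm x <= R"
			then have "h (x, y) = 0" for y
				using *(2)[of "(x,y)"] norm_fst_le[of x y] by linarith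
			then show False using that by simp
		qed
	qed measurable
qed

lemma nice_conv_kernel:
	fixes u :: "'a::euclidean_space => real"
	assumes "nice u" "nice f" shows "nice (%z. u (fst z-snd z)*f (snd z))"
proof -
	from assms obtain B R B' R' where *: "!!x. |u x| <= B" "!!x. u x ~= 0 ==> norm x <= R" "B > 0"
		"!!x. |f x| <= B'" "!!x. f x ~= 0 ==> norm x <= R'" by (metis niceE)
	have [measurable]: "u \<in> BM" "f \<in> BM" using assms by (auto dest: nice_meas)
	show ?thesis
	proof (rule niceI[of _ "B*B'" "R + R' + R'"])
		show "|u (fst z-snd z)*f (snd z)| <= B*B'" for z
			using *(1)[of "fst z-snd z"] *(3) *(4)[of "snd z"] by (auto simp: abs_mult intro!: mult_mono)
		show "norm z <= R + R' + R'" if "u (fst z-snd z)*f (snd z) ~= 0" for z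
		proof -
			have "norm (fst z-snd z) <= R" "norm (snd z) <= R'" using * that by auto
			then have "norm (fst z) <= R + R'" using norm_triangle_sub[of "fst z" "snd z"] by linarith
			then show ?thesis using \<open>norm (snd z) <= R'\<close> norm_triangle_ineq[of "(fst z, 0)" "(0, snd z)"]
				by (cases z) (simp add: norm_Pair)
		qed
	qed measurable
qed

lemma nice_conv: "nice u ==> nice f ==> nice (conv u f)"
	unfolding conv_def using nice_partial_integral[OF nice_conv_kernel, of u f] by simp

lemma nice_conv_integrand: "nice u ==> nice f ==> nice (%t. u (x-t)*f t)"
	by (intro nice_mult nice_reflect)

lemma nice_conv_integrable: "nice u ==> nice f ==> integrable lborel (%t. u (x-t)*f t)"
	by (intro nice_int nice_conv_integrand)

lemma conv_commute: assumes "nice f" "nice g" shows "conv f g = conv g f"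
proof
	fix x
	have [measurable]: "f \<in> BM" "g \<in> BM" using assms by (auto dest: nice_meas)
	show "conv f g x = conv g f x"
		unfolding conv_def using lborel_reflect[of "%t. f (x-t)*g t" x] by (simp add: mult.commute)
qed

lemma conv_assoc:
	assumes "nice f" "nice g" "nice h"
	shows "conv f (conv g h) = conv (conv f g) h"
proof
	fix x
	have [measurable]: "f \<in> BM" "g \<in> BM" "h \<in> BM"
		using assms by (auto dest: nice_meas)
	from assms(1) obtain B where B: "!!x. |f x| <= B" by (metis niceE)
	have n: "nice (%z. f (x-fst z)*(g (fst z-snd z)*h (snd z)))"
		by (rule nice_bmult[OF nice_conv_kernel[OF assms(2,3)], where B=B]) (use B in auto)
	have "conv f (conv g h) x = (LBINT t. LBINT s. f (x-t)*(g (t-s)*h s))"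
		unfolding conv_def by simp
	also have "... = (LBINT s. LBINT t. f (x-t)*(g (t-s)*h s))"
		by (rule nice_Fubini(1)[OF n])
	also have "... = (LBINT s. (LBINT t. f (x-s-(t-s))*g (t-s))*h s)"
		by (simp flip: mult.assoc)
	also have "... = (LBINT s. conv f g (x-s)*h s)"
		unfolding conv_def
		by (rule Bochner_Integration.integral_cong[OF refl])
			(subst lborel_shift[where h="%t. f (_-t)*g t"], auto)
	finally show "conv f (conv g h) x = conv (conv f g) h x" by (simp add: conv_def)
qed

lemma conv_left_commute:
	assumes "nice f" "nice g" "nice h" shows "conv f (conv g h) = conv g (conv f h)"
	using assms by (simp add: conv_assoc conv_commute[of f g])

lemma conv_adjoint:
	assumes "nice u" "nice f" "nice g"
	shows "(LBINT x. conv u f x*g x) = (LBINT x. f x*conv (%t. u (- t)) g x)"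
proof -
	have [measurable]: "f \<in> BM" "g \<in> BM" "u \<in> BM"
		using assms by (auto dest: nice_meas)
	from assms(3) obtain B where B: "!!x. |g x| <= B" by (metis niceE)
	have n: "nice (%z. g (fst z)*(u (fst z-snd z)*f (snd z)))"
		by (rule nice_bmult[OF nice_conv_kernel[OF assms(1,2)], where B=B]) (use B in auto)
	have "(LBINT x. conv u f x*g x) = (LBINT x. LBINT t. g x*(u (x-t)*f t))"
		unfolding conv_def by (simp add: mult.commute)
	also have "... = (LBINT t. LBINT x. g x*(u (x-t)*f t))"
		by (rule nice_Fubini(1)[OF n])
	also have "... = (LBINT t. f t*(LBINT x. u (x-t)*g x))"
		by (simp add: mult.commute mult.left_commute)
	finally show ?thesis by (simp add: conv_def)
qed

lemma conv_add_right:
	assumes "nice u" "nice f" "nice g" shows "conv u (%x. f x + g x) = (%x. conv u f x + conv u g x)"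
	using assms by (auto simp: conv_def distrib_left fun_eq_iff nice_conv_integrable)

lemma conv_diff_right:
	assumes "nice u" "nice f" "nice g" shows "conv u (%x. f x-g x) = (%x. conv u f x-conv u g x)"
	using assms by (auto simp: conv_def right_diff_distrib fun_eq_iff nice_conv_integrable)

lemma conv_sum_right:
	assumes "nice u" "!!i. i \<in> I ==> nice (f i)" shows "conv u (%x. \<Sum>i\<in>I. f i x) = (%x. \<Sum>i\<in>I. conv u (f i) x)"
	using assms by (auto simp: conv_def fun_eq_iff sum_distrib_left nice_conv_integrable intro!: Bochner_Integration.integral_sum)

lemma conv_cmult_right: "conv u (%x. c*f x) = (%x. c*conv u f x)"
	by (auto simp: conv_def fun_eq_iff mult.left_commute)

lemma conv_cmult_left: "conv (%x. c*u x) f = (%x. c*conv u f x)"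
	by (auto simp: conv_def fun_eq_iff mult.assoc)

lemma conv_zero_right[simp]: "conv u (%x. 0) = (%x. 0)"
	by (auto simp: conv_def)

lemma conv_sum_left:
	assumes "nice f" "!!i. i \<in> I ==> nice (u i)" shows "conv (%x. \<Sum>i\<in>I. u i x) f = (%x. \<Sum>i\<in>I. conv (u i) f x)"
	using assms by (auto simp: conv_def fun_eq_iff sum_distrib_right nice_conv_integrable intro!: Bochner_Integration.integral_sum)

lemma conv_diff_left:
	assumes "nice u" "nice v" "nice f" shows "conv (%x. u x-v x) f = (%x. conv u f x-conv v f x)"
	using assms by (auto simp: conv_def left_diff_distrib fun_eq_iff nice_conv_integrable)

lemma abs_conv_le:
	assumes "nice u" "nice f" "nice v" "!!x. |u x| <= v x"
	shows "|conv u f x| <= conv v (%t. |f t| ) x"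
	unfolding conv_def
proof -
	have "|LBINT t. u (x-t)*f t| <= (LBINT t. |u (x-t)*f t| )"
		by (rule integral_abs_bound)
	also have "... <= (LBINT t. v (x-t)*|f t| )"
		using assms by (intro integral_mono nice_conv_integrable nice_abs nice_int nice_conv_integrand)
			(auto simp: abs_mult intro!: mult_right_mono)
	finally show "|LBINT t. u (x-t)*f t| <= (LBINT t. v (x-t)*|f t| )" .
qed

section \<open>The mixed norms and their duality\<close>

text \<open>The norm of l^r over \<open>I\<close> with values in l^2 over \<open>J\<close>:
  \<open>I\<close> enumerates the functions of a sequence, \<open>J\<close> the scales of a square
  function. With \<open>J\<close> a singleton the inner norm is the absolute value.\<close>

definition nrm :: "real => 'i set => 'k set => ('i => 'k => real) => real" where
	"nrm r I J v = (\<Sum>i\<in>I. (\<Sum>m\<in>J. (v i m)\<^sup>2) powr (r/2)) powr (1/r)"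

text \<open>The gradient of \<open>nrm r I J v powr p / p\<close>, that is, the extremiser in the
  duality of mixed norms. For \<open>p = 1\<close> it is the functional that norms
  \<open>v\<close>.\<close>

definition ext :: "real => real => 'i set => 'k set => ('i => 'k => real) => 'i => 'k => real" where
	"ext p r I J v i m = (if i \<in> I & m \<in> J
		then v i m*(\<Sum>m\<in>J. (v i m)\<^sup>2) powr ((r-2)/2)*nrm r I J v powr (p-r) else 0)"

text \<open>The p-th power of the norm of L^p(l^r(l^2)). Keeping the power makes integration over
  fibres and passage to limits immediate; constants attached to \<open>Phi\<close> are therefore
  constants for p-th powers.\<close>

definition Phi :: "real => real => 'i set => 'k set => ('i => 'k => 'a::euclidean_space => real) => real" where
	"Phi p r I J f = (LBINT x. nrm r I J (%i m. f i m x) powr p)"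

definition conj_exp :: "real => real => bool" where
	"conj_exp r r' \<longleftrightarrow> 1 < r & 1 < r' & 1/r + 1/r' = 1"

lemma conj_exp_sym: "conj_exp r r' ==> conj_exp r' r"
	by (auto simp: conj_exp_def)

lemma conj_exp_exists: "1 < r ==> conj_exp r (r/(r-1))"
	by (auto simp: conj_exp_def field_simps)

lemma conj_expD:
	assumes "conj_exp r r'" shows "1 < r" "1 < r'" "(r-1)*r' = r" "r/r' = r-1" "(r'-1)*(r-1) = 1"
proof -
	show r: "1 < r" "1 < r'" using assms by (auto simp: conj_exp_def)
	have "1/r + 1/r' = 1" using assms by (auto simp: conj_exp_def)
	then have "r + r' = r*r'" using r by (simp add: field_simps)
	then show "(r-1)*r' = r" "(r'-1)*(r-1) = 1" by (auto simp: algebra_simps)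
	then show "r/r' = r-1" using r by (simp add: field_simps)
qed

lemma nrm_nonneg[simp]: "0 <= nrm r I J v"
	by (simp add: nrm_def)

lemma nrm_powr_r: "r > 0 ==> nrm r I J v powr r = (\<Sum>i\<in>I. (\<Sum>k\<in>J. (v i k)\<^sup>2) powr (r/2))"
	by (simp add: nrm_def powr_powr sum_nonneg)

lemma nrm_mono:
	assumes "r > 0" "!!i k. i \<in> I ==> k \<in> J ==> |v i k| <= |w i k|"
	shows "nrm r I J v <= nrm r I J w"
	unfolding nrm_def using assms
	by (intro powr_mono2 sum_mono sum_nonneg) (auto simp: abs_le_square_iff intro!: powr_mono2 sum_mono sum_nonneg)

lemma nrm_cong: "(!!i k. i \<in> I ==> k \<in> J ==> v i k = w i k) ==> nrm r I J v = nrm r I J w"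
	unfolding nrm_def by (auto intro!: arg_cong2[of _ _ _ _ "(powr)"] sum.cong)

lemma nrm_cmult: "r > 0 ==> nrm r I J (%i k. c * v i k) = |c|*nrm r I J v"
proof -
	assume r: "r > 0"
	have "((\<Sum>k\<in>J. (c * v i k)\<^sup>2) powr (r/2)) = |c| powr r*(\<Sum>k\<in>J. (v i k)\<^sup>2) powr (r/2)" for i
	proof -
		have "(\<Sum>k\<in>J. (c * v i k)\<^sup>2) = |c| powr 2*(\<Sum>k\<in>J. (v i k)\<^sup>2)"
			by (simp add: power_mult_distrib sum_distrib_left)
		then show ?thesis by (simp add: powr_mult sum_nonneg powr_powr del: powr_numeral)
	qed
	then have "nrm r I J (%i k. c * v i k) = ( |c| powr r*(\<Sum>i\<in>I. (\<Sum>k\<in>J. (v i k)\<^sup>2) powr (r/2))) powr (1/r)"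
		by (simp add: nrm_def sum_distrib_left)
	also have "... = |c|*nrm r I J v"
		using r by (simp add: powr_mult sum_nonneg powr_powr nrm_def)
	finally show ?thesis .
qed

lemma nrm_component:
	assumes "r > 0" "finite I" "finite J" "i \<in> I" "k \<in> J"
	shows "|v i k| <= nrm r I J v"
proof -
	have "(v i k)\<^sup>2 <= (\<Sum>k\<in>J. (v i k)\<^sup>2)"
		using assms by (intro member_le_sum) auto
	then have "((v i k)\<^sup>2) powr (r/2) <= (\<Sum>k\<in>J. (v i k)\<^sup>2) powr (r/2)"
		using assms by (intro powr_mono2) auto
	also have "... <= (\<Sum>i\<in>I. (\<Sum>k\<in>J. (v i k)\<^sup>2) powr (r/2))"
		using assms by (intro member_le_sum) (auto intro!: member_le_sum)
	finally have "(((v i k)\<^sup>2) powr (r/2)) powr (1/r) <= nrm r I J v"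
		unfolding nrm_def using assms by (intro powr_mono2) auto
	moreover have "(((v i k)\<^sup>2) powr (r/2)) powr (1/r) = |v i k|"
	proof -
		have "(v i k)\<^sup>2 = |v i k| powr 2" by simp
		then have "(((v i k)\<^sup>2) powr (r/2)) powr (1/r) = |v i k| powr (2*(r/2)*(1/r))"
			by (simp only: powr_powr)
		then show ?thesis using assms by simp
	qed
	ultimately show ?thesis by simp
qed

lemma nrm_eq_0:
	assumes "r > 0" "finite I" "finite J" "nrm r I J v = 0" "i \<in> I" "k \<in> J" shows "v i k = 0"
	using nrm_component[OF assms(1,2,3,5,6), of v] assms(4) by simp

text \<open>Cauchy-Schwarz in \<open>k\<close>, then Young's inequality in \<open>i\<close> after
  dividing by both norms; if one norm is zero, its components vanish.\<close>

lemma nrm_pairing: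
	assumes "conj_exp r r'" and fin: "finite I" "finite J"
	shows "|\<Sum>i\<in>I. \<Sum>k\<in>J. v i k*w i k| <= nrm r I J v * nrm r' I J w"
proof -
	note r = conj_expD[OF assms(1)]
	define A B where "A = nrm r I J v" and "B = nrm r' I J w"
	define a b where "a i = (\<Sum>k\<in>J. (v i k)\<^sup>2)" and "b i = (\<Sum>k\<in>J. (w i k)\<^sup>2)" for i
	have ab: "a i >= 0" "b i >= 0" for i by (auto simp: a_def b_def sum_nonneg)
	have CS: "|\<Sum>k\<in>J. v i k*w i k| <= sqrt (a i) * sqrt (b i)" for i
		using Cauchy_Schwarz_ineq_sum[of "v i" "w i" J] unfolding a_def b_def
		by (simp add: real_sqrt_mult[symmetric] real_le_rsqrt)
	have le: "|\<Sum>i\<in>I. \<Sum>k\<in>J. v i k*w i k| <= (\<Sum>i\<in>I. sqrt (a i) * sqrt (b i))"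
		by (rule order_trans[OF sum_abs sum_mono]) (rule CS)
	show ?thesis
	proof (cases "A = 0 \<or> B = 0")
		case True
		then have "(\<Sum>i\<in>I. \<Sum>k\<in>J. v i k*w i k) = 0"
			using nrm_eq_0[OF _ fin, of r v] nrm_eq_0[OF _ fin, of r' w] r unfolding A_def B_def
			by (intro sum.neutral ballI) auto
		then show ?thesis using True by (auto simp: A_def B_def)
	next
		case False
		then have AB: "A > 0" "B > 0" by (auto simp: A_def B_def less_le)
		have sa: "sqrt x powr s = x powr (s/2)" if "x >= 0" for x s :: real
			using that by (simp add: powr_half_sqrt[symmetric] powr_powr)
		have "(\<Sum>i\<in>I. (sqrt (a i)/A)*(sqrt (b i)/B)) <= (\<Sum>i\<in>I. (sqrt (a i)/A) powr r/r + (sqrt (b i)/B) powr r'/r')"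
			using assms(1) AB ab unfolding conj_exp_def by (intro sum_mono Youngs_inequality) auto
		also have "... = (\<Sum>i\<in>I. a i powr (r/2))/(A powr r)/r + (\<Sum>i\<in>I. b i powr (r'/2))/(B powr r')/r'"
			using AB ab by (simp add: sum.distrib powr_divide sa sum_divide_distrib)
		also have "(\<Sum>i\<in>I. a i powr (r/2)) = A powr r"
			using r nrm_powr_r[of r I J v] by (auto simp: A_def a_def)
		also have "(\<Sum>i\<in>I. b i powr (r'/2)) = B powr r'"
			using r nrm_powr_r[of r' I J w] by (auto simp: B_def b_def)
		also have "A powr r/A powr r/r + B powr r'/B powr r'/r' = 1"
			using AB assms(1) by (simp add: conj_exp_def)
		finally have "(\<Sum>i\<in>I. sqrt (a i) * sqrt (b i))/(A*B) <= 1"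
			by (simp add: sum_divide_distrib)
		then have "(\<Sum>i\<in>I. sqrt (a i) * sqrt (b i)) <= A*B"
			using AB by (simp add: divide_le_eq)
		then show ?thesis using le by (simp add: A_def B_def)
	qed
qed

lemma ext_pairing:
	assumes "r > 1"
	shows "(\<Sum>i\<in>I. \<Sum>k\<in>J. v i k*ext p r I J v i k) = nrm r I J v powr p"
proof -
	define a where "a i = (\<Sum>k\<in>J. (v i k)\<^sup>2)" for i
	have a: "a i >= 0" for i by (auto simp: a_def sum_nonneg)
	have aa: "x*x powr ((r-2)/2) = x powr (r/2)" if "x >= 0" for x :: real
	proof (cases "x = 0")
		case False
		then have "x*x powr ((r-2)/2) = x powr (1 + (r-2)/2)" using that by (simp add: powr_add)
		then show ?thesis by (simp add: field_simps)
	qed (use assms in simp)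
	have "(\<Sum>i\<in>I. \<Sum>k\<in>J. v i k*ext p r I J v i k) = (\<Sum>i\<in>I. a i*a i powr ((r-2)/2)*nrm r I J v powr (p-r))"
		by (intro sum.cong refl) (simp add: ext_def a_def sum_distrib_right power2_eq_square mult.assoc)
	also have "... = (\<Sum>i\<in>I. a i powr (r/2))*nrm r I J v powr (p-r)"
		using a by (simp add: aa sum_distrib_right)
	also have "(\<Sum>i\<in>I. a i powr (r/2)) = nrm r I J v powr r"
		using assms nrm_powr_r[of r I J v] by (simp add: a_def)
	finally show ?thesis by (simp add: powr_add[symmetric])
qed

lemma nrm_ext:
	assumes "conj_exp r r'"
	shows "nrm r' I J (ext p r I J v) = nrm r I J v powr (p-1)"
proof -
	note r = conj_expD[OF assms(1)]
	define a where "a i = (\<Sum>k\<in>J. (v i k)\<^sup>2)" for i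
	define A where "A = nrm r I J v"
	have a: "a i >= 0" for i by (auto simp: a_def sum_nonneg)
	have A: "A >= 0" by (simp add: A_def)
	have aa: "x*(x powr ((r-2)/2))\<^sup>2 = x powr (r-1)" if "x >= 0" for x :: real
	proof (cases "x = 0")
		case False
		have "(x powr ((r-2)/2))\<^sup>2 = x powr (r-2)" 
			by (simp add: power2_eq_square powr_add[symmetric])
		then have "x*(x powr ((r-2)/2))\<^sup>2 = x powr (1 + (r-2))" using that False by (simp add: powr_mult_base)
		moreover have "1 + (r-2) = r-1" by simp
		ultimately show ?thesis by metis
	qed (use r in simp)
	have AA: "((A powr (p-r))\<^sup>2) powr (r'/2) = A powr ((p-r)*r')"
	proof -
		have "(A powr (p-r))\<^sup>2 = A powr (2*(p-r))" by (simp add: power2_eq_square powr_add[symmetric])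
		moreover have "2*(p-r)*(r'/2) = (p-r)*r'" by simp
		ultimately show ?thesis by (metis powr_powr)
	qed
	have "(\<Sum>k\<in>J. (ext p r I J v i k)\<^sup>2) powr (r'/2) = a i powr (r/2)*A powr ((p-r)*r')" if "i \<in> I" for i
	proof -
		have "(\<Sum>k\<in>J. (ext p r I J v i k)\<^sup>2) = a i*(a i powr ((r-2)/2))\<^sup>2*(A powr (p-r))\<^sup>2"
			using that by (simp add: ext_def a_def A_def power_mult_distrib sum_distrib_right)
		then have "(\<Sum>k\<in>J. (ext p r I J v i k)\<^sup>2) powr (r'/2) = (a i powr (r-1)*(A powr (p-r))\<^sup>2) powr (r'/2)"
			using a by (simp add: aa)
		also have "... = (a i powr ((r-1)*r'/2))*A powr ((p-r)*r')"
			using a by (simp add: powr_mult AA powr_powr)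
		finally show ?thesis using r by simp
	qed
	then have "nrm r' I J (ext p r I J v) = ((\<Sum>i\<in>I. a i powr (r/2))*A powr ((p-r)*r')) powr (1/r')"
		by (simp add: nrm_def sum_distrib_right)
	also have "(\<Sum>i\<in>I. a i powr (r/2)) = A powr r"
		using r nrm_powr_r[of r I J v] by (simp add: a_def A_def)
	also have "(A powr r*A powr ((p-r)*r')) powr (1/r') = A powr (r/r' + (p-r))"
	proof -
		have "(p-r)*r'*(1/r') = p-r" "r*(1/r') = r/r'" using r by auto
		then show ?thesis using A by (simp only: powr_mult powr_powr powr_add powr_ge_zero)
	qed
	also have "r/r' + (p-r) = p-1" using r by simp
	finally show ?thesis by (simp add: A_def)
qed

lemma abs_ext_le:
	assumes "conj_exp r r'" "finite I" "finite J"
	shows "|ext p r I J v i k| <= nrm r I J v powr (p-1)"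
proof (cases "i \<in> I & k \<in> J")
	case True
	then show ?thesis using nrm_component[of r' I J i k "ext p r I J v"] nrm_ext[OF assms(1), of I J p v] assms
		by (simp add: conj_exp_def)
qed (auto simp: ext_def)

lemma powr_0_le_1: "(x::real) powr 0 <= 1" by simp

text \<open>One functional is attained at the given \<open>v\<close> and stays below the norm at
  every \<open>w\<close>. The triangle inequality and Minkowski's integral inequality follow from
  linearity of the pairing.\<close>

lemma nrm_dual:
	assumes "r > 1" "finite I" "finite J"
	obtains d where "!!w. (\<Sum>i\<in>I. \<Sum>k\<in>J. w i k*d i k) <= nrm r I J w" "(\<Sum>i\<in>I. \<Sum>k\<in>J. v i k*d i k) = nrm r I J v"
		"!!i k. |d i k| <= 1"
proof (rule that[of "ext 1 r I J v"])
	let ?r = "r/(r-1)"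
	have c: "conj_exp r ?r" by (rule conj_exp_exists) fact
	show "(\<Sum>i\<in>I. \<Sum>k\<in>J. w i k*ext 1 r I J v i k) <= nrm r I J w" for w
	proof -
		have "(\<Sum>i\<in>I. \<Sum>k\<in>J. w i k*ext 1 r I J v i k) <= nrm r I J w*nrm ?r I J (ext 1 r I J v)"
			using nrm_pairing[OF c assms(2,3), of w "ext 1 r I J v"] by linarith
		also have "... <= nrm r I J w*1"
			by (intro mult_left_mono) (auto simp: nrm_ext[OF c])
		finally show ?thesis by simp
	qed
	show "(\<Sum>i\<in>I. \<Sum>k\<in>J. v i k*ext 1 r I J v i k) = nrm r I J v"
		using ext_pairing[OF assms(1), of v 1 I J] by simp
	show "|ext 1 r I J v i k| <= 1" for i k
		using abs_ext_le[OF c assms(2,3), of 1 v i k] powr_0_le_1[of "nrm r I J v"] by simp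
qed

lemma nrm_triangle:
	assumes "r > 1" "finite I" "finite J"
	shows "nrm r I J (%i k. v i k + w i k) <= nrm r I J v + nrm r I J w"
proof -
	obtain d where d: "!!w. (\<Sum>i\<in>I. \<Sum>k\<in>J. w i k*d i k) <= nrm r I J w"
		"(\<Sum>i\<in>I. \<Sum>k\<in>J. (v i k + w i k)*d i k) = nrm r I J (%i k. v i k + w i k)"
		by (rule nrm_dual[OF assms, of "%i k. v i k + w i k"]) blast
	have "(\<Sum>i\<in>I. \<Sum>k\<in>J. (v i k + w i k)*d i k) = (\<Sum>i\<in>I. \<Sum>k\<in>J. v i k*d i k) + (\<Sum>i\<in>I. \<Sum>k\<in>J. w i k*d i k)"
		by (simp add: distrib_right sum.distrib)
	then show ?thesis using d(1)[of v] d(1)[of w] d(2) by linarith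
qed

lemma nrm_zero[simp]: "r > 0 ==> nrm r I J (%i k. 0) = 0"
	by (simp add: nrm_def)

lemma nrm_sum:
	assumes "r > 1" "finite I" "finite J"
	shows "nrm r I J (%i k. \<Sum>l\<in>L. v l i k) <= (\<Sum>l\<in>L. nrm r I J (v l))"
proof (induction L rule: infinite_finite_induct)
	case (insert l L)
	then show ?case using nrm_triangle[OF assms, of "v l" "%i k. \<Sum>l\<in>L. v l i k"] by simp
qed (use assms in auto)

lemma nrm_le_sum_abs:
	assumes "r > 1" "finite I" "finite J"
	shows "nrm r I J v <= (\<Sum>i\<in>I. \<Sum>k\<in>J. |v i k| )"
proof -
	obtain d where d: "(\<Sum>i\<in>I. \<Sum>k\<in>J. v i k*d i k) = nrm r I J v" "!!i k. |d i k| <= 1"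
		by (rule nrm_dual[OF assms, of v]) blast
	have "v i k*d i k <= |v i k|" for i k
		using d(2)[of i k] by (metis abs_ge_self abs_mult mult_left_le abs_ge_zero order_trans)
	then have "(\<Sum>i\<in>I. \<Sum>k\<in>J. v i k*d i k) <= (\<Sum>i\<in>I. \<Sum>k\<in>J. |v i k| )" by (intro sum_mono)
	then show ?thesis using d by simp
qed

lemma nrm_measurable[measurable (raw)]:
	assumes "!!i k. f i k \<in> borel_measurable M"
	shows "(%x. nrm r I J (%i k. f i k x)) \<in> borel_measurable M"
	unfolding nrm_def using assms by measurable

lemma nice_nrm:
	assumes "r > 1" "finite I" "finite J" "!!i k. nice (f i k)"
	shows "nice (%x. nrm r I J (%i k. f i k x))"
proof (rule nice_dom)
	show "nice (%x. \<Sum>i\<in>I. \<Sum>k\<in>J. |f i k x| )" using assms by (intro nice_sum nice_abs)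
	show "|nrm r I J (%i k. f i k x)| <= (\<Sum>i\<in>I. \<Sum>k\<in>J. |f i k x| )" for x
		using nrm_le_sum_abs[OF assms(1-3), of "%i k. f i k x"] by simp
	have "!!i k. f i k \<in> BM" using assms(4) by (auto dest: nice_meas)
	then show "(%x. nrm r I J (%i k. f i k x)) \<in> BM" by measurable
qed

lemma nrm_integral_le:
	assumes "r > 1" "finite I" "finite J" "!!i k. integrable M (h i k)" "integrable M (%x. nrm r I J (%i k. h i k x))"
	shows "nrm r I J (%i k. LINT x|M. h i k x) <= (LINT x|M. nrm r I J (%i k. h i k x))"
proof -
	obtain d where d: "!!w. (\<Sum>i\<in>I. \<Sum>k\<in>J. w i k*d i k) <= nrm r I J w"
		"(\<Sum>i\<in>I. \<Sum>k\<in>J. (LINT x|M. h i k x)*d i k) = nrm r I J (%i k. LINT x|M. h i k x)"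
		by (rule nrm_dual[OF assms(1-3), of "%i k. LINT x|M. h i k x"]) blast
	have "(\<Sum>i\<in>I. \<Sum>k\<in>J. (LINT x|M. h i k x)*d i k) = (LINT x|M. (\<Sum>i\<in>I. \<Sum>k\<in>J. h i k x*d i k))"
		using assms(4) by simp
	also have "... <= (LINT x|M. nrm r I J (%i k. h i k x))"
		using assms(4,5) by (intro integral_mono d Bochner_Integration.integrable_sum integrable_mult_left)
	finally show ?thesis using d(2) by simp
qed

lemma nice_Phi_integrand:
	assumes "p > 0" "r > 1" "finite I" "finite J" "!!i k. nice (f i k)"
	shows "nice (%x. nrm r I J (%i k. f i k x) powr p)"
	using assms by (intro nice_powr nice_nrm) auto

lemma Phi_nonneg[simp]: "0 <= Phi p r I J f"
	by (simp add: Phi_def)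

lemma Phi_cmult: "r > 0 ==> Phi p r I J (%i k x. c*f i k x) = |c| powr p*Phi p r I J f"
	by (simp add: Phi_def nrm_cmult powr_mult)

text \<open>Young's inequality takes the place of Hoelder's, with the factors \<open>1/p\<close> and
  \<open>1/p'\<close> bounded by 1. The sum on the right is the form that \<open>Phi_duality\<close>
  turns back into a bound.\<close>

lemma Phi_pairing:
	assumes "conj_exp p p'" "conj_exp r r'" "finite I" "finite J" "!!i k. nice (f i k)" "!!i k. nice (g i k)"
	shows "|\<Sum>i\<in>I. \<Sum>k\<in>J. LBINT x. f i k x*g i k x| <= Phi p r I J f + Phi p' r' I J g"
proof -
	note p = conj_expD[OF assms(1)] and r = conj_expD[OF assms(2)]
	let ?F = "%x. nrm r I J (%i k. f i k x)" and ?G = "%x. nrm r' I J (%i k. g i k x)"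
	have int: "integrable lborel (%x. \<Sum>i\<in>I. \<Sum>k\<in>J. f i k x*g i k x)"
		using assms by (intro nice_int nice_sum nice_mult)
	have "(\<Sum>i\<in>I. \<Sum>k\<in>J. LBINT x. f i k x*g i k x) = (LBINT x. (\<Sum>i\<in>I. \<Sum>k\<in>J. f i k x*g i k x))"
		using assms by (simp add: nice_int nice_mult)
	also have "|...| <= (LBINT x. |\<Sum>i\<in>I. \<Sum>k\<in>J. f i k x*g i k x| )" by (rule integral_abs_bound)
	also have "... <= (LBINT x. ?F x powr p + ?G x powr p')"
	proof (rule integral_mono)
		show "integrable lborel (%x. ?F x powr p + ?G x powr p')"
			using assms p r by (intro nice_int nice_add nice_Phi_integrand) auto
		fix x
		have "|\<Sum>i\<in>I. \<Sum>k\<in>J. f i k x*g i k x| <= ?F x*?G x" by (rule nrm_pairing[OF assms(2-4)])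
		also have "... <= ?F x powr p/p + ?G x powr p'/p'"
			using assms(1) unfolding conj_exp_def by (intro Youngs_inequality) auto
		also have "... <= ?F x powr p/1 + ?G x powr p'/1"
			using p by (intro add_mono divide_left_mono) auto
		finally show "|\<Sum>i\<in>I. \<Sum>k\<in>J. f i k x*g i k x| <= ?F x powr p + ?G x powr p'" by simp
	qed (use int in auto)
	also have "... = Phi p r I J f + Phi p' r' I J g"
		unfolding Phi_def using assms p r
		by (intro Bochner_Integration.integral_add nice_int nice_Phi_integrand) auto
	finally show ?thesis .
qed

lemma Phi_ext:
	assumes "conj_exp p p'" "conj_exp r r'"
	shows "Phi p' r' I J (%i k x. ext p r I J (%i k. f i k x) i k) = Phi p r I J f"
	unfolding Phi_def by (simp add: nrm_ext[OF assms(2)] powr_powr conj_expD(3)[OF assms(1)])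

lemma nice_ext:
	assumes "p > 1" "conj_exp r r'" "finite I" "finite J" "!!i k. nice (f i k)"
	shows "nice (%x. ext p r I J (%i k. f i k x) i k)"
proof (rule nice_dom)
	show "nice (%x. nrm r I J (%i k. f i k x) powr (p-1))"
		using assms conj_expD[OF assms(2)] by (intro nice_Phi_integrand) auto
	show "|ext p r I J (%i k. f i k x) i k| <= nrm r I J (%i k. f i k x) powr (p-1)" for x
		by (rule abs_ext_le[OF assms(2-4)])
	have "!!i k. f i k \<in> BM" using assms(5) by (auto dest: nice_meas)
	then show "(%x. ext p r I J (%i k. f i k x) i k) \<in> BM"
		unfolding ext_def by measurable
qed

text \<open>The duality inequalities are stated additively: as they hold for all multiples of \<open>g\<close>,
	optimising over the multiple gives the norm inequality.\<close>

lemma Phi_duality: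
	assumes "conj_exp p p'" "conj_exp r r'" "finite I" "finite J" "!!i k. nice (F i k)" "C > 0"
		and *: "!!g. (!!i k. nice (g i k)) ==>
			(\<Sum>i\<in>I. \<Sum>k\<in>J. LBINT x. F i k x*g i k x) <= C*(X + Phi p' r' I J g)"
	shows "Phi p r I J F <= (2*C) powr p*X"
proof -
	note p = conj_expD[OF assms(1)] and r = conj_expD[OF assms(2)]
	\<comment> \<open>With this multiple, \<open>C\<close> times \<open>Phi\<close> of \<open>t\<close>
	  times the extremiser is exactly \<open>t/2*Phi p r I J F\<close>, half of the left-hand side. It
	  can be absorbed because \<open>F\<close> is nice and the quantity is finite.\<close>
	define t where "t = (2*C) powr (- (p-1))"
	have t: "t > 0" using assms by (simp add: t_def)
	have tp: "t powr p' = t/(2*C)"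
	proof -
		have "- (p-1)*p' = - (p-1)-1" using p by (simp add: algebra_simps)
		then have "t powr p' = (2*C) powr (- (p-1)-1)" unfolding t_def by (simp only: powr_powr)
		also have "... = t/(2*C)" using assms(6) unfolding t_def by (simp add: powr_diff powr_minus_divide)
		finally show ?thesis .
	qed
	let ?e = "%i k x. ext p r I J (%i k. F i k x) i k"
	have ne: "nice (?e i k)" for i k using nice_ext[OF p(1) assms(2-5)] by simp
	have "t*Phi p r I J F = (LBINT x. (\<Sum>i\<in>I. \<Sum>k\<in>J. F i k x*(t*?e i k x)))"
	proof -
		have "(LBINT x. (\<Sum>i\<in>I. \<Sum>k\<in>J. F i k x*(t*?e i k x))) = (LBINT x. t*nrm r I J (%i k. F i k x) powr p)"
			unfolding ext_pairing[OF r(1), symmetric] by (simp add: sum_distrib_left algebra_simps)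
		then show ?thesis by (simp add: Phi_def)
	qed
	also have "... = (\<Sum>i\<in>I. \<Sum>k\<in>J. LBINT x. F i k x*(t*?e i k x))"
		using assms(5) ne by (simp add: nice_int nice_mult nice_cmult)
	also have "... <= C*(X + Phi p' r' I J (%i k x. t*?e i k x))"
		by (rule *) (intro nice_cmult ne)
	also have "Phi p' r' I J (%i k x. t*?e i k x) = t/(2*C)*Phi p r I J F"
		using Phi_cmult[of r' p' I J t ?e] r t tp Phi_ext[OF assms(1,2), of I J F] by simp
	finally have "t/2*Phi p r I J F <= C*X" using assms(6) by (simp add: field_simps)
	then have "Phi p r I J F <= 2*C*X/t" using t by (simp add: field_simps)
	also have "... = (2*C)*(2*C) powr (p-1)*X"
		unfolding t_def powr_minus_divide by simp
	also have "(2*C)*(2*C) powr (p-1) = (2*C) powr p"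
		using assms(6) powr_add[of "2*C" 1 "p-1"] by simp
	finally show ?thesis .
qed

text \<open>At \<open>p = r\<close> the outer sum commutes with the integral. On the singleton
  \<open>{i}\<close> the outer exponent is immaterial and is set to 2, so the sequence-valued bound
  on the diagonal reduces to l^2-valued bounds for single functions.\<close>

lemma Phi_diag:
	assumes "r > 1" "finite I" "finite J" "!!i k. nice (f i k)"
	shows "Phi r r I J f = (\<Sum>i\<in>I. Phi r 2 {i} J f)"
proof -
	have sq: "nrm 2 {i} J v powr r = (\<Sum>k\<in>J. (v i k)\<^sup>2) powr (r/2)" for i and v :: "'a => 'b => real"
		by (simp add: nrm_def powr_powr sum_nonneg)
	have "Phi r r I J f = (LBINT x. (\<Sum>i\<in>I. nrm 2 {i} J (%i k. f i k x) powr r))"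
		unfolding Phi_def using assms(1) by (simp add: nrm_powr_r sq)
	also have "... = (\<Sum>i\<in>I. Phi r 2 {i} J f)"
		unfolding Phi_def using assms
		by (intro Bochner_Integration.integral_sum nice_int nice_Phi_integrand) auto
	finally show ?thesis .
qed

section \<open>Dyadic scales\<close>

definition sc :: "int => real" where "sc k = 2 powr (of_int k)"

lemma sc_pos[simp]: "0 < sc k" "0 <= sc k" "sc k ~= 0"
	by (simp_all add: sc_def)

lemma sc_add: "sc (k + l) = sc k * sc l" by (simp add: sc_def powr_add)

lemma sc_Suc: "sc (k + 1) = 2 * sc k" by (simp add: sc_def powr_add)

lemma sc_0[simp]: "sc 0 = 1" by (simp add: sc_def)

lemma sc_diff: "sc (k-l) = sc k/sc l" by (simp add: sc_def powr_diff)

lemma sc_mono: "k <= l ==> sc k <= sc l" by (simp add: sc_def)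

lemma sc_unbounded: "EX k>=k0. c < sc k"
proof -
	obtain m where "c < 2^m" using real_arch_pow[of 2 c] by auto
	moreover have "(2::real)^m = sc (int m)" by (simp add: sc_def powr_realpow)
	ultimately have "c < sc (int m)" by simp
	then have "c < sc (max (int m) k0)" using sc_mono[of "int m" "max (int m) k0"] by linarith
	then show ?thesis by (meson max.cobounded2)
qed

lemma sc_neg_le_1: "sc (- int m) <= 1"
	using sc_mono[of "- int m" 0] by simp

lemma sc_neg_tendsto: "(%m. sc (- int m)) ----> 0"
proof -
	have "sc (- int m) = (1/2)^m" for m by (simp add: sc_def powr_minus powr_realpow power_one_over inverse_eq_divide)
	then show ?thesis by (simp add: LIMSEQ_realpow_zero)
qed

lemma geometric_int_sum:
	fixes K :: "int set" and v :: real
	assumes "finite K" "0 <= v" "v < 1"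
	shows "(\<Sum>k\<in>K. v^nat |k-k0| ) <= 2/(1-v)"
proof -
	have g: "(\<Sum>j\<in>M. v^j) <= 1/(1-v)" if "finite M" for M :: "nat set"
		using sum_le_suminf[of "%j. v^j" M] that assms by (simp add: summable_geometric suminf_geometric)
	have s: "(\<Sum>k\<in>K'. v^nat |k-k0| ) <= 1/(1-v)" if "inj_on (%k. nat |k-k0| ) K'" "finite K'" for K'
		using g[of "(%k. nat |k-k0| ) ` K'"] that by (simp add: sum.reindex)
	have "(\<Sum>k\<in>K. v^nat |k-k0| ) = (\<Sum>k\<in>{k\<in>K. k0 <= k}. v^nat |k-k0| ) + (\<Sum>k\<in>{k\<in>K. \<not> k0 <= k}. v^nat |k-k0| )"
		using assms(1) by (subst sum.union_disjoint[symmetric]) (auto intro!: sum.cong)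
	also have "... <= 1/(1-v) + 1/(1-v)"
		using assms(1) by (intro add_mono s) (auto simp: inj_on_def)
	finally show ?thesis by simp
qed

lemma nice_indicator: "bounded q ==> q \<in> sets borel ==> nice (%x. indicator q x)"
	by (auto simp: bounded_iff indicator_def intro!: niceI[of _ 1])

lemma nice_ind_mult: "q \<in> sets borel ==> nice f ==> nice (%x. indicator q x*f x)"
	by (rule nice_bmult[where B=1]) (auto simp: indicator_def)

lemma geometric_int_sum2:
	assumes "finite U" "0 <= s" "s < 1"
	shows "(\<Sum>u\<in>U. s^nat |fst u-k| * s^nat |snd u-l| ) <= (2/(1-s))*(2/(1-s :: real))"
proof -
	have "(\<Sum>u\<in>U. s^nat |fst u-k| * s^nat |snd u-l| ) <= (\<Sum>u\<in>fst ` U \<times> snd ` U. s^nat |fst u-k| * s^nat |snd u-l| )"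
		using assms by (intro sum_mono2) (auto intro: rev_image_eqI)
	also have "... = (\<Sum>a\<in>fst ` U. s^nat |a-k| )*(\<Sum>b\<in>snd ` U. s^nat |b-l| )"
		by (simp only: sum_product sum.cartesian_product case_prod_beta')
	also have "... <= (2/(1-s))*(2/(1-s))"
		using assms by (intro mult_mono geometric_int_sum) (auto intro!: sum_nonneg)
	finally show ?thesis .
qed

lemma dyadic_ex: assumes "0 < x" shows "EX k. sc (k-1) < x & x <= sc k"
proof
	have "x = 2 powr log 2 x" using assms by simp
	then show "sc (\<lceil>log 2 x\<rceil> - 1) < x & x <= sc \<lceil>log 2 x\<rceil>" unfolding sc_def using assms by (metis ceiling_correct less_eq_real_def of_int_1 of_int_diff powr_less_cancel_iff powr_le_cancel_iff one_less_numeral_iff semiring_norm(76))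
qed

text \<open>Marcinkiewicz interpolation between strong type \<open>s\<close> (the \<open>K1\<close>
  term) and weak type 1 (the \<open>K2\<close> term), discretised at the levels \<open>sc k\<close>.
  Only the levels from \<open>-n\<close> to \<open>n\<close> are summed; lower values of
  \<open>h\<close> leave an error on a ball that vanishes as \<open>n\<close> grows.\<close>

lemma powr_integral_from_distribution:
	fixes h F :: "'a::euclidean_space => real"
	assumes h: "nice h" "!!x. 0 <= h x" and F: "nice F" "!!x. 0 <= F x" and p: "1 < p" "p < s" and K: "K1 >= 0" "K2 >= 0"
		and D: "!!y. y > 0 ==> measure lborel {x. 2*y < h x} <=
			K1*y powr (-s)*(LBINT x. F x powr s*indicator {x. F x <= y} x)
			+ K2*y powr (-1)*(LBINT x. F x*indicator {x. y < 2*F x} x)"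
	shows "(LBINT x. h x powr p) <= 4 powr p*(K1*(2/(1-2 powr (p-s))) + K2*(2 powr (p-1)*(2/(1-2 powr (1-p)))))*(LBINT x. F x powr p)"
proof -
	note nice_meas[OF h(1), measurable] nice_meas[OF F(1), measurable]
	obtain B R where B: "!!x. |h x| <= B" "!!x. h x ~= 0 ==> norm x <= R" using h(1) by (metis niceE)
	obtain n0 where n0: "B < sc n0" using sc_unbounded by blast
	let ?S = "%n::nat. {- int n..int n}" and ?H = "%k. {x. 2 * sc k < h x}" and ?V = "measure lborel (cball (0::'a) R)"
	let ?A = "%k x. F x powr s*indicator {x. F x <= sc k} x" and ?B = "%k x. F x*indicator {x. sc k < 2*F x} x"
	let ?C = "K1*(2/(1-2 powr (p-s))) + K2*(2 powr (p-1)*(2/(1-2 powr (1-p))))"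
	let ?Y = "%n x. \<Sum>k\<in>?S n. sc k powr p*indicator (?H k) x" and ?W = "%k x. K1 * sc k powr (p-s)*?A k x + K2 * sc k powr (p-1)*?B k x"
		and ?N = "LBINT x. F x powr p" and ?M = "LBINT x. h x powr p" and ?F = "%x. F x powr p"
	have nH: "nice (%x. indicator (?H k) x)" for k
	proof (rule nice_indicator)
		have "h x ~= 0" if "2 * sc k < h x" for x using that sc_pos(1)[of k] by linarith
		then have "?H k \<subseteq> cball 0 R" using B(2) by auto
		then show "bounded (?H k)" using bounded_cball bounded_subset by blast
	qed measurable
	have nF: "nice (%x. F x powr p)" using F p by (intro nice_powr) auto
	have nA: "nice (?A k)" for k using F p by (subst mult.commute, intro nice_ind_mult nice_powr) auto
	have nB: "nice (?B k)" for k using F by (subst mult.commute, intro nice_ind_mult) auto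
	\<comment> \<open>The level \<open>k\<close> with \<open>2 * sc k < h x <= 4 * sc k\<close> pays
	  for \<open>h x powr p\<close> and explains the factor \<open>4 powr p\<close>. If this level lies
	  below \<open>-n\<close>, the value is at most \<open>4 * sc (- int n)\<close>.\<close>
	have pt: "h x powr p <= 4 powr p*?Y n x + (4 * sc (- int n)) powr p*indicator (cball 0 R) x" if n: "n0 <= int n" for n x
	proof (cases "h x = 0")
		case False
		then have "0 < h x/2" using h(2)[of x] by simp
		then obtain k where k: "sc k < h x/2" "h x/2 <= sc (k + 1)" using dyadic_ex[of "h x/2"] by (metis add_diff_cancel_right' diff_add_cancel)
		have nn: "0 <= 4 powr p*?Y n x" by (intro mult_nonneg_nonneg sum_nonneg) auto
		show ?thesis
		proof (cases "- int n <= k")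
			case True
			have "\<not> sc n0 <= sc k" using k(1) B(1)[of x] n0 sc_pos(1)[of k] by linarith
			then have "k < n0" using sc_mono by (meson not_less)
			then have "sc k powr p*indicator (?H k) x <= ?Y n x" using True n by (intro member_le_sum) auto
			then have "4 powr p * sc k powr p <= 4 powr p*?Y n x" using k(1) by (intro mult_left_mono) auto
			moreover have "h x powr p <= (4 * sc k) powr p" using k(2) h(2) p by (intro powr_mono2) (auto simp: sc_Suc)
			moreover have "0 <= (4 * sc (- int n)) powr p*indicator (cball 0 R) x" by simp
			ultimately show ?thesis unfolding powr_mult by linarith
		next
			case F: False
			have "sc (k + 1) <= sc (- int n)" using F by (intro sc_mono) simp
			then have "h x <= 4 * sc (- int n)" using k(2) sc_pos(1)[of "- int n"] by linarith
			then have "h x powr p <= (4 * sc (- int n)) powr p" using h(2) p by (intro powr_mono2) auto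
			then show ?thesis using nn B(2)[OF False] by simp
		qed
	qed (erule ssubst, subst powr_0, intro add_nonneg_nonneg mult_nonneg_nonneg sum_nonneg; simp)
	\<comment> \<open>Let \<open>sc j\<close> be the size of \<open>F x\<close>. The first term lives
	  on \<open>k >= j\<close> and decays since \<open>p < s\<close>; the second lives on
	  \<open>k <= j\<close> and decays since \<open>p > 1\<close>. Both are geometric in
	  \<open>|k-j|\<close>.\<close>
	have ptF: "(\<Sum>k\<in>U. ?W k x) <= ?C*F x powr p" if U: "finite U" for U x
	proof (cases "F x = 0")
		case False
		then have F0: "0 < F x" using F(2)[of x] by simp
		then obtain j where j: "sc (j-1) < F x" "F x <= sc j" using dyadic_ex by blast
		let ?a = "2 powr (p-s)" and ?b = "2 powr (1-p)"
		have 1: "sc k powr (p-s)*?A k x <= F x powr p*?a^nat |k-j|" for k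
		proof (cases "F x <= sc k")
			case True
			then have jk: "j <= k" using sc_mono[of k "j-1"] j(1) by linarith
			have "F x powr (s-p) <= sc j powr (s-p)" using F0 j(2) p by (intro powr_mono2) auto
			then have "?F x*(sc k powr (p-s)*F x powr (s-p)) <= ?F x*(sc k powr (p-s) * sc j powr (s-p))" by (intro mult_left_mono) auto
			also have "sc k powr (p-s) * sc j powr (s-p) = ?a^nat |k-j|"
				using jk by (simp add: sc_def powr_powr powr_power powr_add[symmetric] algebra_simps)
			also have "?F x*(sc k powr (p-s)*F x powr (s-p)) = sc k powr (p-s)*?A k x"
				using True by (simp add: powr_add[symmetric] mult.left_commute)
			finally show ?thesis .
		qed simp
		have 2: "sc k powr (p-1)*?B k x <= F x powr p*2 powr (p-1)*?b^nat |k-j|" for k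
		proof (cases "sc k < 2*F x")
			case True
			then have jk: "k <= j" using sc_mono[of "j + 1" k] j(2) sc_Suc[of j] by linarith
			have "F x powr (1-p) <= sc (j-1) powr (1-p)" using j(1) p by (intro powr_mono2') auto
			then have "?F x*(sc k powr (p-1)*F x powr (1-p)) <= ?F x*(sc k powr (p-1) * sc (j-1) powr (1-p))" by (intro mult_left_mono) auto
			also have "sc k powr (p-1) * sc (j-1) powr (1-p) = 2 powr (p-1)*?b^nat |k-j|"
				using jk by (simp add: sc_def powr_powr powr_power powr_add[symmetric] algebra_simps)
			also have "?F x*(sc k powr (p-1)*F x powr (1-p)) = sc k powr (p-1)*?B k x"
				using True F0 by (simp add: powr_add[symmetric] mult.left_commute)
			finally show ?thesis by (simp add: mult.assoc)
		qed simp
		have "(\<Sum>k\<in>U. ?W k x)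
			<= (\<Sum>k\<in>U. K1*(F x powr p*?a^nat |k-j| ) + K2*(F x powr p*2 powr (p-1)*?b^nat |k-j| ))"
			unfolding mult.assoc[of K1] mult.assoc[of K2] by (intro sum_mono add_mono mult_left_mono 1 2 K)
		also have "... = F x powr p*(K1*(\<Sum>k\<in>U. ?a^nat |k-j| ) + K2*(2 powr (p-1)*(\<Sum>k\<in>U. ?b^nat |k-j| )))"
			by (simp add: sum.distrib sum_distrib_left distrib_left mult_ac)
		also have "... <= F x powr p*?C"
			using p K U by (intro mult_left_mono add_mono geometric_int_sum) (auto simp: powr_less_one)
		finally show ?thesis by (simp only: mult.commute)
	qed (use p in simp)
	have le: "?M <= 4 powr p*(?C*?N) + (4 * sc (- int n)) powr p*?V" if n: "n0 <= int n" for n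
	proof -
		have e: "(LBINT x. ?Y n x) = (\<Sum>k\<in>?S n. sc k powr p*measure lborel (?H k))"
			by (subst Bochner_Integration.integral_sum[OF nice_int[OF nice_cmult[OF nH]]]) simp
		have "?M <= (LBINT x. 4 powr p*?Y n x + (4 * sc (- int n)) powr p*indicator (cball 0 R) x)"
			using h p by (intro integral_mono pt n nice_int nice_add nice_cmult nice_sum nH nice_indicator nice_powr) auto
		also have "... = 4 powr p*(\<Sum>k\<in>?S n. sc k powr p*measure lborel (?H k)) + (4 * sc (- int n)) powr p*?V"
			by (subst Bochner_Integration.integral_add, intro nice_int nice_cmult nice_sum nH, intro nice_int nice_cmult nice_indicator, simp_all only: integral_mult_right_zero e) simp_all
		also have "(\<Sum>k\<in>?S n. sc k powr p*measure lborel (?H k)) <= (\<Sum>k\<in>?S n. LBINT x. ?W k x)"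
		proof (rule sum_mono)
			fix k
			have "sc k powr p*measure lborel (?H k) <= sc k powr p*(K1 * sc k powr (-s)*(LBINT x. ?A k x) + K2 * sc k powr (-1)*(LBINT x. ?B k x))"
				by (intro mult_left_mono D) auto
			also have "... = K1*(sc k powr p * sc k powr (-s))*(LBINT x. ?A k x) + K2*(sc k powr p * sc k powr (-1))*(LBINT x. ?B k x)" by (simp only: distrib_left mult_ac)
			also have "... = (LBINT x. ?W k x)"
				unfolding powr_add[symmetric] using nice_int[OF nA] nice_int[OF nB] by simp
			finally show "sc k powr p*measure lborel (?H k) <= (LBINT x. ?W k x)" .
		qed
		also have "... = (LBINT x. (\<Sum>k\<in>?S n. ?W k x))"
			by (intro Bochner_Integration.integral_sum[symmetric] nice_int nice_add nice_cmult nA nB)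
		also have "... <= (LBINT x. ?C*F x powr p)"
			by (intro integral_mono ptF nice_int nice_sum nice_add nice_cmult nA nB nF) simp
		finally show ?thesis by (simp add: mult_left_mono)
	qed
	have "(%n. (4 * sc (- int n)) powr p) ----> (4*0) powr p" by (intro tendsto_powr' tendsto_mult tendsto_const sc_neg_tendsto) (use p in auto)
	then have "(%n. 4 powr p*(?C*?N) + (4 * sc (- int n)) powr p*?V) ----> 4 powr p*(?C*?N) + 0*?V"
		using p by (intro tendsto_add tendsto_mult tendsto_const) simp
	then show ?thesis using le by (intro LIMSEQ_le_const[of _ _ ?M]) (auto simp: mult.assoc intro!: exI[of _ "nat n0"])
qed

section \<open>Dyadic cells\<close>

text \<open>Half-open dyadic cubes coded by floors, so that the cells of one scale partition the
  space and cells of different scales are nested or disjoint without exceptional sets.\<close>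

definition cell :: "int => 'a::euclidean_space => 'a set" where
	"cell k x = {y. \<forall>b\<in>Basis. \<lfloor>(y \<bullet> b)/sc k\<rfloor> = \<lfloor>(x \<bullet> b)/sc k\<rfloor>}"

lemma cell_refl[simp]: "x \<in> cell k x" by (simp add: cell_def)

lemma cell_eq: "y \<in> cell k x ==> cell k y = cell k x" by (auto simp: cell_def)

lemma cell_Suc_subset: "cell k x \<subseteq> cell (k + 1) x"
proof
	fix y assume y: "y \<in> cell k x"
	have "\<lfloor>(z \<bullet> b)/sc (k+1)\<rfloor> = \<lfloor>(z \<bullet> b)/sc k\<rfloor> div 2" for z b :: 'a
		using floor_divide_real_eq_div[of 2 "(z \<bullet> b)/sc k"] by (simp add: sc_Suc mult.commute)
	then show "y \<in> cell (k+1) x" using y by (auto simp: cell_def)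
qed

lemma cell_mono: "k <= l ==> cell k x \<subseteq> cell l x"
	by (induction l rule: int_ge_induct) (use cell_Suc_subset in blast)+

lemma cell_nested:
	assumes "cell k x \<inter> cell l y ~= {}" "k <= l" shows "cell k x \<subseteq> cell l y"
proof -
	from assms obtain z where z: "z \<in> cell k x" "z \<in> cell l y" by blast
	then show ?thesis using cell_mono[OF assms(2), of z] cell_eq by metis
qed

lemma floor_div_eq_iff: "s > 0 ==> \<lfloor>a/s\<rfloor> = m \<longleftrightarrow> of_int m * s <= a & a < (of_int m + 1) * s" for a s :: real
	by (simp add: floor_eq_iff field_simps)

lemma cell_measurable[measurable]: "cell k x \<in> sets borel"
	unfolding cell_def by measurable

lemma emeasure_cell: "emeasure lborel (cell k (x::'a::euclidean_space)) = ennreal (sc k^DIM('a))"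
proof -
	define l u where "l = (\<Sum>b\<in>Basis. (of_int \<lfloor>(x \<bullet> b)/sc k\<rfloor> * sc k) *\<^sub>R b)"
		and "u = (\<Sum>b\<in>Basis. ((of_int \<lfloor>(x \<bullet> b)/sc k\<rfloor> + 1) * sc k) *\<^sub>R b)"
	have lu: "l \<bullet> b = of_int \<lfloor>(x \<bullet> b)/sc k\<rfloor> * sc k" "u \<bullet> b = (of_int \<lfloor>(x \<bullet> b)/sc k\<rfloor> + 1) * sc k" if "b \<in> Basis" for b
		using that by (auto simp: l_def u_def inner_sum_left inner_Basis if_distrib sum.delta cong: if_cong)
	have c: "cell k x = {y. \<forall>b\<in>Basis. l \<bullet> b <= y \<bullet> b & y \<bullet> b < u \<bullet> b}"
		unfolding cell_def by (auto simp: lu floor_div_eq_iff)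
	have "(\<Prod>b\<in>Basis. (u-l) \<bullet> b) = (\<Prod>b\<in>(Basis::'a set). sc k)"
		by (intro prod.cong refl) (simp add: inner_diff_left lu algebra_simps)
	then have pr: "(\<Prod>b\<in>Basis. (u-l) \<bullet> b) = sc k^DIM('a)" by simp
	have le: "!!b. b \<in> Basis ==> l \<bullet> b <= u \<bullet> b" by (simp add: lu mult_right_mono)
	have "emeasure lborel (cell k x) <= emeasure lborel (cbox l u)"
		by (intro emeasure_mono) (auto simp: c cbox_def less_imp_le)
	moreover have "emeasure lborel (box l u) <= emeasure lborel (cell k x)"
		by (intro emeasure_mono) (auto simp: c box_def less_imp_le)
	ultimately show ?thesis using le pr by (auto simp: emeasure_lborel_cbox_eq emeasure_lborel_box_eq)
qed

lemma measure_cell: "measure lborel (cell k (x::'a::euclidean_space)) = sc k^DIM('a)"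
	by (simp add: measure_def emeasure_cell)

lemma norm_cell_le: "y \<in> cell k x ==> norm (y-x) <= DIM('a) * sc k" for x :: "'a::euclidean_space"
proof -
	assume y: "y \<in> cell k x"
	have "|(y-x) \<bullet> b| <= sc k" if "b \<in> Basis" for b
	proof -
		have "\<lfloor>(y \<bullet> b)/sc k\<rfloor> = \<lfloor>(x \<bullet> b)/sc k\<rfloor>" using y that by (auto simp: cell_def)
		then obtain m where m: "\<lfloor>(y \<bullet> b)/sc k\<rfloor> = m" "\<lfloor>(x \<bullet> b)/sc k\<rfloor> = m" by blast
		then show ?thesis unfolding floor_div_eq_iff[OF sc_pos(1)] by (simp add: inner_diff_left distrib_right abs_le_iff)
	qed
	then have "(\<Sum>b\<in>Basis. |(y-x) \<bullet> b| ) <= (\<Sum>b\<in>(Basis::'a set). sc k)" by (intro sum_mono) auto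
	then show ?thesis using norm_le_l1[of "y-x"] by simp
qed

lemma finite_cells_meeting: "finite {cell k x | x. norm (x::'a::euclidean_space) <= R}"
proof -
	define M where "M = \<lceil>R/sc k\<rceil> + 1"
	define G where "G m = {y::'a. \<forall>b\<in>Basis. \<lfloor>(y \<bullet> b)/sc k\<rfloor> = m b}" for m
	have "{cell k x | x. norm (x::'a) <= R} \<subseteq> G ` (PiE Basis (%_. {-M..M}))"
	proof
		fix Q assume "Q \<in> {cell k x | x. norm (x::'a) <= R}"
		then obtain x where x: "Q = cell k x" "norm x <= R" by blast
		let ?m = "restrict (%b. \<lfloor>(x \<bullet> b)/sc k\<rfloor>) Basis"
		have "Q = G ?m" unfolding x G_def cell_def by auto
		moreover have "\<lfloor>(x \<bullet> b)/sc k\<rfloor> \<in> {-M..M}" if "b \<in> Basis" for b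
		proof -
			have "|x \<bullet> b| <= R" using Basis_le_norm[OF that, of x] x by linarith
			then have "|(x \<bullet> b)/sc k| <= R/sc k" by (simp add: divide_right_mono)
			then have "of_int \<lfloor>(x \<bullet> b)/sc k\<rfloor> < (of_int (M + 1) :: real)" "of_int (-M-1) < (of_int \<lfloor>(x \<bullet> b)/sc k\<rfloor> :: real)"
				using of_int_floor_le[of "(x \<bullet> b)/sc k"] le_of_int_ceiling[of "R/sc k"] floor_correct[of "(x \<bullet> b)/sc k"]
				unfolding M_def of_int_add of_int_minus of_int_diff of_int_1 by linarith+
			then show ?thesis by simp
		qed
		ultimately show "Q \<in> G ` (PiE Basis (%_. {-M..M}))"
			by (intro image_eqI[of _ _ ?m]) (auto simp only: restrict_PiE_iff)
	qed
	then show ?thesis by (rule finite_subset) (intro finite_imageI finite_PiE, simp_all)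
qed

text \<open>The maximal cells on which the average of \<open>F\<close> exceeds \<open>y\<close>.\<close>

lemma stopping_cells:
	fixes F :: "'a::euclidean_space => real"
	assumes F: "nice F" "!!x. 0 <= F x" and y: "y > 0"
	obtains Q where "finite Q" "disjoint Q" "!!q. q \<in> Q ==> EX k x. q = cell k x"
		"!!q. q \<in> Q ==> y*measure lborel q <= (LBINT x:q. F x)"
		"!!q. q \<in> Q ==> (LBINT x:q. F x) <= 2^DIM('a)*y*measure lborel q"
		"!!x. x ~: \<Union>Q ==> (LINT x:cell k0 x|lborel. F x) <= y*measure lborel (cell k0 x)"
proof -
	let ?n = "DIM('a)"
	have si: "set_integrable lborel (cell k x) F" for k x
		unfolding set_integrable_def using nice_int[OF F(1)]
		by (intro integrable_mult_indicator) auto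
	define C where "C = {q. EX k x. k0 <= k & q = cell k x & y*measure lborel (cell k x) < (LINT x:cell k x|lborel. F x)}"
	from F obtain R where R: "!!x. F x ~= 0 ==> norm x <= R" by (metis niceE)
	\<comment> \<open>Above \<open>k1\<close> the whole integral of \<open>F\<close> is too small for
	  an average to exceed \<open>y\<close>. Non-negativity of \<open>k1\<close> allows the volume
	  \<open>sc k^?n\<close> to be compared with \<open>sc k\<close>.\<close>
	obtain k1 where k1: "k1 >= 0" "(LBINT x. F x)/y < sc k1" using sc_unbounded by blast
	have "C \<subseteq> (\<Union>k\<in>{k0..k1}. {cell k x | x. norm (x::'a) <= R})"
	proof
		fix q assume "q \<in> C"
		then obtain k x where q: "k0 <= k" "q = cell k x" "y * sc k^?n < (LINT x:cell k x|lborel. F x)"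
			by (auto simp: C_def measure_cell)
		have "(LINT x:cell k x|lborel. F x) <= (LBINT x. F x)"
			unfolding set_lebesgue_integral_def using si[of k x] nice_int[OF F(1)] F(2)
			by (intro integral_mono) (auto simp: set_integrable_def indicator_def)
		also have "... < y * sc k1" using k1 y by (simp add: divide_less_eq mult.commute)
		finally have "y * sc k^?n < y * sc k1" using q(3) by linarith
		then have lt: "sc k^?n < sc k1" using y by simp
		have "k <= k1"
		proof (rule ccontr)
			assume "\<not> k <= k1"
			then have "sc k1 <= sc k" "sc 0 <= sc k" using k1 by (intro sc_mono; linarith)+
			then show False using lt self_le_power[of "sc k" ?n] by simp
		qed
		moreover have "\<exists>z\<in>cell k x. F z ~= 0"
		proof (rule ccontr)
			assume "\<not> ?thesis"
			then have "(LINT x:cell k x|lborel. F x) = (LINT x|(lborel::'a measure). 0)"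
				unfolding set_lebesgue_integral_def by (intro Bochner_Integration.integral_cong) (auto simp: indicator_def)
			then show False using q(3) mult_pos_pos[OF y zero_less_power[OF sc_pos(1), of k ?n]] by simp
		qed
		then obtain z where z: "z \<in> cell k x" "F z ~= 0" by blast
		have "q = cell k z" "norm z <= R" using q(2) cell_eq[OF z(1)] R[OF z(2)] by simp_all
		ultimately show "q \<in> (\<Union>k\<in>{k0..k1}. {cell k x | x. norm (x::'a) <= R})" using q(1) by auto
	qed
	then have finC: "finite C" by (rule finite_subset) (auto intro: finite_cells_meeting)
	define Q where "Q = {q \<in> C. \<forall>q'\<in>C. q \<subseteq> q' --> q = q'}"
	have QC: "Q \<subseteq> C" by (auto simp: Q_def)
	show thesis
	proof (rule that[of Q])
		show "finite Q" using QC finC finite_subset by blast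
		show "disjoint Q"
		proof (rule disjointI)
			fix a b assume ab: "a \<in> Q" "b \<in> Q" "a ~= b"
			obtain k x where a: "a = cell k x" using ab(1) QC unfolding C_def by blast
			obtain l z where b: "b = cell l z" using ab(2) QC unfolding C_def by blast
			note * = a b
			show "a \<inter> b = {}"
			proof (rule ccontr)
				assume "a \<inter> b ~= {}"
				then have "cell k x \<inter> cell l z ~= {}" "cell l z \<inter> cell k x ~= {}" using * by auto
				then have "a \<subseteq> b \<or> b \<subseteq> a" using cell_nested[of k x l z] cell_nested[of l z k x] * linear[of k l] by argo
				then show False using ab by (auto simp: Q_def)
			qed
		qed
		show "EX k x. q = cell k x" if "q \<in> Q" for q using that QC unfolding C_def by blast
		show "y*measure lborel q <= (LBINT x:q. F x)" if "q \<in> Q" for q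
			using that QC unfolding C_def by (auto intro: less_imp_le)
		show "(LBINT x:q. F x) <= 2^?n*y*measure lborel q" if "q \<in> Q" for q
		proof -
			from that obtain k x where q: "k0 <= k" "q = cell k x" "q \<in> C" using QC unfolding C_def by blast
			have sub: "q \<subseteq> cell (k+1) x" using cell_Suc_subset q by auto
			have "cell (k+1) x ~: C"
			proof
				assume "cell (k+1) x \<in> C"
				then have "q = cell (k+1) x" using that sub by (auto simp: Q_def)
				then have "measure lborel (cell k x) = measure lborel (cell (k+1) x)" using q by simp
				then have "sc k^?n = 2^?n * sc k^?n" by (simp add: measure_cell sc_Suc power_mult_distrib)
				moreover have "(1::real) < 2^?n" by (intro one_less_power) auto
				ultimately show False by simp
			qed
			then have "(LINT x:cell (k+1) x|lborel. F x) <= y*measure lborel (cell (k+1) x)"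
				using q(1) by (force simp: C_def not_less)
			moreover have "(LBINT x:q. F x) <= (LINT x:cell (k+1) x|lborel. F x)"
				unfolding set_lebesgue_integral_def using si[of k x] si[of "k+1" x] F(2) sub q
				by (intro integral_mono) (auto simp: set_integrable_def indicator_def)
			ultimately show ?thesis using q(2) by (simp add: measure_cell sc_Suc power_mult_distrib mult_ac)
		qed
		show "(LINT x:cell k0 x|lborel. F x) <= y*measure lborel (cell k0 x)" if "x ~: \<Union>Q" for x
		proof (rule ccontr)
			assume "\<not> ?thesis"
			then have "cell k0 x \<in> C" by (auto simp: C_def not_le)
			from finite_has_maximal2[OF finC this] obtain m where m: "m \<in> C" "cell k0 x \<subseteq> m" "\<forall>b\<in>C. m \<subseteq> b --> m = b" by blast
			then have "m \<in> Q" by (auto simp: Q_def)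
			then show False using that m(2) cell_refl[of x k0] by blast
		qed
	qed
qed

section \<open>Calderon--Zygmund operators between mixed norm spaces\<close>

text \<open>One shape for all operators to be bounded: at layer \<open>l\<close> the output row
  \<open>k\<close> sees the single input row \<open>tw l k\<close>, with coefficient
  \<open>c l k\<close>. Square functions, their adjoints, and averages at a scale depending on the
  row are instances.\<close>

definition selop :: "'l set => ('l => 'a::euclidean_space => real) => ('l => 'k2 => real) => ('l => 'k2 => 'k1)
		=> ('i => 'k1 => 'a => real) => 'i => 'k2 => 'a => real" where
	"selop L u c tw f i k x = (\<Sum>l\<in>L. c l k*conv (u l) (f i (tw l k)) x)"

text \<open>The constant of \<open>powr_integral_from_distribution\<close> for the data of
  \<open>cz_distribution\<close>: in the second line \<open>A'*2 powr (n * s)\<close> comes from the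
  good part on the stopping cells, \<open>2*A*2^n\<close> from the bad part, \<open>(4*n)^n\<close>
  from the doubled balls, and the leading 2 from the measure of the cells.\<close>

definition czK :: "nat => real => real => real => real => real" where
	"czK n s p A A' = 4 powr p*(A'*(2/(1-2 powr (p-s)))
		+ 2*(A'*2 powr (n * s) + 2*A*2^n + (4*n)^n)*(2 powr (p-1)*(2/(1-2 powr (1-p)))))"

lemma bounded_cell: "bounded (cell k (x::'a::euclidean_space))"
proof -
	have "cell k x \<subseteq> cball x (DIM('a) * sc k)"
		using norm_cell_le[of _ k x] by (auto simp: dist_norm norm_minus_commute)
	then show ?thesis using bounded_cball bounded_subset by blast
qed

lemma measure_cball_le: "d >= 0 ==> measure lborel (cball (a::'a::euclidean_space) d) <= (2*d)^DIM('a)"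
proof -
	assume d: "d >= 0"
	have "cball a d \<subseteq> cbox (a-d *\<^sub>R One) (a + d *\<^sub>R One)"
	proof
		fix x assume "x \<in> cball a d"
		then have "norm (x-a) <= d" by (simp add: dist_norm norm_minus_commute)
		then have "|(x-a) \<bullet> b| <= d" if "b \<in> Basis" for b using Basis_le_norm[OF that, of "x-a"] by linarith
		then have "a \<bullet> b-d <= x \<bullet> b & x \<bullet> b <= a \<bullet> b + d" if "b \<in> Basis" for b
			using that by (force simp: inner_diff_left abs_le_iff)
		then show "x \<in> cbox (a-d *\<^sub>R One) (a + d *\<^sub>R One)"
			by (auto simp: mem_box inner_diff_left inner_add_left)
	qed
	then have "measure lborel (cball a d) <= measure lborel (cbox (a-d *\<^sub>R One) (a + d *\<^sub>R One))"
		by (intro measure_mono_fmeasurable) auto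
	also have "... = (\<Prod>b\<in>(Basis::'a set). 2*d)"
		using d by (subst measure_lborel_cbox_eq, subst if_P) (auto simp: inner_diff_left inner_add_left intro!: prod.cong)
	finally show ?thesis by simp
qed

lemma nrm_all_zero: "r > 0 ==> (!!i k. i \<in> I ==> k \<in> J ==> v i k = 0) ==> nrm r I J v = 0"
	using nrm_cong[of I J v "%_ _. 0" r] by simp

text \<open>By \<open>contr\<close> every layer is a contraction from l^2 to l^2, so the single
  scalar Hoermander sum \<open>hor\<close> over the layers controls the vector-valued
  kernel.\<close>

locale czdat =
	fixes J1 :: "'k1 set" and J2 :: "'k2 set" and L :: "'l set" and u :: "'l => 'a::euclidean_space => real"
		and c :: "'l => 'k2 => real" and tw :: "'l => 'k2 => 'k1" and A :: real
	assumes finJ: "finite J1" "finite J2" "finite L"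
		and nice_u: "!!l. nice (u l)"
		and contr: "!!l w. l \<in> L ==> (\<Sum>k\<in>J2. (c l k*w (tw l k))\<^sup>2) <= (\<Sum>k\<in>J1. (w k)\<^sup>2)"
		and hor: "!!h. (\<Sum>l\<in>L. LBINT x. indicator {x. 2*norm h <= norm x} x*|u l (x-h)-u l x| ) <= A"
begin

abbreviation "T == selop L u c tw"

lemma A_nonneg: "0 <= A"
	by (rule order_trans[OF _ hor[of 0]]) (auto intro!: sum_nonneg integral_nonneg)

lemma nice_T: "(!!i k. nice (f i k)) ==> nice (T f i k)"
	unfolding selop_def[abs_def] by (intro nice_sum nice_cmult nice_conv nice_u)

lemma T_diff: "(!!i k. nice (f i k)) ==> (!!i k. nice (g i k)) ==>
		T (%i k x. f i k x-g i k x) i k x = T f i k x-T g i k x"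
	by (simp add: selop_def conv_diff_right nice_u sum_subtractf right_diff_distrib)

lemma T_sum: "(!!q i k. nice (b q i k)) ==>
		T (%i k x. \<Sum>q\<in>Q. b q i k x) i k x = (\<Sum>q\<in>Q. T (b q) i k x)"
	by (simp add: selop_def conv_sum_right nice_u sum_distrib_left) (rule sum.swap)

lemma contr_nrm:
	assumes "l \<in> L" "r > 0"
	shows "nrm r I J2 (%i k. c l k*w i (tw l k)) <= nrm r I J1 w"
	unfolding nrm_def using assms
	by (intro powr_mono2 sum_mono sum_nonneg contr) auto

text \<open>Mean zero allows \<open>u l (x-a)\<close> to be subtracted under the integral.
  Minkowski's inequality and \<open>contr\<close> reduce the norm to that of \<open>b\<close>, and
  after Fubini the Hoermander sum with \<open>h = t-a\<close> remains for each \<open>t\<close> in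
  the support.\<close>

lemma bad_part:
	fixes r d :: real
	assumes r: "r > 1" "finite I" and b: "!!i k. nice (b i k)" "!!i k. (LBINT t. b i k t) = 0"
		and supp: "!!i k t. b i k t ~= 0 ==> norm (t-a) <= d" and d: "d >= 0"
	shows "(LBINT x. indicator {x. 2*d <= norm (x-a)} x*nrm r I J2 (%i k. T b i k x))
		<= A*(LBINT t. nrm r I J1 (%i k. b i k t))"
proof -
	define B where "B t = nrm r I J1 (%i k. b i k t)" for t
	have nB: "nice B" unfolding B_def[abs_def] using r finJ b by (intro nice_nrm) auto
	have B0: "B t >= 0" for t by (simp add: B_def)
	let ?S = "{x. 2*d <= norm (x-a)}"
	let ?D = "%l x t. |u l (x-t)-u l (x-a)|*B t" and ?T = "%x. nrm r I J2 (%i k. T b i k x)"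
	have [measurable]: "?S \<in> sets borel" by measurable
	have [measurable]: "u l \<in> BM" "B \<in> BM" for l using nice_u nB by (auto dest: nice_meas)
	have n1: "nice (%t. (u l (x-t)-u l (x-a))*b i k t)" for l x i k
		unfolding left_diff_distrib by (intro nice_diff nice_conv_integrand nice_u b nice_cmult)
	have n2: "nice (%t. |u l (x-t)-u l (x-a)|*B t)" for l x
		using nice_abs[OF nice_diff[OF nice_conv_integrand[OF nice_u nB, of l x] nice_cmult[OF nB, of "u l (x-a)"]]]
		by (simp add: left_diff_distrib[symmetric] abs_mult B0)
	have pt: "?T x <= (\<Sum>l\<in>L. LBINT t. |u l (x-t)-u l (x-a)|*B t)" for x
	proof -
		have cv: "conv (u l) (b i k) x = (LBINT t. (u l (x-t)-u l (x-a))*b i k t)" for l i k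
			using b(2)[of i k] nice_conv_integrable[OF nice_u b(1), of l x i k] nice_int[OF b(1), of i k]
			by (simp add: conv_def left_diff_distrib)
		have "?T x
			<= (\<Sum>l\<in>L. nrm r I J2 (%i k. c l k*(LBINT t. (u l (x-t)-u l (x-a))*b i (tw l k) t)))"
			unfolding selop_def cv using r finJ by (intro nrm_sum)
		also have "... <= (\<Sum>l\<in>L. nrm r I J1 (%i k. LBINT t. (u l (x-t)-u l (x-a))*b i k t))"
			using r contr_nrm[where w="%i k. LBINT t. (u _ (x-t)-u _ (x-a))*b i k t"] by (intro sum_mono) auto
		also have "... <= (\<Sum>l\<in>L. LBINT t. nrm r I J1 (%i k. (u l (x-t)-u l (x-a))*b i k t))"
			using r finJ by (intro sum_mono nrm_integral_le nice_int nice_nrm n1) auto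
		also have "... = (\<Sum>l\<in>L. LBINT t. |u l (x-t)-u l (x-a)|*B t)"
			using r by (simp add: nrm_cmult B_def)
		finally show ?thesis .
	qed
	have n3: "nice (%z. indicator ?S (fst z)*( |u l (fst z-snd z)-u l (fst z-a)|*B (snd z)))" for l
	proof (rule nice_bmult)
		have "nice (%z. |u l (fst z-snd z)*B (snd z)-u l (fst z-a)*B (snd z)| )"
			by (intro nice_abs nice_diff nice_conv_kernel nice_u nB nice_tensor[OF nice_shift])
		then show "nice (%z. |u l (fst z-snd z)-u l (fst z-a)|*B (snd z))"
			by (simp add: left_diff_distrib[symmetric] abs_mult B0)
		show "(%z::'a\<times>'a. indicator ?S (fst z) :: real) \<in> BM"
			by (rule measurable_compose[OF borel_measurable_fst, of "indicator ?S"]) measurable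
	qed (auto simp: indicator_def intro!: order_refl)
	have nT: "nice (%x. ?T x)" using r finJ b by (intro nice_nrm nice_T) auto
	have "(LBINT x. indicator ?S x*?T x)
		<= (LBINT x. (\<Sum>l\<in>L. LBINT t. indicator ?S x*(?D l x t)))"
	proof (rule integral_mono)
		show "integrable lborel (%x. indicator ?S x*?T x)"
			by (intro nice_int nice_ind_mult nT) measurable
		show "integrable lborel (%x. \<Sum>l\<in>L. LBINT t. indicator ?S x*(?D l x t))"
			using nice_partial_integral[OF n3] by (intro Bochner_Integration.integrable_sum nice_int) auto
		show "indicator ?S x*?T x <= (\<Sum>l\<in>L. LBINT t. indicator ?S x*(?D l x t))" for x
			using pt[of x] by (auto simp: indicator_def sum_distrib_left[symmetric])
	qed
	also have "... = (\<Sum>l\<in>L. LBINT x. LBINT t. indicator ?S x*(?D l x t))"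
		using nice_partial_integral[OF n3] by (intro Bochner_Integration.integral_sum nice_int) auto
	also have "... = (\<Sum>l\<in>L. LBINT t. LBINT x. indicator ?S x*(?D l x t))"
		using n3 by (intro sum.cong refl nice_Fubini(1)) auto
	also have "... = (LBINT t. (\<Sum>l\<in>L. LBINT x. indicator ?S x*(?D l x t)))"
		using nice_partial_integral[OF nice_swap[OF n3]]
		by (intro Bochner_Integration.integral_sum[symmetric] nice_int) auto
	also have "... <= (LBINT t. A*B t)"
	proof (rule integral_mono)
		show "integrable lborel (%t. \<Sum>l\<in>L. LBINT x. indicator ?S x*(?D l x t))"
			using nice_partial_integral[OF nice_swap[OF n3]] by (intro Bochner_Integration.integrable_sum nice_int) auto
		show "integrable lborel (%t. A*B t)" by (intro nice_int nice_cmult nB)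
		fix t
		show "(\<Sum>l\<in>L. LBINT x. indicator ?S x*(?D l x t)) <= A*B t"
		proof (cases "B t = 0")
			case False
			have "\<exists>i\<in>I. \<exists>k\<in>J1. b i k t ~= 0"
				using False nrm_all_zero[of r I J1 "%i k. b i k t"] r by (auto simp: B_def)
			then have ta: "norm (t-a) <= d" using supp by blast
			have "(LBINT x. indicator ?S x*|u l (x-t)-u l (x-a)| )
				<= (LBINT x. indicator {x. 2*norm (t-a) <= norm x} x*|u l (x-(t-a))-u l x| )" for l
			proof -
				have "(LBINT x. indicator ?S x*|u l (x-t)-u l (x-a)| )
					= (LBINT x. (%x. indicator {x. 2*d <= norm x} x*|u l (x-(t-a))-u l x| ) (x-a))"
					by (intro Bochner_Integration.integral_cong refl) (auto simp: indicator_def algebra_simps)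
				also have "... = (LBINT x. indicator {x. 2*d <= norm x} x*|u l (x-(t-a))-u l x| )"
					by (rule lborel_shift[OF nice_meas])
						(intro nice_ind_mult nice_abs nice_diff nice_shift nice_u, measurable)
				also have "... <= (LBINT x. indicator {x. 2*norm (t-a) <= norm x} x*|u l (x-(t-a))-u l x| )"
					using ta by (intro integral_mono nice_int nice_ind_mult nice_abs nice_diff nice_shift nice_u)
						(auto simp: indicator_def)
				finally show ?thesis .
			qed
			then have "(\<Sum>l\<in>L. LBINT x. indicator ?S x*|u l (x-t)-u l (x-a)| ) <= A"
				by (intro order_trans[OF sum_mono hor[of "t-a"]])
			then have "(\<Sum>l\<in>L. LBINT x. indicator ?S x*|u l (x-t)-u l (x-a)| )*B t <= A*B t"
				using B0 by (intro mult_right_mono)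
			then show ?thesis by (simp add: sum_distrib_right mult.assoc[symmetric])
		qed simp
	qed
	finally show ?thesis by (simp add: B_def)
qed

text \<open>The Calderon-Zygmund decomposition at height \<open>y\<close>. As the components are
  constant on cells of scale \<open>k0\<close>, the norm \<open>F\<close> is at most
  \<open>y\<close> at every point outside the stopping cells. Restricting \<open>F powr s\<close> to
  low values and \<open>F\<close> to high values is what allows summation over the levels.\<close>

lemma cz_distribution:
	fixes r s y A' :: real
	assumes r: "r > 1" "finite I" "s > 0" and f: "!!i j. nice (f i j)"
		and step: "!!i j x y. y \<in> cell k0 x ==> f i j y = f i j x"
		and Lb: "!!g. (!!i j. nice (g i j)) ==> Phi s r I J2 (T g) <= A'*Phi s r I J1 g" and A': "A' >= 0"
		and y: "y > 0"
	defines "F == %x. nrm r I J1 (%i j. f i j x)"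
	shows "measure lborel {x. 2*y < nrm r I J2 (%i j. T f i j x)} <=
			A'*y powr (-s)*(LBINT x. F x powr s*indicator {x. F x <= y} x)
			+ 2*(A'*2 powr (DIM('a) * s) + 2*A*2^DIM('a) + (4*DIM('a))^DIM('a))*y powr (-1)*(LBINT x. F x*indicator {x. y < 2*F x} x)"
proof -
	let ?n = "DIM('a)"
	let ?G = "%x. F x*indicator {x. y < 2*F x} x" and ?P = "LBINT x. F x powr s*indicator {x. F x <= y} x" and ?m = "measure lborel"
	have nF: "nice F" unfolding F_def using r finJ f by (intro nice_nrm) auto
	have F0: "0 <= F x" for x by (simp add: F_def)
	have [measurable]: "F \<in> BM" "f i j \<in> BM" for i j
		using nF f by (auto dest: nice_meas)
	obtain Q where Q: "finite Q" "disjoint Q" "!!q. q \<in> Q ==> EX k x. q = cell k x"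
		"!!q. q \<in> Q ==> y*?m q <= (LBINT x:q. F x)"
		"!!q. q \<in> Q ==> (LBINT x:q. F x) <= 2^?n*y*?m q"
		"!!x. x ~: \<Union>Q ==> (LINT x:cell k0 x|lborel. F x) <= y*?m (cell k0 x)"
		using stopping_cells[OF nF F0 y, of k0 thesis] by blast
	then obtain kk aa where ka: "!!q. q \<in> Q ==> q = cell (kk q) (aa q)" by metis
	define d where "d q = ?n * sc (kk q)" for q
	have d0: "d q >= 0" for q by (simp add: d_def)
	\<comment> \<open>The set is empty off \<open>Q\<close>, so that measurability and niceness of the
	  pieces hold for every index without a side condition.\<close>
	define Qp where "Qp q = (if q \<in> Q then q else {})" for q
	let ?i = "%q. indicator (Qp q) :: 'a => real" and ?s = "%x. \<Sum>q\<in>Q. indicator (Qp q) x :: real"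
	have qm[measurable]: "Qp q \<in> sets borel" for q
		using ka[of q] cell_measurable[of "kk q" "aa q"] by (cases "q \<in> Q") (simp_all add: Qp_def)
	have qb: "bounded (Qp q)" for q
		using ka[of q] bounded_cell[of "kk q" "aa q"] by (cases "q \<in> Q") (simp_all add: Qp_def)
	have qpos: "?m q > 0" if "q \<in> Q" for q
		using ka[OF that] measure_cell[of "kk q" "aa q"] by simp
	define avg where "avg q i j = (LBINT x. ?i q x*f i j x)/?m q" for q i j
	define b where "b q i j x = ?i q x*f i j x-avg q i j*?i q x" for q i j x
	define g where "g i j x = f i j x-(\<Sum>q\<in>Q. b q i j x)" for i j x
	have nb: "nice (b q i j)" for q i j
		unfolding b_def[abs_def] by (intro nice_diff nice_ind_mult nice_cmult nice_indicator qb qm f)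
	have ng: "nice (g i j)" for i j
		unfolding g_def[abs_def] by (intro nice_diff nice_sum nb f)
	have gin: "g i j x = avg q i j" if "q \<in> Q" "x \<in> q" for q i j x
	proof -
		have "(\<Sum>q'\<in>Q. b q' i j x) = (\<Sum>q'\<in>Q. if q' = q then f i j x-avg q i j else 0)"
		proof (rule sum.cong[OF refl])
			fix q' assume q': "q' \<in> Q"
			have "q' ~= q ==> x ~: q'" using that q' Q(2) unfolding disjoint_def by blast
			then show "b q' i j x = (if q' = q then f i j x-avg q i j else 0)"
				using that q' by (auto simp: b_def Qp_def)
		qed
		then show ?thesis using that Q(1) by (simp add: g_def)
	qed
	have gout: "g i j x = f i j x" if "x ~: \<Union>Q" for i j x
		using that by (auto simp: g_def b_def Qp_def indicator_def intro!: sum.neutral)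
	have si: "(LBINT x:q. F x) = (LBINT x. ?i q x*F x)" if "q \<in> Q" for q
		using that by (simp add: set_lebesgue_integral_def Qp_def)
	have avg_le: "nrm r I J1 (avg q)*?m q <= (LBINT x. ?i q x*F x)" if "q \<in> Q" for q
	proof -
		have "nrm r I J1 (avg q)*?m q = nrm r I J1 (%i j. ?m q*avg q i j)"
			using r by (simp add: nrm_cmult mult.commute)
		also have "... = nrm r I J1 (%i j. LBINT x. ?i q x*f i j x)"
			using qpos[OF that] by (simp add: avg_def)
		also have "... <= (LBINT x. nrm r I J1 (%i j. ?i q x*f i j x))"
			using r finJ by (intro nrm_integral_le nice_int nice_nrm nice_ind_mult f qm) auto
		also have "... = (LBINT x. ?i q x*F x)"
			using r by (simp add: nrm_cmult F_def)
		finally show ?thesis .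
	qed
	have avg_le2: "nrm r I J1 (avg q) <= 2^?n*y" if "q \<in> Q" for q
	proof -
		have "nrm r I J1 (avg q)*?m q <= 2^?n*y*?m q"
			using avg_le[OF that] Q(5)[OF that] si[OF that] by linarith
		then show ?thesis using qpos[OF that] by simp
	qed
	have Fout: "F x <= y" if "x ~: \<Union>Q" for x
	proof -
		have "indicator (cell k0 x) z *\<^sub>R F z = F x*indicator (cell k0 x) z" for z
		proof (cases "z \<in> cell k0 x")
			case True
			then have "F z = F x" unfolding F_def by (simp only: step[OF True])
			then show ?thesis using True by simp
		qed simp
		then have "(LINT z:cell k0 x|lborel. F z) = (LBINT z. F x*indicator (cell k0 x) z)"
			unfolding set_lebesgue_integral_def by presburger
		then have "(LINT z:cell k0 x|lborel. F z) = F x*?m (cell k0 x)" by simp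
		then have "F x*?m (cell k0 x) <= y*?m (cell k0 x)" using Q(6)[OF that] by simp
		then show ?thesis by (simp add: measure_cell)
	qed
	define W where "W = (\<Sum>q\<in>Q. ?m q)"
	have W0: "W >= 0" by (simp add: W_def sum_nonneg)
	have sumind: "?s x <= (1::real)" for x
	proof (cases "x \<in> \<Union>Q")
		case True
		then obtain q where q: "q \<in> Q" "x \<in> q" by blast
		have "(\<Sum>q'\<in>Q. indicator (Qp q') x) = (\<Sum>q'\<in>Q. if q' = q then 1 else (0::real))"
		proof (rule sum.cong[OF refl])
			fix q' assume q': "q' \<in> Q"
			have "q' ~= q ==> x ~: q'" using q q' Q(2) unfolding disjoint_def by blast
			then show "indicator (Qp q') x = (if q' = q then 1 else (0::real))" using q q' by (auto simp: Qp_def)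
		qed
		then show ?thesis using Q(1) q by simp
	next
		case False
		then have "?s x = (0::real)" by (intro sum.neutral) (auto simp: Qp_def indicator_def)
		then show ?thesis by simp
	qed
	have intq: "(LBINT x. ?i q x) = ?m q" if "q \<in> Q" for q
		using that by (simp add: Qp_def)
	let ?X = "LBINT x. ?G x"
	have nX: "nice (%x. ?G x)"
		by (subst mult.commute, intro nice_ind_mult nF) measurable
	\<comment> \<open>On a stopping cell \<open>F\<close> is at most its part above \<open>y/2\<close>
	  plus \<open>y/2\<close>, while its average is at least \<open>y\<close>; half of
	  \<open>y*W\<close> is absorbed.\<close>
	have W_le: "W <= 2/y*?X"
	proof -
		have "y*W <= (\<Sum>q\<in>Q. LBINT x. ?i q x*F x)"
			unfolding W_def sum_distrib_left using Q(4) si by (intro sum_mono) auto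
		also have "... <= (\<Sum>q\<in>Q. (LBINT x. ?i q x*(?G x)) + y/2*?m q)"
		proof (rule sum_mono)
			fix q assume q: "q \<in> Q"
			have "(LBINT x. ?i q x*F x) <= (LBINT x. ?i q x*(?G x) + y/2*?i q x)"
				by (intro integral_mono nice_int nice_add nice_ind_mult nF nX nice_cmult nice_indicator qb qm)
					(use y in \<open>auto simp: indicator_def\<close>)
			also have "... = (LBINT x. ?i q x*(?G x)) + (LBINT x. y/2*?i q x)"
				by (intro Bochner_Integration.integral_add nice_int nice_ind_mult nX nice_cmult nice_indicator qb qm)
			also have "(LBINT x. y/2*?i q x) = y/2*?m q" using intq[OF q] by simp
			finally show "(LBINT x. ?i q x*F x) <= (LBINT x. ?i q x*(?G x)) + y/2*?m q" .
		qed
		also have "... = (\<Sum>q\<in>Q. LBINT x. ?i q x*(?G x)) + y/2*W"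
			by (simp add: sum.distrib W_def sum_distrib_left)
		also have "(\<Sum>q\<in>Q. LBINT x. ?i q x*(?G x))
			= (LBINT x. (\<Sum>q\<in>Q. ?i q x*(?G x)))"
			by (intro Bochner_Integration.integral_sum[symmetric] nice_int nice_ind_mult nX qm)
		also have "... <= ?X"
		proof (intro integral_mono nice_int nice_sum nice_ind_mult nX qm)
			fix x
			show "(\<Sum>q\<in>Q. ?i q x*(?G x)) <= ?G x"
				unfolding sum_distrib_right[symmetric] using sumind[of x] F0[of x] by (intro mult_left_le_one_le) (auto intro!: sum_nonneg)
		qed
		finally show ?thesis using y by (simp add: field_simps)
	qed
	have Phig: "Phi s r I J1 g <= ?P + (2^?n*y) powr s*W"
	proof -
		have n4: "nice (%x. F x powr s*indicator {x. F x <= y} x)"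
			using r by (subst mult.commute, intro nice_ind_mult nice_powr nF F0) auto
		have "Phi s r I J1 g <= (LBINT x. F x powr s*indicator {x. F x <= y} x + (2^?n*y) powr s*?s x)"
			unfolding Phi_def
		proof (intro integral_mono nice_int nice_add n4 nice_cmult nice_sum nice_indicator qb qm nice_Phi_integrand ng r finJ)
			fix x
			show "nrm r I J1 (%i j. g i j x) powr s <= F x powr s*indicator {x. F x <= y} x + (2^?n*y) powr s*?s x"
			proof (cases "x \<in> \<Union>Q")
				case True
				then obtain q where q: "q \<in> Q" "x \<in> q" by blast
				have "?i q x <= ?s x"
					using Q(1) q by (intro member_le_sum) auto
				then have "1 <= ?s x" using q by (simp add: Qp_def)
				then have "(2^?n*y) powr s*1 <= (2^?n*y) powr s*?s x"
					by (intro mult_left_mono) auto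
				moreover have "nrm r I J1 (%i j. g i j x) powr s <= (2^?n*y) powr s"
					using gin[OF q] avg_le2[OF q(1)] r by (intro powr_mono2) auto
				moreover have "0 <= F x powr s*indicator {x. F x <= y} x" by simp
				ultimately show ?thesis by linarith
			next
				case False
				then show ?thesis using gout[OF False] Fout[OF False] by (simp add: F_def sum_nonneg)
			qed
		qed
		also have "... = ?P + (LBINT x. (2^?n*y) powr s*?s x)"
			by (intro Bochner_Integration.integral_add nice_int n4 nice_cmult nice_sum nice_indicator qb qm)
		also have "(LBINT x. (2^?n*y) powr s*?s x) = (2^?n*y) powr s*W"
			unfolding W_def using intq by (simp add: nice_int[OF nice_indicator[OF qb qm]] del: integral_indicator)
		finally show ?thesis .
	qed
	have intb: "(LBINT x. nrm r I J1 (%i j. b q i j x)) <= 2*(2^?n*y*?m q)" if q: "q \<in> Q" for q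
	proof -
		have "(LBINT x. nrm r I J1 (%i j. b q i j x)) <= (LBINT x. ?i q x*F x + nrm r I J1 (avg q)*?i q x)"
		proof (intro integral_mono nice_int nice_add nice_ind_mult nF nice_cmult nice_indicator qb qm nice_nrm nb r finJ)
			fix x
			have "nrm r I J1 (%i j. b q i j x) = nrm r I J1 (%i j. ?i q x*f i j x + (- ?i q x)*avg q i j)"
				by (simp add: b_def mult.commute)
			also have "... <= nrm r I J1 (%i j. ?i q x*f i j x) + nrm r I J1 (%i j. (- ?i q x)*avg q i j)"
				using r finJ by (intro nrm_triangle) auto
			also have "... = ?i q x*F x + nrm r I J1 (avg q)*?i q x"
				using r by (simp only: nrm_cmult) (simp add: F_def mult.commute)
			finally show "nrm r I J1 (%i j. b q i j x) <= ?i q x*F x + nrm r I J1 (avg q)*?i q x" .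
		qed
		also have "... = (LBINT x. ?i q x*F x) + (LBINT x. nrm r I J1 (avg q)*?i q x)"
			by (intro Bochner_Integration.integral_add nice_int nice_ind_mult nF nice_cmult nice_indicator qb qm)
		also have "(LBINT x. nrm r I J1 (avg q)*?i q x) = nrm r I J1 (avg q)*?m q"
			using intq[OF q] by simp
		finally show ?thesis using avg_le[OF q] Q(5)[OF q] si[OF q] by linarith
	qed
	have b_mean: "(LBINT t. b q i j t) = 0" for q i j
	proof (cases "q \<in> Q")
		case True
		have "(LBINT t. b q i j t) = (LBINT x. ?i q x*f i j x)-(LBINT x. avg q i j*?i q x)"
			unfolding b_def by (intro Bochner_Integration.integral_diff nice_int nice_ind_mult f nice_cmult nice_indicator qb qm)
		also have "(LBINT x. avg q i j*?i q x) = avg q i j*?m q" using intq[OF True] by simp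
		finally show ?thesis using qpos[OF True] by (simp add: avg_def)
	qed (simp add: b_def Qp_def)
	have b_supp: "norm (t-aa q) <= d q" if "b q i j t ~= 0" for q i j t
	proof -
		have "t \<in> Qp q" using that by (auto simp: b_def indicator_def split: if_splits)
		then have "t \<in> cell (kk q) (aa q)" using ka[of q] by (auto simp: Qp_def split: if_splits)
		then show ?thesis unfolding d_def by (rule norm_cell_le)
	qed
	let ?TF = "%f x. nrm r I J2 (%i j. T f i j x)"
	have nTb: "nice (%x. ?TF (b q) x)" and nTg: "nice (%x. ?TF g x powr s)" and nTf: "nice (%x. ?TF f x)" for q
		using r finJ f nb ng by (auto intro!: nice_nrm nice_T nice_Phi_integrand)
	let ?E = "{x. 2*y < ?TF f x}"
	have nE: "nice (%x. indicator ?E x :: real)"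
	proof (rule nice_indicator)
		from nTf obtain R where R: "!!x. ?TF f x ~= 0 ==> norm x <= R" by (metis niceE)
		then have "?E \<subseteq> cball 0 R" using y by force
		then show "bounded ?E" using bounded_cball bounded_subset by blast
		have [measurable]: "?TF f \<in> BM" using nTf by (rule nice_meas)
		show "?E \<in> sets borel" by measurable
	qed
	let ?out = "%q. {x. 2*d q <= norm (x-aa q)}"
	have om[measurable]: "?out q \<in> sets borel" for q by measurable
	\<comment> \<open>Chebyshev and the union bound in pointwise form: a point of \<open>?E\<close>
	  lies in a doubled ball, or the good part exceeds \<open>y\<close>, or the bad parts together
	  exceed \<open>y\<close> outside all doubled balls.\<close>
	have pt: "indicator ?E x <= y powr (-s)*?TF g x powr s + (\<Sum>q\<in>Q. y powr (-1)*(indicator (?out q) x*?TF (b q) x)) + (\<Sum>q\<in>Q. indicator (cball (aa q) (2*d q)) x)" for x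
	proof -
		have nn: "0 <= y powr (-s)*?TF g x powr s" "0 <= (\<Sum>q\<in>Q. y powr (-1)*(indicator (?out q) x*?TF (b q) x))"
			"0 <= (\<Sum>q\<in>Q. indicator (cball (aa q) (2*d q)) x :: real)"
			by (auto intro!: sum_nonneg)
		have ind1: "indicator ?E x <= (1::real)" by (rule indicator_le_1)
		show ?thesis
		proof (cases "x \<in> ?E")
			case True
			have "?TF f x = nrm r I J2 (%i j. T g i j x + (\<Sum>q\<in>Q. T (b q) i j x))"
			proof -
				have "T g i j x = T f i j x-(\<Sum>q\<in>Q. T (b q) i j x)" for i j
					unfolding g_def[abs_def] by (simp add: T_diff T_sum f nb nice_sum)
				then show ?thesis by simp
			qed
			also have "... <= ?TF g x + nrm r I J2 (%i j. \<Sum>q\<in>Q. T (b q) i j x)"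
				using r finJ by (intro nrm_triangle) auto
			also have "... <= ?TF g x + (\<Sum>q\<in>Q. ?TF (b q) x)"
				using r finJ by (intro add_left_mono nrm_sum) auto
			finally have le: "2*y < ?TF g x + (\<Sum>q\<in>Q. ?TF (b q) x)" using True by simp
			show ?thesis
			proof (cases "\<exists>q\<in>Q. x \<in> cball (aa q) (2*d q)")
				case True
				then obtain q where q: "q \<in> Q" "x \<in> cball (aa q) (2*d q)" by blast
				have "indicator (cball (aa q) (2*d q)) x <= (\<Sum>q\<in>Q. indicator (cball (aa q) (2*d q)) x :: real)"
					using q Q(1) by (intro member_le_sum) auto
				then have "1 <= (\<Sum>q\<in>Q. indicator (cball (aa q) (2*d q)) x :: real)" using q by simp
				then show ?thesis using nn ind1 by linarith
			next
				case False
				then have out: "x \<in> ?out q" if "q \<in> Q" for q using that by (force simp: dist_norm norm_minus_commute)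
				consider "y < ?TF g x" | "y < (\<Sum>q\<in>Q. ?TF (b q) x)" using le by linarith
				then show ?thesis
				proof cases
					case 1
					then have "y powr s <= ?TF g x powr s" using y r by (intro powr_mono2) auto
					then have "1 <= y powr (-s)*?TF g x powr s" using y by (simp add: powr_minus_divide field_simps)
					then show ?thesis using nn ind1 by linarith
				next
					case 2
					have "(\<Sum>q\<in>Q. y powr (-1)*(indicator (?out q) x*?TF (b q) x)) = (\<Sum>q\<in>Q. ?TF (b q) x)/y"
						using out y by (simp add: sum_divide_distrib powr_minus_divide)
					then have "1 <= (\<Sum>q\<in>Q. y powr (-1)*(indicator (?out q) x*?TF (b q) x))" using 2 y by simp
					then show ?thesis using nn ind1 by linarith
				qed
			qed
		next
			case False
			then show ?thesis using nn by simp
		qed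
	qed
	have ncb: "nice (%x. indicator (cball (aa q) (2*d q)) x :: real)" for q by (intro nice_indicator) auto
	have nob: "nice (%x. indicator (?out q) x*?TF (b q) x)" for q by (intro nice_ind_mult nTb om)
	have "?m ?E = (LBINT x. indicator ?E x)" by simp
	also have "... <= (LBINT x. y powr (-s)*?TF g x powr s + (\<Sum>q\<in>Q. y powr (-1)*(indicator (?out q) x*?TF (b q) x)) + (\<Sum>q\<in>Q. indicator (cball (aa q) (2*d q)) x))"
		by (intro integral_mono nice_int nE nice_add nice_cmult nTg nice_sum nob ncb pt)
	also have "... = y powr (-s)*Phi s r I J2 (T g) + (\<Sum>q\<in>Q. y powr (-1)*(LBINT x. indicator (?out q) x*?TF (b q) x)) + (\<Sum>q\<in>Q. ?m (cball (aa q) (2*d q)))"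
		using nice_int[OF nTg] nice_int[OF nob] nice_int[OF ncb]
		by (simp add: Phi_def)
	also have "... <= y powr (-s)*(A'*(?P + (2^?n*y) powr s*W))
			+ (\<Sum>q\<in>Q. y powr (-1)*(A*(2*(2^?n*y*?m q)))) + (\<Sum>q\<in>Q. (4*?n)^?n*?m q)"
	proof (intro add_mono sum_mono mult_left_mono)
		show "Phi s r I J2 (T g) <= A'*(?P + (2^?n*y) powr s*W)"
			using Lb[of g, OF ng] mult_left_mono[OF Phig A'] by linarith
		fix q assume q: "q \<in> Q"
		show "(LBINT x. indicator (?out q) x*?TF (b q) x) <= A*(2*(2^?n*y*?m q))"
		proof (rule order_trans)
			show "(LBINT x. indicator (?out q) x*?TF (b q) x) <= A*(LBINT x. nrm r I J1 (%i j. b q i j x))"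
				by (rule bad_part) (fact r nb b_mean b_supp d0)+
		qed (rule mult_left_mono[OF intb[OF q] A_nonneg])
		have "?m (cball (aa q) (2*d q)) <= (2*(2*d q))^?n" using d0 by (intro measure_cball_le) auto
		also have "... = (4*?n)^?n*?m q"
			using ka[OF q] measure_cell[of "kk q" "aa q"] by (simp add: d_def power_mult_distrib mult_ac)
		finally show "?m (cball (aa q) (2*d q)) <= (4*?n)^?n*?m q" .
	qed (use y in auto)
	finally have le: "?m ?E <= y powr (-s)*(A'*(?P + (2^?n*y) powr s*W))
			+ (\<Sum>q\<in>Q. y powr (-1)*(A*(2*(2^?n*y*?m q)))) + (\<Sum>q\<in>Q. (4*?n)^?n*?m q)" .
	have yy: "y powr (-1)*y = 1" using y by (simp add: powr_minus_divide)
	have ys: "y powr (-s)*(2^?n*y) powr s = 2 powr (?n * s)"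
	proof -
		have "(2::real)^?n = 2 powr ?n" by (simp add: powr_realpow)
		then have "(2^?n*y) powr s = 2 powr (?n * s)*y powr s" using y by (simp add: powr_mult powr_powr)
		then show ?thesis using y by (simp add: powr_minus_divide)
	qed
	have s1: "(\<Sum>q\<in>Q. y powr (-1)*(A*(2*(2^?n*y*?m q)))) = 2*A*2^?n*W"
	proof -
		have "y powr (-1)*(A*(2*(2^?n*y * v))) = 2*A*2^?n * v * (y powr (-1)*y)" for v
			by (simp only: mult_ac)
		then show ?thesis by (simp only: yy W_def sum_distrib_left mult_1_right)
	qed
	have s2: "(\<Sum>q\<in>Q. (4*?n)^?n*?m q) = (4*?n)^?n*W"
		by (simp add: W_def sum_distrib_left)
	have s3: "y powr (-s)*(A'*(?P + (2^?n*y) powr s*W)) = A'*y powr (-s)*?P + A'*2 powr (?n * s)*W"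
		unfolding ys[symmetric] by (simp only: distrib_left mult_ac)
	have "?m ?E <= A'*y powr (-s)*?P + A'*2 powr (?n * s)*W + 2*A*2^?n*W + (4*?n)^?n*W"
		using le unfolding s1 s2 s3 .
	also have "... = A'*y powr (-s)*?P + (A'*2 powr (?n * s) + 2*A*2^?n + (4*?n)^?n)*W"
		by (simp only: distrib_right add.assoc)
	also have "... <= A'*y powr (-s)*?P + (A'*2 powr (?n * s) + 2*A*2^?n + (4*?n)^?n)*(2/y*?X)"
		using A' A_nonneg W_le by (intro add_left_mono mult_left_mono) auto
	also have "... = A'*y powr (-s)*?P + 2*(A'*2 powr (?n * s) + 2*A*2^?n + (4*?n)^?n)*y powr (-1)*?X"
		using y by (simp add: powr_minus_divide)
	finally show ?thesis by simp
qed

end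

section \<open>From step functions to nice functions by dominated convergence\<close>

lemma nrm_tendsto:
	assumes "r > 0" "!!i k. i \<in> I ==> k \<in> J ==> (%m. v m i k) ----> w i k"
	shows "(%m. nrm r I J (v m)) ----> nrm r I J w"
	unfolding nrm_def using assms
	by (intro tendsto_powr' tendsto_sum tendsto_power tendsto_const) (auto intro!: always_eventually sum_nonneg)

lemma Phi_tendsto:
	assumes p: "p > 0" "r > 1" "finite I" "finite J" and H: "!!i k. nice (H i k)"
		and F: "!!m i k. F m i k \<in> BM" "!!m i k x. |F m i k x| <= H i k x"
		and G: "!!i k. G i k \<in> BM" "!!i k. AE x in lborel. (%m. F m i k x) ----> G i k x"
	shows "(%m. Phi p r I J (F m)) ----> Phi p r I J G"
	unfolding Phi_def
proof (rule integral_dominated_convergence)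
	let ?w = "%x. (\<Sum>i\<in>I. \<Sum>k\<in>J. H i k x) powr p"
	have H0: "0 <= H i k x" for i k x using F(2)[of undefined i k x] by linarith
	show "integrable lborel ?w"
		using p H0 by (intro nice_int nice_powr nice_sum H) (auto intro!: sum_nonneg)
	note F(1)[measurable] G(1)[measurable]
	show "(%x. nrm r I J (%i k. G i k x) powr p) \<in> borel_measurable lborel" by measurable
	show "(%x. nrm r I J (%i k. F m i k x) powr p) \<in> borel_measurable lborel" for m by measurable
	have "AE x in lborel. \<forall>i\<in>I. \<forall>k\<in>J. (%m. F m i k x) ----> G i k x"
		using p G(2) by (intro AE_finite_allI) auto
	then show "AE x in lborel. (%m. nrm r I J (%i k. F m i k x) powr p) ----> nrm r I J (%i k. G i k x) powr p"
		by eventually_elim (use p in \<open>auto intro!: tendsto_powr' nrm_tendsto tendsto_const always_eventually\<close>)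
	show "AE x in lborel. norm (nrm r I J (%i k. F m i k x) powr p) <= ?w x" for m
	proof (rule AE_I2)
		fix x
		have "nrm r I J (%i k. F m i k x) <= (\<Sum>i\<in>I. \<Sum>k\<in>J. |F m i k x| )" using p by (intro nrm_le_sum_abs)
		also have "... <= (\<Sum>i\<in>I. \<Sum>k\<in>J. H i k x)" by (intro sum_mono F)
		finally show "norm (nrm r I J (%i k. F m i k x) powr p) <= ?w x" using p by (auto intro!: powr_mono2)
	qed
qed

lemma conv_tendsto:
	assumes u: "nice u" and H: "nice H"
		and F: "!!m. F m \<in> BM" "!!m x. |F m x| <= H x"
		and G: "G \<in> BM" "AE x in lborel. (%m. F m x) ----> G x"
	shows "(%m. conv u (F m) x) ----> conv u G x"
	unfolding conv_def
proof (rule integral_dominated_convergence)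
	note F(1)[measurable] G(1)[measurable]
	have [measurable]: "u \<in> BM" using u by (rule nice_meas)
	show "integrable lborel (%t. |u (x-t)|*H t)"
		using nice_conv_integrable[OF nice_abs[OF u] H] .
	show "(%t. u (x-t)*G t) \<in> borel_measurable lborel" by measurable
	show "(%t. u (x-t)*F m t) \<in> borel_measurable lborel" for m by measurable
	show "AE t in lborel. (%m. u (x-t)*F m t) ----> u (x-t)*G t"
		using G(2) by eventually_elim (intro tendsto_mult tendsto_const)
	show "AE t in lborel. norm (u (x-t)*F m t) <= |u (x-t)|*H t" for m
		using F(2) by (auto simp: abs_mult intro!: mult_left_mono)
qed

text \<open>The lower corner of the cell of scale \<open>-m\<close> around a point. Composition with
  it turns any function into one that is constant on these cells.\<close>

definition rnd :: "nat => 'a::euclidean_space => 'a" where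
	"rnd m x = (\<Sum>b\<in>Basis. (of_int \<lfloor>(x \<bullet> b)/sc (- int m)\<rfloor> * sc (- int m)) *\<^sub>R b)"

lemma rnd_measurable[measurable]: "rnd m \<in> BM"
	unfolding rnd_def[abs_def] by measurable

lemma rnd_cell: "y \<in> cell (- int m) x ==> rnd m y = rnd m x"
	unfolding rnd_def cell_def by (intro sum.cong) auto

lemma rnd_in_cell: "rnd m x \<in> cell (- int m) x"
	by (auto simp: cell_def rnd_def inner_sum_left inner_Basis if_distrib sum.delta cong: if_cong)

lemma norm_rnd: "norm (rnd m x-x) <= DIM('a) * sc (- int m)" for x :: "'a::euclidean_space"
	by (rule norm_cell_le[OF rnd_in_cell])

lemma rnd_tendsto: "(%m. rnd m x) ----> (x::'a::euclidean_space)"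
proof (rule Lim_transform2[OF tendsto_const])
	have "(%m. DIM('a) * sc (- int m)) ----> real DIM('a)*(0::real)" by (intro tendsto_mult tendsto_const sc_neg_tendsto)
	then have "(%m. DIM('a) * sc (- int m)) ----> 0" by simp
	then show "(%m. x-rnd m x) ----> 0"
		by (rule Lim_null_comparison[rotated]) (use norm_rnd[of _ x] in \<open>auto simp: norm_minus_commute\<close>)
qed

text \<open>A measurable function is an almost everywhere limit of continuous ones; clipping their
  height and multiplying by a tent in the norm gives the common bound and support that domination
  requires. The existential form allows a choice for all indices at once.\<close>

lemma cont_approx:
	fixes f :: "'a::euclidean_space => real"
	assumes "nice f"
	shows "EX h B R. (ALL n. continuous_on UNIV (h n)) & (ALL n x. |h n x| <= B) & (ALL n x. h n x ~= 0 --> norm x <= R)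
		& (AE x in lborel. (%n::nat. h n x) ----> f x) & B > 0 & R > 0"
proof -
	from assms obtain B R where f: "f \<in> BM" "!!x. |f x| <= B" "!!x. f x ~= 0 ==> norm x <= R" "B > 0" "R > 0"
		by (metis niceE)
	have "f measurable_on UNIV" using f(1)
		by (intro lebesgue_measurable_imp_measurable_on_real) (auto intro: measurable_completion)
	then obtain N g where g: "negligible N" "!!n. continuous_on UNIV (g n)" "!!x. x ~: N ==> (%n. g n x) ----> f x"
		unfolding measurable_on_def by auto
	define h where "h n x = max (-B) (min B (g n x))*max 0 (min 1 (R + 1-norm x))" for n x
	show ?thesis
	proof (rule exI[of _ h], rule exI[of _ B], rule exI[of _ "R + 1"], intro conjI allI impI)
		show "continuous_on UNIV (h n)" for n
			unfolding h_def by (intro continuous_intros g(2) continuous_on_max continuous_on_min) 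
		show "|h n x| <= B" for n x
		proof -
			have "|max (-B) (min B (g n x))| <= B" "|max 0 (min 1 (R + 1-norm x))| <= 1" using f(4) by auto
			then have "|max (-B) (min B (g n x))|*|max 0 (min 1 (R + 1-norm x))| <= B*1"
				using f(4) by (intro mult_mono) auto
			then show ?thesis by (simp only: h_def abs_mult mult_1_right)
		qed
		show "norm x <= R + 1" if "h n x ~= 0" for n x
			using that unfolding h_def by (auto simp: max_def split: if_splits)
		have "AE x in lebesgue. x ~: N" using g(1) by (simp add: AE_not_in negligible_iff_null_sets)
		then have "AE x in lborel. x ~: N" by (simp add: AE_completion_iff)
		then show "AE x in lborel. (%n. h n x) ----> f x"
		proof eventually_elim
			case (elim x)
			have "(%n. h n x) ----> max (-B) (min B (f x))*max 0 (min 1 (R + 1-norm x))"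
				unfolding h_def by (intro tendsto_intros tendsto_max tendsto_min g(3) elim)
			moreover have "max (-B) (min B (f x))*max 0 (min 1 (R + 1-norm x)) = f x"
				using f(2,3)[of x] by (cases "f x = 0") (auto simp: max_def min_def)
			ultimately show ?case by simp
		qed
	qed (use f in auto)
qed

text \<open>The constant \<open>C\<close> refers to p-th powers of norms.\<close>

definition bdd_on :: "real => real => 'i set => 'k1 set => 'k2 set
		=> (('i => 'k1 => 'a::euclidean_space => real) => 'i => 'k2 => 'a => real) => real => bool" where
	"bdd_on p r I J1 J2 S C \<longleftrightarrow> (ALL f. (ALL i k. nice (f i k)) --> Phi p r I J2 (S f) <= C*Phi p r I J1 f)"

lemma bdd_onD: "bdd_on p r I J1 J2 S C ==> (!!i k. nice (f i k)) ==> Phi p r I J2 (S f) <= C*Phi p r I J1 f"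
	by (auto simp: bdd_on_def)

lemma bdd_on_mono: "bdd_on p r I J1 J2 S C ==> C <= C' ==> bdd_on p r I J1 J2 S C'"
	unfolding bdd_on_def by (meson mult_right_mono order_trans Phi_nonneg)

lemma czK_nonneg: "1 < p ==> p < s ==> 0 <= A ==> 0 <= A' ==> 0 <= czK n s p A A'"
	using powr_less_one[of 2 "p-s"] powr_less_one[of 2 "1-p"] unfolding czK_def
	by (intro mult_nonneg_nonneg add_nonneg_nonneg divide_nonneg_nonneg) auto

context czdat
begin

lemma cz_step:
	fixes r s p A' :: real
	assumes r: "r > 1" "finite I" "1 < p" "p < s" and f: "!!i k. nice (f i k)"
		and step: "!!i k x y. y \<in> cell k0 x ==> f i k y = f i k x"
		and Lb: "bdd_on s r I J1 J2 T A'" and A': "A' >= 0"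
	shows "Phi p r I J2 (T f) <= czK (DIM('a)) s p A A'*Phi p r I J1 f"
	unfolding Phi_def czK_def
proof (rule powr_integral_from_distribution)
	show "nice (%x. nrm r I J2 (%i k. T f i k x))" "nice (%x. nrm r I J1 (%i k. f i k x))"
		using r finJ f by (auto intro!: nice_nrm nice_T)
	show "0 <= 2*(A'*2 powr (real DIM('a) * s) + 2*A*2^DIM('a) + (4*real DIM('a))^DIM('a))"
		using A' A_nonneg by simp
	fix y :: real assume y: "y > 0"
	show "measure lborel {x. 2*y < nrm r I J2 (%i k. T f i k x)} <=
			A'*y powr (-s)*(LBINT x. nrm r I J1 (%i k. f i k x) powr s*indicator {x. nrm r I J1 (%i k. f i k x) <= y} x)
			+ 2*(A'*2 powr (real DIM('a) * s) + 2*A*2^DIM('a) + (4*real DIM('a))^DIM('a))*y powr (-1)*(LBINT x. nrm r I J1 (%i k. f i k x)*indicator {x. y < 2*nrm r I J1 (%i k. f i k x)} x)"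
		using cz_distribution[of r I s f k0 A' y, OF _ _ _ f step _ A' y] r bdd_onD[OF Lb] by simp
qed (use r A' in auto)

lemma T_tendsto:
	assumes p: "p > 0" "r > 1" "finite I" and H: "!!i k. nice (H i k)"
		and F: "!!m i k. F m i k \<in> BM" "!!m i k x. |F m i k x| <= H i k x"
		and G: "!!i k. nice (G i k)" "!!i k. AE x in lborel. (%m. F m i k x) ----> G i k x"
	shows "(%m. Phi p r I J2 (T (F m))) ----> Phi p r I J2 (T G)"
proof (rule Phi_tendsto)
	have nF: "nice (F m i k)" for m i k by (rule nice_dom[OF H F])
	show "T (F m) i k \<in> BM" "T G i k \<in> BM" for m i k
		using nice_T[of "F m"] nice_T[of G] nF G(1) by (auto dest: nice_meas)
	show "nice (%x. \<Sum>l\<in>L. |c l k|*conv (%t. |u l t| ) (H i (tw l k)) x)" for i k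
		by (intro nice_sum nice_cmult nice_conv nice_abs nice_u H)
	show "|T (F m) i k x| <= (\<Sum>l\<in>L. |c l k|*conv (%t. |u l t| ) (H i (tw l k)) x)" for m i k x
	proof -
		have "|conv (u l) (F m i (tw l k)) x| <= conv (%t. |u l t| ) (H i (tw l k)) x" for l
		proof -
			have "|conv (u l) (F m i (tw l k)) x| <= conv (%t. |u l t| ) (%t. |F m i (tw l k) t| ) x"
				by (rule abs_conv_le) (auto intro: nice_u nF nice_abs)
			also have "... <= conv (%t. |u l t| ) (H i (tw l k)) x"
				unfolding conv_def using F(2)
				by (intro integral_mono nice_conv_integrable nice_abs nice_u nF H mult_left_mono) auto
			finally show ?thesis .
		qed
		then show ?thesis unfolding selop_def
			by (intro order_trans[OF sum_abs sum_mono]) (auto simp: abs_mult intro!: mult_left_mono)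
	qed
	show "AE x in lborel. (%m. T (F m) i k x) ----> T G i k x" for i k
		unfolding selop_def using G
		by (intro AE_I2, intro tendsto_sum tendsto_mult tendsto_const)
			(rule conv_tendsto[OF nice_u H F], auto dest: nice_meas)
qed (use p finJ in auto)

text \<open>The bound known for step functions passes to continuous functions composed with ever
  finer rounding, and then to their almost everywhere limits. Both sides converge by domination with
  \<open>H\<close>.\<close>

lemma cz_extrapolate:
	fixes r s p A' :: real and I :: "'i set"
	assumes r: "r > 1" "finite I" "1 < p" "p < s" and Lb: "bdd_on s r I J1 J2 T A'" and A': "A' >= 0"
	shows "bdd_on p r I J1 J2 T (czK (DIM('a)) s p A A')"
	unfolding bdd_on_def
proof (intro allI impI)
	fix f :: "'i => 'k1 => 'a => real"
	let ?C = "czK (DIM('a)) s p A A'"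
	assume "ALL i k. nice (f i k)"
	then have f: "nice (f i k)" for i k by simp

	have "ALL i k. EX h B R. (ALL n. continuous_on UNIV (h n)) & (ALL n x. |h n x| <= B) & (ALL n x. h n x ~= 0 --> norm x <= R)
		& (AE x in lborel. (%n::nat. h n x) ----> f i k x) & B > 0 & R > 0"
		by (intro allI cont_approx f)
	from this[unfolded choice_iff] obtain h B R where h': "ALL i k. (ALL n. continuous_on UNIV (h i k n)) & (ALL n x. |h i k n x| <= B i k)
		& (ALL n x. h i k n x ~= 0 --> norm x <= R i k) & (AE x in lborel. (%n::nat. h i k n x) ----> f i k x) & B i k > 0 & R i k > 0"
		by blast
	then have h: "!!i k n. continuous_on UNIV (h i k n)" "!!i k n x. |h i k n x| <= B i k"
		"!!i k n x. h i k n x ~= 0 ==> norm x <= R i k" "!!i k. AE x in lborel. (%n::nat. h i k n x) ----> f i k x"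
		"!!i k. B i k > 0" by simp_all
	\<comment> \<open>Rounding moves a point by at most \<open>DIM('a) * sc (- int m)\<close>, hence by
	  at most \<open>DIM('a)\<close>: this is the enlargement of the ball.\<close>
	define H where "H i k x = B i k*indicator (cball 0 (R i k + DIM('a))) x" for i k and x :: 'a
	have nH: "nice (H i k)" for i k unfolding H_def[abs_def] by (intro nice_cmult nice_indicator) auto
	have [measurable]: "h i k n \<in> BM" for i k n
		using h(1) by (rule borel_measurable_continuous_onI)
	have hH: "|h i k n x| <= H i k x" for i k n x
		using h(2)[of i k n x] h(3)[of i k n x] h(5)[of i k] by (cases "h i k n x = 0") (auto simp: H_def indicator_def)
	have hrH: "|h i k n (rnd m x)| <= H i k x" for i k n m x
	proof (cases "h i k n (rnd m x) = 0")
		case False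
		have "norm (rnd m x) <= R i k" using h(3) False by blast
		moreover have "norm (rnd m x-x) <= DIM('a)"
			by (rule order_trans[OF norm_rnd mult_left_le]) (use sc_neg_le_1 in auto)
		ultimately have "norm x <= R i k + DIM('a)" using norm_triangle_ineq2[of x "rnd m x"] by (simp add: norm_minus_commute)
		then show ?thesis using h(2) by (simp add: H_def)
	qed (use h(5)[of i k] in \<open>simp add: H_def\<close>)
	have nh: "nice (h i k n)" for i k n by (rule nice_dom[OF nH _ hH]) measurable
	have nhr: "nice (%x. h i k n (rnd m x))" for i k n m by (rule nice_dom[OF nH _ hrH]) measurable
	have cont: "Phi p r I J2 (T (%i k. h i k n)) <= ?C*Phi p r I J1 (%i k. h i k n)" for n
	proof (rule LIMSEQ_le)
		have conv: "(%m. h i k n (rnd m x)) ----> h i k n x" for i k x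
			using h(1)[of i k n] rnd_tendsto[of x] continuous_on_tendsto_compose[of UNIV "h i k n"] by auto
		show "(%m. Phi p r I J2 (T (%i k x. h i k n (rnd m x)))) ----> Phi p r I J2 (T (%i k. h i k n))"
			by (rule T_tendsto[OF _ _ _ nH]) (use r hrH nh conv in auto)
		show "(%m. ?C*Phi p r I J1 (%i k x. h i k n (rnd m x))) ----> ?C*Phi p r I J1 (%i k. h i k n)"
			by (intro tendsto_mult tendsto_const Phi_tendsto[OF _ _ _ _ nH]) (use r finJ hrH nh conv in auto)
		show "EX N. ALL m>=N. Phi p r I J2 (T (%i k x. h i k n (rnd m x))) <= ?C*Phi p r I J1 (%i k x. h i k n (rnd m x))"
		proof (intro exI allI impI)
			fix m :: nat assume "0 <= m"
			show "Phi p r I J2 (T (%i k x. h i k n (rnd m x))) <= ?C*Phi p r I J1 (%i k x. h i k n (rnd m x))"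
				by (rule cz_step[where ?k0.0 = "- int m", OF r nhr _ Lb A']) (simp add: rnd_cell)
		qed
	qed
	show "Phi p r I J2 (T f) <= ?C*Phi p r I J1 f"
	proof (rule LIMSEQ_le)
		show "(%n. Phi p r I J2 (T (%i k. h i k n))) ----> Phi p r I J2 (T f)"
			by (rule T_tendsto[OF _ _ _ nH]) (use r hH f h(4) in auto)
		show "(%n. ?C*Phi p r I J1 (%i k. h i k n)) ----> ?C*Phi p r I J1 f"
			by (intro tendsto_mult tendsto_const Phi_tendsto[OF _ _ _ _ nH]) (use r finJ hH f h(4) in \<open>auto dest: nice_meas\<close>)
	qed (use cont in blast)
qed

end

section \<open>From \<open>L\<^sup>2\<close> to all exponents\<close>

definition dualC :: "real => real => real" where "dualC p C = (2*max 1 C) powr p"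

definition mC1 :: "nat => real => real => real => real" where
	"mC1 n s A C = (if s < 2 then czK n 2 s A C else if s = 2 then C else dualC s (czK n 2 (s/(s-1)) A C))"

text \<open>The route to L^p(l^r(l^2)): from L^2 to L^r for single functions (\<open>mC1\<close>),
  then to the diagonal \<open>p = r\<close>, then by the Calderon-Zygmund step down to
  \<open>p < r\<close>, and by duality up to \<open>p > r\<close>.\<close>

definition mC :: "nat => real => real => real => real => real" where
	"mC n p r A C = (if p < r then czK n r p A (mC1 n r A C) else if p = r then mC1 n r A C
		else dualC p (czK n (r/(r-1)) (p/(p-1)) A (mC1 n (r/(r-1)) A C)))"

lemma conj_lt: "1 < p ==> p < r ==> r/(r-1) < p/(p-1)" for p r :: real
	by (simp add: field_simps)

lemma conj_gt1: "1 < p ==> 1 < p/(p-1)" for p :: real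
	by (simp add: field_simps)

lemma mC1_nonneg: "1 < s ==> 0 <= A ==> 0 <= C ==> 0 <= mC1 n s A C"
	by (auto simp: mC1_def dualC_def intro!: czK_nonneg)

text \<open>By \<open>adj\<close> the index selections are adjoint layer by layer, and with even
  kernels \<open>B.T\<close> is the adjoint of \<open>F.T\<close>. Both directions satisfy the
  Calderon-Zygmund hypotheses, so exponents above the known one are reached through the
  adjoint.\<close>

locale czpair = F: czdat J1 J2 L u c tw A + B: czdat J2 J1 L u c' tw' A
	for J1 :: "'k1 set" and J2 :: "'k2 set" and L :: "'l set" and u :: "'l => 'a::euclidean_space => real"
		and c tw c' tw' A +
	assumes even: "!!l x. u l (- x) = u l x"
		and adj: "!!l X. l \<in> L ==> (\<Sum>k\<in>J2. c l k*X (tw l k) k) = (\<Sum>k\<in>J1. c' l k*X k (tw' l k))"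
begin

lemma swap: "czpair J2 J1 L u c' tw' c tw A"
	using adj[where X="%a b. _ b a", symmetric] by unfold_locales (simp_all add: even)

lemma adjoint:
	assumes f: "!!i k. nice (f i k)" and g: "!!i k. nice (g i k)"
	shows "(\<Sum>k\<in>J2. LBINT x. F.T f i k x*g i k x) = (\<Sum>k\<in>J1. LBINT x. f i k x*B.T g i k x)"
proof -
	note nu = F.nice_u
	define X where "X l k k' = (LBINT x. conv (u l) (f i k) x*g i k' x)" for l k k'
	have X: "X l k k' = (LBINT x. f i k x*conv (u l) (g i k') x)" for l k k'
		unfolding X_def using conv_adjoint[OF nu f g, of l i k i k'] by (simp add: even)
	have "(LBINT x. F.T f i k x*g i k x) = (\<Sum>l\<in>L. c l k*X l (tw l k) k)" for k
	proof -
		have "(LBINT x. F.T f i k x*g i k x) = (LBINT x. (\<Sum>l\<in>L. c l k*(conv (u l) (f i (tw l k)) x*g i k x)))"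
			by (simp add: selop_def sum_distrib_right mult.assoc)
		then show ?thesis
			unfolding X_def using nice_int[OF nice_mult[OF nice_conv[OF nu f] g]] by simp
	qed
	moreover have "(LBINT x. f i k x*B.T g i k x) = (\<Sum>l\<in>L. c' l k*X l k (tw' l k))" for k
	proof -
		have "(LBINT x. f i k x*B.T g i k x) = (LBINT x. (\<Sum>l\<in>L. c' l k*(f i k x*conv (u l) (g i (tw' l k)) x)))"
			by (simp add: selop_def sum_distrib_left mult.left_commute)
		then show ?thesis
			unfolding X using nice_int[OF nice_mult[OF f nice_conv[OF nu g]]] by simp
	qed
	ultimately show ?thesis
		using adj by (simp add: sum.swap[of _ L J1] sum.swap[of _ L J2])
qed

text \<open>The known bound enters through \<open>Phi_pairing\<close>. Taking \<open>max 1 C\<close>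
  gives both summands one constant, which \<open>Phi_duality\<close> converts to
  \<open>dualC\<close>.\<close>

lemma dual_bound:
	fixes I :: "'i set"
	assumes "conj_exp p p'" "conj_exp r r'" "finite I" and Lb: "bdd_on p r I J1 J2 F.T C"
	shows "bdd_on p' r' I J2 J1 B.T (dualC p' C)"
	unfolding bdd_on_def dualC_def
proof (intro allI impI, rule Phi_duality)
	fix g :: "'i => 'k2 => 'a => real" assume g0: "ALL i k. nice (g i k)"
	then have g: "nice (g i k)" for i k by simp
	show "conj_exp p' p" "conj_exp r' r" using assms conj_exp_sym by auto
	show "nice (B.T g i k)" for i k using g by (intro B.nice_T)
	fix f :: "'i => 'k1 => 'a => real" assume f: "!!i k. nice (f i k)"
	have "(\<Sum>i\<in>I. \<Sum>k\<in>J1. LBINT x. B.T g i k x*f i k x) = (\<Sum>i\<in>I. \<Sum>k\<in>J2. LBINT x. F.T f i k x*g i k x)"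
		using adjoint[of f g, OF f g] by (simp add: mult.commute)
	also have "... <= Phi p r I J2 (F.T f) + Phi p' r' I J2 g"
		using Phi_pairing[of p p' r r' I J2 "F.T f" g, OF assms(1-3) F.finJ(2) F.nice_T[OF f] g] by linarith
	also have "... <= C*Phi p r I J1 f + 1*Phi p' r' I J2 g"
		using bdd_onD[OF Lb, of f] f by simp
	also have "... <= max 1 C*Phi p r I J1 f + max 1 C*Phi p' r' I J2 g"
		by (intro add_mono mult_right_mono) auto
	finally show "(\<Sum>i\<in>I. \<Sum>k\<in>J1. LBINT x. B.T g i k x*f i k x) <= max 1 C*(Phi p' r' I J2 g + Phi p r I J1 f)"
		by (simp add: algebra_simps)
qed (use assms F.finJ in auto)

lemma bound_all_exponents1:
	fixes I :: "'i set"
	assumes "1 < s" "0 <= C" and L2: "!!i::'i. bdd_on 2 2 {i} J1 J2 F.T C" "!!i::'i. bdd_on 2 2 {i} J2 J1 B.T C"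
	shows "bdd_on s 2 {i::'i} J1 J2 F.T (mC1 (DIM('a)) s A C)"
proof -
	interpret S: czpair J2 J1 L u c' tw' c tw A by (rule swap)
	have two: "conj_exp 2 2" by (simp add: conj_exp_def)
	consider "s < 2" | "s = 2" | "s > 2" by linarith
	then show ?thesis
	proof cases
		case 1
		then show ?thesis using F.cz_extrapolate[OF _ _ assms(1) _ L2(1) assms(2)] by (simp add: mC1_def)
	next
		case 2 then show ?thesis using L2(1) by (simp add: mC1_def)
	next
		case 3
		have c: "conj_exp (s/(s-1)) s" using conj_exp_exists[of s] assms by (simp add: conj_exp_sym)
		have "bdd_on (s/(s-1)) 2 {i} J2 J1 B.T (czK (DIM('a)) 2 (s/(s-1)) A C)"
			by (rule B.cz_extrapolate) (use conj_lt[of 2 s] conj_gt1[of s] 3 assms in auto)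
		then have "bdd_on s 2 {i} J1 J2 F.T (dualC s (czK (DIM('a)) 2 (s/(s-1)) A C))"
			by (intro S.dual_bound[OF c two]) auto
		then show ?thesis using 3 by (simp add: mC1_def)
	qed
qed

lemma bound_diag:
	fixes I :: "'i set"
	assumes "1 < s" "0 <= C" "finite I" and L2: "!!i::'i. bdd_on 2 2 {i} J1 J2 F.T C" "!!i::'i. bdd_on 2 2 {i} J2 J1 B.T C"
	shows "bdd_on s s I J1 J2 F.T (mC1 (DIM('a)) s A C)"
	unfolding bdd_on_def
proof (intro allI impI)
	fix f :: "'i => 'k1 => 'a => real"
	assume "ALL i k. nice (f i k)"
	then have f: "nice (f i k)" for i k by simp
	have "Phi s s I J2 (F.T f) = (\<Sum>i\<in>I. Phi s 2 {i} J2 (F.T f))"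
		using assms f F.finJ by (intro Phi_diag F.nice_T) auto
	also have "... <= (\<Sum>i\<in>I. mC1 (DIM('a)) s A C*Phi s 2 {i} J1 f)"
		using bdd_onD[OF bound_all_exponents1[OF assms(1,2) L2]] f by (intro sum_mono) auto
	also have "... = mC1 (DIM('a)) s A C*Phi s s I J1 f"
		using assms f F.finJ by (subst Phi_diag) (auto simp: sum_distrib_left)
	finally show "Phi s s I J2 (F.T f) <= mC1 (DIM('a)) s A C*Phi s s I J1 f" .
qed

theorem bound_all_exponents:
	fixes I :: "'i set"
	assumes "1 < p" "1 < r" "0 <= C" "finite I" and L2: "!!i::'i. bdd_on 2 2 {i} J1 J2 F.T C" "!!i::'i. bdd_on 2 2 {i} J2 J1 B.T C"
	shows "bdd_on p r I J1 J2 F.T (mC (DIM('a)) p r A C)"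
proof -
	interpret S: czpair J2 J1 L u c' tw' c tw A by (rule swap)
	consider "p < r" | "p = r" | "p > r" by linarith
	then show ?thesis
	proof cases
		case 1
		then show ?thesis
			using F.cz_extrapolate[OF assms(2,4,1) _ bound_diag[OF assms(2-4) L2] mC1_nonneg] assms F.A_nonneg by (simp add: mC_def)
	next
		case 2 then show ?thesis using bound_diag[OF assms(2-4) L2] by (simp add: mC_def)
	next
		case 3
		let ?p = "p/(p-1)" and ?r = "r/(r-1)"
		have c: "conj_exp ?p p" "conj_exp ?r r" using conj_exp_exists[of p] conj_exp_exists[of r] assms by (simp_all add: conj_exp_sym)
		have g: "1 < ?p" "1 < ?r" "?p < ?r" using conj_gt1 conj_lt[of r p] 3 assms by auto
		have "bdd_on ?p ?r I J2 J1 B.T (czK (DIM('a)) ?r ?p A (mC1 (DIM('a)) ?r A C))"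
			by (rule B.cz_extrapolate) (use g assms F.A_nonneg S.bound_diag[OF g(2) assms(3,4) L2(2,1)] mC1_nonneg in auto)
		then have "bdd_on p r I J1 J2 F.T (dualC p (czK (DIM('a)) ?r ?p A (mC1 (DIM('a)) ?r A C)))"
			by (rule S.dual_bound[OF c assms(4)])
		then show ?thesis using 3 by (simp add: mC_def)
	qed
qed

end

section \<open>Littlewood--Paley pieces\<close>

lemma sum_of_bool:
	fixes f :: "'l => real"
	assumes "finite L" "l \<in> L"
	shows "(\<Sum>l'\<in>L. of_bool (l' = l)*f l') = f l" "(\<Sum>l'\<in>L. of_bool (l = l')*f l') = f l"
	using assms by (subst sum.remove[of L l]; auto intro!: sum.neutral)+

definition bz :: "'a::euclidean_space itself => real" where
	"bz _ = (LBINT x. max 0 (1-norm (x::'a)))"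

text \<open>An explicit tent of radius \<open>sc l\<close> and integral 1. It has explicit size and
  Lipschitz constants, and its lower bound on half the radius will let averages dominate
  atoms.\<close>

definition phi :: "int => 'a::euclidean_space => real" where
	"phi l x = max 0 (sc l-norm x)/(sc l^(DIM('a) + 1)*bz TYPE('a))"

definition dl :: "int => 'a::euclidean_space => real" where
	"dl l x = phi (l-1) x-phi l x"

lemma nice_tent: "nice (%x::'a::euclidean_space. max 0 (c-norm x))"
proof (rule niceI[of _ "|c|" "|c|"])
	show "|max 0 (c-norm x)| <= |c|" for x :: 'a using norm_ge_zero[of x] by linarith
qed (auto simp: max_def split: if_splits)

lemma bz_pos: "bz TYPE('a::euclidean_space) > 0"
proof -
	have "0 < 1/2*measure lborel (cball (0::'a) (1/2))" using content_cball_pos[of "1/2" "0::'a"] by simp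
	also have "... = (LBINT x. 1/2*indicator (cball (0::'a) (1/2)) x)" by simp
	also have "... <= (LBINT x. max 0 (1-norm (x::'a)))"
		by (intro integral_mono nice_int nice_tent nice_cmult nice_indicator) (auto simp: indicator_def)
	finally show ?thesis by (simp add: bz_def)
qed

lemma nice_phi: "nice (phi l)"
	unfolding phi_def[abs_def] divide_inverse by (subst mult.commute) (intro nice_cmult nice_tent)

lemma phi_nonneg: "0 <= phi l x"
	using bz_pos[where 'a='a] by (simp add: phi_def)

lemma phi_minus: "phi l (- x) = phi l x" by (simp add: phi_def)

lemma phi_supp: "phi l x ~= 0 ==> norm x <= sc l"
	by (auto simp: phi_def max_def split: if_splits)

lemma continuous_phi: "continuous_on UNIV (phi l)"
	unfolding phi_def[abs_def] divide_inverse by (intro continuous_intros continuous_on_max)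

lemma phi_le: "phi l (x::'a::euclidean_space) <= 1/(sc l^DIM('a)*bz TYPE('a))"
proof -
	have "phi l x <= sc l/(sc l^(DIM('a) + 1)*bz TYPE('a))"
		unfolding phi_def using bz_pos[where 'a='a] by (intro divide_right_mono) auto
	then show ?thesis by simp
qed

lemma phi_lower: "norm (x::'a::euclidean_space) <= sc (l-1) ==> 1/(2 * sc l^DIM('a)*bz TYPE('a)) <= phi l x"
proof -
	assume "norm x <= sc (l-1)"
	then have "norm x <= sc l/2" by (simp add: sc_diff sc_def[of 1])
	then have "sc l/2 <= max 0 (sc l-norm x)" by linarith
	then have "sc l/2/(sc l^(DIM('a) + 1)*bz TYPE('a)) <= phi l x"
		unfolding phi_def using bz_pos[where 'a='a] by (intro divide_right_mono) auto
	then show ?thesis by simp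
qed

lemma phi_lip: "|phi l (x::'a::euclidean_space)-phi l y| <= norm (x-y)/(sc l^(DIM('a) + 1)*bz TYPE('a))"
proof -
	have "|max 0 (sc l-norm x)-max 0 (sc l-norm y)| <= |norm x-norm y|" by (auto simp: max_def)
	also have "... <= norm (x-y)" by (rule norm_triangle_ineq3)
	finally show ?thesis unfolding phi_def diff_divide_distrib[symmetric]
		using bz_pos[where 'a='a] by (simp add: abs_mult divide_right_mono)
qed

lemma integral_phi: "(LBINT x. phi l (x::'a::euclidean_space)) = 1"
proof -
	have [measurable]: "phi l \<in> borel_measurable (borel :: 'a measure)" by (rule nice_meas[OF nice_phi])
	have "(LBINT x. phi l (x::'a)) = |sc l|^DIM('a) *\<^sub>R (LBINT x. phi l (0 + sc l *\<^sub>R (x::'a)))"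
		by (rule lborel_affine_integral) auto
	also have "... = sc l^DIM('a)*(LBINT x. max 0 (1-norm (x::'a))/(sc l^DIM('a)*bz TYPE('a)))"
	proof -
		have "phi l (0 + sc l *\<^sub>R x) = max 0 (1-norm x)/(sc l^DIM('a)*bz TYPE('a))" for x :: 'a
		proof -
			have "max 0 (sc l-norm (sc l *\<^sub>R x)) = sc l*max 0 (1-norm x)"
				by (simp add: max_mult_distrib_left right_diff_distrib)
			then show ?thesis unfolding phi_def by simp
		qed
		then show ?thesis by simp
	qed
	also have "... = sc l^DIM('a)*(bz TYPE('a)/(sc l^DIM('a)*bz TYPE('a)))" unfolding bz_def by simp
	also have "... = 1" using bz_pos[where 'a='a] by simp
	finally show ?thesis .
qed

lemma nice_dl: "nice (dl l)"
	unfolding dl_def[abs_def] by (intro nice_diff nice_phi)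

lemma dl_minus: "dl l (- x) = dl l x" by (simp add: dl_def phi_minus)

lemma dl_supp: "dl l x ~= 0 ==> norm x <= sc l"
proof -
	assume "dl l x ~= 0"
	then have "phi (l-1) x ~= 0 \<or> phi l x ~= 0" by (auto simp: dl_def)
	then have "norm x <= sc (l-1) \<or> norm x <= sc l" using phi_supp by blast
	then show ?thesis using sc_mono[of "l-1" l] by linarith
qed

lemma integral_dl: "(LBINT x. dl l (x::'a::euclidean_space)) = 0"
	unfolding dl_def by (simp add: nice_int nice_phi integral_phi)

lemma integral_abs_dl: "(LBINT x. |dl l (x::'a::euclidean_space)| ) <= 2"
proof -
	have "(LBINT x. |dl l (x::'a)| ) <= (LBINT x. phi (l-1) (x::'a) + phi l x)"
	proof (intro integral_mono nice_int nice_abs nice_dl nice_add nice_phi)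
		show "|dl l x| <= phi (l-1) x + phi l x" for x :: 'a
			using phi_nonneg[of l x] phi_nonneg[of "l-1" x] by (simp add: dl_def)
	qed
	also have "... = 2" by (simp add: nice_int nice_phi integral_phi)
	finally show ?thesis .
qed

definition dC :: "'a::euclidean_space itself => real" where
	"dC _ = (2^(DIM('a) + 1) + 1)/bz TYPE('a)"

lemma dC_pos: "dC TYPE('a::euclidean_space) > 0"
	using bz_pos[where 'a='a] by (simp add: dC_def add_pos_pos)

lemma dl_lip: "|dl l (x::'a::euclidean_space)-dl l y| <= dC TYPE('a)*norm (x-y)/sc l^(DIM('a) + 1)"
proof -
	let ?n = "DIM('a) + 1"
	have "|dl l x-dl l y| <= |phi (l-1) x-phi (l-1) y| + |phi l x-phi l y|" by (simp add: dl_def)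
	also have "... <= norm (x-y)/(sc (l-1)^?n*bz TYPE('a)) + norm (x-y)/(sc l^?n*bz TYPE('a))"
		by (intro add_mono phi_lip)
	also have "sc (l-1)^?n = sc l^?n/2^?n" by (simp add: sc_diff sc_def[of 1] power_divide)
	also have "norm (x-y)/(sc l^?n/2^?n*bz TYPE('a)) + norm (x-y)/(sc l^?n*bz TYPE('a)) = dC TYPE('a)*norm (x-y)/sc l^?n"
		using bz_pos[where 'a='a] by (simp add: dC_def field_simps)
	finally show ?thesis .
qed

lemma sc_ratio_powr: "j <= l ==> (sc j/sc l) powr et = (2 powr (-et))^nat |l-j|"
proof -
	assume jl: "j <= l"
	have "sc j/sc l = 2 powr (of_int (j-l))" by (simp add: sc_def powr_diff[symmetric])
	then have "(sc j/sc l) powr et = 2 powr (of_int (j-l)*et)" by (simp add: powr_powr)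
	also have "of_int (j-l)*et = (-et)*real (nat |l-j| )" using jl by (simp add: algebra_simps)
	also have "2 powr ... = (2 powr (-et)) powr real (nat |l-j| )" by (simp only: powr_powr)
	also have "... = (2 powr (-et))^nat |l-j|" by (rule powr_realpow) simp
	finally show ?thesis .
qed

text \<open>Where \<open>norm x\<close> is at least \<open>2*norm h\<close>, pieces of scale below
  \<open>norm h\<close> vanish at both points; at larger scales the Lipschitz bound gains
  \<open>norm h/sc k\<close>. The last factor 4 is the sum of the two-sided geometric series of
  ratio 1/2.\<close>

lemma hormander_sum:
	fixes w :: "int => 'a::euclidean_space => real"
	assumes K: "finite K" and w: "!!k. nice (w k)" "!!k x. w k x ~= 0 ==> norm x <= sc k"
		"!!k x y. |w k x-w k y| <= M*norm (x-y)/sc k^(DIM('a) + 1)" and M: "M >= 0"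
	shows "(\<Sum>k\<in>K. LBINT x. indicator {x. 2*norm h <= norm x} x*|w k (x-h)-w k x| ) <= M*4^DIM('a)*4"
proof (cases "h = 0")
	case True
	then show ?thesis using M by simp
next
	case False
	let ?n = "DIM('a)"
	\<comment> \<open>The least scale with \<open>norm h <= sc k0\<close>.\<close>
	define k0 where "k0 = \<lceil>log 2 (norm h)\<rceil>"
	have h0: "norm h > 0" using False by simp
	have k0: "sc k < norm h" if "k < k0" for k
	proof -
		have "of_int k < log 2 (norm h)" using that by (simp add: k0_def less_ceiling_iff)
		then show ?thesis using h0 less_log_iff[of 2 "norm h" "of_int k"] by (simp add: sc_def)
	qed
	have hk0: "norm h <= sc k0"
	proof -
		have "log 2 (norm h) <= of_int k0" by (simp add: k0_def)
		then show ?thesis using h0 log_le_iff[of 2 "norm h" "of_int k0"] by (simp add: sc_def)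
	qed
	have int: "(LBINT x. indicator {x. 2*norm h <= norm x} x*|w k (x-h)-w k x| ) <= M*4^?n*(1/2)^nat |k-k0|" for k
	proof (cases "k < k0")
		case True
		have z: "indicator {x. 2*norm h <= norm x} x*|w k (x-h)-w k x| = 0" for x
		proof (cases "2*norm h <= norm x")
			case le: True
			have "norm (x-h) >= norm h" using le norm_triangle_ineq2[of x h] by linarith
			then have "\<not> norm (x-h) <= sc k" "\<not> norm x <= sc k" using k0[OF True] le h0 by linarith+
			then have "w k (x-h) = 0" "w k x = 0" using w(2) by blast+
			then show ?thesis by simp
		qed simp
		show ?thesis using M by (simp only: z) simp
	next
		case False
		then have hk: "norm h <= sc k" using hk0 sc_mono[of k0 k] by linarith
		have "|LBINT x. indicator {x. 2*norm h <= norm x} x*|w k (x-h)-w k x| |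
				<= (M*norm h/sc k^(?n + 1))*measure lborel (cball (0::'a) (2 * sc k))"
		proof (rule integral_bounded_on_ball)
			show "|indicator {x. 2*norm h <= norm x} t*|w k (t-h)-w k t| | <= M*norm h/sc k^(?n + 1)" for t
				using w(3)[of k "t-h" t] M by (auto simp: indicator_def)
			show "norm t <= 2 * sc k" if "indicator {x. 2*norm h <= norm x} t*|w k (t-h)-w k t| ~= 0" for t
			proof -
				have "w k (t-h) ~= 0 \<or> w k t ~= 0" using that by auto
				then have "norm (t-h) <= sc k \<or> norm t <= sc k" using w(2) by blast
				then show ?thesis using hk norm_triangle_sub[of t h] by (auto intro: order_trans)
			qed
		qed (use M in auto)
		also have "... <= (M*norm h/sc k^(?n + 1))*(2*(2 * sc k))^?n"
			using M by (intro mult_left_mono measure_cball_le) auto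
		also have "... = M*4^?n*(norm h/sc k)"
			by (simp add: power_mult_distrib field_simps)
		also have "... <= M*4^?n*(sc k0/sc k)"
			using hk0 M by (intro mult_left_mono divide_right_mono) auto
		also have "sc k0/sc k = (1/2)^nat |k-k0|"
			using sc_ratio_powr[of k0 k 1] False by (simp add: powr_minus_divide)
		finally show ?thesis by simp
	qed
	have "(\<Sum>k\<in>K. LBINT x. indicator {x. 2*norm h <= norm x} x*|w k (x-h)-w k x| ) <= (\<Sum>k\<in>K. M*4^?n*(1/2)^nat |k-k0| )"
		by (intro sum_mono int)
	also have "... = M*4^?n*(\<Sum>k\<in>K. (1/2)^nat |k-k0| )" by (simp add: sum_distrib_left)
	also have "... <= M*4^?n*4" using geometric_int_sum[OF K, of "1/2" k0] M by (intro mult_left_mono) auto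
	finally show ?thesis .
qed

section \<open>Almost orthogonality\<close>

definition atom1 :: "int => real => real => ('a::euclidean_space => real) => bool" where
	"atom1 j et B u \<longleftrightarrow> nice u & (ALL x. u x ~= 0 --> norm x <= sc j) & (LBINT x. u x) = 0
		& (ALL x h. |u (x + h)-u x| <= B*(norm h/sc j) powr et/sc j^DIM('a))"

definition cU :: "'a::euclidean_space itself => real" where
	"cU _ = 3*2^DIM('a)*dC TYPE('a) + 2"

lemma cU_pos: "cU TYPE('a::euclidean_space) > 0"
	using dC_pos[where 'a='a] by (simp add: cU_def add_pos_pos)

text \<open>A translation by \<open>3 * sc j\<close> leaves the support, so the Hoelder bound alone
  controls the size; \<open>3 powr et <= 3\<close> gives the factor.\<close>

lemma atom1_size:
	fixes u :: "'a::euclidean_space => real"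
	assumes "atom1 j et B u" "0 < et" "et <= 1" "0 <= B"
	shows "|u x| <= 3*B/sc j^DIM('a)"
proof (cases "u x = 0")
	case False
	obtain b :: 'a where b: "b \<in> Basis" using nonempty_Basis by blast
	let ?h = "(3 * sc j) *\<^sub>R b"
	have nh: "norm ?h = 3 * sc j" using b by simp
	have "norm x <= sc j" using assms(1) False by (simp add: atom1_def)
	moreover have "3 * sc j-norm x <= norm (x + ?h)" using norm_triangle_ineq2[of ?h "-x"] nh by (simp add: add.commute)
	ultimately have "\<not> norm (x + ?h) <= sc j" using sc_pos(1)[of j] by linarith
	then have "u (x + ?h) = 0" using assms(1) by (auto simp: atom1_def)
	then have "|u x| <= B*(norm ?h/sc j) powr et/sc j^DIM('a)" using assms(1) unfolding atom1_def by (metis abs_minus_commute diff_zero)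
	also have "norm ?h/sc j = 3" unfolding nh by simp
	also have "B*3 powr et/sc j^DIM('a) <= B*3/sc j^DIM('a)"
		using assms powr_mono[of et 1 3] by (intro divide_right_mono mult_left_mono) auto
	finally show ?thesis by (simp add: mult.commute)
qed (use assms in simp)

lemma conv_dl_supp:
	assumes us: "!!x. u x ~= 0 ==> norm x <= sc j" and nz: "conv (dl l) u x ~= 0"
	shows "norm x <= sc (max j l + 1)"
proof (rule ccontr)
	assume big: "\<not> norm x <= sc (max j l + 1)"
	have z: "dl l (x-t)*u t = 0" for t
	proof (rule ccontr)
		assume "dl l (x-t)*u t ~= 0"
		then have "norm (x-t) <= sc l" "norm t <= sc j" using dl_supp us by auto
		then have "norm x <= sc l + sc j" using norm_triangle_sub[of x t] by linarith
		also have "... <= sc (max j l + 1)" using sc_mono[of l "max j l"] sc_mono[of j "max j l"] by (simp add: sc_Suc)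
		finally show False using big by simp
	qed
	show False using nz unfolding conv_def by (simp only: z) simp
qed

text \<open>The function of smaller scale contributes its mean zero, the one of larger scale its
  regularity. For \<open>j <= l\<close> this is the Lipschitz bound of \<open>dl\<close>, weakened
  from exponent 1 to \<open>et\<close>; otherwise it is the Hoelder bound of \<open>u\<close>,
  against the L^1 norm of \<open>dl\<close>.\<close>

lemma atom1_conv_dl:
	fixes u :: "'a::euclidean_space => real"
	assumes u: "atom1 j et B u" and et: "0 < et" "et <= 1" "0 <= B"
	shows "|conv (dl l) u x| <= cU TYPE('a)*B*(2 powr (-et))^nat |l-j|/sc (max j l)^DIM('a)" (is "_ <= ?R")
proof -
	let ?n = "DIM('a)"
	have nu: "nice u" and us: "!!x. u x ~= 0 ==> norm x <= sc j" and u0: "(LBINT x. u x) = 0"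
		and uh: "!!x h. |u (x + h)-u x| <= B*(norm h/sc j) powr et/sc j^?n" using u by (auto simp: atom1_def)
	show "|conv (dl l) u x| <= ?R"
	proof (cases "j <= l")
		case True
		have "conv (dl l) u x = (LBINT t. (dl l (x-t)-dl l x)*u t)"
			unfolding conv_def left_diff_distrib
			by (simp add: nice_int nice_conv_integrand nice_dl nu u0)
		also have "|...| <= (dC TYPE('a) * sc j/sc l^(?n + 1)*(3*B/sc j^?n))*measure lborel (cball (0::'a) (sc j))"
		proof (rule integral_bounded_on_ball)
			fix t
			show "|(dl l (x-t)-dl l x)*u t| <= dC TYPE('a) * sc j/sc l^(?n + 1)*(3*B/sc j^?n)"
			proof (cases "u t = 0")
				case False
				have "|dl l (x-t)-dl l x| <= dC TYPE('a)*norm t/sc l^(?n + 1)" using dl_lip[of l "x-t" x] by simp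
				also have "... <= dC TYPE('a) * sc j/sc l^(?n + 1)"
					using us[OF False] dC_pos[where 'a='a] by (intro divide_right_mono mult_left_mono) auto
				finally show ?thesis unfolding abs_mult using dC_pos[where 'a='a] et by (intro mult_mono atom1_size[OF u]) auto
			qed (use dC_pos[where 'a='a] et in auto)
		qed (use us dC_pos[where 'a='a] et in auto)
		also have "... <= (dC TYPE('a) * sc j/sc l^(?n + 1)*(3*B/sc j^?n))*(2 * sc j)^?n"
			using dC_pos[where 'a='a] et by (intro mult_left_mono measure_cball_le) auto
		also have "... = 3*2^?n*dC TYPE('a)*B*(sc j/sc l) powr 1/sc l^?n"
			by (simp add: power_mult_distrib field_simps)
		also have "... <= 3*2^?n*dC TYPE('a)*B*(sc j/sc l) powr et/sc l^?n"
			using True et dC_pos[where 'a='a] sc_mono[OF True] by (intro divide_right_mono mult_left_mono powr_mono') auto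
		also have "... = (3*2^?n*dC TYPE('a))*B*(2 powr (-et))^nat |l-j|/sc (max j l)^?n"
			unfolding sc_ratio_powr[OF True] using True by (simp add: max_def)
		also have "... <= ?R"
			using et unfolding cU_def by (intro divide_right_mono mult_right_mono) auto
		finally show ?thesis .
	next
		case False
		have "conv (dl l) u x = conv u (dl l) x" using conv_commute[OF nice_dl nu] by simp
		also have "... = (LBINT t. (u (x-t)-u x)*dl l t)"
			unfolding conv_def left_diff_distrib
			by (simp add: nice_int nice_conv_integrand nice_dl nu integral_dl)
		also have "|...| <= (LBINT t. |(u (x-t)-u x)*dl l t| )" by (rule integral_abs_bound)
		also have "... <= (LBINT t. B*(sc l/sc j) powr et/sc j^?n*|dl l (t::'a)| )"
		proof (intro integral_mono nice_int nice_abs nice_cmult nice_dl)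
			show "nice (%t. (u (x-t)-u x)*dl l t)"
				unfolding left_diff_distrib by (intro nice_diff nice_conv_integrand nice_cmult nice_dl nu)
			fix t
			show "|(u (x-t)-u x)*dl l t| <= B*(sc l/sc j) powr et/sc j^?n*|dl l t|"
			proof (cases "dl l t = 0")
				case False
				have "|u (x-t)-u x| <= B*(norm t/sc j) powr et/sc j^?n" using uh[of x "-t"] by simp
				also have "... <= B*(sc l/sc j) powr et/sc j^?n"
					using dl_supp[OF False] et by (intro divide_right_mono mult_left_mono powr_mono2) auto
				finally show ?thesis unfolding abs_mult by (rule mult_right_mono) simp
			qed simp
		qed
		also have "... <= B*(sc l/sc j) powr et/sc j^?n*2"
			using et by (simp only: Bochner_Integration.integral_mult_right_zero) (intro mult_left_mono integral_abs_dl, auto)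
		also have "... = 2*B*(2 powr (-et))^nat |l-j|/sc (max j l)^?n"
			using False sc_ratio_powr[of l j et] by (simp add: max_def abs_minus_commute)
		also have "... <= ?R"
			using et dC_pos[where 'a='a] unfolding cU_def by (intro divide_right_mono mult_right_mono) auto
		finally show ?thesis .
	qed
qed

lemma atom1_dl: "atom1 l 1 (dC TYPE('a)) (dl l :: 'a::euclidean_space => real)"
	unfolding atom1_def using dl_supp integral_dl nice_dl
	by (auto simp: dl_lip[of l "_ + _" "_", simplified] intro!: order_trans[OF dl_lip])

definition cV :: "'a::euclidean_space itself => real" where
	"cV _ = cU TYPE('a)*dC TYPE('a)*4^DIM('a)"

lemma integral_abs_conv_dl: "(LBINT x. |conv (dl l) (dl m) (x::'a::euclidean_space)| ) <= cV TYPE('a)*(1/2)^nat |l-m|"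
proof -
	let ?n = "DIM('a)" and ?K = "cU TYPE('a)*dC TYPE('a)*(2 powr (-1))^nat |l-m|/sc (max m l)^DIM('a)"
	note a = atom1_conv_dl[OF atom1_dl[of m, where 'a='a], of l]
	have K: "?K >= 0" using cU_pos[where 'a='a] dC_pos[where 'a='a] by simp
	have "|LBINT x. |conv (dl l) (dl m) (x::'a)| | <= ?K*measure lborel (cball (0::'a) (sc (max m l + 1)))"
		using a K dC_pos[where 'a='a] conv_dl_supp[OF dl_supp] by (intro integral_bounded_on_ball) auto
	also have "... <= ?K*(2 * sc (max m l + 1))^?n" by (intro mult_left_mono measure_cball_le K) auto
	also have "... = cV TYPE('a)*(1/2)^nat |l-m|"
		by (simp add: cV_def sc_Suc power_mult_distrib powr_minus_divide)
	finally show ?thesis by simp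
qed

lemma Phi_2: "finite I ==> finite J ==> (!!i k. nice (f i k)) ==> Phi 2 2 I J f = (\<Sum>i\<in>I. \<Sum>k\<in>J. LBINT x. (f i k x)\<^sup>2)"
proof -
	assume *: "finite I" "finite J" "!!i k. nice (f i k)"
	have "Phi 2 2 I J f = (LBINT x. (\<Sum>i\<in>I. \<Sum>k\<in>J. (f i k x)\<^sup>2))"
		unfolding Phi_def by (subst nrm_powr_r) (simp_all add: sum_nonneg)
	then show ?thesis using * by (simp add: power2_eq_square nice_int nice_mult)
qed

lemma integral_conv:
	assumes "nice u" "nice f" shows "(LBINT x. conv u f x) = (LBINT x. u x)*(LBINT x. f x)"
proof -
	have [measurable]: "u \<in> BM" using assms by (auto dest: nice_meas)
	have "(LBINT x. conv u f x) = (LBINT t. LBINT x. u (x-t)*f t)"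
		unfolding conv_def by (rule nice_Fubini(1)[OF nice_conv_kernel[OF assms]])
	also have "... = (LBINT t. (LBINT x. u x)*f t)"
		by (simp add: lborel_shift)
	finally show ?thesis by simp
qed

lemma nice_divide: "nice f ==> nice (%x. f x/c)"
	using nice_cmult[of f "1/c"] by simp

text \<open>Schur's test in additive form, from twice a product being at most the sum of the squares
  under the integral.\<close>

lemma bilinear_Young:
	assumes "nice u" "nice f" "nice g" "(LBINT x. |u x| ) <= c"
	shows "|LBINT x. conv u f x*g x| <= c/2*((LBINT x. (f x)\<^sup>2) + (LBINT x. (g x)\<^sup>2))"
proof -
	let ?c = "LBINT x. |u x|"
	have n: "nice (%x. |u x| )" "nice (%x. (f x)\<^sup>2)" "nice (%x. (g x)\<^sup>2)"
		using assms by (auto simp: power2_eq_square intro: nice_abs nice_mult)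
	have [measurable]: "u \<in> BM" using assms by (auto dest: nice_meas)
	have pt: "|conv u f x*g x| <= (conv (%x. |u x| ) (%x. (f x)\<^sup>2) x + ?c*(g x)\<^sup>2)/2" for x
	proof -
		have "|conv u f x*g x| <= conv (%t. |u t| ) (%t. |f t| ) x*|g x|"
			unfolding abs_mult using assms by (intro mult_right_mono abs_conv_le) (auto intro: nice_abs)
		also have "... = (LBINT t. |u (x-t)|*( |f t|*|g x| ))" by (simp add: conv_def mult.assoc[symmetric])
		also have "... <= (LBINT t. |u (x-t)|*(f t)\<^sup>2/2 + |u (x-t)|*(g x)\<^sup>2/2)"
		proof (rule integral_mono)
			show "integrable lborel (%t. |u (x-t)|*( |f t|*|g x| ))"
				using nice_int[OF nice_cmult[OF nice_conv_integrand[OF n(1) nice_abs[OF assms(2)], of x], of "|g x|"]] by (simp add: mult_ac)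
			show "integrable lborel (%t. |u (x-t)|*(f t)\<^sup>2/2 + |u (x-t)|*(g x)\<^sup>2/2)"
				using nice_conv_integrable[OF n(1,2), of x] nice_int[OF nice_reflect[OF n(1)], of x] by simp
			fix t
			have "0 <= ( |f t| - |g x| )\<^sup>2" by simp
			then have "|f t|*|g x| <= ((f t)\<^sup>2 + (g x)\<^sup>2)/2" by (simp add: power2_diff)
			then have "|u (x-t)|*( |f t|*|g x| ) <= |u (x-t)|*(((f t)\<^sup>2 + (g x)\<^sup>2)/2)" by (intro mult_left_mono) auto
			then show "|u (x-t)|*( |f t|*|g x| ) <= |u (x-t)|*(f t)\<^sup>2/2 + |u (x-t)|*(g x)\<^sup>2/2"
				by (simp add: distrib_left add_divide_distrib)
		qed
		also have "... = (conv (%x. |u x| ) (%x. (f x)\<^sup>2) x + (LBINT t. |u (x-t)| )*(g x)\<^sup>2)/2"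
			using nice_conv_integrable[OF n(1,2), of x] nice_int[OF nice_reflect[OF n(1)], of x]
			by (simp add: conv_def add_divide_distrib)
		also have "(LBINT t. |u (x-t)| ) = ?c" by (subst lborel_reflect[where h="%t. |u t|"]) auto
		finally show ?thesis .
	qed
	have "|LBINT x. conv u f x*g x| <= (LBINT x. |conv u f x*g x| )" by (rule integral_abs_bound)
	also have "... <= (LBINT x. (conv (%x. |u x| ) (%x. (f x)\<^sup>2) x + ?c*(g x)\<^sup>2)/2)"
		using pt nice_int[OF nice_conv[OF n(1,2)]] nice_int[OF n(3)]
		by (intro integral_mono nice_int nice_abs nice_mult nice_conv assms nice_divide nice_add nice_cmult n) auto
	also have "... = ?c/2*((LBINT x. (f x)\<^sup>2) + (LBINT x. (g x)\<^sup>2))"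
		using nice_int[OF nice_conv[OF n(1,2)]] nice_int[OF n(3)]
		by (simp add: integral_conv[OF n(1,2)] distrib_left)
	also have "... <= c/2*((LBINT x. (f x)\<^sup>2) + (LBINT x. (g x)\<^sup>2))"
		using assms(4) by (intro mult_right_mono add_nonneg_nonneg Bochner_Integration.integral_nonneg) auto
	finally show ?thesis .
qed

text \<open>The bound for the adjoint of the square function. Expanding the square, almost
  orthogonality makes the cross terms decay like \<open>(1/2)^nat |m-l|\<close>, so each norm is met
  by a geometric series.\<close>

lemma square_function_L2:
	fixes g :: "int => 'a::euclidean_space => real"
	assumes L: "finite L" and g: "!!l. nice (g l)"
	shows "(LBINT x. (\<Sum>l\<in>L. conv (dl (l + b)) (g l) x)\<^sup>2) <= 4*cV TYPE('a)*(\<Sum>l\<in>L. LBINT x. (g l x)\<^sup>2)"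
proof -
	let ?G = "%l. LBINT x. (g l x)\<^sup>2" and ?D = "%l. dl (l + b) :: 'a => real"
	have G0: "?G l >= 0" for l by (rule Bochner_Integration.integral_nonneg) simp
	have cV: "cV TYPE('a) >= 0" using cU_pos[where 'a='a] dC_pos[where 'a='a] by (simp add: cV_def)
	have t: "(LBINT x. conv (?D l) (g l) x*conv (?D m) (g m) x) <= cV TYPE('a)*(1/2)^nat |m-l|/2*(?G l + ?G m)" for l m
	proof -
		have "(LBINT x. conv (?D l) (g l) x*conv (?D m) (g m) x) = (LBINT x. conv (?D m) (g m) x*conv (?D l) (g l) x)"
			by (simp add: mult.commute)
		also have "... = (LBINT x. g m x*conv (%t. ?D m (- t)) (conv (?D l) (g l)) x)"
			by (rule conv_adjoint) (intro nice_dl g nice_conv)+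
		also have "... = (LBINT x. conv (conv (?D m) (?D l)) (g l) x*g m x)"
			by (simp add: dl_minus conv_assoc nice_dl g mult.commute)
		also have "... <= cV TYPE('a)*(1/2)^nat |m-l|/2*(?G l + ?G m)"
			using bilinear_Young[OF nice_conv[OF nice_dl nice_dl] g[of l] g[of m] integral_abs_conv_dl[of "m+b" "l+b"]] by simp
		finally show ?thesis .
	qed
	have "(LBINT x. (\<Sum>l\<in>L. conv (?D l) (g l) x)\<^sup>2) = (\<Sum>l\<in>L. \<Sum>m\<in>L. LBINT x. conv (?D l) (g l) x*conv (?D m) (g m) x)"
		by (simp add: power2_eq_square sum_product nice_int nice_mult nice_conv nice_dl g)
	also have "... <= (\<Sum>l\<in>L. \<Sum>m\<in>L. cV TYPE('a)*(1/2)^nat |m-l|/2*(?G l + ?G m))"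
		by (intro sum_mono t)
	also have "... = (\<Sum>l\<in>L. \<Sum>m\<in>L. cV TYPE('a)/2*?G l*(1/2)^nat |m-l| ) + (\<Sum>l\<in>L. \<Sum>m\<in>L. cV TYPE('a)/2*?G m*(1/2)^nat |m-l| )"
		by (simp add: sum.distrib[symmetric] algebra_simps)
	also have "(\<Sum>l\<in>L. \<Sum>m\<in>L. cV TYPE('a)/2*?G m*(1/2)^nat |m-l| ) = (\<Sum>m\<in>L. \<Sum>l\<in>L. cV TYPE('a)/2*?G m*(1/2)^nat |l-m| )"
		by (subst sum.swap) (simp add: abs_minus_commute)
	also have "(\<Sum>l\<in>L. \<Sum>m\<in>L. cV TYPE('a)/2*?G l*(1/2)^nat |m-l| ) + ... <= (\<Sum>l\<in>L. cV TYPE('a)/2*?G l*4) + (\<Sum>l\<in>L. cV TYPE('a)/2*?G l*4)"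
		using geometric_int_sum[OF L, of "1/2"] cV G0 unfolding sum_distrib_left[symmetric]
		by (intro add_mono sum_mono mult_left_mono) auto
	also have "... = 4*cV TYPE('a)*(\<Sum>l\<in>L. ?G l)" by (simp add: sum_distrib_left sum.distrib[symmetric] mult.assoc)
	finally show ?thesis .
qed

definition sqA :: "'a::euclidean_space itself => real" where "sqA _ = dC TYPE('a)*4^DIM('a)*4"

text \<open>Forward, the row \<open>(m, l)\<close> is the difference at scale \<open>l + b\<close>
  of the row \<open>m\<close>; backward, these rows are summed over \<open>l\<close>. The passive
  index \<open>J\<close> is carried along so that square functions in two variables can be
  iterated.\<close>

lemma czpair_sq:
	fixes J :: "'k set" and L :: "int set" and b :: int
	assumes fin: "finite J" "finite L"
	shows "czpair J (J \<times> L) L (%l. dl (l + b) :: 'a::euclidean_space => real) (%l m. of_bool (snd m = l)) (%l m. fst m) (%l m. 1) (%l m. (m, l)) (sqA TYPE('a))"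
proof (intro czpair.intro czdat.intro czpair_axioms.intro)
	show "finite J" "finite (J \<times> L)" "finite L" "finite (J \<times> L)" "finite J" using fin by auto
	show "nice (dl (l + b) :: 'a => real)" "nice (dl (l + b) :: 'a => real)" for l by (rule nice_dl)+
	let ?H = "%h::'a. \<Sum>l\<in>L. LBINT x. indicator {x. 2*norm h <= norm x} x*|dl (l + b) (x-h)-dl (l + b) x|"
	have sel: "(\<Sum>m\<in>J \<times> L. of_bool (snd m = l)*X (fst m) m) = (\<Sum>m\<in>J. X m (m, l))" if "l \<in> L" for l and X :: "'k => 'k \<times> int => real"
	proof -
		have "(\<Sum>m\<in>J \<times> L. of_bool (snd m = l)*X (fst m) m) = (\<Sum>m\<in>J. \<Sum>l'\<in>L. of_bool (l' = l)*X m (m, l'))"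
			by (simp add: sum.cartesian_product case_prod_beta')
		also have "... = (\<Sum>m\<in>J. X m (m, l))"
			using that fin by (intro sum.cong refl sum_of_bool) auto
		finally show ?thesis .
	qed
	show "(\<Sum>m\<in>J \<times> L. of_bool (snd m = l)*X (fst m) m) = (\<Sum>m\<in>J. 1*X m (m, l))" if "l \<in> L" for l and X :: "'k => 'k \<times> int => real"
		using sel[OF that] by simp
	show "(\<Sum>m\<in>J \<times> L. (of_bool (snd m = l)*w (fst m))\<^sup>2) <= (\<Sum>m\<in>J. (w m)\<^sup>2)" if "l \<in> L" for l and w :: "'k => real"
	proof -
		have "(of_bool c)\<^sup>2 = (of_bool c :: real)" for c by simp
		then show ?thesis using sel[OF that, of "%a b. (w a)\<^sup>2"] by (simp only: power_mult_distrib)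
	qed
	show "(\<Sum>m\<in>J. (1*w (m, l))\<^sup>2) <= (\<Sum>m\<in>J \<times> L. (w m)\<^sup>2)" if "l \<in> L" for l and w :: "'k \<times> int => real"
	proof -
		have "(\<Sum>m\<in>J. (1*w (m, l))\<^sup>2) = (\<Sum>m\<in>(%m. (m, l)) ` J. (w m)\<^sup>2)"
			by (subst sum.reindex) (auto simp: inj_on_def)
		also have "... <= (\<Sum>m\<in>J \<times> L. (w m)\<^sup>2)" using fin that by (intro sum_mono2) auto
		finally show ?thesis .
	qed
	have h: "?H h <= sqA TYPE('a)" for h :: 'a
	proof -
		have "?H h
			= (\<Sum>l\<in>(%l. l + b) ` L. LBINT x. indicator {x. 2*norm h <= norm x} x*|dl l (x-h)-dl l x| )"
			by (subst sum.reindex) auto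
		also have "... <= sqA TYPE('a)"
			unfolding sqA_def using fin dC_pos[where 'a='a] by (intro hormander_sum nice_dl dl_supp dl_lip) auto
		finally show ?thesis .
	qed
	show "?H h <= sqA TYPE('a)"
		"?H h <= sqA TYPE('a)" for h :: 'a
		using h by auto
	show "dl (l + b) (- x) = dl (l + b) x" for l and x :: 'a by (rule dl_minus)
qed (use fin in auto)

text \<open>The L^2 bound is proved for the adjoint and dualised. Since \<open>C\<close> precedes
  all finite sets, uniformity in \<open>L\<close> does the work of the infinite square
  function.\<close>

theorem square_function_bound:
	assumes "1 < p" "1 < r"
	shows "EX C. ALL (I::'i set) (J::'k set) L b. finite I --> finite J --> finite L -->
		bdd_on p r I J (J \<times> L) (%f i m. conv (dl (snd m + b) :: 'a::euclidean_space => real) (f i (fst m))) C"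
proof (intro exI allI impI)
	fix I :: "'i set" and J :: "'k set" and L :: "int set" and b :: int
	assume fin: "finite I" "finite J" "finite L"
	interpret P: czpair J "J \<times> L" L "%l. dl (l + b) :: 'a => real" "%l m. of_bool (snd m = l)" "%l m. fst m" "%l m. 1" "%l m. (m, l)" "sqA TYPE('a)"
		by (rule czpair_sq) fact+
	interpret S: czpair "J \<times> L" J L "%l. dl (l + b) :: 'a => real" "%l m. 1" "%l m. (m, l)" "%l m. of_bool (snd m = l)" "%l m. fst m" "sqA TYPE('a)"
		by (rule P.swap)
	let ?C = "4*cV TYPE('a)"
	have cV: "?C >= 0" using cU_pos[where 'a='a] dC_pos[where 'a='a] by (simp add: cV_def)
	have B: "bdd_on 2 2 {i} (J \<times> L) J P.B.T ?C" for i :: 'i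
		unfolding bdd_on_def
	proof (intro allI impI)
		fix g :: "'i => 'k \<times> int => 'a => real" assume "ALL i m. nice (g i m)"
		then have g: "!!i m. nice (g i m)" by blast
		have "Phi 2 2 {i} J (P.B.T g) = (\<Sum>m\<in>J. LBINT x. (\<Sum>l\<in>L. conv (dl (l + b)) (g i (m, l)) x)\<^sup>2)"
			using fin g by (simp add: Phi_2 P.B.nice_T selop_def)
		also have "... <= (\<Sum>m\<in>J. ?C*(\<Sum>l\<in>L. LBINT x. (g i (m, l) x)\<^sup>2))"
			using fin g by (intro sum_mono square_function_L2) auto
		also have "... = ?C*Phi 2 2 {i} (J \<times> L) g"
			using fin g by (simp add: Phi_2 sum_distrib_left) (simp add: sum.cartesian_product case_prod_beta')
		finally show "Phi 2 2 {i} J (P.B.T g) <= ?C*Phi 2 2 {i} (J \<times> L) g" .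
	qed
	have two: "conj_exp 2 2" by (simp add: conj_exp_def)
	let ?D = "max ?C (dualC 2 ?C)"
	have "bdd_on 2 2 {i} J (J \<times> L) P.F.T ?D" for i :: 'i
		by (rule bdd_on_mono[OF S.dual_bound[OF two two _ B]]) auto
	moreover have "bdd_on 2 2 {i} (J \<times> L) J P.B.T ?D" for i :: 'i by (rule bdd_on_mono[OF B]) auto
	ultimately have *: "bdd_on p r I J (J \<times> L) P.F.T (mC (DIM('a)) p r (sqA TYPE('a)) ?D)"
		using assms fin cV by (intro P.bound_all_exponents) auto
	have eq: "P.F.T f i m x = conv (dl (snd m + b)) (f i (fst m)) x" if "m \<in> J \<times> L" for f :: "'i => 'k => 'a => real" and i m x
		using that fin unfolding selop_def by (subst sum_of_bool(2)) auto
	have "Phi p r I (J \<times> L) (P.F.T f) = Phi p r I (J \<times> L) (%i m. conv (dl (snd m + b)) (f i (fst m)))" for f :: "'i => 'k => 'a => real"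
		unfolding Phi_def using eq by (intro Bochner_Integration.integral_cong refl arg_cong[of _ _ "%v. v powr p"] nrm_cong) auto
	then show "bdd_on p r I J (J \<times> L) (%f i m. conv (dl (snd m + b) :: 'a => real) (f i (fst m))) (mC (DIM('a)) p r (sqA TYPE('a)) ?D)"
		using * by (simp add: bdd_on_def)
qed

text \<open>Each row is averaged at its own scale \<open>e m\<close>, a task usually given to the
  vector-valued maximal inequality. The Hoermander sum runs over the distinct scales in use, and L^2
  is Young's inequality row by row.\<close>

theorem averages_bound:
	assumes "1 < p" "1 < r"
	shows "EX C. ALL (I::'i set) (J::'k set) e. finite I --> finite J -->
		bdd_on p r I J J (%f i m. conv (phi (e m) :: 'a::euclidean_space => real) (f i m)) C"
proof (intro exI allI impI)
	fix I :: "'i set" and J :: "'k set" and e :: "'k => int"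
	assume fin: "finite I" "finite J"
	let ?A = "1/bz TYPE('a)*4^DIM('a)*4"
	have hor: "(\<Sum>l\<in>e ` J. LBINT x. indicator {x. 2*norm h <= norm x} x*|phi l (x-h)-phi l x| ) <= ?A" for h :: 'a
		using fin bz_pos[where 'a='a]
		by (intro hormander_sum nice_phi phi_supp order_trans[OF phi_lip]) (auto simp: mult.commute)
	have contr: "(\<Sum>m\<in>J. (of_bool (e m = l)*w m)\<^sup>2) <= (\<Sum>m\<in>J. (w m)\<^sup>2)" for l and w :: "'k => real"
		by (intro sum_mono) auto
	interpret P: czpair J J "e ` J" "phi :: int => 'a => real" "%l m. of_bool (e m = l)" "%l m. m" "%l m. of_bool (e m = l)" "%l m. m" ?A
		by unfold_locales (use fin hor contr in \<open>auto simp: nice_phi phi_minus\<close>)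
	interpret S: czpair J J "e ` J" "phi :: int => 'a => real" "%l m. of_bool (e m = l)" "%l m. m" "%l m. of_bool (e m = l)" "%l m. m" ?A
		by (rule P.swap)
	have eq: "P.F.T f i m x = conv (phi (e m)) (f i m) x" if "m \<in> J" for f :: "'i => 'k => 'a => real" and i m x
		using that fin unfolding selop_def by (subst sum_of_bool(2)) auto
	have two: "conj_exp 2 2" by (simp add: conj_exp_def)
	have B: "bdd_on 2 2 {i} J J P.F.T ((2*1) powr 2)" for i :: 'i
		unfolding bdd_on_def
	proof (intro allI impI, rule Phi_duality[OF two two])
		fix f :: "'i => 'k => 'a => real" assume "ALL i m. nice (f i m)"
		then have f: "!!i m. nice (f i m)" by simp
		show "nice (P.F.T f i m)" for i m by (rule P.F.nice_T[OF f])
		fix g :: "'i => 'k => 'a => real" assume g: "!!i m. nice (g i m)"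
		have phi1: "(LBINT x. |phi l (x::'a)| ) <= 1" for l using integral_phi[of l, where 'a='a] by (simp add: phi_nonneg)
		have "(\<Sum>m\<in>J. LBINT x. P.F.T f i m x*g i m x) <= (\<Sum>m\<in>J. 1/2*((LBINT x. (f i m x)\<^sup>2) + (LBINT x. (g i m x)\<^sup>2)))"
		proof (rule sum_mono)
			fix m assume "m \<in> J"
			then show "(LBINT x. P.F.T f i m x*g i m x) <= 1/2*((LBINT x. (f i m x)\<^sup>2) + (LBINT x. (g i m x)\<^sup>2))"
				using bilinear_Young[OF nice_phi f[of i m] g[of i m] phi1, of "e m"] eq[of m f i] by simp
		qed
		also have "... = 1/2*(Phi 2 2 {i} J f + Phi 2 2 {i} J g)"
			using fin f g by (simp add: Phi_2 sum.distrib sum_divide_distrib[symmetric])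
		also have "... <= 1*(Phi 2 2 {i} J f + Phi 2 2 {i} J g)" by (intro mult_right_mono add_nonneg_nonneg) auto
		finally show "(\<Sum>i\<in>{i}. \<Sum>m\<in>J. LBINT x. P.F.T f i m x*g i m x) <= 1*(Phi 2 2 {i} J f + Phi 2 2 {i} J g)" by simp
	qed (use fin in auto)
	have *: "bdd_on p r I J J P.F.T (mC (DIM('a)) p r ?A ((2*1) powr 2))"
		using assms fin B by (intro P.bound_all_exponents) auto
	have "Phi p r I J (P.F.T f) = Phi p r I J (%i m. conv (phi (e m)) (f i m))" for f :: "'i => 'k => 'a => real"
		unfolding Phi_def using eq by (intro Bochner_Integration.integral_cong refl arg_cong[of _ _ "%v. v powr p"] nrm_cong) auto
	then show "bdd_on p r I J J (%f i m. conv (phi (e m) :: 'a => real) (f i m)) (mC (DIM('a)) p r ?A ((2*1) powr 2))"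
		using * by (simp add: bdd_on_def)
qed

section \<open>Convolution on a product\<close>

definition conv1 :: "('a::euclidean_space => real) => ('a \<times> 'b::euclidean_space => real) => 'a \<times> 'b => real" where
	"conv1 u f z = conv u (%x. f (x, snd z)) (fst z)"

definition conv2 :: "('b::euclidean_space => real) => ('a::euclidean_space \<times> 'b => real) => 'a \<times> 'b => real" where
	"conv2 v f z = conv v (%y. f (fst z, y)) (snd z)"

definition ten :: "('a => real) => ('b => real) => 'a \<times> 'b => real" where
	"ten u v z = u (fst z) * v (snd z)"

lemma nice_ten: "nice u ==> nice v ==> nice (ten u v)"
	unfolding ten_def[abs_def] by (rule nice_tensor)

lemma nice_conv1:
	fixes f :: "'a::euclidean_space \<times> 'b::euclidean_space => real"
	assumes "nice u" "nice f" shows "nice (conv1 u f)"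
proof -
	from assms obtain B R B' R' where *: "!!x. |u x| <= B" "!!x. u x ~= 0 ==> norm x <= R" "B > 0"
		"!!x. |f x| <= B'" "!!x. f x ~= 0 ==> norm x <= R'" by (metis niceE)
	have [measurable]: "u \<in> BM" "f \<in> BM" using assms by (auto dest: nice_meas)
	have "nice (%w::('a \<times> 'b) \<times> 'a. u (fst (fst w)-snd w)*f (snd w, snd (fst w)))"
	proof (rule niceI[of _ "B*B'" "R + R' + R' + R'"])
		show "|u (fst (fst w)-snd w)*f (snd w, snd (fst w))| <= B*B'" for w :: "('a \<times> 'b) \<times> 'a"
			using *(1)[of "fst (fst w)-snd w"] *(3) *(4)[of "(snd w, snd (fst w))"] by (auto simp: abs_mult intro!: mult_mono)
		show "norm w <= R + R' + R' + R'" if "u (fst (fst w)-snd w)*f (snd w, snd (fst w)) ~= 0" for w :: "('a \<times> 'b) \<times> 'a"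
		proof -
			obtain x y t where w: "w = ((x, y), t)" by (metis prod.exhaust)
			have "norm (x-t) <= R" "norm (t, y) <= R'" using * that by (auto simp: w)
			then have "norm t <= R'" "norm y <= R'" using norm_fst_le[of t y] norm_snd_le[of y t] by linarith+
			moreover have "norm x <= norm t + norm (x-t)" by (rule norm_triangle_sub)
			moreover have "norm ((x, y), t) <= norm (x, y) + norm t" "norm (x, y) <= norm x + norm y" by (rule norm_Pair_le)+
			ultimately show ?thesis using \<open>norm (x - t) <= R\<close> by (simp add: w)
		qed
	qed measurable
	from nice_partial_integral[OF this] show ?thesis by (simp add: conv1_def[abs_def] conv_def)
qed

lemma conv2_swap: "conv2 v f z = conv1 v (%w. f (snd w, fst w)) (snd z, fst z)"
	by (simp add: conv1_def conv2_def)

lemma nice_conv2: "nice v ==> nice f ==> nice (conv2 v f)"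
	using nice_swap[OF nice_conv1[OF _ nice_swap]] by (simp add: conv2_swap[abs_def])

lemma conv_ten:
	fixes u :: "'a::euclidean_space => real" and v :: "'b::euclidean_space => real"
	assumes "nice u" "nice v" "nice f"
	shows "conv (ten u v) f = conv1 u (conv2 v f)" "conv (ten u v) f = conv2 v (conv1 u f)"
proof -
	have n: "nice (%w. u (fst z-fst w)*(v (snd z-snd w)*f (fst w, snd w)))" for z
	proof -
		have "nice (%w. ten u v (z-w)*f w)" by (intro nice_conv_integrand nice_ten assms)
		then show ?thesis by (simp add: ten_def mult.assoc)
	qed
	have 0: "conv (ten u v) f z = (LBINT x. LBINT y. u (fst z-x)*(v (snd z-y)*f (x, y)))" for z
		unfolding nice_Fubini(2)[OF n] by (simp add: conv_def ten_def mult.assoc)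
	show "conv (ten u v) f = conv1 u (conv2 v f)"
		unfolding fun_eq_iff 0 by (simp add: conv1_def conv2_def conv_def)
	show "conv (ten u v) f = conv2 v (conv1 u f)"
		unfolding fun_eq_iff 0 nice_Fubini(1)[OF n]
		by (simp add: conv1_def conv2_def conv_def mult.left_commute[of "u _" "v _"])
qed

lemma ten_conv:
	assumes "nice u" "nice v" "nice u'" "nice v'"
	shows "conv (ten u v) (ten u' v') = ten (conv u u') (conv v v')"
proof
	fix z
	have "conv2 v (ten u' v') w = u' (fst w)*conv v v' (snd w)" for w
		by (simp add: conv2_def ten_def conv_cmult_right)
	then have "conv1 u (conv2 v (ten u' v')) z = conv u (%x. conv v v' (snd z)*u' x) (fst z)"
		by (simp add: conv1_def mult.commute)
	also have "... = conv v v' (snd z)*conv u u' (fst z)" by (simp add: conv_cmult_right)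
	finally show "conv (ten u v) (ten u' v') z = ten (conv u u') (conv v v') z"
		using assms by (simp add: conv_ten nice_ten ten_def mult.commute)
qed

lemma Phi_fibers:
	fixes F :: "'i => 'k => 'a::euclidean_space \<times> 'b::euclidean_space => real"
	assumes "p > 0" "r > 1" "finite I" "finite J" "!!i m. nice (F i m)"
	shows "Phi p r I J F = (LBINT y. Phi p r I J (%i m x. F i m (x, y)))"
		and "nice (%y. Phi p r I J (%i m x. F i m (x, y)))"
		and "Phi p r I J F = Phi p r I J (%i m w. F i m (snd w, fst w))"
proof -
	let ?G = "%x y. nrm r I J (%i m. F i m (x, y)) powr p"
	have n: "nice (%z. ?G (fst z) (snd z))" using nice_Phi_integrand[OF assms] by simp
	have n': "nice (%z. ?G (snd z) (fst z))" using nice_swap[OF n] by simp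
	show e: "Phi p r I J F = (LBINT y. Phi p r I J (%i m x. F i m (x, y)))"
		using nice_Fubini[OF n] by (simp add: Phi_def)
	show "nice (%y. Phi p r I J (%i m x. F i m (x, y)))"
		using nice_partial_integral[OF n'] by (simp add: Phi_def)
	show "Phi p r I J F = Phi p r I J (%i m w. F i m (snd w, fst w))"
		using e nice_Fubini(2)[of "%x y. ?G y x", OF n'] by (simp add: Phi_def)
qed

text \<open>Freezing the second variable, the one-variable bound holds on each fibre with the same
  constant; since \<open>Phi\<close> is an integral of p-th powers, it can be integrated over the
  fibres.\<close>

lemma bdd_on_fibers:
	fixes F :: "'i => 'k1 => 'a::euclidean_space \<times> 'b::euclidean_space => real"
	assumes "p > 0" "r > 1" "finite I" "finite J1" "finite J2" and F: "!!i k. nice (F i k)" and G: "!!i k. nice (G i k)"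
		and S: "bdd_on p r I J1 J2 S C" and eq: "!!i k x y. G i k (x, y) = S (%i k x. F i k (x, y)) i k x"
	shows "Phi p r I J2 G <= C*Phi p r I J1 F"
proof -
	have "Phi p r I J2 G = (LBINT y. Phi p r I J2 (%i k x. G i k (x, y)))"
		by (rule Phi_fibers) fact+
	also have "... <= (LBINT y. C*Phi p r I J1 (%i k x. F i k (x, y)))"
	proof (intro integral_mono nice_int nice_cmult Phi_fibers assms)
		fix y
		show "Phi p r I J2 (%i k x. G i k (x, y)) <= C*Phi p r I J1 (%i k x. F i k (x, y))"
			using bdd_onD[OF S, of "%i k x. F i k (x, y)"] F unfolding eq by (simp add: nice_section1)
	qed
	also have "... = C*Phi p r I J1 F" using Phi_fibers(1)[of p r I J1 F] assms by simp
	finally show ?thesis .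
qed

lemma bdd_on_fibers2:
	fixes F :: "'i => 'k1 => 'a::euclidean_space \<times> 'b::euclidean_space => real"
	assumes "p > 0" "r > 1" "finite I" "finite J1" "finite J2" and F: "!!i k. nice (F i k)" and G: "!!i k. nice (G i k)"
		and S: "bdd_on p r I J1 J2 S C" and eq: "!!i k x y. G i k (x, y) = S (%i k y. F i k (x, y)) i k y"
	shows "Phi p r I J2 G <= C*Phi p r I J1 F"
proof -
	have "Phi p r I J2 (%i k w. G i k (snd w, fst w)) <= C*Phi p r I J1 (%i k w. F i k (snd w, fst w))"
		by (rule bdd_on_fibers[OF assms(1-5) nice_swap[OF F] nice_swap[OF G] S]) (simp add: eq)
	then show ?thesis
		using Phi_fibers(3)[of p r I J2 G] Phi_fibers(3)[of p r I J1 F] assms by simp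
qed

abbreviation scale_x :: "(unit \<times> int) \<times> int => int" where "scale_x k == snd k"
abbreviation scale_y :: "(unit \<times> int) \<times> int => int" where "scale_y k == snd (fst k)"

text \<open>The nested shape is what two applications of \<open>square_function_bound\<close>
  produce from a single row: first the scales in \<open>y\<close>, then those in
  \<open>x\<close>.\<close>

definition scales :: "int set => int set => ((unit \<times> int) \<times> int) set" where
	"scales Lx Ly = ({()} \<times> Ly) \<times> Lx"

lemma finite_scales: "finite Lx ==> finite Ly ==> finite (scales Lx Ly)"
	by (simp add: scales_def)

lemma product_square_function:
	assumes "1 < p" "1 < r"
	shows "EX C>0. ALL (I::'i set) (Lx::int set) (Ly::int set) b b' f. finite I --> finite Lx --> finite Ly --> (ALL i. nice (f i :: 'a::euclidean_space \<times> 'b::euclidean_space => real)) -->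
		Phi p r I (scales Lx Ly) (%i k. conv (ten (dl (scale_x k + b)) (dl (scale_y k + b'))) (f i)) <= C*Phi p r I {()} (%i _. f i)"
proof -
	obtain C1 where C1: "!!(I::'i set) (J::(unit \<times> int) set) L b. finite I ==> finite J ==> finite L ==>
		bdd_on p r I J (J \<times> L) (%f i k. conv (dl (snd k + b) :: 'a => real) (f i (fst k))) C1"
		using square_function_bound[OF assms] by blast
	obtain C2 where C2: "!!(I::'i set) (J::unit set) L b. finite I ==> finite J ==> finite L ==>
		bdd_on p r I J (J \<times> L) (%f i k. conv (dl (snd k + b) :: 'b => real) (f i (fst k))) C2"
		using square_function_bound[OF assms] by blast
	show ?thesis
	proof (intro exI[of _ "max 1 C1*max 1 C2"] conjI allI impI, goal_cases)
		case (2 I Lx Ly b b' f)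
		note fin = 2(1-3) and f = 2(4)[rule_format]
		let ?F = "%i k. conv2 (dl (snd k + b')) (f i)"
		have "Phi p r I (scales Lx Ly) (%i k. conv (ten (dl (scale_x k + b)) (dl (scale_y k + b'))) (f i)) <= max 1 C1*Phi p r I ({()} \<times> Ly) ?F"
			unfolding scales_def
			by (rule bdd_on_fibers[OF _ _ _ _ _ _ _ bdd_on_mono[OF C1]])
				(use assms fin f in \<open>auto intro!: nice_conv1 nice_conv2 nice_conv nice_ten nice_dl simp: conv_ten nice_dl conv1_def\<close>)
		also have "Phi p r I ({()} \<times> Ly) ?F <= max 1 C2*Phi p r I {()} (%i _. f i)"
			by (rule bdd_on_fibers2[OF _ _ _ _ _ _ _ bdd_on_mono[OF C2]])
				(use assms fin f in \<open>auto intro!: nice_conv2 nice_dl simp: conv2_def\<close>)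
		finally show ?case
			by (simp add: mult.assoc mult_left_mono)
	qed simp
qed

lemma product_averages:
	assumes "1 < p" "1 < r"
	shows "EX C>0. ALL (I::'i set) (J::'k set) e e' f. finite I --> finite J --> (ALL i m. nice (f i m :: 'a::euclidean_space \<times> 'b::euclidean_space => real)) -->
		Phi p r I J (%i m. conv (ten (phi (e m)) (phi (e' m))) (f i m)) <= C*Phi p r I J f"
proof -
	obtain C1 where C1: "!!(I::'i set) (J::'k set) e. finite I ==> finite J ==>
		bdd_on p r I J J (%f i m. conv (phi (e m) :: 'a => real) (f i m)) C1"
		using averages_bound[OF assms] by blast
	obtain C2 where C2: "!!(I::'i set) (J::'k set) e. finite I ==> finite J ==>
		bdd_on p r I J J (%f i m. conv (phi (e m) :: 'b => real) (f i m)) C2"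
		using averages_bound[OF assms] by blast
	show ?thesis
	proof (intro exI[of _ "max 1 C1*max 1 C2"] conjI allI impI, goal_cases)
		case (2 I J e e' f)
		note fin = 2(1,2) and f = 2(3)[rule_format]
		let ?F = "%i m. conv2 (phi (e' m)) (f i m)"
		have "Phi p r I J (%i m. conv (ten (phi (e m)) (phi (e' m))) (f i m)) <= max 1 C1*Phi p r I J ?F"
			by (rule bdd_on_fibers[OF _ _ _ _ _ _ _ bdd_on_mono[OF C1]])
				(use assms fin f in \<open>auto intro!: nice_conv1 nice_conv2 nice_conv nice_ten nice_phi simp: conv_ten nice_phi conv1_def\<close>)
		also have "Phi p r I J ?F <= max 1 C2*Phi p r I J f"
			by (rule bdd_on_fibers2[OF _ _ _ _ _ _ _ bdd_on_mono[OF C2]])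
				(use assms fin f in \<open>auto intro!: nice_conv2 nice_phi simp: conv2_def\<close>)
		finally show ?case
			by (simp add: mult.assoc mult_left_mono)
	qed simp
qed

section \<open>Product atoms\<close>

text \<open>Continuity is part of the notion because the transposed kernel applied to a nice
  function must be continuous when the reproducing formula is tested against it.\<close>

definition atom2 :: "int => int => real => real => ('a::euclidean_space \<times> 'b::euclidean_space => real) => bool" where
	"atom2 j k et B K \<longleftrightarrow> nice K & continuous_on UNIV K & (ALL x y. K (x, y) ~= 0 --> norm x <= sc j & norm y <= sc k)
		& (ALL y. (LBINT x. K (x, y)) = 0) & (ALL x. (LBINT y. K (x, y)) = 0)
		& (ALL x y h h'. |(K (x + h, y + h')-K (x, y + h'))-(K (x + h, y)-K (x, y))|
					<= B*(norm h/sc j) powr et/sc j^DIM('a)*(norm h'/sc k) powr et/sc k^DIM('b))"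

text \<open>Turns a pointwise bound on a ball of radius \<open>sc (a + 1)\<close> into domination by
  an averaging kernel. The shift 2 arises because \<open>phi l\<close> is bounded below only up to
  radius \<open>sc (l-1)\<close>.\<close>

lemma phi_lower_inverse:
	fixes w :: "'c::euclidean_space"
	assumes "norm w <= sc (a + 1)"
	shows "1/sc a^DIM('c) <= 2*4^DIM('c)*bz TYPE('c)*phi (a + 2) w"
proof -
	have "1/(2 * sc (a + 2)^DIM('c)*bz TYPE('c)) <= phi (a + 2) w"
		by (rule phi_lower) (use assms in \<open>simp add: add.commute\<close>)
	moreover have "sc (a + 2) = 4 * sc a" by (simp add: sc_add sc_def[of 2])
	ultimately show ?thesis using bz_pos[where 'a='c] by (simp add: power_mult_distrib field_simps)
qed

text \<open>One-variable almost orthogonality is used twice: for each increment in \<open>y\<close>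
  the difference of \<open>K\<close> is an atom in \<open>x\<close>, so the convolution in
  \<open>x\<close> is an atom in \<open>y\<close> whose constant already contains the gain in
  \<open>x\<close>. Support and size then give domination by a product of averages.\<close>

lemma atom2_conv_dl:
	fixes K :: "'a::euclidean_space \<times> 'b::euclidean_space => real"
	assumes K: "atom2 j k et B K" and et: "0 < et" "et <= 1" "0 <= B"
	shows "|conv (ten (dl l) (dl m)) K z| <= 4*4^DIM('a)*4^DIM('b)*bz TYPE('a)*bz TYPE('b)*cU TYPE('a)*cU TYPE('b)*B
		* (2 powr (-et))^(nat |l-j| )*(2 powr (-et))^(nat |m-k| )*ten (phi (max j l + 2)) (phi (max k m + 2)) z"
proof -
	let ?s = "2 powr (-et)" and ?n = "DIM('a)" and ?m = "DIM('b)"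
	have nK: "nice K" and Ks: "!!x y. K (x, y) ~= 0 ==> norm x <= sc j & norm y <= sc k"
		and K1: "!!y. (LBINT x. K (x, y)) = 0" and K2: "!!x. (LBINT y. K (x, y)) = 0"
		and Kh: "!!x y h h'. |(K (x + h, y + h')-K (x, y + h'))-(K (x + h, y)-K (x, y))|
					<= B*(norm h/sc j) powr et/sc j^?n*(norm h'/sc k) powr et/sc k^?m"
		using K by (auto simp: atom2_def)
	have dif: "atom1 j et (B*(norm h'/sc k) powr et/sc k^?m) (%x. K (x, y + h')-K (x, y))" for y h'
		unfolding atom1_def
	proof (intro conjI allI impI)
		show "nice (%x. K (x, y + h')-K (x, y))" by (intro nice_diff nice_section1 nK)
		show "norm x <= sc j" if "K (x, y + h')-K (x, y) ~= 0" for x using that Ks[of x y] Ks[of x "y + h'"] by fastforce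
		show "(LBINT x. K (x, y + h')-K (x, y)) = 0"
			using K1 by (simp add: nice_int nice_section1 nK)
		show "|K (x + h, y + h')-K (x + h, y)-(K (x, y + h')-K (x, y))| <= B*(norm h'/sc k) powr et/sc k^?m*(norm h/sc j) powr et/sc j^?n" for x h
			using Kh[of x h y h'] by (simp add: algebra_simps)
	qed
	let ?B1 = "cU TYPE('a)*B*?s^nat |l-j|/sc (max j l)^?n"
	have nK1: "nice (conv1 (dl l) K)" by (intro nice_conv1 nice_dl nK)
	have a1: "atom1 k et ?B1 (%y. conv1 (dl l) K (x, y))" for x
		unfolding atom1_def
	proof (intro conjI allI impI)
		show "nice (%y. conv1 (dl l) K (x, y))" by (intro nice_section2 nK1)
		show "norm y <= sc k" if "conv1 (dl l) K (x, y) ~= 0" for y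
		proof (rule ccontr)
			assume "\<not> norm y <= sc k"
			then have "K (t, y) = 0" for t using Ks[of t y] by blast
			then show False using that by (simp add: conv1_def conv_def)
		qed
		show "(LBINT y. conv1 (dl l) K (x, y)) = 0"
		proof -
			obtain D where D: "!!t. |dl l (t::'a)| <= D" using nice_dl by (metis niceE)
			have [measurable]: "(dl l :: 'a => real) \<in> BM" by (rule nice_meas[OF nice_dl])
			have "nice (%w::'b \<times> 'a. dl l (x-snd w)*K (snd w, fst w))"
				by (rule nice_bmult[OF nice_swap[OF nK], where B=D]) (use D in auto)
			then have "(LBINT y. LBINT t. dl l (x-t)*K (t, y)) = (LBINT t. LBINT y. dl l (x-t)*K (t, y))"
				by (rule nice_Fubini(1))
			then show ?thesis using K2 by (simp add: conv1_def conv_def)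
		qed
		show "|conv1 (dl l) K (x, y + h')-conv1 (dl l) K (x, y)| <= ?B1*(norm h'/sc k) powr et/sc k^?m" for y h'
		proof -
			have "conv1 (dl l) K (x, y + h')-conv1 (dl l) K (x, y) = conv (dl l) (%x. K (x, y + h')-K (x, y)) x"
				by (simp add: conv1_def conv_diff_right nice_dl nice_section1 nK)
			then show ?thesis using atom1_conv_dl[OF dif et(1,2), of h' l y x] et by (simp add: field_simps)
		qed
	qed
	have B1: "0 <= ?B1" using et cU_pos[where 'a='a] by simp
	have eq: "conv (ten (dl l) (dl m)) K z = conv (dl m) (%y. conv1 (dl l) K (fst z, y)) (snd z)"
		by (simp add: conv_ten(2) nice_dl nK conv2_def)
	have le: "|conv (ten (dl l) (dl m)) K z| <= cU TYPE('b)*?B1*?s^nat |m-k|/sc (max k m)^?m"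
		unfolding eq by (rule atom1_conv_dl[OF a1 et(1,2) B1])
	show ?thesis
	proof (cases "conv (ten (dl l) (dl m)) K z = 0")
		case True
		then show ?thesis using et bz_pos[where 'a='a] bz_pos[where 'a='b] cU_pos[where 'a='a] cU_pos[where 'a='b]
			by (simp add: ten_def phi_nonneg)
	next
		case False
		have y: "norm (snd z) <= sc (max k m + 1)"
			by (rule conv_dl_supp[of "%y. conv1 (dl l) K (fst z, y)" k m]) (use a1[of "fst z"] False eq in \<open>auto simp: atom1_def\<close>)
		have "EX y. conv1 (dl l) K (fst z, y) ~= 0"
		proof (rule ccontr)
			assume "\<not> ?thesis"
			then have "(%y. conv1 (dl l) K (fst z, y)) = (%y. 0)" by auto
			then show False using False eq by simp
		qed
		then obtain y0 where y0: "conv (dl l) (%x. K (x, y0)) (fst z) ~= 0" by (auto simp: conv1_def)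
		have x: "norm (fst z) <= sc (max j l + 1)"
			by (rule conv_dl_supp[of "%x. K (x, y0)" j l]) (use Ks y0 in auto)
		let ?c = "cU TYPE('a)*cU TYPE('b)*B*?s^nat |l-j|*?s^nat |m-k|"
		have c: "?c >= 0" using et cU_pos[where 'a='a] cU_pos[where 'a='b] by simp
		have "|conv (ten (dl l) (dl m)) K z| <= ?c*((1/sc (max j l)^?n)*(1/sc (max k m)^?m))"
			using le by (simp add: field_simps)
		also have "... <= ?c*((2*4^?n*bz TYPE('a)*phi (max j l + 2) (fst z))*(2*4^?m*bz TYPE('b)*phi (max k m + 2) (snd z)))"
			using c bz_pos[where 'a='a] phi_nonneg[of _ "fst z"] by (intro mult_left_mono mult_mono phi_lower_inverse x y) auto
		finally show ?thesis by (simp add: ten_def mult_ac)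
	qed
qed

section \<open>The reproducing formula\<close>

lemma continuous_conv:
	fixes u f :: "'a::euclidean_space => real"
	assumes "nice u" "continuous_on UNIV u" "nice f" shows "continuous_on UNIV (conv u f)"
	unfolding continuous_on_sequentially
proof (intro allI ballI impI, elim conjE)
	fix X :: "nat => 'a" and x assume X: "X ----> x"
	obtain B where B: "!!x. |u x| <= B" using assms(1) by (metis niceE)
	have [measurable]: "u \<in> BM" "f \<in> BM" using assms by (auto dest: nice_meas)
	show "(conv u f \<circ> X) ----> conv u f x"
		unfolding comp_def conv_def
	proof (rule integral_dominated_convergence)
		show "integrable lborel (%t. B*|f t| )" by (intro nice_int nice_cmult nice_abs assms)
		show "AE t in lborel. (%n. u (X n-t)*f t) ----> u (x-t)*f t"
		proof (intro AE_I2 tendsto_mult tendsto_const)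
			show "(%n. u (X n-t)) ----> u (x-t)" for t
				by (rule continuous_on_tendsto_compose[OF assms(2)]) (auto intro!: tendsto_diff X)
		qed
		show "AE t in lborel. norm (u (X n-t)*f t) <= B*|f t|" for n
			using B by (auto simp: abs_mult intro!: mult_right_mono)
	qed measurable
qed

lemma abs_conv_phi_le:
	fixes g :: "'a::euclidean_space => real"
	assumes "nice g" "!!x. |g x| <= B" shows "|conv (phi l) g x| <= B"
proof -
	have [measurable]: "(phi l :: 'a => real) \<in> BM" by (rule nice_meas[OF nice_phi])
	have "|conv (phi l) g x| <= (LBINT t. |phi l (x-t)*g t| )" unfolding conv_def by (rule integral_abs_bound)
	also have "... <= (LBINT t. B*phi l (x-t))"
	proof (rule integral_mono)
		show "integrable lborel (%t. |phi l (x-t)*g t| )"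
			by (intro nice_int nice_abs nice_conv_integrand nice_phi assms)
		show "integrable lborel (%t. B*phi l (x-t))"
			by (intro nice_int nice_cmult nice_reflect nice_phi)
		show "|phi l (x-t)*g t| <= B*phi l (x-t)" for t
			unfolding abs_mult abs_of_nonneg[OF phi_nonneg] mult.commute[of B] by (intro mult_left_mono phi_nonneg assms)
	qed
	also have "... = B" by (simp add: lborel_reflect integral_phi)
	finally show ?thesis .
qed

lemma conv_phi_tendsto:
	fixes g :: "'a::euclidean_space => real"
	assumes g: "nice g" "continuous_on UNIV g"
	shows "(%L. conv (phi (- int L)) g x) ----> g x"
proof (rule LIMSEQ_I)
	fix e :: real assume e: "e > 0"
	obtain d where d: "d > 0" "!!y. dist y x < d ==> dist (g y) (g x) < e/2"
		using g(2) e unfolding continuous_on_iff by (metis UNIV_I half_gt_zero)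
	obtain N where N: "!!L. L >= N ==> sc (- int L) < d"
		using order_tendstoD(2)[OF sc_neg_tendsto d(1)] by (auto simp: eventually_sequentially)
	show "EX N. ALL L>=N. norm (conv (phi (- int L)) g x-g x) < e"
	proof (intro exI[of _ N] allI impI)
		fix L assume L: "L >= N"
		have "conv (phi (- int L)) g x-g x = (LBINT t. (g (x-t)-g x)*phi (- int L) t)"
			using conv_commute[OF nice_phi g(1), of "- int L"]
			by (simp add: conv_def left_diff_distrib nice_int nice_conv_integrand nice_phi g(1) integral_phi)
		also have "|...| <= (LBINT t. |(g (x-t)-g x)*phi (- int L) t| )" by (rule integral_abs_bound)
		also have "... <= (LBINT t. e/2*phi (- int L) (t::'a))"
		proof (intro integral_mono nice_int nice_abs nice_cmult nice_phi)
			show "nice (%t. (g (x-t)-g x)*phi (- int L) t)"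
				unfolding left_diff_distrib by (intro nice_diff nice_conv_integrand nice_cmult nice_phi g)
			fix t :: 'a
			show "|(g (x-t)-g x)*phi (- int L) t| <= e/2*phi (- int L) t"
			proof (cases "phi (- int L) t = 0")
				case False
				then have "norm t < d" using phi_supp[OF False] N[OF L] by linarith
				then have "|g (x-t)-g x| <= e/2" using d(2)[of "x-t"] by (simp add: dist_norm)
				then have "|g (x-t)-g x|*phi (- int L) t <= e/2*phi (- int L) t"
					by (rule mult_right_mono[OF _ phi_nonneg])
				then show ?thesis by (simp only: abs_mult abs_of_nonneg[OF phi_nonneg])
			qed simp
		qed
		also have "... = e/2" by (simp add: integral_phi)
		finally show "norm (conv (phi (- int L)) g x-g x) < e" using e by simp
	qed
qed

lemma conv_phi_large:
	fixes g :: "'a::euclidean_space => real"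
	assumes g: "nice g"
	shows "(%L. conv (phi (int L)) g x) ----> 0"
proof (rule Lim_null_comparison)
	let ?c = "(LBINT t. |g t| )/bz TYPE('a)"
	show "\<forall>\<^sub>F L in sequentially. norm (conv (phi (int L)) g x) <= ?c * sc (- int L)"
	proof (intro always_eventually allI)
		fix L :: nat
		have one: "1 <= sc (int L)" using sc_mono[of 0 "int L"] by simp
		have "|conv (phi (int L)) g x| <= (LBINT t. |phi (int L) (x-t)*g t| )" unfolding conv_def by (rule integral_abs_bound)
		also have "... <= (LBINT t. 1/(sc (int L)^DIM('a)*bz TYPE('a))*|g t| )"
		proof (rule integral_mono)
			show "integrable lborel (%t. |phi (int L) (x-t)*g t| )"
				by (intro nice_int nice_abs nice_conv_integrand nice_phi g)
			show "integrable lborel (%t. 1/(sc (int L)^DIM('a)*bz TYPE('a))*|g t| )"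
				by (intro nice_int nice_cmult nice_abs g)
			show "|phi (int L) (x-t)*g t| <= 1/(sc (int L)^DIM('a)*bz TYPE('a))*|g t|" for t
				unfolding abs_mult abs_of_nonneg[OF phi_nonneg] by (intro mult_right_mono phi_le) simp
		qed
		also have "... = ?c*(1/sc (int L)^DIM('a))" by simp
		also have "... <= ?c*(1/sc (int L)^1)"
			using one bz_pos[where 'a='a] by (intro mult_left_mono divide_left_mono power_increasing divide_nonneg_pos Bochner_Integration.integral_nonneg) auto
		also have "1/sc (int L)^1 = sc (- int L)" by (simp add: sc_def powr_minus_divide)
		finally show "norm (conv (phi (int L)) g x) <= ?c * sc (- int L)" by simp
	qed
	show "(%L. ?c * sc (- int L)) ----> 0" by (intro tendsto_mult_right_zero sc_neg_tendsto)
qed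

definition PL :: "nat => 'a::euclidean_space => real" where
	"PL L x = phi (- int L) x-phi (int L) x"

definition PR :: "nat => int set" where "PR L = {- int L + 1..int L}"

lemma PL_sum: "PL L x = (\<Sum>l\<in>PR L. dl l x)"
proof -
	have "(\<Sum>l\<in>PR L. dl l x) = phi (- int L) x-phi (int L) x"
	proof (induction L)
		case (Suc L)
		have "PR (Suc L) = insert (- int L) (insert (int L + 1) (PR L))" by (auto simp: PR_def)
		moreover have "- int L ~: PR L" "int L + 1 ~: PR L" "- int L ~= int L + 1" by (auto simp: PR_def)
		moreover have "finite (PR L)" by (simp add: PR_def)
		moreover have "dl (- int L) x = phi (- int (Suc L)) x-phi (- int L) x"
			unfolding dl_def by (intro arg_cong2[where f="(-)"] arg_cong2[where f=phi]) auto
		moreover have "dl (int L + 1) x = phi (int L) x-phi (int (Suc L)) x"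
			unfolding dl_def by (intro arg_cong2[where f="(-)"] arg_cong2[where f=phi]) auto
		ultimately show ?case using Suc by simp
	qed (simp add: PR_def)
	then show ?thesis by (simp add: PL_def)
qed

lemma nice_PL: "nice (PL L)"
	unfolding PL_def[abs_def] by (intro nice_diff nice_phi)

lemma PL_minus: "PL L (- x) = PL L x" by (simp add: PL_def phi_minus)

lemma conv_PL:
	fixes g :: "'a::euclidean_space => real"
	assumes "nice g"
	shows "continuous_on UNIV g ==> (%L. conv (PL L) g x) ----> g x"
		and "(!!x. |g x| <= B) ==> |conv (PL L) g x| <= 2*B"
proof -
	have e: "conv (PL L) g x = conv (phi (- int L)) g x-conv (phi (int L)) g x" for L
		unfolding PL_def[abs_def] by (simp add: conv_diff_left nice_phi assms)
	show "(%L. conv (PL L) g x) ----> g x" if "continuous_on UNIV g"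
		unfolding e using tendsto_diff[OF conv_phi_tendsto[OF assms that] conv_phi_large[OF assms]] by simp
	show "|conv (PL L) g x| <= 2*B" if "!!x. |g x| <= B"
		unfolding e using abs_conv_phi_le[OF assms that, of "- int L" x] abs_conv_phi_le[OF assms that, of "int L" x] by linarith
qed

text \<open>The even kernel \<open>PL L\<close> is moved to the continuous function
  \<open>G\<close>, where the convolutions converge pointwise and boundedly.\<close>

lemma conv1_PL_tendsto:
	fixes F G :: "'a::euclidean_space \<times> 'b::euclidean_space => real"
	assumes F: "nice F" and G: "nice G" "continuous_on UNIV G"
	shows "(%L. LBINT z. conv1 (PL L) F z*G z) ----> (LBINT z. F z*G z)"
proof -
	have adj: "(LBINT z. conv1 (PL L) F z*G z) = (LBINT z. F z*conv1 (PL L) G z)" for L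
	proof -
		have n1: "nice (%z. conv1 (PL L) F (fst z, snd z)*G (fst z, snd z))" 
			using nice_mult[OF nice_conv1[OF nice_PL F] G(1)] by simp
		have n2: "nice (%z. F (fst z, snd z)*conv1 (PL L) G (fst z, snd z))"
			using nice_mult[OF F nice_conv1[OF nice_PL G(1)]] by simp
		have "(LBINT x. conv1 (PL L) F (x, y)*G (x, y)) = (LBINT x. F (x, y)*conv1 (PL L) G (x, y))" for y
			using conv_adjoint[OF nice_PL nice_section1[OF F] nice_section1[OF G(1)], of L y y]
			by (simp add: conv1_def PL_minus)
		then show ?thesis using nice_Fubini[OF n1] nice_Fubini[OF n2] by simp
	qed
	obtain B where B: "!!z. |G z| <= B" using G(1) by (metis niceE)
	have [measurable]: "F \<in> BM" "G \<in> BM" "conv1 (PL L) G \<in> BM" for L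
		using F G nice_conv1[OF nice_PL G(1)] by (auto dest: nice_meas)
	have c: "continuous_on UNIV (%x. G (x, y))" for y
		by (rule continuous_on_compose2[OF G(2)]) (auto intro!: continuous_intros)
	show ?thesis unfolding adj
	proof (rule integral_dominated_convergence)
		show "integrable lborel (%z. 2*B*|F z| )" by (intro nice_int nice_cmult nice_abs F)
		show "AE z in lborel. (%L. F z*conv1 (PL L) G z) ----> F z*G z"
		proof (intro AE_I2 tendsto_mult tendsto_const)
			show "(%L. conv1 (PL L) G z) ----> G z" for z
				using conv_PL(1)[OF nice_section1[OF G(1)] c, of "snd z" "fst z"] by (simp add: conv1_def)
		qed
		show "AE z in lborel. norm (F z*conv1 (PL L) G z) <= 2*B*|F z|" for L
		proof (rule AE_I2)
			fix z
			have "|conv1 (PL L) G z| <= 2*B"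
				unfolding conv1_def by (rule conv_PL(2)[OF nice_section1[OF G(1)] B])
			then show "norm (F z*conv1 (PL L) G z) <= 2*B*|F z|"
				by (simp add: abs_mult mult.commute[of "|F z|"] mult_right_mono)
		qed
	qed measurable
qed

lemma nice_integral_swap:
	assumes "nice (f :: 'a::euclidean_space \<times> 'b::euclidean_space => real)"
	shows "(LBINT z. f (snd z, fst z)) = (LBINT z. f z)"
proof -
	have n: "nice (%z. f (fst z, snd z))" using assms by simp
	show ?thesis using nice_Fubini[OF n] nice_Fubini(2)[of "%y x. f (x, y)", OF nice_swap[OF assms]] by simp
qed

lemma conv2_PL_tendsto:
	fixes F G :: "'a::euclidean_space \<times> 'b::euclidean_space => real"
	assumes F: "nice F" and G: "nice G" "continuous_on UNIV G"
	shows "(%L. LBINT z. conv2 (PL L) F z*G z) ----> (LBINT z. F z*G z)"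
proof -
	have c: "continuous_on UNIV (%w. G (snd w, fst w))"
		by (rule continuous_on_compose2[OF G(2)]) (auto intro!: continuous_intros)
	have e: "(LBINT z. conv1 (PL L) (%w. F (snd w, fst w)) z*G (snd z, fst z)) = (LBINT z. conv2 (PL L) F z*G z)" for L
		using nice_integral_swap[OF nice_mult[OF nice_conv2[OF nice_PL F] G(1)], of L] by (simp add: conv2_swap)
	show ?thesis
		using conv1_PL_tendsto[OF nice_swap[OF F] nice_swap[OF G(1)] c] nice_integral_swap[OF nice_mult[OF F G(1)]]
		unfolding e by simp
qed

text \<open>Weak form of the expansion of the identity. The bound is uniform in both truncations, so
  the limit may be taken in one variable after the other.\<close>

lemma reproducing:
	fixes F G :: "'i => 'a::euclidean_space \<times> 'b::euclidean_space => real"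
	assumes F: "!!i. nice (F i)" and G: "!!i. nice (G i)" "!!i. continuous_on UNIV (G i)"
		and le: "!!L M. |\<Sum>i\<in>I. LBINT z. conv (ten (PL L) (PL M)) (F i) z*G i z| <= C"
	shows "|\<Sum>i\<in>I. LBINT z. F i z*G i z| <= C"
proof -
	have 1: "|\<Sum>i\<in>I. LBINT z. conv2 (PL M) (F i) z*G i z| <= C" for M
	proof (rule LIMSEQ_le_const2)
		show "(%L. |\<Sum>i\<in>I. LBINT z. conv1 (PL L) (conv2 (PL M) (F i)) z*G i z| ) ----> |\<Sum>i\<in>I. LBINT z. conv2 (PL M) (F i) z*G i z|"
			by (intro tendsto_rabs tendsto_sum conv1_PL_tendsto nice_conv2 nice_PL F G)
		show "EX N. ALL L>=N. |\<Sum>i\<in>I. LBINT z. conv1 (PL L) (conv2 (PL M) (F i)) z*G i z| <= C"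
			using le by (simp add: conv_ten(1) nice_PL F)
	qed
	show ?thesis
	proof (rule LIMSEQ_le_const2)
		show "(%M. |\<Sum>i\<in>I. LBINT z. conv2 (PL M) (F i) z*G i z| ) ----> |\<Sum>i\<in>I. LBINT z. F i z*G i z|"
			by (intro tendsto_rabs tendsto_sum conv2_PL_tendsto F G)
		show "EX N. ALL M>=N. |\<Sum>i\<in>I. LBINT z. conv2 (PL M) (F i) z*G i z| <= C" using 1 by blast
	qed
qed

section \<open>Bi-parameter operators on \<open>L\<^sup>p(\<ell>\<^sup>r)\<close>\<close>

definition W :: "int \<times> int \<times> int => 'a::euclidean_space => real" where
	"W l = conv (dl (fst l)) (conv (dl (fst (snd l))) (dl (snd (snd l))))"

text \<open>Scales of the three differences are coded by their offsets from the scale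
  \<open>j\<close> of the kernel piece. At fixed offsets the sum over kernel pieces becomes a
  pairing of two shifted square functions.\<close>

definition sh :: "int => int \<times> int \<times> int => int \<times> int \<times> int" where
	"sh j s = (j + fst s, j + fst (snd s), j + snd (snd s))"

definition size3 :: "int \<times> int \<times> int => nat" where
	"size3 s = nat |fst s| + nat |fst (snd s)| + nat |snd (snd s)|"

lemma nice_W: "nice (W l)" unfolding W_def by (intro nice_conv nice_dl)

text \<open>The factor farthest from the scale \<open>j\<close> is moved to the front: it will hit the kernel, and
	its distance dominates the average of the three distances.\<close>

lemma W_sort:
	"EX a b c. size3 s <= 3*nat |a| & (ALL j. (W (sh j s) :: 'a::euclidean_space => real) = conv (dl (j + a)) (conv (dl (j + b)) (dl (j + c))))"
proof -
	obtain s1 s2 s3 where s: "s = (s1, s2, s3)" by (metis prod.exhaust)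
	have w: "(W (sh j s) :: 'a => real) = conv (dl (j + s1)) (conv (dl (j + s2)) (dl (j + s3)))" for j
		by (simp add: W_def sh_def s)
	have w2: "(W (sh j s) :: 'a => real) = conv (dl (j + s2)) (conv (dl (j + s1)) (dl (j + s3)))" for j
		unfolding w by (rule conv_left_commute) (rule nice_dl)+
	have w3: "(W (sh j s) :: 'a => real) = conv (dl (j + s3)) (conv (dl (j + s1)) (dl (j + s2)))" for j
		unfolding w conv_commute[OF nice_dl nice_dl, of "j + s2" "j + s3"] by (rule conv_left_commute) (rule nice_dl)+
	have "size3 s = nat |s1| + nat |s2| + nat |s3|" by (simp add: size3_def s)
	then have "size3 s <= 3*nat |s1| \<or> size3 s <= 3*nat |s2| \<or> size3 s <= 3*nat |s3|" by linarith
	then show ?thesis using w w2 w3 by blast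
qed

lemma sum_shift_le:
	fixes F :: "int \<times> int \<times> int => real"
	assumes "finite A" "T \<subseteq> sh j ` A" "!!l. 0 <= F l"
	shows "(\<Sum>l\<in>T. F l) <= (\<Sum>s\<in>A. F (sh j s))"
proof -
	have "(\<Sum>l\<in>T. F l) <= (\<Sum>l\<in>sh j ` A. F l)" using assms by (intro sum_mono2) auto
	also have "... = (\<Sum>s\<in>A. F (sh j s))"
		by (subst sum.reindex) (auto simp: inj_on_def sh_def prod_eq_iff)
	finally show ?thesis .
qed

lemma geometric3_sum:
	fixes v :: real
	assumes "finite A" "0 <= v" "v < 1"
	shows "(\<Sum>s\<in>A \<times> A \<times> A. v^size3 s) <= (2/(1-v))^3"
proof -
	let ?S = "\<Sum>k\<in>A. v^nat |k|"
	have pt: "v^size3 s = v^nat |fst s|*(v^nat |fst (snd s)| * v^nat |snd (snd s)| )" for s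
		by (simp only: size3_def power_add mult.assoc)
	have "(\<Sum>s\<in>A \<times> A \<times> A. v^size3 s) = (\<Sum>a\<in>A. \<Sum>b\<in>A. \<Sum>c\<in>A. v^nat |a|*(v^nat |b| * v^nat |c| ))"
		unfolding pt by (simp only: sum.cartesian_product case_prod_beta')
	also have "... = ?S^3" by (simp add: sum_distrib_left[symmetric] sum_distrib_right[symmetric] power3_eq_cube mult.assoc)
	also have "... <= (2/(1-v))^3"
		using geometric_int_sum[OF assms, of 0] assms by (intro power_mono) (auto intro!: sum_nonneg)
	finally show ?thesis .
qed

lemma PL_product:
	"conv (PL a) (conv (PL b) (PL c)) = (%x. \<Sum>l\<in>PR a \<times> PR b \<times> PR c. W l (x::'a::euclidean_space))"
proof -
	have f: "finite (PR n)" for n by (simp add: PR_def)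
	have PLe: "PL n = (%x::'a. \<Sum>l\<in>PR n. dl l x)" for n by (rule ext) (rule PL_sum)
	have n: "nice (%x::'a. \<Sum>l\<in>PR n. conv g (dl l) x)" if "nice g" for g n
		by (intro nice_sum nice_conv nice_dl that)
	have bc: "conv (PL b) (PL c) = (%x::'a. \<Sum>l2\<in>PR b. \<Sum>l3\<in>PR c. conv (dl l2) (dl l3) x)"
		unfolding PLe[of b] conv_sum_left[OF nice_PL nice_dl]
		by (simp only: PLe[of c] conv_sum_right[OF nice_dl nice_dl])
	have "conv (PL a) (conv (PL b) (PL c)) = (%x::'a. \<Sum>l1\<in>PR a. conv (dl l1) (conv (PL b) (PL c)) x)"
		unfolding PLe[of a] by (rule conv_sum_left[OF nice_conv[OF nice_PL nice_PL] nice_dl])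
	also have "... = (%x. \<Sum>l1\<in>PR a. \<Sum>l2\<in>PR b. \<Sum>l3\<in>PR c. conv (dl l1) (conv (dl l2) (dl l3)) x)"
		unfolding bc by (simp only: conv_sum_right[OF nice_dl n[OF nice_dl]] conv_sum_right[OF nice_dl nice_conv[OF nice_dl nice_dl]])
	finally show ?thesis by (simp only: sum.cartesian_product case_prod_beta' W_def)
qed

lemma sum_scales: "(\<Sum>m\<in>scales Lx Ly. h (scale_x m) (scale_y m)) = (\<Sum>j\<in>Lx. \<Sum>k\<in>Ly. h j k)"
proof -
	have "(\<Sum>m\<in>scales Lx Ly. h (scale_x m) (scale_y m)) = (\<Sum>a\<in>{()} \<times> Ly. \<Sum>j\<in>Lx. h j (snd a))"
		unfolding scales_def by (simp add: sum.cartesian_product case_prod_beta')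
	also have "... = (\<Sum>u\<in>{()}. \<Sum>k\<in>Ly. \<Sum>j\<in>Lx. h j k)"
		by (subst sum.cartesian_product) (simp add: case_prod_beta')
	finally show ?thesis by (simp add: sum.swap[of _ Ly])
qed

lemma ten_minus: "(!!x. u (- x) = u x) ==> (!!y. v (- y) = v y) ==> ten u v (- z) = ten u v z"
	by (simp add: ten_def)

lemma Phi_abs: "Phi p r I J (%i k x. |f i k x| ) = Phi p r I J f"
	by (simp add: Phi_def nrm_def)

text \<open>Commutativity of convolution distributes the three differences: the first falls on
  \<open>K\<close> and yields decay together with an averaging kernel, the second on
  \<open>f\<close>, and the third, being even, on \<open>g\<close>.\<close>

lemma atom_term_bound:
	fixes K :: "'a::euclidean_space \<times> 'b::euclidean_space => real"
	assumes K: "atom2 j k et B K" and et: "0 < et" "et <= 1" "0 <= B" and f: "nice f" and g: "nice g"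
	defines "D == %l m. ten (dl l) (dl m) :: 'a \<times> 'b => real"
	shows "|LBINT z. conv K (conv (ten (conv (dl l1) (conv (dl l2) (dl l3))) (conv (dl m1) (conv (dl m2) (dl m3)))) f) z*g z|
		<= 4*4^DIM('a)*4^DIM('b)*bz TYPE('a)*bz TYPE('b)*cU TYPE('a)*cU TYPE('b)*B
			* (2 powr (-et))^(nat |l1-j| )*(2 powr (-et))^(nat |m1-k| )
			* (LBINT z. conv (ten (phi (max j l1 + 2)) (phi (max k m1 + 2))) (%z. |conv (D l2 m2) f z| ) z*|conv (D l3 m3) g z| )"
		(is "_ <= ?c*(LBINT z. ?X z*?Y z)")
proof -
	have nK: "nice K" using K by (simp add: atom2_def)
	have nD: "nice (D l m)" for l m unfolding D_def by (intro nice_ten nice_dl)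
	define H where "H = conv (D l1 m1) K"
	have nH: "nice H" unfolding H_def by (intro nice_conv nD nK)
	define V where "V = conv H (conv (D l2 m2) f)"
	have nV: "nice V" unfolding V_def by (intro nice_conv nH nD f)
	have c: "?c >= 0" using et bz_pos[where 'a='a] bz_pos[where 'a='b] cU_pos[where 'a='a] cU_pos[where 'a='b] by simp
	have "ten (conv (dl l1) (conv (dl l2) (dl l3))) (conv (dl m1) (conv (dl m2) (dl m3))) = conv (D l1 m1) (conv (D l2 m2) (D l3 m3))"
		by (simp add: D_def ten_conv nice_dl nice_conv)
	then have "conv K (conv (ten (conv (dl l1) (conv (dl l2) (dl l3))) (conv (dl m1) (conv (dl m2) (dl m3)))) f)
			= conv K (conv (D l1 m1) (conv (D l2 m2) (conv (D l3 m3) f)))"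
		using nD f by (simp add: conv_assoc nice_conv)
	also have "... = conv H (conv (D l2 m2) (conv (D l3 m3) f))"
		unfolding H_def conv_left_commute[OF nK nD nice_conv[OF nD nice_conv[OF nD f]]]
		using conv_assoc[OF nD nK nice_conv[OF nD nice_conv[OF nD f]]] by simp
	also have "conv (D l2 m2) (conv (D l3 m3) f) = conv (D l3 m3) (conv (D l2 m2) f)"
		by (rule conv_left_commute[OF nD nD f])
	also have "conv H (conv (D l3 m3) (conv (D l2 m2) f)) = conv (D l3 m3) V"
		unfolding V_def by (rule conv_left_commute[OF nH nD nice_conv[OF nD f]])
	finally have "(LBINT z. conv K (conv (ten (conv (dl l1) (conv (dl l2) (dl l3))) (conv (dl m1) (conv (dl m2) (dl m3)))) f) z*g z)
			= (LBINT z. conv (D l3 m3) V z*g z)" by simp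
	also have "... = (LBINT z. V z*conv (%z. D l3 m3 (- z)) g z)" by (rule conv_adjoint[OF nD nV g])
	also have "... = (LBINT z. V z*conv (D l3 m3) g z)" by (simp add: D_def ten_minus dl_minus)
	also have "|...| <= (LBINT z. |V z*conv (D l3 m3) g z| )" by (rule integral_abs_bound)
	also have "... <= (LBINT z. ?c*(?X z*?Y z))"
	proof (rule integral_mono)
		show "integrable lborel (%z. |V z*conv (D l3 m3) g z| )" by (intro nice_int nice_abs nice_mult nV nice_conv nD g)
		show "integrable lborel (%z. ?c*(?X z*?Y z))"
			by (intro nice_int nice_cmult nice_mult nice_conv nice_ten nice_phi nice_abs nD f g)
		fix z
		have "|V z| <= conv (%z. ?c*ten (phi (max j l1 + 2)) (phi (max k m1 + 2)) z) (%t. |conv (D l2 m2) f t| ) z"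
			unfolding V_def
		proof (rule abs_conv_le[OF nH nice_conv[OF nD f]])
			show "nice (%z. ?c*ten (phi (max j l1 + 2)) (phi (max k m1 + 2)) z)" by (intro nice_cmult nice_ten nice_phi)
			show "|H x| <= ?c*ten (phi (max j l1 + 2)) (phi (max k m1 + 2)) x" for x
				unfolding H_def D_def by (rule atom2_conv_dl[OF K et])
		qed
		also have "... = ?c*?X z" by (simp only: conv_cmult_left)
		finally show "|V z*conv (D l3 m3) g z| <= ?c*(?X z*?Y z)"
			unfolding abs_mult mult.assoc[of ?c, symmetric] by (rule mult_right_mono) simp
	qed
	finally show ?thesis by simp
qed

text \<open>After three reproducing formulas the form is a sum over scales of the differences. For
  fixed offsets \<open>s\<close> and \<open>t\<close> from the kernel scales, the sum over kernel
  pieces is bounded by square functions with the factor \<open>v^size3 s * v^size3 t\<close>, and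
  the offsets are then summed.\<close>

theorem product_operator_bilinear:
	fixes p p' r r' et :: real
	assumes p: "conj_exp p p'" and r: "conj_exp r r'" and et: "0 < et" "et <= 1"
	shows "EX C>0. ALL (I::'i set) Lx Ly (K :: int => int => 'a::euclidean_space \<times> 'b::euclidean_space => real) B f g.
		finite I --> finite Lx --> finite Ly --> 0 <= B --> (ALL j k. atom2 j k et B (K j k)) --> (ALL i. nice (f i)) --> (ALL i. nice (g i)) -->
		|\<Sum>i\<in>I. LBINT z. conv (%z. \<Sum>j\<in>Lx. \<Sum>k\<in>Ly. K j k z) (f i) z*g i z|
			<= C*B*(Phi p r I {()} (%i _. f i) + Phi p' r' I {()} (%i _. g i))"
proof -
	note pd = conj_expD[OF p] and rd = conj_expD[OF r]
	show ?thesis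
		using product_averages[OF pd(1) rd(1), where 'i='i and 'k="(unit \<times> int) \<times> int" and 'a='a and 'b='b] product_square_function[OF pd(1) rd(1), where 'i='i and 'a='a and 'b='b] product_square_function[OF pd(2) rd(2), where 'i='i and 'a='a and 'b='b]
	proof (elim exE conjE, goal_cases)
	case (1 Ca Cs Cs')
	note Ca = 1(1,2)[rule_format] and Cs = 1(3,4)[rule_format] and Cs' = 1(5,6)[rule_format]
	\<comment> \<open>Only the farthest of the three differences meets the kernel. Its distance is at
	  least a third of \<open>size3\<close>, whence the third part of the exponent.\<close>
	define v where "v = 2 powr (-et/3)"
	have v: "0 < v" "v < 1" using et by (auto simp: v_def powr_less_one)
	have v3: "(2 powr (-et))^nat |a| <= v^N" if "N <= 3*nat |a|" for a :: int and N
	proof -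
		have "2 powr (-et) = v^3" by (simp add: v_def powr_power)
		then have "(2 powr (-et))^nat |a| = v^(3*nat |a| )" by (simp add: power_mult)
		also have "... <= v^N" using v that by (intro power_decreasing) auto
		finally show ?thesis .
	qed
	define c0 where "c0 = 4*4^DIM('a)*4^DIM('b)*bz TYPE('a)*bz TYPE('b)*cU TYPE('a)*cU TYPE('b)"
	have c0: "c0 > 0" unfolding c0_def using bz_pos[where 'a='a] bz_pos[where 'a='b] cU_pos[where 'a='a] cU_pos[where 'a='b] by simp
	define G3 where "G3 = (2/(1-v))^3"
	have G3: "G3 > 0" using v by (simp add: G3_def)
	define C where "C = c0*G3*G3*(Ca*Cs + Cs')"
	have Cpos: "C > 0" using c0 G3 Ca(1) Cs(1) Cs'(1) by (simp add: C_def add_pos_pos)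
	show ?thesis
	proof (intro exI[of _ C] conjI allI impI, goal_cases)
		case (2 I Lx Ly K B f g)
		note fin = 2(1-3) and B = 2(4) and K = 2(5)[rule_format] and f = 2(6)[rule_format] and g = 2(7)[rule_format]
		have nK: "nice (K j k)" and cK: "continuous_on UNIV (K j k)" for j k using K[of j k] by (auto simp: atom2_def)
		let ?Kr = "%j k z. K j k (- z)"
		have nKr: "nice (?Kr j k)" for j k using nice_uminus[OF nK] .
		have cKr: "continuous_on UNIV (?Kr j k)" for j k
			by (rule continuous_on_compose2[OF cK]) (auto intro!: continuous_intros)
		\<comment> \<open>The transposed operator applied to \<open>g\<close>. It is continuous because
		  the kernel pieces are, which permits the use of \<open>reproducing\<close>.\<close>
		define G where "G i z = (\<Sum>j\<in>Lx. \<Sum>k\<in>Ly. conv (?Kr j k) (g i) z)" for i z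
		have nG: "nice (G i)" for i unfolding G_def[abs_def] by (intro nice_sum nice_conv nKr g)
		have cG: "continuous_on UNIV (G i)" for i
			unfolding G_def[abs_def] by (intro continuous_on_sum continuous_conv nKr cKr g)
		let ?\<Phi> = "Phi p r I {()} (%i _. f i)" and ?\<Psi> = "Phi p' r' I {()} (%i _. g i)"
		have adj: "(LBINT z. h z*G i z) = (\<Sum>j\<in>Lx. \<Sum>k\<in>Ly. LBINT z. conv (K j k) h z*g i z)" if h: "nice h" for h i
		proof -
			have "(LBINT z. h z*G i z) = (\<Sum>j\<in>Lx. \<Sum>k\<in>Ly. LBINT z. h z*conv (?Kr j k) (g i) z)"
				unfolding G_def by (simp add: sum_distrib_left nice_int nice_mult h nice_conv nKr g)
			then show ?thesis by (simp add: conv_adjoint[OF nK h g])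
		qed
		have tot: "(LBINT z. conv (%z. \<Sum>j\<in>Lx. \<Sum>k\<in>Ly. K j k z) (f i) z*g i z) = (LBINT z. f i z*G i z)" for i
			unfolding adj[OF f] by (simp add: conv_sum_left nice_sum nK f sum_distrib_right nice_int nice_mult nice_conv g)
		define tm where "tm i j k l m = (LBINT z. conv (K j k) (conv (ten (W l) (W m)) (f i)) z*g i z)" for i j k l m
		\<comment> \<open>The kernel pieces index an l^2 sum: averages of the square function of
		  \<open>f\<close> are paired with the square function of \<open>g\<close>, both at scales shifted
		  by the fixed offsets.\<close>
		have inner: "(\<Sum>j\<in>Lx. \<Sum>k\<in>Ly. \<Sum>i\<in>I. |tm i j k (sh j s) (sh k t)| ) <= c0*B * v^size3 s * v^size3 t*(Ca*Cs*?\<Phi> + Cs'*?\<Psi>)" for s t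
		proof -
			obtain a b c where abc: "size3 s <= 3*nat |a|" "!!j. (W (sh j s) :: 'a => real) = conv (dl (j + a)) (conv (dl (j + b)) (dl (j + c)))"
				using W_sort[of s] by blast
			obtain a' b' c' where abc': "size3 t <= 3*nat |a'|" "!!j. (W (sh j t) :: 'b => real) = conv (dl (j + a')) (conv (dl (j + b')) (dl (j + c')))"
				using W_sort[of t] by blast
			let ?J = "scales Lx Ly"
			let ?Xa = "%i q. conv (ten (dl (scale_x q + b)) (dl (scale_y q + b'))) (f i)"
			let ?X = "%i q. conv (ten (phi (scale_x q + (max 0 a + 2))) (phi (scale_y q + (max 0 a' + 2)))) (%z. |?Xa i q z| )"
			let ?Ya = "%i q. conv (ten (dl (scale_x q + c)) (dl (scale_y q + c'))) (g i)"
			let ?M = "c0*B * v^size3 s * v^size3 t"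
			have nX0: "nice (?Xa i q)" and nY0: "nice (?Ya i q)" for i q by (intro nice_conv nice_ten nice_dl f g)+
			have nX: "nice (?X i q)" for i q by (intro nice_conv nice_ten nice_phi nice_abs nX0)
			have M: "?M >= 0" using c0 B v by simp
			have tb: "|tm i (scale_x q) (scale_y q) (sh (scale_x q) s) (sh (scale_y q) t)| <= ?M*(LBINT z. ?X i q z*|?Ya i q z| )" for i q
			proof -
				define j k where "j = scale_x q" and "k = scale_y q"
				have mx: "max j (j + a) + 2 = j + (max 0 a + 2)" "max k (k + a') + 2 = k + (max 0 a' + 2)" by auto
				let ?Q = "LBINT z. ?X i q z*|?Ya i q z|"
				have X0: "0 <= ?X i q z" for z
					unfolding conv_def by (rule Bochner_Integration.integral_nonneg) (auto simp: ten_def phi_nonneg)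
				have Q: "?Q >= 0" by (rule Bochner_Integration.integral_nonneg) (simp add: X0)
				have "|tm i j k (sh j s) (sh k t)| <= c0*B*(2 powr (-et))^(nat |a| )*(2 powr (-et))^(nat |a'| )*?Q"
					using atom_term_bound[OF K[of j k] et B f[of i] g[of i], of "j + a" "j + b" "j + c" "k + a'" "k + b'" "k + c'"]
					unfolding tm_def abc(2) abc'(2) c0_def mx by (simp add: j_def k_def)
				also have "... <= ?M*?Q"
					using c0 B v Q by (intro mult_right_mono mult_mono v3 abc(1) abc'(1)) auto
				finally show ?thesis by (simp add: j_def k_def)
			qed
			have "(\<Sum>j\<in>Lx. \<Sum>k\<in>Ly. \<Sum>i\<in>I. |tm i j k (sh j s) (sh k t)| ) = (\<Sum>q\<in>?J. \<Sum>i\<in>I. |tm i (scale_x q) (scale_y q) (sh (scale_x q) s) (sh (scale_y q) t)| )"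
				by (rule sum_scales[symmetric])
			also have "... <= (\<Sum>q\<in>?J. \<Sum>i\<in>I. ?M*(LBINT z. ?X i q z*|?Ya i q z| ))" by (intro sum_mono tb)
			also have "... = ?M*(\<Sum>i\<in>I. \<Sum>q\<in>?J. LBINT z. ?X i q z*|?Ya i q z| )"
				by (simp only: sum_distrib_left sum.swap[of _ I])
			also have "... <= ?M*(Phi p r I ?J ?X + Phi p' r' I ?J (%i q z. |?Ya i q z| ))"
				using Phi_pairing[OF p r fin(1) finite_scales[OF fin(2,3)] nX nice_abs[OF nY0]] M
				by (intro mult_left_mono) (auto simp: abs_le_iff)
			also have "... <= ?M*(Ca*Cs*?\<Phi> + Cs'*?\<Psi>)"
			proof (intro mult_left_mono add_mono M)
				have "Phi p r I ?J ?X <= Ca*Phi p r I ?J (%i q z. |?Xa i q z| )"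
					by (rule Ca(2)) (intro fin finite_scales nice_abs nX0)+
				also have "... <= Ca*(Cs*?\<Phi>)"
					unfolding Phi_abs using Ca(1) by (intro mult_left_mono Cs(2) fin f) auto
				finally show "Phi p r I ?J ?X <= Ca*Cs*?\<Phi>" by simp
				show "Phi p' r' I ?J (%i q z. |?Ya i q z| ) <= Cs'*?\<Psi>"
					unfolding Phi_abs by (intro Cs'(2) fin g)
			qed
			finally show ?thesis .
		qed
		have key: "|\<Sum>i\<in>I. LBINT z. conv (ten (%x. \<Sum>l\<in>T. W l x) (%y. \<Sum>m\<in>T'. W m y)) (f i) z*G i z| <= C*B*(?\<Phi> + ?\<Psi>)"
			if T: "finite T" "finite T'" for T T'
		proof -
			have ts: "ten (%x. \<Sum>l\<in>T. W l x) (%y. \<Sum>m\<in>T'. W m y) = (%z. \<Sum>l\<in>T. \<Sum>m\<in>T'. ten (W l) (W m) z :: real)"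
				by (auto simp: ten_def fun_eq_iff sum_product)
			have nU: "nice (conv (ten (%x. \<Sum>l\<in>T. W l x) (%y. \<Sum>m\<in>T'. W m y)) (f i))" for i
				by (intro nice_conv nice_ten nice_sum nice_W f)
			have e: "(LBINT z. conv (ten (%x. \<Sum>l\<in>T. W l x) (%y. \<Sum>m\<in>T'. W m y)) (f i) z*G i z)
				= (\<Sum>j\<in>Lx. \<Sum>k\<in>Ly. \<Sum>l\<in>T. \<Sum>m\<in>T'. tm i j k l m)" for i
				unfolding adj[OF nU] unfolding ts tm_def
				by (simp add: conv_sum_left conv_sum_right nice_sum nice_conv nice_ten nice_W f nK sum_distrib_right nice_int nice_mult g)
			define comps where "comps = fst ` T \<union> (fst \<circ> snd) ` T \<union> (snd \<circ> snd) ` T \<union> fst ` T' \<union> (fst \<circ> snd) ` T' \<union> (snd \<circ> snd) ` T'"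
			\<comment> \<open>All differences between a scale occurring in \<open>T\<close> or
			  \<open>T'\<close> and a kernel scale, so that, whichever \<open>j\<close> is meant, every
			  element of these sets is \<open>sh j s\<close> with offsets in \<open>A\<close>.\<close>
			define A where "A = (%(c, j). c-j) ` (comps \<times> (Lx \<union> Ly))"
			let ?S = "A \<times> A \<times> A"
			have finA: "finite A" using T fin by (simp add: A_def comps_def)
			have sub: "U \<subseteq> sh j ` ?S" if U: "U = T \<or> U = T'" and j: "j \<in> Lx \<union> Ly" for U j
			proof
				fix l assume l: "l \<in> U"
				have "fst l \<in> comps" "fst (snd l) \<in> comps" "snd (snd l) \<in> comps" using l U by (auto simp: comps_def)
				then have "(fst l-j, fst (snd l)-j, snd (snd l)-j) \<in> ?S" using j by (auto simp: A_def)
				moreover have "l = sh j (fst l-j, fst (snd l)-j, snd (snd l)-j)" by (simp add: sh_def)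
				ultimately show "l \<in> sh j ` ?S" by blast
			qed
			have "|\<Sum>i\<in>I. \<Sum>j\<in>Lx. \<Sum>k\<in>Ly. \<Sum>l\<in>T. \<Sum>m\<in>T'. tm i j k l m| <= (\<Sum>i\<in>I. \<Sum>j\<in>Lx. \<Sum>k\<in>Ly. \<Sum>l\<in>T. \<Sum>m\<in>T'. |tm i j k l m| )"
				by (intro order_trans[OF sum_abs] sum_mono order_refl)
			also have "... = (\<Sum>j\<in>Lx. \<Sum>k\<in>Ly. \<Sum>l\<in>T. \<Sum>m\<in>T'. \<Sum>i\<in>I. |tm i j k l m| )"
				by (simp only: sum.swap[of _ _ I])
			also have "... <= (\<Sum>j\<in>Lx. \<Sum>k\<in>Ly. \<Sum>s\<in>?S. \<Sum>t\<in>?S. \<Sum>i\<in>I. |tm i j k (sh j s) (sh k t)| )"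
			proof (intro sum_mono)
				fix j k assume jk: "j \<in> Lx" "k \<in> Ly"
				have "(\<Sum>l\<in>T. \<Sum>m\<in>T'. \<Sum>i\<in>I. |tm i j k l m| ) <= (\<Sum>l\<in>T. \<Sum>t\<in>?S. \<Sum>i\<in>I. |tm i j k l (sh k t)| )"
					using finA jk by (intro sum_mono sum_shift_le sub sum_nonneg) auto
				also have "... <= (\<Sum>s\<in>?S. \<Sum>t\<in>?S. \<Sum>i\<in>I. |tm i j k (sh j s) (sh k t)| )"
					using finA jk by (intro sum_shift_le sub sum_nonneg) auto
				finally show "(\<Sum>l\<in>T. \<Sum>m\<in>T'. \<Sum>i\<in>I. |tm i j k l m| ) <= (\<Sum>s\<in>?S. \<Sum>t\<in>?S. \<Sum>i\<in>I. |tm i j k (sh j s) (sh k t)| )" .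
			qed
			also have "... = (\<Sum>s\<in>?S. \<Sum>t\<in>?S. \<Sum>j\<in>Lx. \<Sum>k\<in>Ly. \<Sum>i\<in>I. |tm i j k (sh j s) (sh k t)| )"
				by (simp only: sum.swap[of _ ?S Ly] sum.swap[of _ ?S Lx])
			also have "... <= (\<Sum>s\<in>?S. \<Sum>t\<in>?S. c0*B * v^size3 s * v^size3 t*(Ca*Cs*?\<Phi> + Cs'*?\<Psi>))"
				by (intro sum_mono inner)
			also have "... = c0*B*(\<Sum>s\<in>?S. v^size3 s)*(\<Sum>t\<in>?S. v^size3 t)*(Ca*Cs*?\<Phi> + Cs'*?\<Psi>)"
				by (simp add: sum_distrib_left sum_distrib_right mult_ac)
			also have "... <= c0*B*G3*G3*(Ca*Cs*?\<Phi> + Cs'*?\<Psi>)"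
				using geometric3_sum[OF finA, of v] v c0 B Ca(1) Cs(1) Cs'(1) G3 unfolding G3_def
				by (intro mult_right_mono mult_mono add_nonneg_nonneg) (auto intro!: sum_nonneg)
			also have "... <= c0*B*G3*G3*((Ca*Cs + Cs')*(?\<Phi> + ?\<Psi>))"
				using c0 B Ca(1) Cs(1) Cs'(1) G3 by (intro mult_left_mono) (auto simp: algebra_simps)
			also have "... = C*B*(?\<Phi> + ?\<Psi>)" by (simp add: C_def mult_ac)
			finally show ?thesis unfolding e .
		qed
		have "|\<Sum>i\<in>I. LBINT z. f i z*G i z| <= C*B*(?\<Phi> + ?\<Psi>)"
		\<comment> \<open>Three nested uses insert three product kernels \<open>PL\<close>; their
		  convolution expands by \<open>PL_product\<close> into the sums over \<open>W\<close> treated in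
		  \<open>key\<close>.\<close>
		proof (rule reproducing[OF f nG cG], rule reproducing[OF _ nG cG], goal_cases)
			case (2 L1 M1 L2 M2)
			show ?case
			proof (rule reproducing[OF _ nG cG], goal_cases)
				case (2 L3 M3)
				have "conv (ten (PL L3) (PL M3)) (conv (ten (PL L2) (PL M2)) (conv (ten (PL L1) (PL M1)) (f i)))
					= conv (ten (%x. \<Sum>l\<in>PR L3 \<times> PR L2 \<times> PR L1. W l x) (%y. \<Sum>m\<in>PR M3 \<times> PR M2 \<times> PR M1. W m y)) (f i)" for i
					unfolding PL_product[symmetric]
					by (simp add: conv_assoc ten_conv[symmetric] nice_ten nice_PL nice_conv f)
				then show ?case by (simp add: key PR_def)
			qed (intro nice_conv nice_ten nice_PL f)
		qed (intro nice_conv nice_ten nice_PL f)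
		then show ?case
			by (simp only: tot)
	qed (fact Cpos)
	qed
qed

theorem product_operator_bound:
	fixes p r et :: real
	assumes "1 < p" "1 < r" "0 < et" "et <= 1"
	shows "EX C>0. ALL (I::'i set) Lx Ly (K :: int => int => 'a::euclidean_space \<times> 'b::euclidean_space => real) B f.
		finite I --> finite Lx --> finite Ly --> 0 < B --> (ALL j k. atom2 j k et B (K j k)) --> (ALL i. nice (f i)) -->
		Phi p r I {()} (%i _. conv (%z. \<Sum>j\<in>Lx. \<Sum>k\<in>Ly. K j k z) (f i)) <= C*B powr p*Phi p r I {()} (%i _. f i)"
proof -
	let ?p = "p/(p-1)" and ?r = "r/(r-1)"
	have c: "conj_exp p ?p" "conj_exp r ?r" using assms by (auto intro: conj_exp_exists)
	show ?thesis
		using product_operator_bilinear[OF c assms(3,4), where 'i='i and 'a='a and 'b='b]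
	proof (elim exE conjE, goal_cases)
	case (1 C)
	note C = 1(1,2)[rule_format]
	show ?thesis
	proof (intro exI[of _ "(2*C) powr p"] conjI allI impI, goal_cases)
		case (2 I Lx Ly K B f)
		note fin = 2(1-3) and B = 2(4) and K = 2(5) and f = 2(6)
	let ?Q = "%z. \<Sum>j\<in>Lx. \<Sum>k\<in>Ly. K j k z"
		have nK: "nice ?Q" using K by (intro nice_sum) (auto simp: atom2_def)
		have "Phi p r I {()} (%i _. conv ?Q (f i)) <= (2*(C*B)) powr p*Phi p r I {()} (%i _. f i)"
		proof (rule Phi_duality[OF c])
			show "nice (conv ?Q (f i))" for i using nK f by (intro nice_conv) auto
			fix g :: "'i => unit => 'a \<times> 'b => real" assume g: "!!i m. nice (g i m)"
			have "g i = (%_. g i ())" for i by (auto simp: fun_eq_iff)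
			then have e: "(%i _. g i ()) = g" by auto
			have "(\<Sum>i\<in>I. LBINT z. conv ?Q (f i) z*g i () z) <= C*B*(Phi p r I {()} (%i _. f i) + Phi ?p ?r I {()} (%i _. g i ()))"
				using C(2)[of I Lx Ly B K f "%i. g i ()"] fin B K f g by (simp add: abs_le_iff)
			then show "(\<Sum>i\<in>I. \<Sum>m\<in>{()}. LBINT z. conv ?Q (f i) z*g i m z) <= C*B*(Phi p r I {()} (%i _. f i) + Phi ?p ?r I {()} g)"
				unfolding e by simp
		qed (use fin B C(1) in auto)
		also have "(2*(C*B)) powr p = (2*C) powr p*B powr p" using B C(1) by (simp add: powr_mult mult.assoc[symmetric])
		finally show ?case .
	qed (use C(1) in simp)
	qed
qed

section \<open>Decomposition of the kernel into atoms\<close>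

definition zet :: "real => real" where "zet s = max 0 (min 1 (2-s))"

text \<open>A telescoping partition of unity in the norm, made of tents. The two scales are chosen
  so that the piece lives where \<open>sc j/4 < s < sc j\<close>.\<close>

definition chi :: "int => real => real" where "chi j s = zet (s/sc (j-1))-zet (s/sc (j-2))"

lemma sc_1_2: "sc (j-1) = sc j/2" "sc (j-2) = sc j/4"
	by (simp_all add: sc_diff sc_def[of 1] sc_def[of 2])

lemma zet_bounds: "0 <= zet s" "zet s <= 1" by (auto simp: zet_def)

lemma zet_lip: "|zet a-zet b| <= |a-b|" by (auto simp: zet_def)

lemma zet_measurable[measurable]: "zet \<in> BM" unfolding zet_def[abs_def] by measurable

lemma chi_measurable[measurable]: "chi j \<in> BM" unfolding chi_def[abs_def] by measurable

lemma chi_bounds: "0 <= s ==> 0 <= chi j s" "chi j s <= 1"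
proof -
	show "chi j s <= 1" using zet_bounds[of "s/sc (j-1)"] zet_bounds[of "s/sc (j-2)"] by (simp add: chi_def)
	assume "0 <= s"
	then have "s/sc (j-1) <= s/sc (j-2)" by (intro divide_left_mono sc_mono) auto
	then show "0 <= chi j s" by (auto simp: chi_def zet_def)
qed

lemma chi_abs_le: "0 <= s ==> |chi j s| <= 1" using chi_bounds(1)[of s j] chi_bounds(2)[of j s] by simp

lemma chi_supp:
	assumes "chi j v ~= 0" shows "sc j/4 < v" "v < sc j"
proof -
	have s: "sc (j-1) = sc j/2" "sc (j-2) = sc j/4" by (rule sc_1_2)+
	show "sc j/4 < v"
	proof (rule ccontr)
		assume "\<not> sc j/4 < v"
		then have "v <= sc j/4" "v <= sc j/2" using sc_pos(1)[of j] by linarith+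
		then have "v/sc (j-1) <= 1" "v/sc (j-2) <= 1" by (simp_all add: s field_simps)
		then show False using assms by (simp add: chi_def zet_def)
	qed
	show "v < sc j"
	proof (rule ccontr)
		assume "\<not> v < sc j"
		then have "sc j <= v" "sc j <= 2 * v" using sc_pos(1)[of j] by linarith+
		then have "2 <= v/sc (j-1)" "2 <= v/sc (j-2)" by (simp_all add: s field_simps)
		then show False using assms by (simp add: chi_def zet_def)
	qed
qed

lemma chi_lip: "|chi j a-chi j b| <= 6*|a-b|/sc j"
proof -
	have m: "a/sc (j-1)-b/sc (j-1) = 2*(a-b)/sc j" "a/sc (j-2)-b/sc (j-2) = 4*(a-b)/sc j"
		by (simp_all add: sc_1_2 field_simps)
	have "|zet (a/sc (j-1))-zet (b/sc (j-1))| <= 2*|a-b|/sc j"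
		using zet_lip[of "a/sc (j-1)" "b/sc (j-1)"] unfolding m by (simp only: abs_divide abs_mult abs_numeral abs_of_pos[OF sc_pos(1)])
	moreover have "|zet (a/sc (j-2))-zet (b/sc (j-2))| <= 4*|a-b|/sc j"
		using zet_lip[of "a/sc (j-2)" "b/sc (j-2)"] unfolding m by (simp only: abs_divide abs_mult abs_numeral abs_of_pos[OF sc_pos(1)])
	ultimately have "|chi j a-chi j b| <= 2*|a-b|/sc j + 4*|a-b|/sc j" unfolding chi_def by linarith
	then show ?thesis by (simp add: add_divide_distrib[symmetric])
qed

lemma chi_sum: "(\<Sum>j\<in>{a..<a + int n}. chi j s) = zet (s/sc (a + int n-2))-zet (s/sc (a-2))"
proof (induction n)
	case (Suc n)
	have "{a..<a + int (Suc n)} = insert (a + int n) {a..<a + int n}" by auto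
	then show ?case using Suc by (simp add: chi_def algebra_simps)
qed simp

definition hk :: "real => real => ('a::euclidean_space => real) => bool" where
	"hk V et v \<longleftrightarrow> (ALL x. x ~= 0 --> |v x| <= V/norm x^DIM('a)) &
		(ALL x h. norm x > 2*norm h --> |v (x + h)-v x| <= V*(norm h/norm x) powr et/norm x^DIM('a))"

definition cn :: "('a::euclidean_space => real) => bool" where
	"cn v \<longleftrightarrow> (ALL a b. 0 < a --> a < b --> (LINT x:{x. a < norm x & norm x < b}|lborel. v x) = 0)"

lemma powr_eta: fixes t c et :: real assumes "0 <= t" "1 <= c" "et <= 1" "0 < et" shows "(c*t) powr et <= c*t powr et"
proof -
	have "(c*t) powr et = c powr et*t powr et" by (rule powr_mult)
	also have "... <= c*t powr et" using powr_mono[of et 1 c] assms by (intro mult_right_mono) auto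
	finally show ?thesis .
qed

lemma cut_size:
	fixes v :: "'a::euclidean_space => real"
	assumes "hk V et v" "0 <= V"
	shows "|chi j (norm x) * v x| <= 4^DIM('a)*V/sc j^DIM('a)"
proof (cases "chi j (norm x) = 0")
	case False
	have x: "sc j/4 < norm x" using chi_supp[OF False] by simp
	then have "norm x > 0" using sc_pos(1)[of j] by linarith
	then have x0: "x ~= 0" by simp
	have "|chi j (norm x) * v x| <= 1*|v x|" unfolding abs_mult by (intro mult_right_mono chi_abs_le) auto
	also have "... <= V/norm x^DIM('a)" using assms x0 by (simp add: hk_def)
	also have "... <= V/(sc j/4)^DIM('a)"
		using x assms by (intro divide_left_mono power_mono mult_pos_pos zero_less_power) (auto simp: x0)
	finally show ?thesis by (simp add: power_divide mult.commute)
qed (use assms in simp)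

text \<open>Increments above \<open>sc j/16\<close> are covered by the size bound. For smaller ones
  a nonzero difference forces \<open>norm x > sc j/8\<close>, so the regularity hypothesis applies,
  and the product rule separates the increments of the cutoff and of the kernel.\<close>

lemma cut_holder:
	fixes v :: "'a::euclidean_space => real"
	assumes v: "hk V et v" and et: "0 < et" "et <= 1" and V: "0 <= V"
	shows "|chi j (norm (x + h)) * v (x + h)-chi j (norm x) * v x| <= 32*8^DIM('a)*V*(norm h/sc j) powr et/sc j^DIM('a)"
proof -
	define s where "s = sc j"
	define n where "n = DIM('a)"
	define E where "E = V*(norm h/s) powr et/s^n"
	have s: "s > 0" by (simp add: s_def)
	have E: "E >= 0" using s V by (simp add: E_def)
	have "|chi j (norm (x + h)) * v (x + h)-chi j (norm x) * v x| <= 32*8^n*E"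
	proof (cases "norm h < s/16")
		case False
		have "1 <= (16*(norm h/s)) powr et" using False s et by (intro ge_one_powr_ge_zero) (auto simp: field_simps)
		also have "... <= 16*(norm h/s) powr et" using s et by (intro powr_eta) auto
		finally have "1*(V/s^n) <= 16*(norm h/s) powr et*(V/s^n)" using V s by (intro mult_right_mono) auto
		then have 1: "V/s^n <= 16*E" by (simp add: E_def mult_ac)
		have "|chi j (norm (x + h)) * v (x + h)-chi j (norm x) * v x| <= 2*(4^n*V/s^n)"
			using cut_size[OF v V, of j x] cut_size[OF v V, of j "x + h"] unfolding n_def s_def by linarith
		also have "... = 2*4^n*(V/s^n)" by simp
		also have "... <= 2*4^n*(16*E)" using 1 by (intro mult_left_mono) auto
		also have "... <= 32*8^n*E" using E by (simp add: mult_right_mono power_mono)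
		finally show ?thesis .
	next
		case h: True
		show ?thesis
		proof (cases "chi j (norm (x + h)) = 0 & chi j (norm x) = 0")
			case False
			have tri: "norm (x + h) <= norm x + norm h" by (rule norm_triangle_ineq)
			have "s/4 < norm x \<or> s/4 < norm (x + h)" using False chi_supp(1)[of j "norm x"] chi_supp(1)[of j "norm (x + h)"] by (auto simp: s_def)
			then have x: "s/8 < norm x" using tri h s by linarith
			then have x0: "x ~= 0" using s by auto
			have p: "1/norm x^n <= 8^n/s^n"
			proof -
				have "1/norm x^n <= 1/(s/8)^n" using x s x0 by (intro divide_left_mono power_mono) auto
				then show ?thesis by (simp add: power_divide)
			qed
			have q: "(norm h/norm x) powr et <= 8*(norm h/s) powr et"
			proof -
				have "norm h/norm x <= norm h/(s/8)" using x s x0 by (intro divide_left_mono) auto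
				then have "(norm h/norm x) powr et <= (8*(norm h/s)) powr et" using et by (intro powr_mono2) (auto simp: mult.commute)
				also have "... <= 8*(norm h/s) powr et" using s et by (intro powr_eta) auto
				finally show ?thesis .
			qed
			have a: "|chi j (norm (x + h))*(v (x + h)-v x)| <= 8*8^n*E"
			proof -
				have "|chi j (norm (x + h))*(v (x + h)-v x)| <= 1*|v (x + h)-v x|" unfolding abs_mult by (intro mult_right_mono chi_abs_le) auto
				also have "... <= V*(norm h/norm x) powr et*(1/norm x^n)" using v h x by (simp add: hk_def n_def)
				also have "... <= V*(8*(norm h/s) powr et)*(8^n/s^n)"
					using V by (intro mult_mono mult_left_mono p q) auto
				finally show ?thesis by (simp add: E_def mult_ac)
			qed
			have b: "|(chi j (norm (x + h))-chi j (norm x)) * v x| <= 6*8^n*E"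
			proof -
				have "|norm (x + h)-norm x| <= norm h" using norm_triangle_ineq3[of "x + h" x] by simp
				then have "6*|norm (x + h)-norm x|/s <= 6*(norm h/s)" using s by (simp add: divide_right_mono)
				moreover have "norm h/s <= (norm h/s) powr et"
					using powr_mono'[of et 1 "norm h/s"] h s et by simp
				ultimately have c: "|chi j (norm (x + h))-chi j (norm x)| <= 6*(norm h/s) powr et"
					using chi_lip[of j "norm (x + h)" "norm x"] unfolding s_def[symmetric] by linarith
				have "|v x| <= V*(1/norm x^n)" using v x0 by (simp add: hk_def n_def)
				also have "... <= V*(8^n/s^n)" using V by (intro mult_left_mono p)
				finally have "|(chi j (norm (x + h))-chi j (norm x)) * v x| <= 6*(norm h/s) powr et*(V*(8^n/s^n))"
					unfolding abs_mult using c by (intro mult_mono) auto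
				then show ?thesis by (simp add: E_def mult_ac)
			qed
			have "|chi j (norm (x + h)) * v (x + h)-chi j (norm x) * v x| <= 8*8^n*E + 6*8^n*E"
				using a b by (simp add: algebra_simps)
			also have "... = 14*(8^n*E)" by simp
			also have "... <= 32*(8^n*E)" using E by (intro mult_right_mono) auto
			finally show ?thesis by simp
		qed (use E in simp)
	qed
	then show ?thesis by (simp add: E_def n_def s_def mult.assoc)
qed

text \<open>The regularity bound gives continuity away from the origin, a single point.\<close>

lemma hk_measurable:
	fixes v :: "'a::euclidean_space => real"
	assumes v: "hk V et v" and et: "0 < et"
	shows "v \<in> BM"
proof -
	have c: "isCont v x" if x: "x ~= 0" for x
		unfolding isCont_def LIM_isCont_iff
	proof (rule LIM_zero_cancel)
		have "((%h. (norm h/norm x) powr et*(V/norm x^DIM('a))) \<longlongrightarrow> 0*(V/norm x^DIM('a))) (at 0)"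
			using et by (intro tendsto_mult tendsto_zero_powrI[where b=et] tendsto_const) (auto intro!: tendsto_eq_intros simp: x)
		then have "((%h. (norm h/norm x) powr et*(V/norm x^DIM('a))) \<longlongrightarrow> 0) (at 0)" by simp
		moreover have "eventually (%h. norm (v (x + h)-v x) <= (norm h/norm x) powr et*(V/norm x^DIM('a))) (at 0)"
			unfolding eventually_at
			using v x by (intro exI[of _ "norm x/2"]) (auto simp: hk_def mult.commute)
		ultimately show "((%h. v (x + h)-v x) \<longlongrightarrow> 0) (at 0)"
			by (rule Lim_null_comparison[rotated])
	qed
	have [measurable]: "(%x. indicator (-{0}) x *\<^sub>R v x) \<in> BM"
		by (rule borel_measurable_continuous_on_indicator) (auto intro!: continuous_at_imp_continuous_on c)
	have "v = (%x. indicator (-{0}) x *\<^sub>R v x + indicator {0} x *\<^sub>R v 0)" by (auto simp: indicator_def)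
	also have "... \<in> BM" by measurable
	finally show ?thesis .
qed

lemma nice_cut:
	fixes v :: "'a::euclidean_space => real"
	assumes v: "hk V et v" "0 < et" "0 <= V" and g: "g \<in> BM" "!!s. |g s| <= 1" "!!s. g s ~= 0 ==> e < s & s <= M" and e: "0 < e"
	shows "nice (%x. g (norm x) * v x)"
proof (rule niceI[of _ "V/e^DIM('a)" M])
	note hk_measurable[OF v(1,2), measurable] g(1)[measurable]
	show "(%x. g (norm x) * v x) \<in> BM" by measurable
	show "|g (norm x) * v x| <= V/e^DIM('a)" for x
	proof (cases "g (norm x) = 0")
		case False
		then have x: "e < norm x" "x ~= 0" using g(3) e by force+
		have "|g (norm x) * v x| <= 1*|v x|" unfolding abs_mult by (intro mult_right_mono g) auto
		also have "... <= V/norm x^DIM('a)" using v x by (simp add: hk_def)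
		also have "... <= V/e^DIM('a)" using x v e by (intro divide_left_mono power_mono) auto
		finally show ?thesis .
	qed (use v e in simp)
	show "norm x <= M" if "g (norm x) * v x ~= 0" for x using that g(3) by auto
qed

text \<open>The tent-shaped cutoff is an average of sharp cutoffs, for which the cancellation is assumed.\<close>

lemma radial_cancellation:
	fixes v :: "'a::euclidean_space => real"
	assumes v: "hk V et v" "0 < et" "0 <= V" and cn: "cn v" and e: "0 < e" "e <= R"
	shows "nice (%x. (of_bool (e < norm x)*zet (norm x/R)) * v x)"
		and "(LBINT x. (of_bool (e < norm x)*zet (norm x/R)) * v x) = 0"
proof -
	have R: "R > 0" using e by simp
	let ?w = "%x. of_bool (e < norm x)*zet (norm x/R)" and ?u = "%x. of_bool (e < norm x & norm x < 2*R) * v x"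
	show "nice (%x. ?w x * v x)"
	proof (rule nice_cut[OF v, of "%s. of_bool (e < s)*zet (s/R)" e "2*R"])
		show "e < s & s <= 2*R" if "of_bool (e < s)*zet (s/R) ~= 0" for s
			using that R by (auto simp: zet_def min_def max_def field_simps split: if_splits)
	qed (use zet_bounds e in \<open>auto simp: abs_mult\<close>)
	\<comment> \<open>\<open>zet (norm x/R)\<close> is the length of the set of \<open>t\<close> in
	  \<open>{1..2}\<close> with \<open>norm x < t*R\<close>. For fixed \<open>t\<close> the cutoff in
	  \<open>x\<close> is the sharp shell from \<open>e\<close> to \<open>t*R\<close>, where
	  cancellation is known; Fubini joins the two.\<close>
	define F where "F x t = indicator {1..2} t*(?u x * of_bool (norm x < t*R))" for x :: 'a and t :: real
	have n1: "nice (%x. ?u x)"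
		using e(1) by (intro nice_cut[OF v, of "%s. of_bool (e < s & s < 2*R)" e "2*R"]) auto
	have n2: "nice (indicator {1..2::real} :: real => real)" by (rule niceI[of _ 1 2]) (auto simp: indicator_def)
	have "nice (%z. of_bool (norm (fst z) < snd z*R)*((of_bool (e < norm (fst z) & norm (fst z) < 2*R) * v (fst z))*indicator {1..2} (snd z)))"
		by (rule nice_bmult[OF nice_tensor[OF n1 n2], where B=1]) auto
	then have nF: "nice (%z. F (fst z) (snd z))" by (simp add: F_def mult_ac)
	have 1: "(LBINT t. F x t) = ?w x * v x" for x
	proof -
		have "(LBINT t. indicator {1..2} t * of_bool (norm x < t*R)) = (LBINT t. (indicator ({1..2} \<inter> {norm x/R<..}) t :: real))"
			using R by (intro Bochner_Integration.integral_cong) (auto simp: indicator_def field_simps)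
		also have "... = measure lborel ({1..2} \<inter> {norm x/R<..})" by simp
		also have "... = zet (norm x/R)"
		proof (cases "norm x/R < 1")
			case True
			then have "{1..2} \<inter> {norm x/R<..} = {1..2}" by auto
			then show ?thesis using True by (simp add: zet_def)
		next
			case False
			then have "{1..2} \<inter> {norm x/R<..} = {norm x/R<..2}" by auto
			then show ?thesis using False by (cases "norm x/R <= 2") (auto simp: zet_def)
		qed
		finally have a: "(LBINT t. indicator {1..2} t * of_bool (norm x < t*R)) = zet (norm x/R)" .
		have "(LBINT t. F x t) = (LBINT t. ?u x*(indicator {1..2} t * of_bool (norm x < t*R)))"
			by (simp add: F_def mult_ac)
		also have "... = ?u x*zet (norm x/R)"
			by (simp only: integral_mult_right_zero a)
		also have "... = ?w x * v x"
			using R by (auto simp: zet_def field_simps)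
		finally show ?thesis .
	qed
	have 2: "(LBINT x. F x t) = 0" for t
	proof (cases "t \<in> {1..2} & t*R > e")
		case True
		have "(LBINT x. F x t) = (LINT x:{x. e < norm x & norm x < t*R}|lborel. v x)"
			unfolding set_lebesgue_integral_def
		proof (rule Bochner_Integration.integral_cong[OF refl])
			fix x
			have "t*R <= 2*R" using True R by (intro mult_right_mono) auto
			then show "F x t = indicator {x. e < norm x & norm x < t*R} x *\<^sub>R v x" using True by (auto simp: F_def indicator_def)
		qed
		then show ?thesis using cn True e by (simp add: cn_def)
	next
		case False
		then have "F x t = 0" for x by (auto simp: F_def indicator_def)
		then show ?thesis by simp
	qed
	have "(LBINT x. ?w x * v x) = (LBINT x. LBINT t. F x t)" by (simp only: 1)
	also have "... = (LBINT t. LBINT x. F x t)" by (rule nice_Fubini(1)[OF nF])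
	finally show "(LBINT x. ?w x * v x) = 0" by (simp only: 2 integral_zero)
qed

text \<open>Below \<open>sc (j-2)\<close> both tents equal 1 and cancel, so a sharp inner cutoff may
  be inserted there. It makes the two tents separately integrable against the kernel.\<close>

lemma chi_cancellation:
	fixes v :: "'a::euclidean_space => real"
	assumes v: "hk V et v" "0 < et" "0 <= V" and cn: "cn v"
	shows "(LBINT x. chi j (norm x) * v x) = 0"
proof -
	let ?e = "sc (j-2)"
	have le: "?e <= sc (j-1)" by (rule sc_mono) simp
	have "chi j (norm x) * v x = (of_bool (?e < norm x)*zet (norm x/sc (j-1))) * v x-(of_bool (?e < norm x)*zet (norm x/sc (j-2))) * v x" for x
		using chi_supp(1)[of j "norm x"] by (cases "?e < norm x") (auto simp: chi_def sc_1_2 left_diff_distrib)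
	then show ?thesis
		using radial_cancellation[OF v cn, of ?e "sc (j-1)"] radial_cancellation[OF v cn, of ?e "sc (j-2)"] le by (simp add: nice_int)
qed

lemma atom1_cut:
	fixes v :: "'a::euclidean_space => real"
	assumes v: "hk V et v" "0 < et" "et <= 1" "0 <= V" and cn: "cn v"
	shows "atom1 j et (32*8^DIM('a)*V) (%x. chi j (norm x) * v x)"
	unfolding atom1_def
proof (intro conjI allI impI)
	show "nice (%x. chi j (norm x) * v x)"
	proof (rule niceI)
		show "(%x. chi j (norm x) * v x) \<in> BM" using hk_measurable[OF v(1,2)] by measurable
		show "|chi j (norm x) * v x| <= 4^DIM('a)*V/sc j^DIM('a)" for x by (rule cut_size[OF v(1,4)])
		show "norm x <= sc j" if "chi j (norm x) * v x ~= 0" for x using that chi_supp(2)[of j "norm x"] by auto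
	qed
	show "norm x <= sc j" if "chi j (norm x) * v x ~= 0" for x using that chi_supp(2)[of j "norm x"] by auto
	show "(LBINT x. chi j (norm x) * v x) = 0" using v cn by (intro chi_cancellation)
	show "|chi j (norm (x + h)) * v (x + h)-chi j (norm x) * v x| <= 32*8^DIM('a)*V*(norm h/sc j) powr et/sc j^DIM('a)" for x h
		by (rule cut_holder[OF v])
qed

text \<open>The hypotheses for a real-valued kernel, with exponent at most 1. Quotients are nested
  so that freezing a variable yields \<open>hk\<close> literally.\<close>

definition rk :: "real => real => ('a::euclidean_space => 'b::euclidean_space => real) => bool" where
	"rk C et K \<longleftrightarrow> 0 < C & 0 < et & et <= 1 & (ALL y. y ~= 0 --> cn (%x. K x y)) & (ALL x. x ~= 0 --> cn (K x)) &
		(ALL x y. x ~= 0 --> y ~= 0 --> |K x y| <= C/norm y^DIM('b)/norm x^DIM('a)) &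
		(ALL x h y. norm x > 2*norm h --> y ~= 0 -->
			|K (x + h) y-K x y| <= C/norm y^DIM('b)*(norm h/norm x) powr et/norm x^DIM('a)) &
		(ALL x y k. norm y > 2*norm k --> x ~= 0 -->
			|K x (y + k)-K x y| <= C/norm x^DIM('a)*(norm k/norm y) powr et/norm y^DIM('b)) &
		(ALL x h y k. norm x > 2*norm h --> norm y > 2*norm k -->
			|(K (x + h) (y + k)-K x (y + k))-(K (x + h) y-K x y)|
				<= C*(norm h/norm x) powr et/norm x^DIM('a)*(norm k/norm y) powr et/norm y^DIM('b))"

lemma rk_swap: assumes "rk C et K" shows "rk C et (%y x. K x y)"
proof -
	note k = assms[unfolded rk_def]
	show ?thesis unfolding rk_def
	proof (intro conjI allI impI)
		fix x h :: 'b and y k :: 'a assume *: "norm x > 2*norm h" "norm y > 2*norm k"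
		have "|(K (y + k) (x + h)-K y (x + h))-(K (y + k) x-K y x)|
				<= C*(norm k/norm y) powr et/norm y^DIM('a)*(norm h/norm x) powr et/norm x^DIM('b)" using k * by blast
		then show "|K (y + k) (x + h)-K (y + k) x-(K y (x + h)-K y x)|
			<= C*(norm h/norm x) powr et/norm x^DIM('b)*(norm k/norm y) powr et/norm y^DIM('a)"
			by (simp add: mult_ac algebra_simps)
	qed (use k in \<open>auto simp: divide_divide_eq_left mult.commute\<close>)
qed

lemma rk_hk:
	fixes K :: "'a::euclidean_space => 'b::euclidean_space => real"
	assumes "rk C et K"
	shows "y ~= 0 ==> hk (C/norm y^DIM('b)) et (%x. K x y)"
		and "norm y > 2*norm k ==> hk (C*(norm k/norm y) powr et/norm y^DIM('b)) et (%x. K x (y + k)-K x y)"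
proof -
	note k = assms[unfolded rk_def]
	show "y ~= 0 ==> hk (C/norm y^DIM('b)) et (%x. K x y)" unfolding hk_def using k by blast
	assume y: "norm y > 2*norm k"
	show "hk (C*(norm k/norm y) powr et/norm y^DIM('b)) et (%x. K x (y + k)-K x y)"
		unfolding hk_def
	proof (intro conjI allI impI)
		fix x :: 'a assume "x ~= 0"
		then have "|K x (y + k)-K x y| <= C/norm x^DIM('a)*(norm k/norm y) powr et/norm y^DIM('b)" using k y by blast
		then show "|K x (y + k)-K x y| <= C*(norm k/norm y) powr et/norm y^DIM('b)/norm x^DIM('a)" by (simp add: mult_ac)
	next
		fix x h :: 'a assume "norm x > 2*norm h"
		then have "|(K (x + h) (y + k)-K x (y + k))-(K (x + h) y-K x y)|
				<= C*(norm h/norm x) powr et/norm x^DIM('a)*(norm k/norm y) powr et/norm y^DIM('b)" using k y by blast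
		then show "|K (x + h) (y + k)-K (x + h) y-(K x (y + k)-K x y)|
				<= C*(norm k/norm y) powr et/norm y^DIM('b)*(norm h/norm x) powr et/norm x^DIM('a)" by (simp add: mult_ac algebra_simps)
	qed
qed

definition KJ :: "('a::euclidean_space => 'b::euclidean_space => real) => int => int => 'a \<times> 'b => real" where
	"KJ K j k z = chi j (norm (fst z))*(chi k (norm (snd z))*K (fst z) (snd z))"

lemma KJ_swap: "KJ (%y x. K x y) k j (y, x) = KJ K j k (x, y)" by (simp add: KJ_def mult_ac)

lemma KJ_holder:
	fixes K :: "'a::euclidean_space => 'b::euclidean_space => real"
	assumes K: "rk C et K"
	shows "|KJ K j k (x + h, y)-KJ K j k (x, y)| <= 32*8^DIM('a)*(4^DIM('b)*C/sc k^DIM('b))*(norm h/sc j) powr et/sc j^DIM('a)"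
proof -
	have C: "0 < C" "0 < et" "et <= 1" using K by (auto simp: rk_def)
	show ?thesis
	proof (cases "chi k (norm y) = 0")
		case False
		have y: "y ~= 0" "sc k/4 < norm y" using chi_supp(1)[OF False] less_trans[OF _ chi_supp(1)[OF False], of 0] by auto
		have h: "hk (C/norm y^DIM('b)) et (%x. K x y)" by (rule rk_hk(1)[OF K y(1)])
		have "|KJ K j k (x + h, y)-KJ K j k (x, y)| = |chi k (norm y)|*|chi j (norm (x + h))*K (x + h) y-chi j (norm x)*K x y|"
			unfolding abs_mult[symmetric] by (simp add: KJ_def algebra_simps)
		also have "... <= 1*(32*8^DIM('a)*(C/norm y^DIM('b))*(norm h/sc j) powr et/sc j^DIM('a))"
			using C by (intro mult_mono cut_holder[OF h] chi_abs_le) auto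
		also have "... <= 32*8^DIM('a)*(C/(sc k/4)^DIM('b))*(norm h/sc j) powr et/sc j^DIM('a)"
			unfolding mult_1 using y C by (intro divide_right_mono mult_right_mono mult_left_mono divide_left_mono power_mono) auto
		finally show ?thesis by (simp add: power_divide mult_ac)
	qed (use C in \<open>simp add: KJ_def\<close>)
qed

lemma continuous_KJ:
	fixes K :: "'a::euclidean_space => 'b::euclidean_space => real"
	assumes K: "rk C et K"
	shows "continuous_on UNIV (KJ K j k)"
proof (rule continuous_at_imp_continuous_on, rule ballI)
	have et: "0 < et" using K by (simp add: rk_def)
	fix z
	obtain M1 M2 where M: "!!x y h. |KJ K j k (x + h, y)-KJ K j k (x, y)| <= M1*(norm h/sc j) powr et"
			"!!x y h. |KJ K j k (x, y + h)-KJ K j k (x, y)| <= M2*(norm h/sc k) powr et"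
	proof
		show "|KJ K j k (x + h, y)-KJ K j k (x, y)| <= (32*8^DIM('a)*(4^DIM('b)*C/sc k^DIM('b))/sc j^DIM('a))*(norm h/sc j) powr et" for x y h
			using KJ_holder[OF K, of j k x h y] by simp
		show "|KJ K j k (x, y + h)-KJ K j k (x, y)| <= (32*8^DIM('b)*(4^DIM('a)*C/sc j^DIM('a))/sc k^DIM('b))*(norm h/sc k) powr et" for x y h
			using KJ_holder[OF rk_swap[OF K], of k j y h x] unfolding KJ_swap[of K k j] by simp
	qed
	show "isCont (KJ K j k) z"
		unfolding isCont_def LIM_isCont_iff
	proof (rule LIM_zero_cancel, rule Lim_null_comparison[OF always_eventually], rule allI)
		fix h
		show "norm (KJ K j k (z + h)-KJ K j k z) <= M1*(norm (fst h)/sc j) powr et + M2*(norm (snd h)/sc k) powr et"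
			using M(1)[of "fst z" "fst h" "snd z + snd h"] M(2)[of "fst z" "snd z" "snd h"] by (cases z; cases h) simp
	next
		have "((%h. M1*(norm (fst h)/sc j) powr et + M2*(norm (snd h)/sc k) powr et) \<longlongrightarrow> M1*0 + M2*0) (at (0 :: 'a \<times> 'b))"
			using et by (intro tendsto_add tendsto_mult tendsto_const tendsto_zero_powrI[where b=et]) (auto intro!: tendsto_eq_intros)
		then show "((%h. M1*(norm (fst h)/sc j) powr et + M2*(norm (snd h)/sc k) powr et) \<longlongrightarrow> 0) (at (0 :: 'a \<times> 'b))" by simp
	qed
qed

definition cK :: "'a::euclidean_space itself => 'b::euclidean_space itself => real => real" where
	"cK _ _ C = 32*8^DIM('b)*(32*8^DIM('a)*C)"

text \<open>\<open>cut_holder\<close> is applied twice: the increment in \<open>x\<close> of the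
  kernel cut in \<open>x\<close>, as a function of \<open>y\<close>, is itself a one-parameter
  kernel whose constant contains the gain in \<open>x\<close>. The constant \<open>cK\<close> is the
  product of the two factors.\<close>

theorem atom2_KJ:
	fixes K :: "'a::euclidean_space => 'b::euclidean_space => real"
	assumes K: "rk C et K"
	shows "atom2 j k et (cK TYPE('a) TYPE('b) C) (KJ K j k)"
	unfolding atom2_def
proof (intro conjI allI impI)
	have C: "0 < C" "0 < et" "et <= 1" using K by (auto simp: rk_def)
	show supp: "norm x <= sc j" "norm y <= sc k" if "KJ K j k (x, y) ~= 0" for x y
		using that chi_supp(2)[of j "norm x"] chi_supp(2)[of k "norm y"] by (auto simp: KJ_def)
	show cont: "continuous_on UNIV (KJ K j k)" by (rule continuous_KJ[OF K])
	have size: "|KJ K j k z| <= 4^DIM('a)*(4^DIM('b)*C/sc k^DIM('b))/sc j^DIM('a)" for z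
	proof (cases "chi k (norm (snd z)) = 0")
		case False
		have y: "snd z ~= 0" "sc k/4 < norm (snd z)" using chi_supp(1)[OF False] less_trans[OF _ chi_supp(1)[OF False], of 0] by auto
		have h: "hk (C/norm (snd z)^DIM('b)) et (%x. K x (snd z))" by (rule rk_hk(1)[OF K y(1)])
		have "|KJ K j k z| = |chi k (norm (snd z))|*|chi j (norm (fst z))*K (fst z) (snd z)|"
			unfolding abs_mult[symmetric] by (simp add: KJ_def mult_ac)
		also have "... <= 1*(4^DIM('a)*(C/norm (snd z)^DIM('b))/sc j^DIM('a))"
			using C by (intro mult_mono cut_size[OF h] chi_abs_le) auto
		also have "... <= 4^DIM('a)*(C/(sc k/4)^DIM('b))/sc j^DIM('a)"
			unfolding mult_1 using y C by (intro divide_right_mono mult_left_mono divide_left_mono power_mono) auto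
		finally show ?thesis by (simp add: power_divide mult_ac)
	qed (use C in \<open>simp add: KJ_def\<close>)
	show "nice (KJ K j k)"
	proof (rule niceI[OF _ size])
		show "KJ K j k \<in> BM" using borel_measurable_continuous_onI[OF cont] .
		show "norm z <= sc j + sc k" if "KJ K j k z ~= 0" for z
			using that supp[of "fst z" "snd z"] norm_triangle_ineq[of "(fst z, 0)" "(0, snd z)"] by (cases z) (simp add: norm_Pair)
	qed
	show "(LBINT x. KJ K j k (x, y)) = 0" for y
	proof (cases "y = 0")
		case False
		have "(LBINT x. KJ K j k (x, y)) = (LBINT x. chi k (norm y)*(chi j (norm x)*K x y))" by (simp add: KJ_def mult_ac)
		then show ?thesis using chi_cancellation[OF rk_hk(1)[OF K False] C(2)] K C(1) False by (simp add: rk_def)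
	qed (simp add: KJ_def chi_def)
	show "(LBINT y. KJ K j k (x, y)) = 0" for x
	proof (cases "x = 0")
		case False
		have "(LBINT y. KJ K j k (x, y)) = (LBINT y. chi j (norm x)*(chi k (norm y)*K x y))" by (simp add: KJ_def mult_ac)
		then show ?thesis using chi_cancellation[OF rk_hk(1)[OF rk_swap[OF K] False] C(2)] K C(1) False by (simp add: rk_def)
	qed (simp add: KJ_def chi_def)
	fix x y and h :: 'a and h' :: 'b
	define V where "V = 32*8^DIM('a)*C*(norm h/sc j) powr et/sc j^DIM('a)"
	define u where "u y = chi j (norm (x + h))*K (x + h) y-chi j (norm x)*K x y" for y
	have V: "0 <= V" using C by (simp add: V_def)
	have "hk V et u" unfolding hk_def
	proof (intro conjI allI impI)
		fix y :: 'b assume y: "y ~= 0"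
		have "|u y| <= 32*8^DIM('a)*(C/norm y^DIM('b))*(norm h/sc j) powr et/sc j^DIM('a)"
			unfolding u_def using C by (intro cut_holder[OF rk_hk(1)[OF K y]]) auto
		then show "|u y| <= V/norm y^DIM('b)" by (simp add: V_def mult_ac)
	next
		fix y k :: 'b assume y: "norm y > 2*norm k"
		have "u (y + k)-u y = chi j (norm (x + h))*(K (x + h) (y + k)-K (x + h) y)-chi j (norm x)*(K x (y + k)-K x y)"
			by (simp add: u_def algebra_simps)
		also have "|...| <= 32*8^DIM('a)*(C*(norm k/norm y) powr et/norm y^DIM('b))*(norm h/sc j) powr et/sc j^DIM('a)"
			using C by (intro cut_holder[OF rk_hk(2)[OF K y]]) auto
		finally show "|u (y + k)-u y| <= V*(norm k/norm y) powr et/norm y^DIM('b)" by (simp add: V_def mult_ac)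
	qed
	from cut_holder[OF this C(2,3) V, of k y h']
	show "|(KJ K j k (x + h, y + h')-KJ K j k (x, y + h'))-(KJ K j k (x + h, y)-KJ K j k (x, y))|
		<= cK TYPE('a) TYPE('b) C*(norm h/sc j) powr et/sc j^DIM('a)*(norm h'/sc k) powr et/sc k^DIM('b)"
		by (simp add: u_def KJ_def V_def cK_def algebra_simps)
qed

section \<open>The one-parameter operators\<close>

abbreviation vn :: "real => 'i set => ('i => real) => real" where
	"vn r I v == nrm r I {()} (%i _. v i)"

lemma integral_pos_continuous:
	fixes g :: "'a::euclidean_space => real"
	assumes g: "nice g" "continuous_on UNIV g" "!!x. 0 <= g x" "0 < g x0"
	shows "0 < (LBINT x. g x)"
proof -
	have "(LBINT x. g x) ~= 0"
	proof
		assume "(LBINT x. g x) = 0"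
		then have ae: "AE x in lborel. g x = 0"
			using integral_nonneg_eq_0_iff_AE[OF nice_int[OF g(1)]] g(3) by simp
		have [measurable]: "g \<in> BM" using g(1) by (rule nice_meas)
		have "open {x. 0 < g x}" using g(2) by (intro open_Collect_less) auto
		moreover have "{x. 0 < g x} \<in> null_sets lborel"
		proof (rule AE_iff_null_sets[THEN iffD2])
			show "{x. 0 < g x} \<in> sets lborel" by measurable
			show "AE x in lborel. x ~: {x. 0 < g x}" using ae by eventually_elim simp
		qed
		then have "negligible {x. 0 < g x}" by (simp add: negligible_iff_null_sets null_sets_completionI)
		ultimately show False using g(4) open_not_negligible by blast
	qed
	moreover have "0 <= (LBINT x. g x)" using g(3) by simp
	ultimately show ?thesis by simp
qed

text \<open>For increments beyond the scale the size bound suffices; the constant 6 is twice the 3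
  of \<open>atom1_size\<close>.\<close>

lemma atom1_lower_exponent:
	fixes u :: "'a::euclidean_space => real"
	assumes u: "atom1 j 1 B u" and "0 < et" "et <= 1" "0 <= B"
	shows "atom1 j et (6*B) u"
	unfolding atom1_def
proof (intro conjI allI impI)
	fix x h :: 'a
	let ?t = "norm h/sc j"
	show "|u (x + h)-u x| <= 6*B*?t powr et/sc j^DIM('a)"
	proof (cases "?t <= 1")
		case True
		have "|u (x + h)-u x| <= B*?t powr 1/sc j^DIM('a)" using u unfolding atom1_def by blast
		also have "... <= 6*B*?t powr et/sc j^DIM('a)"
			using True assms by (intro divide_right_mono mult_mono powr_mono') auto
		finally show ?thesis .
	next
		case False
		have "|u (x + h)-u x| <= 2*(3*B/sc j^DIM('a))"
			using atom1_size[OF u, of x] atom1_size[OF u, of "x + h"] assms by simp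
		also have "... = 6*B*1/sc j^DIM('a)" by simp
		also have "... <= 6*B*?t powr et/sc j^DIM('a)"
			using False assms by (intro divide_right_mono mult_left_mono ge_one_powr_ge_zero) auto
		finally show ?thesis .
	qed
qed (use u in \<open>auto simp: atom1_def\<close>)

lemma atom1_continuous:
	fixes u :: "'a::euclidean_space => real"
	assumes u: "atom1 j et B u" and et: "0 < et"
	shows "continuous_on UNIV u"
proof (rule continuous_at_imp_continuous_on, rule ballI)
	fix x
	show "isCont u x"
		unfolding isCont_def LIM_isCont_iff
	proof (rule LIM_zero_cancel, rule Lim_null_comparison[OF always_eventually], rule allI)
		fix h
		show "norm (u (x + h)-u x) <= (B/sc j^DIM('a))*(norm h/sc j) powr et"
			using u by (simp add: atom1_def)
	next
		have "((%h::'a. (B/sc j^DIM('a))*(norm h/sc j) powr et) \<longlongrightarrow> (B/sc j^DIM('a))*0) (at 0)"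
			using et by (intro tendsto_mult tendsto_const tendsto_zero_powrI[where b=et]) (auto intro!: tendsto_eq_intros)
		then show "((%h::'a. (B/sc j^DIM('a))*(norm h/sc j) powr et) \<longlongrightarrow> 0) (at 0)" by simp
	qed
qed

lemma continuous_dl: "continuous_on UNIV (dl l)"
	unfolding dl_def[abs_def] by (intro continuous_on_diff continuous_phi)

lemma continuous_ten:
	assumes "continuous_on UNIV u" "continuous_on UNIV w" shows "continuous_on UNIV (ten u w)"
	unfolding ten_def[abs_def]
	by (intro continuous_on_mult continuous_on_compose2[OF assms(1)] continuous_on_compose2[OF assms(2)] continuous_intros) auto

lemma Phi_ten:
	fixes g :: "'i => 'a::euclidean_space => real" and w :: "'b::euclidean_space => real"
	assumes "0 < p" "1 < r" "finite I" "!!i. nice (g i)" "nice w"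
	shows "Phi p r I {()} (%i _. ten (g i) w) = Phi p r I {()} (%i _. g i)*(LBINT y. |w y| powr p)"
proof -
	have e: "nrm r I {()} (%i _. ten (g i) w (x, y)) powr p = |w y| powr p * vn r I (%i. g i x) powr p" for x y
		using assms(2) by (simp add: ten_def mult.commute[of _ "w y"] nrm_cmult powr_mult)
	have "Phi p r I {()} (%i _. ten (g i) w) = (LBINT y. Phi p r I {()} (%i _ x. ten (g i) w (x, y)))"
		using assms by (intro Phi_fibers(1)) (auto intro: nice_ten)
	then show ?thesis by (simp add: Phi_def e)
qed

text \<open>The tensor product of the kernel pieces with \<open>dl 0\<close> on the line consists of
  product atoms, and applied to \<open>f i\<close> tensor \<open>dl 0\<close> it yields the
  one-parameter operator tensor a fixed \<open>?w\<close>. The norm of \<open>?w\<close> is positive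
  because \<open>?w 0\<close> is the square integral of \<open>dl 0\<close>, so it can be divided
  out.\<close>

theorem one_parameter_bound:
	fixes p r et :: real
	assumes p: "1 < p" "1 < r" "0 < et" "et <= 1"
	shows "EX C>0. ALL (I::'i set) A (v :: 'a::euclidean_space => real) V f.
		finite I --> finite A --> 0 < V --> hk V et v --> cn v --> (ALL i. nice (f i)) -->
		Phi p r I {()} (%i _. conv (%x. \<Sum>j\<in>A. chi j (norm x) * v x) (f i)) <= C*V powr p*Phi p r I {()} (%i _. f i)"
proof -
	show ?thesis
		using product_operator_bound[OF p, where 'i='i and 'a='a and 'b=real]
	proof (elim exE conjE, goal_cases)
	case (1 C)
	note C = 1(1,2)[rule_format]
	let ?u = "dl 0 :: real => real"
	let ?w = "conv ?u ?u"
	define D where "D = dC TYPE(real)"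
	have D: "D > 0" by (simp add: D_def dC_pos)
	define c0 where "c0 = (LBINT y. |?w y| powr p)"
	define c1 where "c1 = (LBINT y. |?u y| powr p)"
	have nw: "nice ?w" by (intro nice_conv nice_dl)
	have "phi (-1) (0::real) = 2*phi 0 (0::real)" "phi 0 (0::real) > 0"
		using bz_pos[where 'a=real] by (simp_all add: phi_def sc_def powr_minus field_simps)
	then have "?u 0 ~= 0" by (simp add: dl_def)
	then have "0 < (LBINT t. ?u t*?u t)"
		by (intro integral_pos_continuous[where ?x0.0 = 0] nice_mult nice_dl continuous_on_mult continuous_dl) (auto simp: zero_less_mult_iff linorder_neq_iff)
	also have "... = ?w 0" by (simp add: conv_def dl_minus)
	finally have w0: "?w 0 > 0" .
	have c0: "c0 > 0" unfolding c0_def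
	proof (rule integral_pos_continuous[where ?x0.0 = 0])
		show "nice (%y. |?w y| powr p)" using p by (intro nice_powr nice_abs nw) auto
		show "continuous_on UNIV (%y. |?w y| powr p)"
			using p by (intro continuous_on_powr' continuous_on_rabs continuous_conv nice_dl continuous_dl continuous_on_const) auto
	qed (use w0 in auto)
	have c1: "c1 >= 0" by (simp add: c1_def)
	define B where "B V = 32*8^DIM('a)*V*(6*D)" for V
	show ?thesis
	proof (intro exI[of _ "(C*(32*8^DIM('a)*(6*D)) powr p*(c1 + 1))/c0"] conjI allI impI, goal_cases)
		case (2 I A v V f)
		note I = 2(1,2) and V = 2(3) and v = 2(4,5) and f = 2(6)[rule_format]
		let ?a = "%j x. chi j (norm x) * v x"
		have a: "atom1 j et (32*8^DIM('a)*V) (?a j)" for j using V v p by (intro atom1_cut) auto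
		have d: "atom1 k et (6*D) (dl k :: real => real)" for k
			unfolding D_def using p dC_pos[where 'a=real] by (intro atom1_lower_exponent atom1_dl) auto
		have na: "nice (?a j)" for j using a by (simp add: atom1_def)
		have nv: "nice (%x. \<Sum>j\<in>A. ?a j x)" by (intro nice_sum na)
		have at: "atom2 j k et (B V) (ten (?a j) (dl k :: real => real))" for j k
			unfolding atom2_def
		proof (intro conjI allI impI)
			show "nice (ten (?a j) (dl k :: real => real))" by (intro nice_ten na nice_dl)
			show "norm x <= sc j" "norm y <= sc k" if "ten (?a j) (dl k) (x, y) ~= 0" for x and y :: real
				using that a[of j] d[of k] unfolding atom1_def ten_def by auto
			show "(LBINT x. ten (?a j) (dl k) (x, y)) = 0" for y :: real using a[of j] by (simp add: atom1_def ten_def)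
			show "(LBINT y. ten (?a j) (dl k :: real => real) (x, y)) = 0" for x by (simp add: ten_def integral_dl)
			show "|(ten (?a j) (dl k) (x + h, y + h')-ten (?a j) (dl k) (x, y + h'))-(ten (?a j) (dl k) (x + h, y)-ten (?a j) (dl k) (x, y))|
					<= B V*(norm h/sc j) powr et/sc j^DIM('a)*(norm h'/sc k) powr et/sc k^DIM(real)" for x y h and h' :: real
			proof -
				have "(ten (?a j) (dl k) (x + h, y + h')-ten (?a j) (dl k) (x, y + h'))-(ten (?a j) (dl k) (x + h, y)-ten (?a j) (dl k) (x, y))
					= (?a j (x + h)-?a j x)*(dl k (y + h')-dl k y)" by (simp add: ten_def algebra_simps)
				also have "|...| <= (32*8^DIM('a)*V*(norm h/sc j) powr et/sc j^DIM('a))*(6*D*(norm h'/sc k) powr et/sc k^DIM(real))"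
					unfolding abs_mult using a[of j] d[of k] V unfolding atom1_def by (intro mult_mono) auto
				finally show ?thesis by (simp add: B_def mult_ac)
			qed
			have "continuous_on UNIV (?a j)" by (rule atom1_continuous[OF a p(3)])
			then show "continuous_on UNIV (ten (?a j) (dl k :: real => real))" by (rule continuous_ten[OF _ continuous_dl])
		qed
		have B: "B V > 0" using V D by (simp add: B_def)
		have e: "conv (%z. \<Sum>j\<in>A. \<Sum>k\<in>{0}. ten (?a j) (dl k) z) (ten (f i) ?u) = ten (conv (%x. \<Sum>j\<in>A. ?a j x) (f i)) ?w" for i
		proof -
			have "(%z. \<Sum>j\<in>A. \<Sum>k\<in>{0}. ten (?a j) (dl k) z) = ten (%x. \<Sum>j\<in>A. ?a j x) ?u"
				by (auto simp: ten_def fun_eq_iff sum_distrib_right)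
			then show ?thesis using ten_conv[OF nv nice_dl f nice_dl] by simp
		qed
		let ?P = "Phi p r I {()} (%i _. conv (%x. \<Sum>j\<in>A. ?a j x) (f i))" and ?Q = "Phi p r I {()} (%i _. f i)"
		have "?P*c0 = Phi p r I {()} (%i _. ten (conv (%x. \<Sum>j\<in>A. ?a j x) (f i)) ?w)"
			unfolding c0_def using p I by (intro Phi_ten[symmetric] nw nice_conv[OF nv f]) auto
		also have "... <= C*B V powr p*Phi p r I {()} (%i _. ten (f i) ?u)"
			unfolding e[symmetric] by (intro C(2) I B at nice_ten f nice_dl) simp
		also have "Phi p r I {()} (%i _. ten (f i) ?u) = ?Q*c1"
			unfolding c1_def using p I f by (intro Phi_ten nice_dl) auto
		also have "C*B V powr p*(?Q*c1) <= C*B V powr p*(?Q*(c1 + 1))"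
			using C(1) by (intro mult_left_mono) auto
		also have "B V powr p = (32*8^DIM('a)*(6*D)) powr p*V powr p" by (simp add: B_def powr_mult[symmetric] mult_ac)
		finally have "?P <= C*((32*8^DIM('a)*(6*D)) powr p*V powr p)*(?Q*(c1 + 1))/c0"
			using c0 by (simp add: pos_le_divide_eq)
		then show "?P <= (C*(32*8^DIM('a)*(6*D)) powr p*(c1 + 1))/c0*V powr p*?Q" by (simp add: mult_ac)
	qed (use C(1) c0 c1 D in \<open>auto intro!: divide_pos_pos mult_pos_pos\<close>)
	qed
qed

section \<open>Local estimates\<close>

text \<open>What is used of the cubic shells, stated for Euclidean norms; \<open>c\<close> absorbs
  the distortion between the two norms.\<close>

definition ann :: "int => (int => 'a::euclidean_space set) => bool" where
	"ann c S \<longleftrightarrow> 0 <= c & (ALL k. S k \<in> sets borel & (\<forall>x\<in>S k. sc (k-c) <= norm x & norm x <= sc (k + c)))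
		& disjoint_family S & (\<Union>k. S k) = - {0}"

text \<open>The gain in p-th powers from source block \<open>i\<close> to target block
  \<open>k\<close>, \<open>u = i-k\<close>: \<open>2 powr (- n*u)\<close> for \<open>u >= 0\<close>
  and \<open>2 powr (- n*(p-1)*|u|)\<close> for \<open>u < 0\<close>.\<close>

definition dec :: "nat => real => int => real" where
	"dec n p u = 2 powr (real n*((p-1)*real_of_int u-p*max (real_of_int u) 0))"

definition E0 :: "nat => real => int => real" where "E0 n p c = 2 powr (2*p*real n*(1 + real_of_int c))"

lemma dec_pos[simp]: "0 < dec n p u" "0 <= dec n p u" by (simp_all add: dec_def)

lemma E0_pos[simp]: "0 < E0 n p c" "0 <= E0 n p c" by (simp_all add: E0_def)

lemma sc_pow: "sc k^n = 2 powr (real n*real_of_int k)"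
	by (simp add: sc_def powr_realpow[symmetric] powr_powr mult.commute)

text \<open>For neighbouring blocks \<open>dec\<close> is at least a constant, so the global bound
  can be written with the same factor.\<close>

lemma dec_near:
	assumes "|u| <= 2*c + 2" "0 <= c" "1 < p" shows "1 <= E0 n p c*dec n p u"
proof -
	have u: "|real_of_int u| <= 2*real_of_int c + 2" using assms(1) by linarith
	have "- (p*|real_of_int u| ) <= (p-1)*real_of_int u-p*max (real_of_int u) 0"
		using assms(3) mult_right_mono[of 1 p "real_of_int u"] by (cases "0 <= u") (auto simp: algebra_simps)
	moreover have "p*|real_of_int u| <= p*(2*real_of_int c + 2)" using u assms by (intro mult_left_mono) auto
	ultimately have "0 <= 2*p*(1 + real_of_int c) + ((p-1)*real_of_int u-p*max (real_of_int u) 0)" by (simp add: algebra_simps)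
	then have "0 <= real n*(2*p*(1 + real_of_int c) + ((p-1)*real_of_int u-p*max (real_of_int u) 0))" by simp
	also have "... = 2*p*real n*(1 + real_of_int c) + real n*((p-1)*real_of_int u-p*max (real_of_int u) 0)" by (simp add: algebra_simps)
	finally show ?thesis unfolding E0_def dec_def powr_add[symmetric] by (intro ge_one_powr_ge_zero) auto
qed

text \<open>The origin of \<open>dec\<close>: measure of the target block, p-th power of the largest
  value of the kernel between the blocks, and measure of the source block to the power
  \<open>p-1\<close> from Jensen's inequality.\<close>

lemma dec_far:
	"(2 * sc (k + c))^n*((1/sc (max i k-c-1)^n) powr p*((2 * sc (i + c))^n) powr (p-1)) = E0 n p c*dec n p (i-k)"
proof -
	have m: "max (real_of_int i) (real_of_int k) = real_of_int k + max (real_of_int i-real_of_int k) 0" by simp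
	have 2: "2 * sc a = sc (a + 1)" for a by (simp add: sc_Suc)
	have "(2 * sc (k + c))^n*((1/sc (max i k-c-1)^n) powr p*((2 * sc (i + c))^n) powr (p-1))
		= 2 powr (real n*(k + c + 1) + (- (real n*(max i k-c-1))*p + real n*(i + c + 1)*(p-1)))"
		unfolding 2 sc_pow powr_minus_divide[symmetric] powr_powr powr_add[symmetric] by simp
	also have "real n*(k + c + 1) + (- (real n*(max i k-c-1))*p + real n*(i + c + 1)*(p-1))
		= 2*p*real n*(1 + real_of_int c) + real n*((p-1)*real_of_int (i-k)-p*max (real_of_int (i-k)) 0)"
		unfolding of_int_max of_int_diff m by (simp add: algebra_simps)
	finally show ?thesis by (simp add: E0_def dec_def powr_add)
qed

lemma ann_far:
	assumes "ann c S" "x \<in> S k" "x' \<in> S i" "2*c + 2 < |i-k|"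
	shows "sc (max i k-c-1) <= norm (x-x')"
proof -
	have *: "sc (b-c-1) <= norm (y-y')" if "y \<in> S b" "y' \<in> S a" "2*c + 2 < b-a" for y y' a b
	proof -
		have "norm y' <= sc (a + c)" "sc (b-c) <= norm y" using assms(1) that by (auto simp: ann_def)
		moreover have "sc (a + c) <= sc (b-c-1)" using that by (intro sc_mono) auto
		moreover have "sc (b-c) = 2 * sc (b-c-1)" using sc_Suc[of "b-c-1"] by simp
		ultimately show ?thesis using norm_triangle_ineq2[of y y'] by linarith
	qed
	show ?thesis
	proof (cases "i < k")
		case True then show ?thesis using *[of x k x' i] assms by (simp add: max_def)
	next
		case False then show ?thesis using *[of x' i x k] assms by (simp add: max_def norm_minus_commute)
	qed
qed

lemma jensen_ball:
	fixes g :: "'a::euclidean_space => real"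
	assumes g: "nice g" "!!x. 0 <= g x" "!!x. g x ~= 0 ==> norm x <= R" and R: "0 < R" and p: "1 < p"
	shows "(LBINT x. g x) powr p <= ((2*R)^DIM('a)) powr (p-1)*(LBINT x. g x powr p)"
proof -
	define m where "m = (2*R)^DIM('a)"
	define t where "t = (LBINT x. g x)/m"
	have m: "m > 0" using R by (simp add: m_def)
	have t: "t >= 0" using m g by (simp add: t_def)
	have gt: "(LBINT x. g x) = t*m" using m by (simp add: t_def)
	have ngp: "nice (%x. g x powr p)" using g p by (intro nice_powr) auto
	have nA: "nice (indicator (cball 0 R) :: 'a => real)" using nice_indicator[OF bounded_cball, of 0 R] by simp
	\<comment> \<open>The tangent to the convex function of exponent \<open>p\<close> at the average
	  \<open>t\<close>, written as an instance of Young's inequality; its integral is Jensen's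
	  inequality.\<close>
	have pt: "p*t powr (p-1)*g x-(p-1)*t powr p*indicator (cball 0 R) x <= g x powr p" for x
	proof (cases "g x = 0")
		case False
		then have x: "x \<in> cball 0 R" using g(3) by simp
		have "1/p + 1/(p/(p-1)) = 1" "1 < p/(p-1)" using p by (auto simp: field_simps)
		then have "g x*t powr (p-1) <= g x powr p/p + (t powr (p-1)) powr (p/(p-1))/(p/(p-1))"
			using g p t by (intro Youngs_inequality) auto
		also have "(t powr (p-1)) powr (p/(p-1)) = t powr p" using p by (simp add: powr_powr)
		finally have "p*(g x*t powr (p-1)) <= p*(g x powr p/p + t powr p/(p/(p-1)))" using p by (intro mult_left_mono) auto
		also have "... = g x powr p + (p-1)*t powr p" using p by (simp add: field_simps)
		finally show ?thesis using x by (simp add: mult_ac)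
	qed (use p in \<open>auto simp: indicator_def\<close>)
	have i: "integrable lborel g" "integrable lborel (indicator (cball 0 R) :: 'a => real)" "integrable lborel (%x. g x powr p)"
		by (rule nice_int[OF g(1)] nice_int[OF nA] nice_int[OF ngp])+
	have "p*t powr (p-1)*(LBINT x. g x)-(p-1)*t powr p*(LBINT x. indicator (cball (0::'a) R) x)
		= (LBINT x. p*t powr (p-1)*g x-(p-1)*t powr p*indicator (cball 0 R) x)"
		using i by simp
	also have "... <= (LBINT x. g x powr p)"
		using i by (intro integral_mono pt Bochner_Integration.integrable_diff integrable_mult_right)
	finally have 1: "p*t powr (p-1)*(LBINT x. g x)-(p-1)*t powr p*measure lborel (cball (0::'a) R) <= (LBINT x. g x powr p)" by simp
	have "(p-1)*t powr p*measure lborel (cball (0::'a) R) <= (p-1)*t powr p*m"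
		using p measure_cball_le[of R "0::'a"] R by (intro mult_left_mono) (auto simp: m_def)
	moreover have "p*t powr (p-1)*(LBINT x. g x) = p*t powr p*m"
		unfolding gt using t p by (cases "t = 0") (auto simp: powr_diff)
	moreover have "p*t powr p*m-(p-1)*t powr p*m = t powr p*m" by (simp add: algebra_simps)
	ultimately have 2: "t powr p*m <= (LBINT x. g x powr p)" using 1 by linarith
	have "(LBINT x. g x) powr p = t powr p*m powr p" unfolding gt by (rule powr_mult)
	also have "m powr p = m powr (p-1)*m" using m by (simp add: powr_diff)
	also have "t powr p*(m powr (p-1)*m) = m powr (p-1)*(t powr p*m)" by simp
	also have "... <= m powr (p-1)*(LBINT x. g x powr p)" using 2 by (intro mult_left_mono) auto
	finally show ?thesis by (simp add: m_def)
qed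

definition ker :: "int => int => ('a::euclidean_space => real) => 'a => real" where
	"ker a b v x = (\<Sum>j\<in>{a..<b}. chi j (norm x) * v x)"

lemma chi_sum_bounds:
	assumes "0 <= s" shows "0 <= (\<Sum>j\<in>{a..<b}. chi j s)" "(\<Sum>j\<in>{a..<b}. chi j s) <= 1"
proof -
	show "0 <= (\<Sum>j\<in>{a..<b}. chi j s)" using assms by (intro sum_nonneg chi_bounds)
	show "(\<Sum>j\<in>{a..<b}. chi j s) <= 1"
	proof (cases "a <= b")
		case True
		then have "b = a + int (nat (b-a))" by simp
		then show ?thesis using chi_sum[where a = a and n = "nat (b-a)" and s = s] zet_bounds[of "s/sc (b-2)"] zet_bounds[of "s/sc (a-2)"] by simp
	qed simp
qed

lemma nice_ker:
	assumes "hk V et v" "0 < et" "0 < V" shows "nice (ker a b v)"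
	unfolding ker_def[abs_def]
proof (intro nice_sum niceI)
	fix j
	show "(%x. chi j (norm x) * v x) \<in> BM" using hk_measurable[OF assms(1,2)] by measurable
	show "|chi j (norm x) * v x| <= 4^DIM('a)*V/sc j^DIM('a)" for x using assms by (intro cut_size) auto
	show "norm x <= sc j" if "chi j (norm x) * v x ~= 0" for x using that chi_supp(2)[of j "norm x"] by auto
qed

lemma ker_le:
	fixes v :: "'a::euclidean_space => real"
	assumes "hk V et v" "0 < V" "sc M <= norm x" shows "|ker a b v x| <= V*(1/sc M^DIM('a))"
proof -
	have x: "0 < norm x" using assms(3) sc_pos(1)[of M] by linarith
	have "|ker a b v x| = |\<Sum>j\<in>{a..<b}. chi j (norm x)|*|v x|" by (simp add: ker_def sum_distrib_right[symmetric] abs_mult)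
	also have "... <= 1*|v x|" using chi_sum_bounds[of "norm x" a b] by (intro mult_right_mono) auto
	also have "... <= V/norm x^DIM('a)" using assms x by (simp add: hk_def)
	also have "... <= V/sc M^DIM('a)" using assms x by (intro divide_left_mono power_mono mult_pos_pos) auto
	finally show ?thesis by simp
qed

lemma ann_integral_le:
	fixes S :: "int => 'a::euclidean_space set"
	assumes "ann c S" "!!x. x \<in> S k ==> g x <= B" "0 <= B" "integrable lborel (%x. indicator (S k) x*g x)"
	shows "(LBINT x. indicator (S k) x*g x) <= (2 * sc (k + c))^DIM('a)*B"
proof -
	have i: "integrable lborel (%x::'a. B*indicator (cball 0 (sc (k + c))) x :: real)"
		using emeasure_lborel_cball_finite[of "0::'a" "sc (k + c)"] by (intro integrable_mult_right integrable_real_indicator) auto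
	have "(LBINT x. indicator (S k) x*g x) <= (LBINT x. B*indicator (cball (0::'a) (sc (k + c))) x)"
		using assms(1-3) by (intro integral_mono assms(4) i) (auto simp: indicator_def ann_def)
	also have "... = B*measure lborel (cball (0::'a) (sc (k + c)))" by simp
	also have "... <= B*(2 * sc (k + c))^DIM('a)" using assms(3) by (intro mult_left_mono measure_cball_le) auto
	finally show ?thesis by (simp add: mult.commute)
qed

lemma nice_ind_ann: "ann c S ==> nice f ==> nice (%x. indicator (S k) x*f x)"
	by (rule nice_ind_mult) (auto simp: ann_def)

text \<open>Near the diagonal the global bound is used, far from it only the size of the kernel. The
  kernel and its constant are quantified after \<open>C\<close>, since slices of a two-parameter
  kernel will be inserted.\<close>

theorem local_one:
	fixes S :: "int => 'a::euclidean_space set"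
	assumes p: "1 < p" "1 < r" "0 < et" "et <= 1" and S: "ann c S"
	shows "EX C>0. ALL (I::'i set) a b v V f i k. finite I --> 0 < V --> hk V et v --> cn v --> (ALL j. nice (f j)) --> (ALL j x. f j x ~= 0 --> x \<in> S i) -->
		(LBINT x. indicator (S k) x * vn r I (%j. conv (ker a b v) (f j) x) powr p)
			<= C*V powr p*dec DIM('a) p (i-k)*Phi p r I {()} (%j _. f j)"
proof -
	show ?thesis
		using one_parameter_bound[OF p, where 'i='i and 'a='a]
	proof (elim exE conjE, goal_cases)
	case (1 C)
	note C = 1(1,2)[rule_format]
	have c: "0 <= c" using S by (simp add: ann_def)
	let ?n = "DIM('a)"
	show ?thesis
	proof (intro exI[of _ "(C + 1)*E0 ?n p c"] conjI allI impI, goal_cases)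
		case (2 I a b v V f i k)
		note I = 2(1) and V = 2(2) and v = 2(3,4) and f = 2(5)[rule_format] and fs = 2(6)
		let ?P = "Phi p r I {()} (%j _. f j)"
		let ?G = "%x. vn r I (%j. conv (ker a b v) (f j) x)"
		have nk: "nice (ker a b v)" using v V p by (intro nice_ker)
		have nG: "nice (%x. ?G x powr p)" using p I by (intro nice_Phi_integrand nice_conv nk f) auto
		have CV: "0 <= V powr p*?P" by simp
		have "(LBINT x. indicator (S k) x*?G x powr p) <= (C + 1)*(E0 ?n p c*dec ?n p (i-k))*(V powr p*?P)"
		proof (cases "|i-k| <= 2*c + 2")
			case True
			have "(LBINT x. indicator (S k) x*?G x powr p) <= (LBINT x. ?G x powr p)"
				by (intro integral_mono nice_int nice_ind_ann[OF S] nG) (auto simp: indicator_def)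
			also have "... <= C*V powr p*?P"
				using C(2)[of I "{a..<b}" V v f] I V v f by (simp add: Phi_def ker_def[abs_def])
			also have "... = C*1*(V powr p*?P)" by simp
			also have "... <= (C + 1)*(E0 ?n p c*dec ?n p (i-k))*(V powr p*?P)"
				using C(1) c p True by (intro mult_right_mono mult_mono dec_near CV) auto
			finally show ?thesis .
		next
			case False
			let ?N = "%t. vn r I (%j. f j t)"
			have nN: "nice ?N" using p I by (intro nice_nrm f) auto
			\<comment> \<open>The largest value of the truncated kernel between two distant blocks.\<close>
			define q where "q = V*(1/sc (max i k-c-1)^?n)"
			have q: "q >= 0" using V by (simp add: q_def)
			have le: "?G x powr p <= q powr p*(((2 * sc (i + c))^?n) powr (p-1)*?P)" if x: "x \<in> S k" for x
			proof -
				have "?G x <= (LBINT t. vn r I (%j. ker a b v (x-t)*f j t))"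
					unfolding conv_def
					by (intro nrm_integral_le I nice_int nice_nrm nice_conv_integrand nk f p) auto
				also have "... = (LBINT t. |ker a b v (x-t)|*?N t)" using p by (simp add: nrm_cmult)
				also have "... <= (LBINT t. q*?N t)"
				proof (rule integral_mono)
					show "integrable lborel (%t. |ker a b v (x-t)|*?N t)" using nice_conv_integrable[OF nice_abs[OF nk] nN] .
					show "integrable lborel (%t. q*?N t)" by (intro nice_int nice_cmult nN)
					fix t
					show "|ker a b v (x-t)|*?N t <= q*?N t"
					proof (cases "t \<in> S i")
						case True
						then have "sc (max i k-c-1) <= norm (x-t)" using ann_far[OF S x True] False by simp
						then show ?thesis unfolding q_def by (intro mult_right_mono ker_le[OF v(1) V]) auto
					next
						case False
						then have "f j t = 0" for j using fs by blast
						then show ?thesis using p by simp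
					qed
				qed
				also have "... = q*(LBINT t. ?N t)" by simp
				finally have "?G x powr p <= (q*(LBINT t. ?N t)) powr p" using p by (intro powr_mono2) auto
				also have "... = q powr p*(LBINT t. ?N t) powr p" by (rule powr_mult)
				also have "... <= q powr p*(((2 * sc (i + c))^?n) powr (p-1)*?P)"
					unfolding Phi_def
				proof (intro mult_left_mono jensen_ball nN p)
					show "norm t <= sc (i + c)" if "?N t ~= 0" for t
					proof -
						have "EX j. f j t ~= 0"
						proof (rule ccontr)
							assume "\<nexists>j. f j t ~= 0" then show False using that p by simp
						qed
						then show ?thesis using fs S by (auto simp: ann_def)
					qed
				qed auto
				finally show ?thesis .
			qed
			have "(LBINT x. indicator (S k) x*?G x powr p) <= (2 * sc (k + c))^?n*(q powr p*(((2 * sc (i + c))^?n) powr (p-1)*?P))"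
				by (intro ann_integral_le[OF S] le nice_int nice_ind_ann[OF S] nG) auto
			also have "... = ((2 * sc (k + c))^?n*((1/sc (max i k-c-1)^?n) powr p*((2 * sc (i + c))^?n) powr (p-1)))*(V powr p*?P)"
				unfolding q_def powr_mult by (simp add: mult_ac)
			also have "... = 1*(E0 ?n p c*dec ?n p (i-k))*(V powr p*?P)" unfolding dec_far by simp
			also have "... <= (C + 1)*(E0 ?n p c*dec ?n p (i-k))*(V powr p*?P)"
				using C(1) by (intro mult_right_mono CV) auto
			finally show ?thesis .
		qed
		then show ?case by (simp add: mult_ac)
	qed (use C(1) in simp)
	qed
qed

section \<open>Block estimates in two variables\<close>

definition KN :: "('a::euclidean_space => 'b::euclidean_space => real) => int => int => 'a \<times> 'b => real" where
	"KN K a b z = (\<Sum>j\<in>{a..<b}. \<Sum>k\<in>{a..<b}. KJ K j k z)"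

lemma KN_ker: "KN K a b (x, w) = ker a b (%x. (\<Sum>k\<in>{a..<b}. chi k (norm w))*K x w) x"
	by (simp add: KN_def ker_def KJ_def sum_distrib_left sum_distrib_right mult_ac)

lemma KN_swap: "KN (%y x. K x y) a b (y, x) = KN K a b (x, y)"
	unfolding KN_def by (subst sum.swap) (simp only: KJ_swap[of K])

lemma nice_KN: "rk C et K ==> nice (KN K a b)"
	unfolding KN_def[abs_def] using atom2_KJ[of C et K] by (intro nice_sum) (auto simp: atom2_def)

lemma conv_swap:
	assumes "nice u" "nice f"
	shows "conv (%z. u (snd z, fst z)) (%z. f (snd z, fst z)) (y, x) = conv u f (x, y)"
proof -
	have "nice (%w. u ((x, y)-w)*f w)" by (intro nice_conv_integrand assms)
	then have n: "nice (%w. u (x-fst w, y-snd w)*f (fst w, snd w))" by (simp add: minus_prod_def)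
	have n': "nice (%w. u (x-snd w, y-fst w)*f (snd w, fst w))" using nice_swap[OF n] by simp
	show ?thesis
		using nice_Fubini[of "%s t. u (x-s, y-t)*f (s, t)", OF n] nice_Fubini(2)[of "%t s. u (x-s, y-t)*f (s, t)", OF n']
		by (simp add: conv_def minus_prod_def)
qed

text \<open>When the blocks are far apart in \<open>y\<close>, only the size of the kernel is used
  in that variable: for fixed \<open>y\<close> and \<open>y'\<close> the slice is a one-parameter
  kernel of constant at most \<open>q\<close>, Minkowski and Jensen treat the integral over
  \<open>y'\<close>, and \<open>local_one\<close> acts in \<open>x\<close>.\<close>

lemma local_two_far:
	fixes S :: "int => 'a::euclidean_space set" and S' :: "int => 'b::euclidean_space set" and K :: "'a => 'b => real"
	assumes p: "1 < p" "1 < r" and K: "rk C0 et K" and S: "ann c S" and S': "ann c S'"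
	shows "EX C>0. ALL (I::'i set) a b f i j k l. finite I --> (ALL v. nice (f v)) --> (ALL v z. f v z ~= 0 --> z \<in> S i \<times> S' j) --> 2*c + 2 < |j-l| -->
		(LBINT z. indicator (S k \<times> S' l) z * vn r I (%v. conv (KN K a b) (f v) z) powr p)
			<= C*(dec DIM('a) p (i-k)*dec DIM('b) p (j-l))*Phi p r I {()} (%v _. f v)"
proof -
	have C0: "0 < C0" and et: "0 < et" "et <= 1" using K by (auto simp: rk_def)
	let ?m = "DIM('b)"
	show ?thesis
		using local_one[OF p et S, where 'i='i]
	proof (elim exE conjE, goal_cases)
	case (1 C)
	note C = 1(1,2)[rule_format]
	show ?thesis
	proof (intro exI[of _ "C*C0 powr p*E0 ?m p c"] conjI allI impI, goal_cases)
		case (2 I a b f i j k l)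
		note I = 2(1) and f = 2(2)[rule_format] and fs0 = 2(3) and far = 2(4)
		from fs0 have fs: "x \<in> S i" "y \<in> S' j" if "f v (x, y) ~= 0" for v x y using that by blast+
		have nK: "nice (KN K a b)" by (rule nice_KN[OF K])
		let ?P = "Phi p r I {()} (%v _. f v)"
		let ?G = "%z. vn r I (%v. conv (KN K a b) (f v) z) powr p"
		have nG: "nice ?G" using p I by (intro nice_Phi_integrand nice_conv nK f) auto
		have nGy: "nice (%x. ?G (x, y))" for y by (rule nice_section1[OF nG])
		define M where "M = max j l-c-1"
		define q where "q = C0*(1/sc M^?m)"
		have q: "q > 0" using C0 by (simp add: q_def)
		define J where "J = ((2 * sc (j + c))^?m) powr (p-1)"
		have J: "J >= 0" by (simp add: J_def)
		define B where "B = J*(C*q powr p*dec DIM('a) p (i-k)*?P)"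
		have B: "B >= 0" using J C(1) by (simp add: B_def)
		have inner: "(LBINT x. indicator (S k) x*?G (x, y)) <= B" if y: "y \<in> S' l" for y
		proof -
			\<comment> \<open>The contribution of one fibre \<open>y'\<close>: a convolution in
			  \<open>x\<close> alone, with the slice of the kernel at \<open>y-y'\<close>.\<close>
			define H where "H v x y' = conv (%x. KN K a b (x, y-y')) (%x. f v (x, y')) x" for v x y'
			have H0: "H v x y' = 0" if "y' ~: S' j" for v x y' using fs(2) that by (simp add: H_def conv_def) (metis (mono_tags, lifting) integral_zero mult_zero_right Bochner_Integration.integral_cong)
			have GH: "conv (KN K a b) (f v) (x, y) = (LBINT y'. H v x y')" for v x
			proof -
				have "nice (%w. KN K a b ((x, y)-w)*f v w)" by (intro nice_conv_integrand nK f)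
				then have "nice (%w. KN K a b (x-fst w, y-snd w)*f v (fst w, snd w))" by (simp add: minus_prod_def)
				from nice_Fubini[of "%s t. KN K a b (x-s, y-t)*f v (s, t)", OF this]
				show ?thesis by (simp add: H_def conv_def minus_prod_def)
			qed
			have nH: "nice (%z. H v (fst z) (snd z))" for v
			proof -
				obtain B1 R1 where 1: "!!z. |KN K a b z| <= B1" "!!z. KN K a b z ~= 0 ==> norm z <= R1" "B1 > 0" using nK by (metis niceE)
				obtain B2 R2 where 2: "!!z. |f v z| <= B2" "!!z. f v z ~= 0 ==> norm z <= R2" using f[of v] by (metis niceE)
				note nice_meas[OF nK, measurable] nice_meas[OF f, measurable]
				have "nice (%w. KN K a b (fst (fst w)-snd w, y-snd (fst w))*f v (snd w, snd (fst w)))"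
				proof (rule niceI[of _ "B1*B2" "R1 + 3*R2"])
					show "|KN K a b (fst (fst w)-snd w, y-snd (fst w))*f v (snd w, snd (fst w))| <= B1*B2" for w
						unfolding abs_mult using 1(3) by (intro mult_mono 1 2) auto
					show "norm w <= R1 + 3*R2" if "KN K a b (fst (fst w)-snd w, y-snd (fst w))*f v (snd w, snd (fst w)) ~= 0" for w
					proof -
						obtain x y' x' where w: "w = ((x, y'), x')" by (metis prod.exhaust)
						have "norm (x-x', y-y') <= R1" "norm (x', y') <= R2" using that by (auto simp: w intro: 1 2)
						then have "norm (x-x') <= R1" "norm x' <= R2" "norm y' <= R2"
							using norm_fst_le[of "x-x'" "y-y'"] norm_fst_le[of x' y'] norm_snd_le[of y' x'] by linarith+
						moreover have "norm x <= norm (x-x') + norm x'" using norm_triangle_ineq[of "x-x'" x'] by simp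
						moreover have "norm w <= norm (x, y') + norm x'" "norm (x, y') <= norm x + norm y'"
							using norm_triangle_ineq[of "((x, y'), 0)" "(0, x')"] norm_triangle_ineq[of "(x, 0)" "(0, y')"] by (simp_all add: w norm_Pair)
						ultimately show ?thesis by linarith
					qed
				qed measurable
				from nice_partial_integral[OF this] show ?thesis by (simp add: H_def conv_def)
			qed
			let ?h = "%x y'. vn r I (%v. H v x y')"
			have nh: "nice (%z. ?h (fst z) (snd z))" using p I nH by (intro nice_nrm) auto
			have nhp: "nice (%z. ?h (fst z) (snd z) powr p)" using p nh by (intro nice_powr) auto
			have nHx: "nice (%y'. H v x y')" for v x using nice_section2[OF nH[of v], of x] by simp
			have nk: "nice (%z. indicator (S k) (fst z)*?h (fst z) (snd z) powr p)"
				by (rule nice_bmult[OF nhp, where B=1]) (use S in \<open>auto simp: ann_def indicator_def intro!: measurable_compose[OF borel_measurable_fst borel_measurable_indicator, unfolded indicator_def comp_def]\<close>)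
			have "(LBINT x. indicator (S k) x*?G (x, y)) <= (LBINT x. J*(LBINT y'. indicator (S k) x*?h x y' powr p))"
			proof (rule integral_mono)
				show "integrable lborel (%x. indicator (S k) x*?G (x, y))" by (intro nice_int nice_ind_ann[OF S] nGy)
				have "nice (%x. LBINT y'. indicator (S k) x*?h x y' powr p)" using nice_partial_integral[OF nk] by simp
				then show "integrable lborel (%x. J*(LBINT y'. indicator (S k) x*?h x y' powr p))" by (intro nice_int nice_cmult)
				fix x
				have "vn r I (%v. conv (KN K a b) (f v) (x, y)) <= (LBINT y'. ?h x y')"
					unfolding GH using p I by (intro nrm_integral_le nice_int nice_nrm nHx) auto
				then have "?G (x, y) <= (LBINT y'. ?h x y') powr p" using p by (intro powr_mono2) auto
				also have "... <= J*(LBINT y'. ?h x y' powr p)"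
					unfolding J_def
				proof (intro jensen_ball p)
					show "nice (?h x)" using p I by (intro nice_nrm nHx) auto
					show "norm y' <= sc (j + c)" if "?h x y' ~= 0" for y'
					proof -
						have "y' \<in> S' j" using that H0[of y' _ x] p by (cases "y' \<in> S' j") auto
						then show ?thesis using S' by (auto simp: ann_def)
					qed
				qed auto
				finally have "indicator (S k) x*?G (x, y) <= indicator (S k) x*(J*(LBINT y'. ?h x y' powr p))" by (intro mult_left_mono) auto
				then show "indicator (S k) x*?G (x, y) <= J*(LBINT y'. indicator (S k) x*?h x y' powr p)" by (simp add: mult.left_commute)
			qed
			also have "... = J*(LBINT y'. LBINT x. indicator (S k) x*?h x y' powr p)"
				using nice_Fubini(1)[OF nk] by simp
			also have "... <= J*(LBINT y'. C*q powr p*dec DIM('a) p (i-k)*Phi p r I {()} (%v _ x. f v (x, y')))"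
			proof (intro mult_left_mono J integral_mono)
				show "integrable lborel (%y'. LBINT x. indicator (S k) x*?h x y' powr p)"
					using nice_int[OF nice_partial_integral[OF nice_swap[OF nk]]] by simp
				show "integrable lborel (%y'. C*q powr p*dec DIM('a) p (i-k)*Phi p r I {()} (%v _ x. f v (x, y')))"
					using p I f by (intro nice_int nice_cmult Phi_fibers(2)) auto
				fix y'
				show "(LBINT x. indicator (S k) x*?h x y' powr p) <= C*q powr p*dec DIM('a) p (i-k)*Phi p r I {()} (%v _ x. f v (x, y'))"
				proof (cases "y' \<in> S' j")
					case True
					let ?w = "y-y'"
					have w: "sc M <= norm ?w" unfolding M_def by (rule ann_far[OF S' y True far])
					then have w0: "?w ~= 0" using sc_pos(1)[of M] by (metis norm_zero not_le)
					\<comment> \<open>On the slice the cutoff in \<open>y\<close> is a number between 0 and 1,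
					  which is put into the one-parameter kernel.\<close>
					define X where "X = (\<Sum>k\<in>{a..<b}. chi k (norm ?w))"
					have X: "0 <= X" "X <= 1" unfolding X_def by (rule chi_sum_bounds, simp)+
					have le: "C0/norm ?w^?m <= q"
						unfolding q_def using C0 w w0 by (simp add: divide_left_mono power_mono)
					have h: "hk (C0/norm ?w^?m) et (%x. K x ?w)" by (rule rk_hk(1)[OF K w0])
					have hq: "hk q et (%x. X*K x ?w)"
						unfolding hk_def
					proof (intro conjI allI impI)
						fix x :: 'a assume "x ~= 0"
						then have "|K x ?w| <= (C0/norm ?w^?m)/norm x^DIM('a)" using h by (simp add: hk_def)
						also have "... <= q/norm x^DIM('a)" by (intro divide_right_mono le) auto
						finally have "X*|K x ?w| <= 1*(q/norm x^DIM('a))" using X by (intro mult_mono) auto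
						then show "|X*K x ?w| <= q/norm x^DIM('a)" using X by (simp add: abs_mult)
					next
						fix x h' :: 'a assume "norm x > 2*norm h'"
						then have "|K (x + h') ?w-K x ?w| <= (C0/norm ?w^?m)*(norm h'/norm x) powr et/norm x^DIM('a)" using h by (simp add: hk_def)
						also have "... <= q*(norm h'/norm x) powr et/norm x^DIM('a)" by (intro divide_right_mono mult_right_mono le) auto
						finally have "X*|K (x + h') ?w-K x ?w| <= 1*(q*(norm h'/norm x) powr et/norm x^DIM('a))" using X by (intro mult_mono) auto
						then show "|X*K (x + h') ?w-X*K x ?w| <= q*(norm h'/norm x) powr et/norm x^DIM('a)"
							using X by (simp add: abs_mult right_diff_distrib[symmetric])
					qed
					have "cn (%x. K x ?w)" using K w0 by (simp add: rk_def)
					then have cnX: "cn (%x. X*K x ?w)" by (simp add: cn_def set_lebesgue_integral_def mult.left_commute)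
					have e: "(%x. KN K a b (x, ?w)) = ker a b (%x. X*K x ?w)" by (auto simp: KN_ker X_def)
					show ?thesis
						unfolding H_def e by (rule C(2)[OF I q hq cnX nice_section1[OF f]]) (rule fs(1))
				next
					case False
					then show ?thesis using H0[of y'] p C(1) by simp
				qed
			qed
			also have "... = B"
				using p I f by (simp add: B_def Phi_fibers(1)[of p r I "{()}" "%v _. f v"])
			finally show ?thesis .
		qed
		have nS: "nice (%z. indicator (S k \<times> S' l) z*?G z)"
			by (rule nice_ind_mult[OF _ nG]) (use S S' in \<open>auto simp: ann_def intro!: borel_Times\<close>)
		have ie: "(LBINT x. indicator (S k \<times> S' l) (x, y)*?G (x, y)) = indicator (S' l) y*(LBINT x. indicator (S k) x*?G (x, y))" for y
			unfolding integral_mult_right_zero[symmetric] by (simp add: indicator_times mult_ac)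
		have "(LBINT z. indicator (S k \<times> S' l) z*?G z) = (LBINT y. indicator (S' l) y*(LBINT x. indicator (S k) x*?G (x, y)))"
			using nice_Fubini[of "%x y. indicator (S k \<times> S' l) (x, y)*?G (x, y)"] nS unfolding ie[symmetric] by simp
		also have "... <= (2 * sc (l + c))^?m*B"
		proof (rule ann_integral_le[OF S' inner B])
			have "nice (%z. indicator (S k \<times> S' l) (snd z, fst z)*?G (snd z, fst z))" using nice_swap[OF nS] by simp
			from nice_int[OF nice_partial_integral[OF this]]
			show "integrable lborel (%y. indicator (S' l) y*(LBINT x. indicator (S k) x*?G (x, y)))" by (simp only: ie fst_conv snd_conv)
		qed
		also have "... = ((2 * sc (l + c))^?m*((1/sc (max j l-c-1)^?m) powr p*((2 * sc (j + c))^?m) powr (p-1)))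
				* (C*C0 powr p*dec DIM('a) p (i-k)*?P)"
			unfolding B_def J_def q_def M_def powr_mult by (simp add: mult_ac)
		also have "... = C*C0 powr p*E0 ?m p c*(dec DIM('a) p (i-k)*dec ?m p (j-l))*?P"
			unfolding dec_far by (simp add: mult_ac)
		finally show ?case .
	qed (use C(1) C0 in simp)
	qed
qed

text \<open>The part \<open>- tw*u\<close> matches the growth of the block norms of a Morrey-Herz
  function; \<open>- de*|u|\<close> is the slack that makes sums over blocks converge.\<close>

definition om :: "real => real => int => real" where
	"om tw de u = 2 powr (- tw*real_of_int u-de*|real_of_int u| )"

lemma om_pos[simp]: "0 < om tw de u" "0 <= om tw de u" by (simp_all add: om_def)

text \<open>The margin in the exponent is at least \<open>2*de\<close> on each side. One
  \<open>de\<close> is spent on the summation over source blocks in \<open>sum_powr_le\<close>, the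
  other stays in \<open>om\<close>.\<close>

lemma dec_le_om:
	assumes "2*de <= real n-tw" "2*de <= real n*(p-1) + tw"
	shows "dec n p u*2 powr (de*|real_of_int u| ) <= om tw de u"
proof -
	have "real n*((p-1)*real_of_int u-p*max (real_of_int u) 0) + de*|real_of_int u| <= - tw*real_of_int u-de*|real_of_int u|"
	proof (cases "0 <= u")
		case True
		then show ?thesis using mult_right_mono[OF assms(1), of "real_of_int u"] by (simp add: algebra_simps)
	next
		case False
		then show ?thesis using mult_right_mono_neg[OF assms(2), of "real_of_int u"] by (simp add: algebra_simps)
	qed
	then show ?thesis unfolding dec_def om_def powr_add[symmetric] by (intro powr_mono) auto
qed

text \<open>Each term is bounded by the s-th root of the whole weighted sum times a geometric factor
  in the distance from \<open>(k, l)\<close>; summing these factors costs only a constant.\<close>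

lemma sum_powr_le:
	fixes de s :: real
	assumes "0 < de" "0 < s"
	shows "EX G>0. ALL F (x :: int \<times> int => real) k l. finite F --> (ALL u. 0 <= x u) -->
		(\<Sum>u\<in>F. x u) powr s <= G*(\<Sum>u\<in>F. 2 powr (de*( |real_of_int (fst u-k)| + |real_of_int (snd u-l)| ))*x u powr s)"
proof -
	define v where "v = 2 powr (- de/s)"
	have v: "0 < v" "v < 1" using assms by (auto simp: v_def powr_less_one)
	show ?thesis
	proof (intro exI[of _ "((2/(1-v))*(2/(1-v))) powr s"] conjI allI impI, goal_cases)
		case (2 F x k l)
		note F = 2(1) and x = 2(2)
		let ?e = "%u. 2 powr (de*( |real_of_int (fst u-k)| + |real_of_int (snd u-l)| ))"
		define M where "M = (\<Sum>u\<in>F. ?e u*x u powr s)"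
		have M: "M >= 0" using x by (auto simp: M_def intro!: sum_nonneg)
		have t: "x u <= M powr (1/s)*(v^nat |fst u-k| * v^nat |snd u-l| )" if "u \<in> F" for u
		proof -
			have "?e u*x u powr s <= M" unfolding M_def by (rule member_le_sum[OF that]) (use F in auto)
			then have "(?e u*x u powr s) powr (1/s) <= M powr (1/s)" using assms by (intro powr_mono2) auto
			then have "?e u powr (1/s)*x u <= M powr (1/s)" using x assms by (simp add: powr_mult powr_powr)
			moreover have "v^nat |fst u-k| * v^nat |snd u-l|*?e u powr (1/s) = 1"
				unfolding v_def by (simp add: powr_power powr_powr powr_add[symmetric] add_divide_distrib algebra_simps)
			moreover have "v^nat |fst u-k| * v^nat |snd u-l| >= 0" using v by simp
			ultimately show ?thesis
				using mult_left_mono[of "?e u powr (1/s)*x u" "M powr (1/s)" "v^nat |fst u-k| * v^nat |snd u-l|"]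
				by (simp add: mult.assoc[symmetric]) (simp add: mult_ac)
		qed
		have "(\<Sum>u\<in>F. x u) <= (\<Sum>u\<in>F. M powr (1/s)*(v^nat |fst u-k| * v^nat |snd u-l| ))" by (intro sum_mono t)
		also have "... <= M powr (1/s)*((2/(1-v))*(2/(1-v)))"
			unfolding sum_distrib_left[symmetric] using F v by (intro mult_left_mono geometric_int_sum2) auto
		finally have "(\<Sum>u\<in>F. x u) powr s <= (M powr (1/s)*((2/(1-v))*(2/(1-v)))) powr s"
			using x assms by (intro powr_mono2 sum_nonneg) auto
		also have "... = ((2/(1-v))*(2/(1-v))) powr s*M"
			unfolding powr_mult[of "M powr (1/s)"] using M assms by (simp add: powr_powr)
		finally show ?case by (simp add: M_def)
	qed (use v in simp)
qed

lemma AE_off_axes: "AE z in lborel. fst z ~= (0::'a::euclidean_space) & snd z ~= (0::'b::euclidean_space)"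
proof (rule AE_I')
	have "emeasure (lborel :: ('a \<times> 'b) measure) ({0} \<times> UNIV) = 0" "emeasure (lborel :: ('a \<times> 'b) measure) (UNIV \<times> {0}) = 0"
		unfolding lborel_prod[symmetric] by (subst lborel.emeasure_pair_measure_Times; simp)+
	then show "({0} \<times> UNIV) \<union> (UNIV \<times> {0}) \<in> null_sets (lborel :: ('a \<times> 'b) measure)"
		by (intro null_sets.Un) (auto simp: null_sets_def intro!: borel_Times)
qed auto

definition ix :: "(int => 'a set) => 'a => int" where "ix S x = (THE i. x \<in> S i)"

lemma ix_eq: "ann c S ==> x \<in> S i ==> ix S x = i"
	unfolding ix_def ann_def by (intro the_equality) (auto simp: disjoint_family_on_def, blast)

lemma ix_measurable:
	fixes S :: "int => 'a::euclidean_space set"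
	assumes "ann c S" shows "ix S \<in> borel \<rightarrow>\<^sub>M count_space UNIV"
proof (subst measurable_count_space_eq_countable)
	\<comment> \<open>The origin lies in no block, so its index is an unspecified value; it is added to
	  the preimage of that value by hand.\<close>
	have "ix S -` {i} \<inter> space borel = S i \<union> (if ix S 0 = i then {0} else {})" for i
	proof (intro set_eqI iffI)
		fix x assume x: "x \<in> ix S -` {i} \<inter> space borel"
		show "x \<in> S i \<union> (if ix S 0 = i then {0} else {})"
		proof (cases "x = 0")
			case False
			then obtain j where "x \<in> S j" using assms unfolding ann_def by blast
			then show ?thesis using x ix_eq[OF assms] by auto
		qed (use x in auto)
	qed (use ix_eq[OF assms] in \<open>auto split: if_splits\<close>)
	moreover have "S i \<union> (if ix S 0 = i then {0} else {}) \<in> sets borel" for i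
		using assms by (intro sets.Un) (auto simp: ann_def)
	ultimately show "ix S \<in> space borel \<rightarrow> UNIV & (\<forall>a\<in>UNIV. ix S -` {a} \<inter> space borel \<in> sets borel)" by simp
qed auto

text \<open>The four inequalities on \<open>de\<close> say that in each variable, for positive and
  for negative offsets, the gain \<open>dec\<close> exceeds the growth of exponent \<open>tw\<close>
  with room \<open>2*de\<close>.\<close>

locale bicz =
	fixes K :: "'a::euclidean_space => 'b::euclidean_space => real" and C0 et p r tw de :: real and c :: int
		and S :: "int => 'a set" and S' :: "int => 'b set"
	assumes p: "1 < p" "1 < r" and K: "rk C0 et K" and S: "ann c S" and S': "ann c S'"
		and de: "0 < de" "2*de <= DIM('a)-tw" "2*de <= DIM('a)*(p-1) + tw" "2*de <= DIM('b)-tw" "2*de <= DIM('b)*(p-1) + tw"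
begin

text \<open>Blocks far apart in \<open>y\<close> are treated by \<open>local_two_far\<close>, those
  far apart in \<open>x\<close> by the same lemma for the kernel with variables exchanged, and the
  remaining ones by the global bound.\<close>

lemma local_two:
	"EX C>0. ALL (I::'i set) a b f i j k l. finite I --> (ALL m. nice (f m)) --> (ALL m z. f m z ~= 0 --> z \<in> S i \<times> S' j) -->
		(LBINT z. indicator (S k \<times> S' l) z * vn r I (%m. conv (KN K a b) (f m) z) powr p)
			<= C*(dec DIM('a) p (i-k)*dec DIM('b) p (j-l))*Phi p r I {()} (%m _. f m)"
proof -
	have et: "0 < et" "et <= 1" "0 < C0" using K by (auto simp: rk_def)
	have c: "0 <= c" using S by (simp add: ann_def)
	show ?thesis
		using local_two_far[OF p K S S', where 'i='i] local_two_far[OF p rk_swap[OF K] S' S, where 'i='i] product_operator_bound[OF p et(1,2), where 'i='i and 'a='a and 'b='b]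
	proof (elim exE conjE, goal_cases)
	case (1 C1 C2 C3)
	note C1 = 1(1,2)[rule_format] and C2 = 1(3,4)[rule_format] and C3 = 1(5,6)[rule_format]
	define B where "B = cK TYPE('a) TYPE('b) C0"
	have B: "B > 0" using et by (simp add: B_def cK_def)
	define C4 where "C4 = C3*B powr p*(E0 DIM('a) p c*E0 DIM('b) p c)"
	have C4: "C4 >= 0" using C3(1) by (simp add: C4_def)
	show ?thesis
	proof (intro exI[of _ "C1 + C2 + C4"] conjI allI impI, goal_cases)
		case (2 I a b f i j k l)
		note I = 2(1) and f = 2(2)[rule_format] and fs = 2(3) and f0 = 2(2)
		let ?P = "Phi p r I {()} (%m _. f m)"
		let ?d = "dec DIM('a) p (i-k)*dec DIM('b) p (j-l)"
		let ?G = "%z. vn r I (%m. conv (KN K a b) (f m) z) powr p"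
		have nK: "nice (KN K a b)" by (rule nice_KN[OF K])
		have nG: "nice ?G" using p I by (intro nice_Phi_integrand nice_conv nK f) auto
		have nS: "nice (%z. indicator (S k \<times> S' l) z*?G z)"
			by (rule nice_ind_mult[OF _ nG]) (use S S' in \<open>auto simp: ann_def intro!: borel_Times\<close>)
		consider "2*c + 2 < |j-l|" | "2*c + 2 < |i-k|" | "|i-k| <= 2*c + 2" "|j-l| <= 2*c + 2" by linarith
		then have "\<exists>C\<in>{C1, C2, C4}. (LBINT z. indicator (S k \<times> S' l) z*?G z) <= C*?d*?P"
		proof cases
			case 1
			then show ?thesis using C1(2)[where f=f and i=i and k=k and a=a and b=b, OF I f _ 1] fs by blast
		next
			case 2
			let ?f = "%m z. f m (snd z, fst z)"
			have e: "conv (KN (%y x. K x y) a b) (?f m) w = conv (KN K a b) (f m) (snd w, fst w)" for m w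
			proof -
				have "KN (%y x. K x y) a b = (%z. KN K a b (snd z, fst z))"
				proof
					fix z show "KN (%y x. K x y) a b z = KN K a b (snd z, fst z)" using KN_swap[of K a b "fst z" "snd z"] by simp
				qed
				then show ?thesis using conv_swap[OF nK f, of m "fst w" "snd w"] by simp
			qed
			have "(LBINT w. indicator (S' l \<times> S k) w * vn r I (%m. conv (KN (%y x. K x y) a b) (?f m) w) powr p)
				<= C2*(dec DIM('b) p (j-l)*dec DIM('a) p (i-k))*Phi p r I {()} (%m _. ?f m)"
				by (rule C2(2)[where f="?f", OF I nice_swap[OF f] _ 2]) (use fs in fastforce)
			also have "Phi p r I {()} (%m _. ?f m) = ?P" using p I f by (simp add: Phi_fibers(3)[of p r I "{()}" "%m _. f m"])
			also have "(LBINT w. indicator (S' l \<times> S k) w * vn r I (%m. conv (KN (%y x. K x y) a b) (?f m) w) powr p)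
				= (LBINT w. indicator (S k \<times> S' l) (snd w, fst w)*?G (snd w, fst w))"
				unfolding e by (simp add: indicator_times mult_ac)
			also have "... = (LBINT z. indicator (S k \<times> S' l) z*?G z)"
				using nice_integral_swap[OF nS] by simp
			finally show ?thesis by (auto simp: mult_ac)
		next
			case 3
			have "(LBINT z. indicator (S k \<times> S' l) z*?G z) <= (LBINT z. ?G z)"
				by (intro integral_mono nice_int nS nG) (auto simp: indicator_def)
			also have "... <= C3*B powr p*?P"
				using C3(2)[of I "{a..<b}" "{a..<b}" B "KJ K" f] I B f atom2_KJ[OF K] by (simp add: Phi_def KN_def[abs_def] B_def)
			also have "... = C3*B powr p*(1*1)*?P" by simp
			also have "... <= C3*B powr p*((E0 DIM('a) p c*dec DIM('a) p (i-k))*(E0 DIM('b) p c*dec DIM('b) p (j-l)))*?P"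
				using C3(1) c p 3 by (intro mult_right_mono mult_left_mono mult_mono dec_near) auto
			also have "... = C4*?d*?P" by (simp add: C4_def mult_ac)
			finally show ?thesis by blast
		qed
		then obtain C where C: "C \<in> {C1, C2, C4}" and "(LBINT z. indicator (S k \<times> S' l) z*?G z) <= C*(?d*?P)" by (auto simp: mult.assoc)
		note this(2)
		also have "C*(?d*?P) <= (C1 + C2 + C4)*(?d*?P)" using C C1(1) C2(1) C4 by (intro mult_right_mono) auto
		finally show ?case by (simp only: mult.assoc)
	qed (use C1(1) C2(1) C4 in simp)
	qed
qed

definition wt :: "int => int => 'a \<times> 'b => real" where
	"wt k l z = om tw de (ix S (fst z)-k) * om tw de (ix S' (snd z)-l)"

lemma wt_pos[simp]: "0 < wt k l z" "0 <= wt k l z" by (simp_all add: wt_def)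

lemma wt_measurable[measurable]: "wt k l \<in> BM"
proof -
	have m: "(%z. om tw de (ix T (g z)-k)) \<in> BM" if "ann c T" "g \<in> BM"
		for T :: "int => 'c::euclidean_space set" and g :: "'a \<times> 'b => 'c" and k
		by (rule measurable_compose[OF measurable_compose[OF that(2) ix_measurable[OF that(1)]]]) simp
	show ?thesis unfolding wt_def[abs_def] by (intro borel_measurable_times m S S') measurable
qed

lemma block_measurable[measurable]: "S k \<times> S' l \<in> sets borel"
	using S S' by (auto simp: ann_def intro!: borel_Times)

lemma blocks_disjoint: "disjoint_family_on (%u. S (fst u) \<times> S' (snd u)) F"
	using S S' unfolding ann_def disjoint_family_on_def by (fastforce simp: prod_eq_iff)

lemma wt_block: "z \<in> S i \<times> S' j ==> wt k l z = om tw de (i-k) * om tw de (j-l)"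
	using ix_eq[OF S, of "fst z" i] ix_eq[OF S', of "snd z" j] by (auto simp: wt_def)

text \<open>The input is cut to finitely many blocks and the images are added with
  \<open>sum_powr_le\<close>; its weights times \<open>dec\<close> are at most \<open>om\<close>,
  which on a block is the value of \<open>wt k l\<close>. For the fixed truncated kernel, dominated
  convergence exhausts all blocks.\<close>

theorem local_estimate:
	"EX C>0. ALL (I::'i set) a b f k l. finite I --> (ALL m. nice (f m)) -->
		(NN z. indicator (S k \<times> S' l) z*ennreal (vn r I (%m. conv (KN K a b) (f m) z) powr p))
			<= ennreal C*(NN z. ennreal (wt k l z)*ennreal (vn r I (%m. f m z) powr p))"
proof -
	show ?thesis
		using local_two[where 'i='i] sum_powr_le[OF de(1) less_trans[OF zero_less_one p(1)]]
	proof (elim exE conjE, goal_cases)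
	case (1 C1 G)
	note C1 = 1(1,2)[rule_format] and G = 1(3,4)[rule_format]
	show ?thesis
	proof (intro exI[of _ "G*C1"] conjI allI impI, goal_cases)
		case (2 I a b f k l)
		note I = 2(1) and f = 2(2)[rule_format]
	let ?V = "%z. vn r I (%m. f m z) powr p" and ?L = "NN z. indicator (S k \<times> S' l) z*ennreal (vn r I (%m. conv (KN K a b) (f m) z) powr p)"
		have nK: "nice (KN K a b)" by (rule nice_KN[OF K])
		define U where "U u = S (fst u) \<times> S' (snd u)" for u
		define F where "F n = {- int n..int n} \<times> {- int n..int n}" for n
		have fin: "finite (F n)" for n by (simp add: F_def)
		let ?f = "%u m z. indicator (U u) z*f m z"
		let ?g = "%n m z. \<Sum>u\<in>F n. ?f u m z"
		let ?R = "NN z. ennreal (wt k l z)*ennreal (?V z)"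
		let ?i = "indicator (S k \<times> S' l) :: 'a \<times> 'b => real"
		have Um[measurable]: "U u \<in> sets borel" for u unfolding U_def by (rule block_measurable)
		have nf: "nice (?f u m)" for u m by (intro nice_ind_mult Um f)
		have ng: "nice (?g n m)" for n m by (intro nice_sum nf)
		have gi: "?g n m z = indicator (\<Union>u\<in>F n. U u) z*f m z" for n m z
			unfolding U_def indicator_UN_disjoint[OF fin blocks_disjoint] by (simp add: sum_distrib_right)
		have gle: "|?g n m z| <= |f m z|" for n m z unfolding gi by (auto simp: indicator_def)
		have gconv: "AE z in lborel. (%n. ?g n m z) ----> f m z" for m
		proof -
			have "AE z in lborel. fst z ~= (0::'a) & snd z ~= (0::'b)" by (rule AE_off_axes)
			then show ?thesis
			proof eventually_elim
				case (elim z)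
				then have "fst z \<in> (\<Union>k. S k)" "snd z \<in> (\<Union>k. S' k)" using S S' by (simp_all add: ann_def)
				then obtain i j where "fst z \<in> S i" "snd z \<in> S' j" by blast
				then have "z \<in> U (i, j)" by (cases z) (auto simp: U_def)
				moreover have "(i, j) \<in> F n" if "n >= nat (max |i| |j| )" for n using that by (auto simp: F_def)
				ultimately have "!!n. n >= nat (max |i| |j| ) ==> ?g n m z = f m z" unfolding gi by (auto simp: indicator_def)
				then show ?case by (intro tendsto_eventually eventually_sequentiallyI)
			qed
		qed
		have low: "ennreal (Phi p r I {()} (%m _ z. ?i z*conv (KN K a b) (?g n m) z)) <= ennreal (G*C1)*?R" for n
		proof -
			let ?w = "%u. om tw de (fst u-k) * om tw de (snd u-l)"
			let ?x = "%u z. vn r I (%m. conv (KN K a b) (?f u m) z)"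
			let ?e = "%u. 2 powr (de*( |real_of_int (fst u-k)| + |real_of_int (snd u-l)| ))"
			have nx: "nice (%z. ?i z*?x u z powr p)" for u
				using p I by (intro nice_ind_mult block_measurable nice_Phi_integrand nice_conv nK nf) auto
			have "Phi p r I {()} (%m _ z. ?i z*conv (KN K a b) (?g n m) z) <= (LBINT z. G*(\<Sum>u\<in>F n. ?e u*(?i z*?x u z powr p)))"
				unfolding Phi_def
			proof (rule integral_mono)
				show "integrable lborel (%z. vn r I (%m. ?i z*conv (KN K a b) (?g n m) z) powr p)"
					using p I by (intro nice_int nice_Phi_integrand nice_ind_mult block_measurable nice_conv nK ng) auto
				show "integrable lborel (%z. G*(\<Sum>u\<in>F n. ?e u*(?i z*?x u z powr p)))" by (intro nice_int nice_cmult nice_sum nx)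
				fix z
				have "vn r I (%m. ?i z*conv (KN K a b) (?g n m) z) powr p = ?i z * vn r I (%m. conv (KN K a b) (?g n m) z) powr p"
					using p by (auto simp: indicator_def)
				also have "vn r I (%m. conv (KN K a b) (?g n m) z) <= (\<Sum>u\<in>F n. ?x u z)"
					unfolding conv_sum_right[OF nK nf] using p I by (intro nrm_sum) auto
				then have "vn r I (%m. conv (KN K a b) (?g n m) z) powr p <= (\<Sum>u\<in>F n. ?x u z) powr p" using p by (intro powr_mono2) auto
				then have "?i z * vn r I (%m. conv (KN K a b) (?g n m) z) powr p <= ?i z*(G*(\<Sum>u\<in>F n. ?e u*?x u z powr p))"
					by (intro mult_left_mono order_trans[OF _ G(2)] fin) auto
				finally show "vn r I (%m. ?i z*conv (KN K a b) (?g n m) z) powr p <= G*(\<Sum>u\<in>F n. ?e u*(?i z*?x u z powr p))"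
					by (simp add: sum_distrib_left mult_ac)
			qed
			also have "... = G*(\<Sum>u\<in>F n. ?e u*(LBINT z. ?i z*?x u z powr p))"
				using nice_int[OF nx] by simp
			also have "... <= G*(\<Sum>u\<in>F n. C1*(?w u*Phi p r I {()} (%m _. ?f u m)))"
			proof (intro mult_left_mono sum_mono)
				fix u
				let ?P = "Phi p r I {()} (%m _. ?f u m)"
				have "?e u*(LBINT z. ?i z*?x u z powr p) <= ?e u*(C1*(dec DIM('a) p (fst u-k)*dec DIM('b) p (snd u-l))*?P)"
					by (intro mult_left_mono C1(2) I nf) (auto simp: U_def indicator_def split: if_splits)
				also have "... = C1*((dec DIM('a) p (fst u-k)*2 powr (de*|real_of_int (fst u-k)| ))*(dec DIM('b) p (snd u-l)*2 powr (de*|real_of_int (snd u-l)| ))*?P)"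
					by (simp add: distrib_left powr_add mult_ac)
				also have "... <= C1*(?w u*?P)"
					using C1(1) de by (intro mult_left_mono mult_right_mono mult_mono dec_le_om) auto
				finally show "?e u*(LBINT z. ?i z*?x u z powr p) <= C1*(?w u*?P)" .
			qed (use G in auto)
			also have "... = (G*C1)*(\<Sum>u\<in>F n. ?w u*Phi p r I {()} (%m _. ?f u m))" by (simp add: sum_distrib_left mult_ac)
			finally have "ennreal (Phi p r I {()} (%m _ z. ?i z*conv (KN K a b) (?g n m) z)) <= ennreal ((G*C1)*(\<Sum>u\<in>F n. ?w u*Phi p r I {()} (%m _. ?f u m)))"
				by (rule ennreal_leI)
			also have "... = ennreal (G*C1)*(\<Sum>u\<in>F n. ennreal (?w u)*ennreal (Phi p r I {()} (%m _. ?f u m)))"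
				using G(1) C1(1) by (simp add: ennreal_mult sum_nonneg sum_ennreal[symmetric])
			also have "(\<Sum>u\<in>F n. ennreal (?w u)*ennreal (Phi p r I {()} (%m _. ?f u m))) <= ?R"
			proof -
				have Pe: "ennreal (Phi p r I {()} (%m _. ?f u m)) = (NN z. indicator (U u) z*ennreal (?V z))" for u
				proof -
					have "ennreal (Phi p r I {()} (%m _. ?f u m)) = (NN z. ennreal (vn r I (%m. ?f u m z) powr p))"
						unfolding Phi_def using p I by (intro nn_integral_eq_integral[symmetric] nice_int nice_Phi_integrand nf) auto
					also have "... = (NN z. indicator (U u) z*ennreal (?V z))"
						using p by (intro nn_integral_cong) (auto simp: indicator_def)
					finally show ?thesis .
				qed
				note nice_meas[OF f, measurable]
				have "(\<Sum>u\<in>F n. ennreal (?w u)*ennreal (Phi p r I {()} (%m _. ?f u m)))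
					= (NN z. (\<Sum>u\<in>F n. ennreal (?w u)*(indicator (U u) z*ennreal (?V z))))"
					unfolding Pe by (subst nn_integral_sum) (auto intro!: sum.cong nn_integral_cmult[symmetric])
				also have "... <= ?R"
				proof (rule nn_integral_mono)
					fix z
					have "(\<Sum>u\<in>F n. ennreal (?w u)*(indicator (U u) z*ennreal (?V z)))
						= (\<Sum>u\<in>F n. indicator (U u) z)*(ennreal (wt k l z)*ennreal (?V z))"
						unfolding sum_distrib_right by (intro sum.cong refl) (auto simp: indicator_def U_def wt_block)
					also have "(\<Sum>u\<in>F n. indicator (U u) z :: ennreal) = indicator (\<Union>u\<in>F n. U u) z"
						unfolding U_def by (rule indicator_UN_disjoint[OF fin blocks_disjoint, symmetric])
					also have "...*(ennreal (wt k l z)*ennreal (?V z)) <= ennreal (wt k l z)*ennreal (?V z)"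
						by (auto simp: indicator_def)
					finally show "(\<Sum>u\<in>F n. ennreal (?w u)*(indicator (U u) z*ennreal (?V z))) <= ennreal (wt k l z)*ennreal (?V z)" .
				qed
				finally show ?thesis .
			qed
			finally show ?thesis by (simp add: mult_left_mono)
		qed
		let ?H = "%m. conv (%z. |f m z| ) (%z. |KN K a b z| )"
		have "(%n. Phi p r I {()} (%m _ z. ?i z*conv (KN K a b) (?g n m) z)) ----> Phi p r I {()} (%m _ z. ?i z*conv (KN K a b) (f m) z)"
		proof (rule Phi_tendsto[where H = "%m _. ?H m"])
			show "|?i z*conv (KN K a b) (?g n m) z| <= ?H m z" for n m z
			proof -
				have "|conv (KN K a b) (?g n m) z| <= ?H m z"
					unfolding conv_commute[OF nK ng] by (rule abs_conv_le[OF ng nK nice_abs[OF f] gle])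
				then show ?thesis by (auto simp: indicator_def)
			qed
			show "AE z in lborel. (%n. ?i z*conv (KN K a b) (?g n m) z) ----> ?i z*conv (KN K a b) (f m) z" for m
				by (intro AE_I2 tendsto_mult tendsto_const conv_tendsto[OF nK nice_abs[OF f] nice_meas[OF ng] gle nice_meas[OF f] gconv])
		qed (use p I in \<open>auto intro!: nice_meas[OF nice_ind_mult] block_measurable nice_conv nice_abs nK ng f\<close>)
		then have "ennreal (Phi p r I {()} (%m _ z. ?i z*conv (KN K a b) (f m) z)) <= ennreal (G*C1)*?R"
			by (intro LIMSEQ_le_const2[OF tendsto_ennrealI]) (auto intro: low)
		moreover have "?L
			= ennreal (Phi p r I {()} (%m _ z. ?i z*conv (KN K a b) (f m) z))"
		proof -
			have "ennreal (Phi p r I {()} (%m _ z. ?i z*conv (KN K a b) (f m) z)) = (NN z. ennreal (vn r I (%m. ?i z*conv (KN K a b) (f m) z) powr p))"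
				unfolding Phi_def using p I by (intro nn_integral_eq_integral[symmetric] nice_int nice_Phi_integrand nice_ind_mult block_measurable nice_conv nK f) auto
			also have "... = ?L"
				using p by (intro nn_integral_cong) (auto simp: indicator_def)
			finally show ?thesis by simp
		qed
		ultimately show ?case by simp
	qed (use G(1) C1(1) in simp)
	qed
qed

end

section \<open>Principal values\<close>

lemma chi_sum': "a <= b ==> (\<Sum>j\<in>{a..<b}. chi j s) = zet (s/sc (b-2))-zet (s/sc (a-2))"
	using chi_sum[where a = a and n = "nat (b-a)" and s = s] by simp

lemma chi_sum_eventually:
	assumes "0 < s"
	shows "eventually (%N. (\<Sum>j\<in>{- int N..<b}. chi j s) = zet (s/sc (b-2))) sequentially"
proof (rule eventually_sequentiallyI)
	fix N :: nat assume N: "max (nat |b| ) (nat \<lceil>2/s\<rceil>) <= N"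
	have "2/s <= real N" using N by linarith
	also have "... <= 2^N" using of_nat_less_two_power[of N, where 'a=real] by linarith
	also have "... = sc (int N)" by (simp add: sc_def powr_realpow)
	also have "... <= sc (int N + 2)" by (rule sc_mono) simp
	finally have "2 <= s * sc (int N + 2)" using assms by (simp add: field_simps)
	also have "... = s/sc (- int N-2)" by (simp add: sc_def divide_powr_uminus add.commute)
	finally have "zet (s/sc (- int N-2)) = 0" by (simp add: zet_def)
	moreover have "- int N <= b" using N by linarith
	ultimately show "(\<Sum>j\<in>{- int N..<b}. chi j s) = zet (s/sc (b-2))" by (simp add: chi_sum')
qed

text \<open>The pieces cut out by \<open>chi\<close> have integrals of order
  \<open>sc j powr s\<close>, a geometric series as \<open>j\<close> decreases; Fatou's lemma adds
  them up.\<close>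

lemma norm_powr_integrable:
	fixes s R :: real
	assumes s: "0 < s"
	shows "(\<integral>\<^sup>+x. ennreal (indicator (cball 0 R) x*norm x powr (s-DIM('a))) \<partial>(lborel :: 'a::euclidean_space measure)) < \<infinity>"
proof -
	obtain J where J: "R < sc J" using sc_unbounded by blast
	let ?n = "DIM('a)" and ?g = "%x::'a. norm x powr (s-DIM('a))"
	let ?F = "%N x. \<Sum>j\<in>{- int N..<J + 2}. ennreal (chi j (norm x)*?g x)"
	define v where "v = 2 powr (- s)"
	have v: "0 <= v" "v < 1" using s by (auto simp: v_def powr_less_one)
	define M where "M = 8^?n * sc (J + 2) powr s*(2/(1-v))"
	have tm: "(NN x. ennreal (chi j (norm x)*?g x)) <= ennreal (8^?n * sc j powr s)" for j
	proof -
		have "chi j (norm x)*?g x <= 4^?n * sc j powr s/sc j^?n*indicator (cball 0 (sc j)) x" for x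
		proof (cases "chi j (norm x) = 0")
			case False
			have x: "sc j/4 < norm x" "norm x < sc j" using chi_supp[OF False] by auto
			have x0: "0 < norm x" using x sc_pos(1)[of j] by linarith
			have "chi j (norm x)*?g x <= 1*(norm x powr s/norm x^?n)"
				using x0 chi_bounds(2)[of j "norm x"] by (intro mult_mono) (auto simp: powr_diff powr_realpow)
			also have "... <= sc j powr s/(sc j/4)^?n"
				unfolding mult_1 using x x0 s by (intro frac_le powr_mono2 power_mono) auto
			finally show ?thesis using x by (simp add: power_divide mult.commute)
		qed simp
		then have "(NN x. ennreal (chi j (norm x)*?g x)) <= (\<integral>\<^sup>+x. ennreal (4^?n * sc j powr s/sc j^?n)*indicator (cball 0 (sc j)) x \<partial>(lborel :: 'a measure))"
			by (intro nn_integral_mono) (auto simp: ennreal_mult'[symmetric] ennreal_indicator[symmetric] intro!: ennreal_leI simp del: ennreal_indicator)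
		also have "... = ennreal (4^?n * sc j powr s/sc j^?n)*emeasure lborel (cball (0::'a) (sc j))" by (rule nn_integral_cmult_indicator) simp
		also have "... = ennreal (4^?n * sc j powr s/sc j^?n*measure lborel (cball (0::'a) (sc j)))"
			using emeasure_lborel_cball_finite[of "0::'a" "sc j"]
			by (subst emeasure_eq_ennreal_measure) (auto intro!: ennreal_mult[symmetric] simp del: times_divide_eq_left)
		also have "... <= ennreal (4^?n * sc j powr s/sc j^?n*(2 * sc j)^?n)"
			by (intro ennreal_leI mult_left_mono measure_cball_le) auto
		also have "4^?n * sc j powr s/sc j^?n*(2 * sc j)^?n = 8^?n * sc j powr s"
			by (simp add: power_mult_distrib) (simp add: power_mult_distrib[symmetric])
		finally show ?thesis .
	qed
	have F: "(NN x. ?F N x) <= ennreal M" for N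
	proof -
		have "(NN x. ?F N x) <= (\<Sum>j\<in>{- int N..<J + 2}. ennreal (8^?n * sc j powr s))"
			by (subst nn_integral_sum, measurable) (intro sum_mono tm)
		also have "... = ennreal (\<Sum>j\<in>{- int N..<J + 2}. 8^?n * sc j powr s)" by (rule sum_ennreal) simp
		also have "(\<Sum>j\<in>{- int N..<J + 2}. 8^?n * sc j powr s) = 8^?n * sc (J + 2) powr s*(\<Sum>j\<in>{- int N..<J + 2}. v^nat |j-(J + 2)| )"
		proof -
			have "sc j powr s = sc (J + 2) powr s * v^nat |j-(J + 2)|" if "j < J + 2" for j
				using that by (simp add: v_def sc_def powr_power powr_powr powr_add[symmetric] algebra_simps)
			then show ?thesis by (simp add: sum_distrib_left mult.assoc)
		qed
		also have "... <= M" unfolding M_def by (intro mult_left_mono geometric_int_sum v) auto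
		finally show ?thesis by (simp add: ennreal_leI)
	qed
	have "(NN x. ennreal (indicator (cball 0 R) x*?g x)) <= (NN x. liminf (%N. ?F N x))"
	proof (rule nn_integral_mono)
		fix x :: 'a
		show "ennreal (indicator (cball 0 R) x*?g x) <= liminf (%N. ?F N x)"
		proof (cases "x ~= 0 & norm x <= R")
			case True
			have "eventually (%N. ennreal (?g x) = ?F N x) sequentially"
				using chi_sum_eventually[of "norm x" "J + 2"]
			proof (rule eventually_mono)
				fix N assume e: "(\<Sum>j\<in>{- int N..<J + 2}. chi j (norm x)) = zet (norm x/sc (J + 2-2))"
				have "zet (norm x/sc J) = 1" using True J by (simp add: zet_def field_simps)
				then show "ennreal (?g x) = ?F N x" using e by (simp add: sum_ennreal chi_bounds sum_distrib_right[symmetric])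
			qed (use True in simp)
			then have "(%N. ?F N x) ----> ennreal (?g x)" by (intro tendsto_eventually) (auto elim: eventually_mono)
			then show ?thesis using True by (simp add: lim_imp_Liminf)
		qed (auto simp: indicator_def)
	qed
	also have "... <= liminf (%N. NN x. ?F N x)" by (intro nn_integral_liminf) measurable
	also have "... <= ennreal M" by (intro Liminf_le always_eventually allI F) simp
	finally show ?thesis by (simp add: le_less_trans)
qed

lemma nn_integral_ten:
	assumes [measurable]: "g \<in> BM" "h \<in> BM"
	shows "(\<integral>\<^sup>+z. g (fst z)*h (snd z) \<partial>(lborel :: ('a::euclidean_space \<times> 'b::euclidean_space) measure)) = (NN x. g x)*(NN y. h y)"
	unfolding lborel_prod[symmetric] by (subst lborel.nn_integral_fst[symmetric]) (auto simp: nn_integral_cmult nn_integral_multc)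

definition Lc :: "('a::euclidean_space => real) => bool" where
	"Lc f \<longleftrightarrow> nice f & (EX L>=0. ALL z w. |f z-f w| <= L*norm (z-w))"

text \<open>The mixed second difference of \<open>f\<close> in the offset \<open>w\<close>. The
  three added terms depend on at most one component of \<open>w\<close>, hence integrate to zero
  against a kernel with cancellation in each variable.\<close>

definition dd :: "('a::real_vector \<times> 'b::real_vector => real) => 'a \<times> 'b => 'a \<times> 'b => real" where
	"dd f z w = f (z-w)-f (fst z, snd z-snd w)-f (fst z-fst w, snd z) + f z"

lemma dd_rep:
	fixes f :: "'a::euclidean_space \<times> 'b::euclidean_space => real"
	assumes f: "nice f" and Q: "nice Q" "!!y. (LBINT x. Q (x, y)) = 0" "!!x. (LBINT y. Q (x, y)) = 0"
	shows "(LBINT w. f (z-w)*Q w) = (LBINT w. dd f z w*Q w)" "integrable lborel (%w. dd f z w*Q w)"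
proof -
	obtain B where B: "!!z. |f z| <= B" using f by (metis niceE)
	note nice_meas[OF f, measurable]
	have n: "nice (%w. f (g w)*Q w)" if "g \<in> BM" for g
		by (rule nice_bmult[OF Q(1) measurable_compose[OF that nice_meas[OF f]] B])
	have n1: "nice (%w. f (fst z, snd z-snd w)*Q w)" and n2: "nice (%w. f (fst z-fst w, snd z)*Q w)"
		and n3: "nice (%w. f (z-w)*Q w)" and n4: "nice (%w. f z*Q w)"
		by (intro n; measurable)+
	have "(LBINT w. f (fst z, snd z-snd w)*Q w) = 0"
		using nice_Fubini[of "%x y. f (fst z, snd z-y)*Q (x, y)"] n1 Q(2) by simp
	moreover have "(LBINT w. f (fst z-fst w, snd z)*Q w) = 0"
		using nice_Fubini[of "%x y. f (fst z-x, snd z)*Q (x, y)"] n2 Q(3) by simp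
	moreover have "(LBINT w. Q w) = 0"
		using nice_Fubini[of "%x y. Q (x, y)"] Q by simp
	moreover have e: "dd f z w*Q w = f (z-w)*Q w-f (fst z, snd z-snd w)*Q w-f (fst z-fst w, snd z)*Q w + f z*Q w" for w
		by (simp add: dd_def algebra_simps)
	ultimately show "(LBINT w. f (z-w)*Q w) = (LBINT w. dd f z w*Q w)"
		unfolding e using nice_int[OF n1] nice_int[OF n2] nice_int[OF n3] nice_int[OF n4] by simp
	show "integrable lborel (%w. dd f z w*Q w)"
		unfolding e by (intro Bochner_Integration.integrable_add Bochner_Integration.integrable_diff nice_int n1 n2 n3 n4)
qed

text \<open>The difference vanishes when either component of \<open>w\<close> does. Lipschitz
  continuity bounds it by the smaller of the two norms, hence by their geometric mean: half a power
  in each variable, enough to make it integrable against the kernel near the axes.\<close>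

lemma dd_bound:
	assumes "!!z w. |f z-f w| <= L*norm (z-w)" "0 <= L"
	shows "|dd f z w| <= 2*L*(norm (fst w) powr (1/2)*norm (snd w) powr (1/2))"
proof -
	let ?a = "norm (fst w)" and ?b = "norm (snd w)"
	have "|dd f z w| <= L*?a + L*?a"
		using assms(1)[of "z-w" "(fst z, snd z-snd w)"] assms(1)[of "(fst z-fst w, snd z)" z]
		by (cases z; cases w) (simp add: dd_def norm_Pair)
	moreover have "|dd f z w| <= L*?b + L*?b"
		using assms(1)[of "z-w" "(fst z-fst w, snd z)"] assms(1)[of "(fst z, snd z-snd w)" z]
		by (cases z; cases w) (simp add: dd_def norm_Pair)
	ultimately have "|dd f z w| <= 2*L*min ?a ?b" by (simp add: min_def)
	also have "min ?a ?b = min ?a ?b powr (1/2)*min ?a ?b powr (1/2)" by (simp add: powr_add[symmetric])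
	also have "... <= ?a powr (1/2)*?b powr (1/2)" by (intro mult_mono powr_mono2) auto
	finally show ?thesis using assms(2) by (simp add: mult_left_mono)
qed

lemma chi_sum_le: "0 <= s ==> |\<Sum>j\<in>{a..<b}. chi j s| <= zet (s/sc (b-2))"
	using chi_sum_bounds(1)[of s a b] zet_bounds(1) by (cases "a <= b") (auto simp: chi_sum')

lemma KN_eq: "KN K a b w = (\<Sum>j\<in>{a..<b}. chi j (norm (fst w)))*(\<Sum>k\<in>{a..<b}. chi k (norm (snd w)))*K (fst w) (snd w)"
	using KN_ker[of K a b "fst w" "snd w"] by (simp add: ker_def sum_distrib_right[symmetric] mult.assoc)

text \<open>Since \<open>dd f z\<close> is not compactly supported, the kernel needs an outer
  cutoff. Tents are used because they arise as limits of sums of \<open>chi\<close> and, behind a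
  sharp inner truncation, keep the cancellation.\<close>

definition cutK :: "int => ('a::euclidean_space => 'b::euclidean_space => real) => 'a \<times> 'b => real" where
	"cutK J K w = of_bool (fst w ~= 0 & snd w ~= 0)*(zet (norm (fst w)/sc J)*zet (norm (snd w)/sc J)*K (fst w) (snd w))"

lemma KN_axes: "\<not> (fst w ~= 0 & snd w ~= 0) ==> KN K a b w = 0"
	by (auto simp: KN_eq chi_def)

lemma KN_tendsto: "(%N. KN K (- int N) (J + 2) w) ----> cutK J K w"
proof (cases "fst w ~= 0 & snd w ~= 0")
	case True
	then have "eventually (%N. (\<Sum>j\<in>{- int N..<J + 2}. chi j (norm (fst w))) = zet (norm (fst w)/sc J)) sequentially"
		"eventually (%N. (\<Sum>j\<in>{- int N..<J + 2}. chi j (norm (snd w))) = zet (norm (snd w)/sc J)) sequentially"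
		using chi_sum_eventually[of _ "J + 2"] by simp_all
	then have "eventually (%N. KN K (- int N) (J + 2) w = cutK J K w) sequentially" by eventually_elim (use True in \<open>simp add: KN_eq cutK_def\<close>)
	then show ?thesis by (rule tendsto_eventually)
qed (auto simp: KN_axes cutK_def)

lemma cutK_measurable: "rk C0 et K ==> cutK J K \<in> BM"
	by (rule borel_measurable_LIMSEQ_real[OF KN_tendsto]) (auto intro: nice_meas nice_KN)

text \<open>Smooth truncations by sums of \<open>chi\<close> and sharp truncations both turn into
  integrals of \<open>dd f z\<close> against truncations of \<open>Q\<close>, dominated by the
  integrable \<open>D\<close>. Both therefore converge to the integral without inner
  truncation.\<close>

lemma pv_limit:
	fixes K :: "'a::euclidean_space => 'b::euclidean_space => real"
	assumes K: "rk C0 et K" and f: "Lc f"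
	shows "EX L. (%N. conv (KN K (- int N) (int N)) f z) ----> L &
		((%(e1, e2). LINT w:{w. norm (fst w) > e1 & norm (snd w) > e2}|lborel. f (z-w)*K (fst w) (snd w)) \<longlongrightarrow> L) (at_right 0 \<times>\<^sub>F at_right 0)"
proof -
	let ?n = "DIM('a)" and ?m = "DIM('b)"
	let ?S = "%e1 e2. LINT w:{w. norm (fst w) > e1 & norm (snd w) > e2}|lborel. f (z-w)*K (fst w) (snd w)" and ?k = "%N. KN K (- int N) (int N)"
	have C0: "0 < C0" "0 < et" using K by (auto simp: rk_def)
	have nf: "nice f" using f by (simp add: Lc_def)
	obtain L where L: "!!z w. |f z-f w| <= L*norm (z-w)" "0 <= L" using f unfolding Lc_def by blast
	obtain R where R: "!!z. f z ~= 0 ==> norm z <= R" using nf by (metis niceE)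
	\<comment> \<open>If \<open>f (z-w)\<close> is nonzero, both components of \<open>w\<close> are
	  below \<open>sc J\<close>, where the tents equal 1. The outer cutoff may thus be inserted before
	  \<open>f (z-w)\<close> is replaced by \<open>dd f z w\<close>.\<close>
	obtain J where J: "R + norm z < sc J" using sc_unbounded by blast
	have supp: "norm (fst w) < sc J" "norm (snd w) < sc J" if "f (z-w) ~= 0" for w
		using R[OF that] norm_triangle_ineq2[of w z] J norm_fst_le[of "fst w" "snd w"] norm_snd_le[of "snd w" "fst w"] by (simp_all add: norm_minus_commute)
	define th where "th s = zet (s/sc J)" for s
	have th: "0 <= th s" "th s <= 1" "s <= sc J ==> th s = 1" "th s ~= 0 ==> s <= 2 * sc J" for s
		using order_trans[of s "sc J" "sc J*2"] by (auto simp: th_def zet_def field_simps min_def max_def split: if_splits)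
	define Q where Q0: "Q = cutK J K"
	have Q_def: "Q w = of_bool (fst w ~= 0 & snd w ~= 0)*(th (norm (fst w))*th (norm (snd w))*K (fst w) (snd w))" for w
		by (simp add: Q0 cutK_def th_def)
	have QK: "|Q w| <= |K (fst w) (snd w)|" for w
	proof -
		have "|th (norm (fst w))*th (norm (snd w))|*|K (fst w) (snd w)| <= 1*|K (fst w) (snd w)|"
			using th(1,2) by (intro mult_right_mono) (auto simp: abs_mult mult_le_one)
		then show ?thesis by (simp add: Q_def abs_mult)
	qed
	define q where "q N = KN K (- int N) (J + 2)" for N
	let ?X = "%N x. \<Sum>j\<in>{- int N..<J + 2}. chi j (norm x)"
	have qX: "q N w = ?X N (fst w)*?X N (snd w)*K (fst w) (snd w)" for N w
		by (simp only: q_def KN_eq)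
	have qQ: "|q N w| <= |Q w|" for N w
	proof (cases "fst w ~= 0 & snd w ~= 0")
		case True
		have "|?X N (fst w)| <= th (norm (fst w))" "|?X N (snd w)| <= th (norm (snd w))"
			unfolding th_def using chi_sum_le[of _ "- int N" "J + 2"] by simp_all
		then show ?thesis using True th(1) unfolding qX Q_def abs_mult by (auto intro!: mult_mono)
	qed (auto simp: q_def KN_axes)
	have qlim: "(%N. q N w) ----> Q w" for w unfolding q_def Q0 by (rule KN_tendsto)
	have nq: "nice (q N)" for N unfolding q_def by (rule nice_KN[OF K])
	have [measurable]: "Q \<in> BM" unfolding Q0 by (rule cutK_measurable[OF K])
	have dm[measurable]: "dd f z \<in> BM" using nf[THEN nice_meas] unfolding dd_def[abs_def] by measurable
	define g where "g x = indicator (cball 0 (2 * sc J)) x*norm x powr (1/2-?n)" for x :: 'a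
	define g' where "g' y = indicator (cball 0 (2 * sc J)) y*norm y powr (1/2-?m)" for y :: 'b
	have gm[measurable]: "g \<in> BM" "g' \<in> BM" unfolding g_def[abs_def] g'_def[abs_def]
		by (intro borel_measurable_times borel_measurable_indicator powr_real_measurable; simp)+
	have g0: "0 <= g x" "0 <= g' y" for x y by (simp_all add: g_def g'_def)
	define D where "D w = 2*L*C0*(g (fst w)*g' (snd w))" for w
	have D0: "0 <= D w" for w using L C0 g0 by (simp add: D_def)
	have gI: "(NN x. ennreal (g x)) < \<infinity>" "(NN y. ennreal (g' y)) < \<infinity>"
		unfolding g_def g'_def by (rule norm_powr_integrable, simp)+
	have "(NN w. ennreal (g (fst w))*ennreal (g' (snd w))) < \<infinity>"
		using gI by (subst nn_integral_ten) (auto simp: ennreal_mult_less_top)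
	then have "integrable lborel (%w. g (fst w)*g' (snd w))"
		using g0 by (intro integrableI_nonneg) (auto simp: ennreal_mult)
	then have Di: "integrable lborel D" unfolding D_def[abs_def] by (rule integrable_mult_right)
	have bd: "|dd f z w*u| <= D w" if u: "|u| <= |Q w|" for u w
	proof (cases "Q w = 0")
		case False
		then have w: "fst w ~= 0" "snd w ~= 0" and le: "norm (fst w) <= 2 * sc J" "norm (snd w) <= 2 * sc J" using th(4) by (auto simp: Q_def split: if_splits)
		have "|u| <= |K (fst w) (snd w)|" by (rule order_trans[OF u QK])
		also have "... <= C0/norm (snd w)^?m/norm (fst w)^?n" using K w unfolding rk_def by simp
		finally have "|dd f z w|*|u| <= (2*L*(norm (fst w) powr (1/2)*norm (snd w) powr (1/2)))*(C0/norm (snd w)^?m/norm (fst w)^?n)"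
			using L C0 by (intro mult_mono dd_bound[OF L]) auto
		also have "... = D w" using w le by (simp add: D_def g_def g'_def powr_diff powr_realpow mult_ac)
		finally show ?thesis by (simp add: abs_mult)
	qed (use u D0 in auto)
	define L0 where "L0 = (LBINT w. dd f z w*Q w)"
	have Qi: "integrable lborel (%w. dd f z w*Q w)"
		by (rule Bochner_Integration.integrable_bound[OF Di]) (use bd D0 in auto)
	have "(%N. LBINT w. dd f z w*q N w) ----> L0"
		unfolding L0_def
	proof (rule integral_dominated_convergence[OF _ _ Di])
		show "(%w. dd f z w*q N w) \<in> borel_measurable lborel" for N using nq[of N, THEN nice_meas] by measurable
		show "AE w in lborel. (%N. dd f z w*q N w) ----> dd f z w*Q w" by (intro AE_I2 tendsto_mult tendsto_const qlim)
		show "AE w in lborel. norm (dd f z w*q N w) <= D w" for N using bd qQ by auto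
	qed measurable
	moreover have "eventually (%N. (LBINT w. dd f z w*q N w) = conv (?k N) f z) sequentially"
	proof (rule eventually_sequentiallyI)
		fix N :: nat assume N: "nat |J + 2| <= N"
		have "conv (?k N) f z = (LBINT w. f (z-w)*KN K (- int N) (int N) w)"
			by (simp only: conv_commute[OF nice_KN[OF K] nf]) (simp add: conv_def)
		also have "... = (LBINT w. f (z-w)*q N w)"
		proof (rule Bochner_Integration.integral_cong[OF refl])
			fix w
			show "f (z-w)*KN K (- int N) (int N) w = f (z-w)*q N w"
			proof (cases "f (z-w) = 0")
				case False
				have "(\<Sum>j\<in>{- int N..<int N}. chi j s) = (\<Sum>j\<in>{- int N..<J + 2}. chi j s)" if "s < sc J" for s
				proof -
					have "sc J <= sc (int N-2)" using N by (intro sc_mono) linarith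
					then have "zet (s/sc (int N-2)) = 1" "zet (s/sc J) = 1" using that by (simp_all add: zet_def field_simps)
					moreover have "- int N <= int N" "- int N <= J + 2" using N by linarith+
					ultimately show ?thesis by (simp add: chi_sum')
				qed
				then have "KN K (- int N) (int N) w = ?X N (fst w)*?X N (snd w)*K (fst w) (snd w)"
					using supp[OF False] by (simp add: KN_eq)
				then show ?thesis by (simp add: qX)
			qed simp
		qed
		also have "... = (LBINT w. dd f z w*q N w)"
		proof (rule dd_rep(1)[OF nf nq])
			have a: "nice (KJ K j k)" "!!y. (LBINT x. KJ K j k (x, y)) = 0" "!!x. (LBINT y. KJ K j k (x, y)) = 0" for j k
				using atom2_KJ[OF K, of j k] by (auto simp: atom2_def)
			show "(LBINT x. q N (x, y)) = 0" for y
				unfolding q_def KN_def by (simp add: a nice_int nice_section1)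
			show "(LBINT y. q N (x, y)) = 0" for x
				unfolding q_def KN_def by (simp add: a nice_int nice_section2)
		qed
		finally show "(LBINT w. dd f z w*q N w) = conv (?k N) f z" by simp
	qed
	ultimately have 1: "(%N. conv (?k N) f z) ----> L0" by (rule Lim_transform_eventually)
	define b where "b e1 e2 w = (of_bool (e1 < norm (fst w) & e2 < norm (snd w)) :: real)" for e1 e2 and w :: "'a \<times> 'b"
	have bm[measurable]: "b e1 e2 \<in> BM" for e1 e2 unfolding b_def[abs_def] by measurable
	have b01: "0 <= b e1 e2 w" "b e1 e2 w <= 1" for e1 e2 w by (auto simp: b_def)
	let ?b = "%e1 e2 w. b e1 e2 w*Q w" and ?D = "%e w. D w*(1-b e e w)"
	have sharp: "(?S e1 e2) = (LBINT w. dd f z w*(?b e1 e2 w))"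
		if v: "0 < e1" "0 < e2" "e1 <= sc J" "e2 <= sc J" for e1 e2
	proof -
		have "(?S e1 e2) = (LBINT w. f (z-w)*(?b e1 e2 w))"
			unfolding set_lebesgue_integral_def
		proof (rule Bochner_Integration.integral_cong[OF refl])
			fix w
			show "indicator {w. norm (fst w) > e1 & norm (snd w) > e2} w *\<^sub>R (f (z-w)*K (fst w) (snd w)) = f (z-w)*(?b e1 e2 w)"
			proof (cases "f (z-w) = 0")
				case False
				then have "th (norm (fst w)) = 1" "th (norm (snd w)) = 1" using supp[OF False] th(3) by auto
				then show ?thesis using v by (auto simp: b_def Q_def)
			qed simp
		qed
		also have "... = (LBINT w. dd f z w*(?b e1 e2 w))"
		proof (rule dd_rep(1)[OF nf])
			let ?h = "%v s. of_bool (v < s)*zet (s/sc J)"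
			have e: "?b e1 e2 (x, y) = ?h e2 (norm y)*(?h e1 (norm x)*K x y)"
				"?b e1 e2 (x, y) = ?h e1 (norm x)*(?h e2 (norm y)*K x y)" for x y
				using v by (auto simp: b_def Q_def th_def)
			show "nice (%w. ?b e1 e2 w)"
			proof (rule niceI[of _ "C0/e2^?m/e1^?n" "2 * sc J + 2 * sc J"])
				show "|?b e1 e2 w| <= C0/e2^?m/e1^?n" for w
				proof (cases "?b e1 e2 w = 0")
					case False
					then have w: "e1 < norm (fst w)" "e2 < norm (snd w)" "fst w ~= 0" "snd w ~= 0" by (auto simp: b_def Q_def split: if_splits)
					have "|?b e1 e2 w| <= |K (fst w) (snd w)|" using QK w by (simp add: b_def)
					also have "... <= C0/norm (snd w)^?m/norm (fst w)^?n" using K w unfolding rk_def by simp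
					also have "... <= C0/e2^?m/e1^?n"
						using w v C0 by (intro frac_le divide_left_mono power_mono) auto
					finally show ?thesis .
				qed (use C0 v in auto)
				show "norm w <= 2 * sc J + 2 * sc J" if "?b e1 e2 w ~= 0" for w
					using that th(4)[of "norm (fst w)"] th(4)[of "norm (snd w)"] norm_triangle_ineq[of "(fst w, 0)" "(0, snd w)"]
					by (cases w) (auto simp: Q_def norm_Pair split: if_splits)
			qed measurable
			show "(LBINT x. ?b e1 e2 (x, y)) = 0" for y
			proof (cases "y = 0")
				case False
				have "(LBINT x. ?h e1 (norm x)*K x y) = 0"
					by (rule radial_cancellation(2)[OF rk_hk(1)[OF K False]]) (use K C0 v False in \<open>auto simp: rk_def\<close>)
				then show ?thesis unfolding e(1) by (simp only: integral_mult_right_zero mult_zero_right)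
			qed (simp add: Q_def)
			show "(LBINT y. ?b e1 e2 (x, y)) = 0" for x
			proof (cases "x = 0")
				case False
				have "(LBINT y. ?h e2 (norm y)*K x y) = 0"
					by (rule radial_cancellation(2)[OF rk_hk(1)[OF rk_swap[OF K] False]]) (use K C0 v False in \<open>auto simp: rk_def\<close>)
				then show ?thesis unfolding e(2) by (simp only: integral_mult_right_zero mult_zero_right)
			qed (simp add: Q_def)
		qed
		finally show ?thesis .
	qed
	define e where "e n = 1/real (Suc n)" for n
	have e0: "e ----> 0" unfolding e_def[abs_def] using LIMSEQ_inverse_real_of_nat by (simp add: inverse_eq_divide)
	have elim: "eventually (%n. e n < c) sequentially" if "0 < c" for c using order_tendstoD(2)[OF e0 that] .
	\<comment> \<open>One sequence of truncations with equal radii controls all pairs: for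
	  \<open>e1\<close> and \<open>e2\<close> below \<open>e n\<close>, the integrals differ from
	  \<open>L0\<close> by at most that of \<open>D\<close> over the points with a component of norm at
	  most \<open>e n\<close>.\<close>
	have "(%n. LBINT w. ?D (e n) w) ----> (LINT w|(lborel :: ('a \<times> 'b) measure). 0 :: real)"
	proof (rule integral_dominated_convergence[OF _ _ Di])
		have Dm: "D \<in> BM" using Di by (simp add: borel_measurable_integrable)
		show "(%w. ?D (e n) w) \<in> borel_measurable lborel" for n using Dm by measurable
		show "AE w in lborel. norm (?D (e n) w) <= D w" for n
			using D0 b01 by (auto simp: abs_mult intro!: mult_left_le)
		show "AE w in lborel. (%n. ?D (e n) w) ----> 0"
			using AE_off_axes
		proof eventually_elim
			case (elim w)
			have "eventually (%n. ?D (e n) w = 0) sequentially"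
				using \<open>!!c. 0 < c ==> eventually (%n. e n < c) sequentially\<close>[of "min (norm (fst w)) (norm (snd w))"] elim
				by (auto elim!: eventually_mono simp: b_def)
			then show ?case by (rule tendsto_eventually)
		qed
	qed simp
	then have E: "(%n. LBINT w. ?D (e n) w) ----> 0" by simp
	have 2: "((%(e1, e2). ?S e1 e2) \<longlongrightarrow> L0) (at_right 0 \<times>\<^sub>F at_right 0)"
	proof (rule tendstoI)
		fix d :: real assume "0 < d"
		then have "eventually (%n. (LBINT w. ?D (e n) w) < d & e n < sc J) sequentially"
			using order_tendstoD(2)[OF E] elim[OF sc_pos(1)] by (intro eventually_conj) auto
		then obtain n where n: "(LBINT w. ?D (e n) w) < d" "e n < sc J" by (auto simp: eventually_sequentially)
		have en: "0 < e n" by (simp add: e_def)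
		have close: "dist (?S e1 e2) L0 < d"
			if v: "0 < e1" "e1 < e n" "0 < e2" "e2 < e n" for e1 e2
		proof -
			have bQ: "|?b e1 e2 w| <= |Q w|" for w by (simp add: b_def)
			have bi: "integrable lborel (%w. dd f z w*(?b e1 e2 w))"
				by (rule Bochner_Integration.integrable_bound[OF Di], measurable, rule AE_I2) (use bd[OF bQ] D0 in simp)
			have Db: "|?D (e n) w| <= |D w|" for w by (simp add: b_def)
			have Dbi: "integrable lborel (%w. ?D (e n) w)"
				by (rule Bochner_Integration.integrable_bound[OF Di]) (use Db borel_measurable_integrable[OF Di] in \<open>simp_all\<close>)
			have "|(LBINT w. dd f z w*(?b e1 e2 w))-L0| = |LBINT w. dd f z w*(?b e1 e2 w)-dd f z w*Q w|"
				unfolding L0_def using bi Qi by simp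
			also have "... <= (LBINT w. |dd f z w*(?b e1 e2 w)-dd f z w*Q w| )" by (rule integral_abs_bound)
			also have "... <= (LBINT w. ?D (e n) w)"
			proof (rule integral_mono)
				show "integrable lborel (%w. |dd f z w*(?b e1 e2 w)-dd f z w*Q w| )" using bi Qi by simp
				show "integrable lborel (%w. ?D (e n) w)" by (rule Dbi)
				fix w
				show "|dd f z w*(?b e1 e2 w)-dd f z w*Q w| <= ?D (e n) w"
					using bd[OF order_refl, of w] v D0[of w] by (auto simp: b_def)
			qed
			also have "... < d" by (rule n(1))
			finally show ?thesis using sharp[of e1 e2] v n(2) by (simp add: dist_real_def)
		qed
		have ev: "eventually (%t. 0 < t & t < e n) (at_right 0)" using en by (auto simp: eventually_at_right_field)
		show "\<forall>\<^sub>F x in at_right 0 \<times>\<^sub>F at_right 0. dist (case x of (e1, e2) => ?S e1 e2) L0 < d"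
			unfolding eventually_prod_filter using ev close by (intro exI[of _ "%t. 0 < t & t < e n"]) auto
	qed
	show ?thesis using 1 2 by blast
qed

section \<open>Extension to weighted Lebesgue spaces\<close>

lemma Lc_lin: assumes "Lc f" "Lc g" shows "Lc (%z. a*f z + b*g z)"
proof -
	obtain L M where L: "0 <= L" "!!z w. |f z-f w| <= L*norm (z-w)" and M: "0 <= M" "!!z w. |g z-g w| <= M*norm (z-w)"
		using assms unfolding Lc_def by blast
	have "|(a*f z + b*g z)-(a*f w + b*g w)| <= ( |a|*L + |b|*M)*norm (z-w)" for z w
	proof -
		have "(a*f z + b*g z)-(a*f w + b*g w) = a*(f z-f w) + b*(g z-g w)" by (simp add: algebra_simps)
		also have "|...| <= |a|*|f z-f w| + |b|*|g z-g w|" unfolding abs_mult[symmetric] by (rule abs_triangle_ineq)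
		also have "... <= |a|*(L*norm (z-w)) + |b|*(M*norm (z-w))" by (intro add_mono mult_left_mono L M) auto
		finally show ?thesis by (simp add: algebra_simps)
	qed
	then show ?thesis using assms L(1) M(1) unfolding Lc_def by (auto intro!: nice_add nice_cmult exI[of _ "|a|*L + |b|*M"])
qed

lemma Lc_conv_phi:
	fixes g :: "'a::euclidean_space => real"
	assumes g: "nice g" shows "Lc (conv (phi l) g)"
proof -
	define c where "c = 1/(sc l^(DIM('a) + 1)*bz TYPE('a))"
	have c: "|phi l (x :: 'a)-phi l y| <= c*norm (x-y)" "0 <= c" for x y
		using phi_lip[of l x y] bz_pos[where 'a='a] by (simp_all add: c_def)
	have "|conv (phi l) g z-conv (phi l) g w| <= (c*(LBINT t. |g t| ))*norm (z-w)" for z w :: 'a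
	proof -
		have i: "integrable lborel (%t. phi l (x-t)*g t)" for x by (rule nice_conv_integrable[OF nice_phi g])
		have "|conv (phi l) g z-conv (phi l) g w| = |LBINT t. (phi l (z-t)-phi l (w-t))*g t|"
			using i by (simp add: conv_def left_diff_distrib)
		also have "... <= (LBINT t. |(phi l (z-t)-phi l (w-t))*g t| )" by (rule integral_abs_bound)
		also have "... <= (LBINT t. c*norm (z-w)*|g t| )"
		proof (rule integral_mono)
			show "integrable lborel (%t. |(phi l (z-t)-phi l (w-t))*g t| )" using i by (simp add: left_diff_distrib)
			show "integrable lborel (%t. c*norm (z-w)*|g t| )" by (intro nice_int nice_cmult nice_abs g)
			show "|(phi l (z-t)-phi l (w-t))*g t| <= c*norm (z-w)*|g t|" for t
				unfolding abs_mult using c(1)[of "z-t" "w-t"] by (intro mult_right_mono) auto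
		qed
		finally show ?thesis by (simp add: mult_ac)
	qed
	then show ?thesis using c(2) unfolding Lc_def by (auto intro!: nice_conv nice_phi g exI[of _ "c*(LBINT t. |g t| )"])
qed

lemma ennreal_squeeze0: "(!!n. a n <= b n) ==> b ----> 0 ==> a ----> (0 :: ennreal)"
	by (rule tendsto_sandwich[OF always_eventually always_eventually tendsto_const]) auto

context bicz
begin

definition np :: "('a \<times> 'b => real) => ('a \<times> 'b => real) => ennreal" where
	"np Q u = (NN z. ennreal (Q z)*ennreal ( |u z| powr p))"

abbreviation "bl k l == indicator (S k \<times> S' l) :: 'a \<times> 'b => real"
abbreviation "w0 == wt 0 0"

lemma np_mono:
	assumes "AE z in lborel. |u z| <= |v z|" shows "np Q u <= np Q v"
	unfolding np_def
	by (rule nn_integral_mono_AE, use assms in eventually_elim) (use p in \<open>auto intro!: mult_left_mono ennreal_leI powr_mono2\<close>)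

lemma np_weight:
	fixes Q V :: "'a \<times> 'b => real" and a :: real
	assumes "!!z. Q z <= a*V z" "0 <= a" "!!z. 0 <= V z" "V \<in> BM" "u \<in> BM"
	shows "np Q u <= ennreal a*np V u"
proof -
	note assms(4,5)[measurable]
	have "np Q u <= (NN z. ennreal a*(ennreal (V z)*ennreal ( |u z| powr p)))"
		unfolding np_def
	proof (rule nn_integral_mono)
		fix z
		have "ennreal (Q z) <= ennreal a*ennreal (V z)" using assms(1-3) by (simp add: ennreal_mult[symmetric] ennreal_leI)
		then show "ennreal (Q z)*ennreal ( |u z| powr p) <= ennreal a*(ennreal (V z)*ennreal ( |u z| powr p))"
			unfolding mult.assoc[symmetric] by (rule mult_right_mono) simp
	qed
	then show ?thesis by (simp add: np_def nn_integral_cmult)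
qed

lemma np_add:
	assumes [measurable]: "Q \<in> BM" "u \<in> BM" "v \<in> BM"
	shows "np Q (%z. u z + v z) <= ennreal (2 powr p)*(np Q u + np Q v)"
proof -
	have pt: "|u z + v z| powr p <= 2 powr p*( |u z| powr p + |v z| powr p)" for z
	proof -
		have "|u z + v z| powr p <= (2*max |u z| |v z| ) powr p" using p by (intro powr_mono2) auto
		also have "... = 2 powr p*max |u z| |v z| powr p" by (rule powr_mult)
		also have "... <= 2 powr p*( |u z| powr p + |v z| powr p)" by (intro mult_left_mono) (auto simp: max_def)
		finally show ?thesis .
	qed
	have "np Q (%z. u z + v z) <= (NN z. ennreal (2 powr p)*(ennreal (Q z)*ennreal ( |u z| powr p) + ennreal (Q z)*ennreal ( |v z| powr p)))"
		unfolding np_def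
	proof (rule nn_integral_mono)
		fix z
		have "ennreal (Q z)*ennreal ( |u z + v z| powr p) <= ennreal (Q z)*ennreal (2 powr p*( |u z| powr p + |v z| powr p))"
			by (intro mult_left_mono ennreal_leI pt) auto
		then show "ennreal (Q z)*ennreal ( |u z + v z| powr p) <= ennreal (2 powr p)*(ennreal (Q z)*ennreal ( |u z| powr p) + ennreal (Q z)*ennreal ( |v z| powr p))"
			by (simp add: ennreal_mult distrib_left mult_ac)
	qed
	also have "... = ennreal (2 powr p)*(np Q u + np Q v)"
		unfolding np_def by (subst nn_integral_cmult, measurable) (subst nn_integral_add, auto)
	finally show ?thesis .
qed

lemma np_fatou:
	assumes [measurable]: "Q \<in> BM" "!!n. u n \<in> BM"
		and lim: "AE z in lborel. Q z ~= 0 --> (%n. u n z) ----> v z"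
		and le: "!!n. np Q (u n) <= b n" and b: "b ----> a"
	shows "np Q v <= a"
proof -
	have "np Q v <= (NN z. liminf (%n. ennreal (Q z)*ennreal ( |u n z| powr p)))"
		unfolding np_def
	proof (rule nn_integral_mono_AE, use lim in eventually_elim)
		case (elim z)
		show ?case
		proof (cases "Q z = 0")
			case False
			have "(%n. ennreal (Q z*|u n z| powr p)) ----> ennreal (Q z*|v z| powr p)"
				using elim False p by (intro tendsto_ennrealI tendsto_mult tendsto_powr' tendsto_rabs tendsto_const) auto
			then show ?thesis by (simp add: lim_imp_Liminf ennreal_mult''[OF powr_ge_zero])
		qed simp
	qed
	also have "... <= liminf (%n. np Q (u n))" unfolding np_def by (rule nn_integral_liminf) measurable
	also have "... <= liminf b" by (intro Liminf_mono always_eventually allI le)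
	also have "... = a" by (rule lim_imp_Liminf[OF _ b]) simp
	finally show ?thesis .
qed

text \<open>Moving the base block costs a constant depending on \<open>k\<close> and
  \<open>l\<close>. Hence convergence in the space of \<open>w0\<close> implies convergence of the
  images on every block.\<close>

lemma wt_le: "EX c>0. ALL z. wt k l z <= c*w0 z"
proof (intro exI conjI allI)
	have o: "om tw de (i-k) <= 2 powr (tw*k + de*|real_of_int k| ) * om tw de i" for i k
	proof -
		have "de*|real_of_int i| <= de*( |real_of_int (i-k)| + |real_of_int k| )" using de(1) by (intro mult_left_mono) auto
		then show ?thesis unfolding om_def powr_add[symmetric] by (intro powr_mono) (auto simp: algebra_simps)
	qed
	show "wt k l z <= (2 powr (tw*k + de*|real_of_int k| )*2 powr (tw*l + de*|real_of_int l| ))*w0 z" for z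
		using mult_mono[OF o[of "ix S (fst z)" k] o[of "ix S' (snd z)" l]] by (simp add: wt_def mult_ac)
qed simp

lemma om_le_powr:
	fixes T :: "int => 'c::euclidean_space set"
	assumes "ann c T" "x ~= 0" shows "om tw de (ix T x) <= 2 powr ( |tw|*c)*norm x powr (- tw)"
proof -
	have "x \<in> (\<Union>k. T k)" using assms by (simp add: ann_def)
	then obtain i where i: "x \<in> T i" by blast
	have n: "sc (i-c) <= norm x" "norm x <= sc (i + c)" using assms(1) i by (auto simp: ann_def)
	have "om tw de i <= 2 powr (- tw*i)" using de(1) by (auto simp: om_def intro!: powr_mono)
	also have "... <= 2 powr ( |tw|*c)*norm x powr (- tw)"
	proof (cases "0 <= tw")
		case True
		have "sc (i + c) powr (- tw) <= norm x powr (- tw)" using n True assms(2) by (intro powr_mono2') auto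
		then have "2 powr ( |tw|*c) * sc (i + c) powr (- tw) <= 2 powr ( |tw|*c)*norm x powr (- tw)" by (intro mult_left_mono) auto
		then show ?thesis using True by (simp add: sc_def powr_powr powr_add[symmetric] algebra_simps)
	next
		case False
		have "sc (i-c) powr (- tw) <= norm x powr (- tw)" using n False by (intro powr_mono2) auto
		then have "2 powr ( |tw|*c) * sc (i-c) powr (- tw) <= 2 powr ( |tw|*c)*norm x powr (- tw)" by (intro mult_left_mono) auto
		then show ?thesis using False by (simp add: sc_def powr_powr powr_add[symmetric] algebra_simps)
	qed
	finally show ?thesis by (simp add: ix_eq[OF assms(1) i])
qed

text \<open>Off the axes \<open>w0\<close> is at most a constant times the product of the powers
  \<open>- tw\<close> of the two norms, and \<open>tw\<close> is smaller than both dimensions; so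
  \<open>w0\<close> is locally integrable and the space contains all nice functions.\<close>

lemma w0_ball: "np w0 (%z. B*indicator (cball 0 R) z) < \<infinity>"
proof -
	let ?e = "2 powr ( |tw|*c) :: real"
	let ?g = "%x::'a. indicator (cball 0 R) x*norm x powr (- tw)" and ?h = "%y::'b. indicator (cball 0 R) y*norm y powr (- tw)"
	have e: "(DIM('a)-tw)-DIM('a) = - tw" "(DIM('b)-tw)-DIM('b) = - tw" and "0 < DIM('a)-tw" "0 < DIM('b)-tw" using de by auto
	then have f: "(NN x. ennreal (?g x)) < \<infinity>" "(NN y. ennreal (?h y)) < \<infinity>"
		using norm_powr_integrable[of "DIM('a)-tw" R, where 'a='a] norm_powr_integrable[of "DIM('b)-tw" R, where 'a='b] unfolding e by simp_all
	have m[measurable]: "?g \<in> BM" "?h \<in> BM"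
		by (intro borel_measurable_times borel_measurable_indicator powr_real_measurable; simp)+
	have "np w0 (%z. B*indicator (cball 0 R) z) <= (NN z. ennreal ( |B| powr p*(?e*?e))*(ennreal (?g (fst z))*ennreal (?h (snd z))))"
		unfolding np_def
	proof (rule nn_integral_mono_AE, use AE_off_axes in eventually_elim)
		case (elim z)
		show ?case
		proof (cases "z \<in> cball 0 R")
			case True
			then have "norm (fst z) <= R" "norm (snd z) <= R" using norm_fst_le[of "fst z" "snd z"] norm_snd_le[of "snd z" "fst z"] by auto
			moreover have "w0 z*|B| powr p <= (?e*norm (fst z) powr (- tw))*(?e*norm (snd z) powr (- tw))*|B| powr p"
				using om_le_powr[OF S, of "fst z"] om_le_powr[OF S', of "snd z"] elim unfolding wt_def by (intro mult_right_mono mult_mono) auto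
			ultimately show ?thesis using True by (simp add: ennreal_mult[symmetric] mult_ac ennreal_leI)
		qed (use p in simp)
	qed
	also have "... = ennreal ( |B| powr p*(?e*?e))*((NN x. ennreal (?g x))*(NN y. ennreal (?h y)))"
		by (subst nn_integral_cmult, measurable) (subst nn_integral_ten, auto)
	also have "... < \<infinity>" using f by (simp add: ennreal_mult_less_top)
	finally show ?thesis .
qed

definition X :: "('a \<times> 'b => real) => bool" where
	"X f \<longleftrightarrow> f \<in> BM & np w0 f < \<infinity>"

lemma X_nice: assumes "nice f" shows "X f"
proof -
	obtain B R where B: "!!x. |f x| <= B" "!!x. f x ~= 0 ==> norm x <= R" "B > 0" using assms by (metis niceE)
	have "np w0 f <= np w0 (%z. B*indicator (cball 0 R) z)" using B by (intro np_mono AE_I2) (auto simp: indicator_def)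
	then show ?thesis using w0_ball[of B R] assms by (simp add: X_def nice_meas le_less_trans)
qed

lemma np_diff_tendsto:
	assumes [measurable]: "f \<in> BM" "!!n. h n \<in> BM" "H \<in> BM"
		and lim: "AE z in lborel. (%n. h n z) ----> f z" and le: "!!n z. |f z-h n z| <= |H z|" and fin: "np w0 H < \<infinity>"
	shows "(%n. np w0 (%z. f z-h n z)) ----> 0"
proof -
	have "(%n. np w0 (%z. f z-h n z)) ----> (\<integral>\<^sup>+z. 0 \<partial>(lborel :: ('a \<times> 'b) measure))"
		unfolding np_def
	proof (rule nn_integral_dominated_convergence[where w = "%z. ennreal (w0 z)*ennreal ( |H z| powr p)"])
		show "AE z in lborel. (%n. ennreal (w0 z)*ennreal ( |f z-h n z| powr p)) ----> 0"
			using lim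
		proof eventually_elim
			case (elim z)
			then have "(%n. ennreal (w0 z*|f z-h n z| powr p)) ----> ennreal (w0 z*|f z-f z| powr p)"
				using p by (intro tendsto_ennrealI tendsto_mult tendsto_powr' tendsto_rabs tendsto_diff tendsto_const) auto
			then show ?case using p by (simp add: ennreal_mult)
		qed
		show "AE z in lborel. ennreal (w0 z)*ennreal ( |f z-h n z| powr p) <= ennreal (w0 z)*ennreal ( |H z| powr p)" for n
			using le p by (intro AE_I2 mult_left_mono ennreal_leI powr_mono2) auto
	qed (use fin in \<open>auto simp: np_def\<close>)
	then show ?thesis by simp
qed

definition Ap :: "('a \<times> 'b => real) => bool" where
	"Ap f \<longleftrightarrow> (ALL e>0. EX g. Lc g & np w0 (%z. f z-g z) < ennreal e)"

lemma Ap_limit: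
	assumes f: "f \<in> BM" and h: "!!n. h n \<in> BM" "!!n. Ap (h n)" and H: "H \<in> BM"
		and lim: "AE z in lborel. (%n. h n z) ----> f z" and le: "!!n z. |f z-h n z| <= |H z|" and fin: "np w0 H < \<infinity>"
	shows "Ap f"
	unfolding Ap_def
proof (intro allI impI)
	fix e :: real assume e: "0 < e"
	let ?e = "e/(4*2 powr p)"
	have e1: "?e > 0" using e by simp
	then have "eventually (%n. np w0 (%z. f z-h n z) < ennreal ?e) sequentially"
		using np_diff_tendsto[OF f h(1) H lim le fin] by (intro order_tendstoD) auto
	then obtain n where n: "np w0 (%z. f z-h n z) < ennreal ?e" by (auto simp: eventually_sequentially)
	obtain g where g: "Lc g" "np w0 (%z. h n z-g z) < ennreal ?e" using h(2)[of n] e1 unfolding Ap_def by blast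
	have gm: "g \<in> BM" using g(1) by (simp add: Lc_def nice_meas)
	have "np w0 (%z. f z-g z) = np w0 (%z. (f z-h n z) + (h n z-g z))" by simp
	also have "... <= ennreal (2 powr p)*(np w0 (%z. f z-h n z) + np w0 (%z. h n z-g z))"
		using f h(1) gm by (intro np_add) auto
	also have "... <= ennreal (2 powr p)*(ennreal ?e + ennreal ?e)" using n g by (intro mult_left_mono add_mono) auto
	also have "... = ennreal (e/2)" using e by (simp add: ennreal_plus[symmetric] ennreal_mult[symmetric] del: ennreal_plus)
	also have "... < ennreal e" using e by (simp add: ennreal_less_iff)
	finally show "EX g. Lc g & np w0 (%z. f z-g z) < ennreal e" using g(1) by blast
qed

lemma ball_meas: "(%z::'a \<times> 'b. B*indicator (cball 0 R) z :: real) \<in> BM"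
	by (intro borel_measurable_times borel_measurable_indicator) auto

text \<open>Density in stages: averages of continuous functions are Lipschitz, nice functions are
  limits of continuous ones, and truncation in height and radius reaches the whole space. Each stage
  is dominated convergence through \<open>Ap_limit\<close>.\<close>

lemma Ap_X:
	assumes f: "X f" shows "Ap f"
proof -
	have Ap_Lc: "Ap g" if "Lc g" for g unfolding Ap_def np_def using that p by (auto intro!: exI[of _ g])
	have Ap_cont: "Ap g" if g: "nice g" "continuous_on UNIV g" for g
	proof -
		obtain B R where B: "!!x. |g x| <= B" "!!x. g x ~= 0 ==> norm x <= R" "B > 0" using g(1) by (metis niceE)
		let ?h = "%n. conv (phi (- int n)) g"
		show ?thesis
		proof (rule Ap_limit[where h = ?h and H = "%z. 2*B*indicator (cball 0 (R + 1)) z"])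
			show "AE z in lborel. (%n. ?h n z) ----> g z" by (intro AE_I2 conv_phi_tendsto g)
			show "|g z-?h n z| <= |2*B*indicator (cball 0 (R + 1)) z|" for n z
			proof (cases "norm z <= R + 1")
				case True
				have "|?h n z| <= B" by (rule abs_conv_phi_le[OF g(1) B(1)])
				then show ?thesis using True B(1)[of z] by simp
			next
				case False
				have z0: "phi (- int n) (z-t)*g t = 0" for t
				proof (rule ccontr)
					assume "phi (- int n) (z-t)*g t ~= 0"
					then have "norm (z-t) <= sc (- int n)" "norm t <= R" using phi_supp B(2) by auto
					moreover have "sc (- int n) <= sc 0" by (rule sc_mono) simp
					ultimately show False using norm_triangle_ineq[of "z-t" t] False by simp
				qed
				have "?h n z = 0" unfolding conv_def by (simp only: z0 integral_zero)
				moreover have "g z = 0" using B(2)[of z] False by (cases "g z = 0") auto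
				ultimately show ?thesis by simp
			qed
		qed (use w0_ball ball_meas in \<open>auto intro!: nice_meas nice_conv nice_phi g Ap_Lc Lc_conv_phi\<close>)
	qed
	have Ap_nice: "Ap g" if g: "nice g" for g
	proof -
		obtain B R where B: "!!x. |g x| <= B" "!!x. g x ~= 0 ==> norm x <= R" "B > 0" using g by (metis niceE)
		obtain h B' R' where h: "!!n::nat. continuous_on UNIV (h n)" "!!n x. |h n x| <= B'" "!!n x. h n x ~= 0 ==> norm x <= R'" "AE x in lborel. (%n. h n x) ----> g x" "B' > 0"
			using cont_approx[OF g] by blast
		have nh: "nice (h n)" for n using h by (intro niceI[of _ B' R'] borel_measurable_continuous_onI) auto
		have le: "|g z-h n z| <= |(B + B')*indicator (cball 0 (max R R')) z|" for n z
			using B(1)[of z] B(2)[of z] h(2)[of n z] h(3)[of n z] B(3) h(5) by (cases "norm z <= max R R'"; cases "g z = 0"; cases "h n z = 0") (auto simp: le_max_iff_disj)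
		show ?thesis
			by (rule Ap_limit[OF nice_meas[OF g] nice_meas[OF nh] Ap_cont[OF nh h(1)] ball_meas h(4) le w0_ball])
	qed
	have fm[measurable]: "f \<in> BM" and fin: "np w0 f < \<infinity>" using f by (auto simp: X_def)
	let ?h = "%n z. if |f z| <= real n & norm z <= real n then f z else 0"
	have nh: "nice (?h n)" for n by (rule niceI[of _ "real n" "real n"]) (auto split: if_splits)
	have lim: "(%n. ?h n z) ----> f z" for z
	proof (rule tendsto_eventually, rule eventually_sequentiallyI)
		fix n assume "nat \<lceil>max |f z| (norm z)\<rceil> <= n"
		then show "?h n z = f z" by (auto simp: nat_ceiling_le_eq)
	qed
	show ?thesis
		by (rule Ap_limit[OF fm nice_meas[OF nh] Ap_nice[OF nh] fm AE_I2[OF lim] _ fin]) auto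
qed

section \<open>The operator on Lipschitz functions and its extension by density\<close>

definition T0 :: "('a \<times> 'b => real) => 'a \<times> 'b => real" where
	"T0 f z = lim (%N. conv (KN K (- int N) (int N)) f z)"

lemma T0_lim:
	assumes "Lc f" shows "(%N. conv (KN K (- int N) (int N)) f z) ----> T0 f z"
proof -
	obtain L where L: "(%N. conv (KN K (- int N) (int N)) f z) ----> L" using pv_limit[OF K assms, of z] by blast
	show ?thesis unfolding T0_def limI[OF L] by (rule L)
qed

lemma Lc_meas: "Lc f ==> f \<in> BM" by (simp add: Lc_def nice_meas)

lemma T0_meas: "Lc f ==> T0 f \<in> BM"
	by (rule borel_measurable_LIMSEQ_real[OF T0_lim]) (auto intro!: nice_meas nice_conv nice_KN[OF K] simp: Lc_def)

lemma T0_lin: assumes "Lc f" "Lc g" shows "T0 (%z. a*f z + b*g z) z = a*T0 f z + b*T0 g z"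
proof (rule LIMSEQ_unique[OF T0_lim[OF Lc_lin[OF assms]]])
	have n: "nice f" "nice g" using assms by (auto simp: Lc_def)
	have "conv (KN K (- int N) (int N)) (%z. a*f z + b*g z) z = a*conv (KN K (- int N) (int N)) f z + b*conv (KN K (- int N) (int N)) g z" for N
		unfolding conv_add_right[OF nice_KN[OF K] nice_cmult[OF n(1)] nice_cmult[OF n(2)]] conv_cmult_right ..
	then show "(%N. conv (KN K (- int N) (int N)) (%z. a*f z + b*g z) z) ----> a*T0 f z + b*T0 g z"
		using assms by (simp add: tendsto_add tendsto_mult_left T0_lim)
qed

lemma bl_meas[measurable]: "bl k l \<in> BM" by measurable

lemma T0_bound:
	"EX C>0. ALL (I::'i set) f k l. finite I --> (ALL j. Lc (f j)) -->
		np (bl k l) (%z. vn r I (%j. T0 (f j) z)) <= ennreal C*np (wt k l) (%z. vn r I (%j. f j z))"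
proof -
	show ?thesis
		using local_estimate[where 'i='i]
	proof (elim exE conjE, goal_cases)
	case (1 C)
	note C = 1(1,2)[rule_format]
	show ?thesis
	proof (intro exI[of _ C] conjI allI impI C(1))
		fix I :: "'i set" and f :: "'i => 'a \<times> 'b => real" and k l assume I: "finite I" and "ALL j. Lc (f j)"
		then have f: "Lc (f j)" for j by blast
		have n: "nice (conv (KN K a b) (f j))" "nice (f j)" for a b j using f[of j] by (auto simp: Lc_def intro!: nice_conv nice_KN[OF K])
		show "np (bl k l) (%z. vn r I (%j. T0 (f j) z)) <= ennreal C*np (wt k l) (%z. vn r I (%j. f j z))"
		proof (rule np_fatou[where u = "%N z. vn r I (%j. conv (KN K (- int N) (int N)) (f j) z)"])
			show "AE z in lborel. bl k l z ~= 0 --> (%N. vn r I (%j. conv (KN K (- int N) (int N)) (f j) z)) ----> vn r I (%j. T0 (f j) z)"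
				using p by (intro AE_I2 impI nrm_tendsto T0_lim f) auto
			show "np (bl k l) (%z. vn r I (%j. conv (KN K (- int N) (int N)) (f j) z)) <= ennreal C*np (wt k l) (%z. vn r I (%j. f j z))" for N
				using C(2)[where a = "- int N" and b = "int N" and f = f and k = k and l = l, OF I n(2)] by (simp add: np_def ennreal_indicator)
			show "(%z. vn r I (%j. conv (KN K (- int N) (int N)) (f j) z)) \<in> BM" for N
				by (intro nrm_measurable nice_meas n)
		qed (auto intro: bl_meas)
	qed
	qed
qed

lemma T0_diff_bound: "EX C>0. ALL f g. Lc f --> Lc g --> np (bl k l) (%z. T0 f z-T0 g z) <= ennreal C*np w0 (%z. f z-g z)"
proof -
	show ?thesis
		using T0_bound[where 'i=unit] wt_le[of k l]
	proof (elim exE conjE, goal_cases)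
	case (1 C c')
	note C = 1(1,2)[rule_format] and c' = 1(3,4)[rule_format]
	have vn1: "vn r {()} (%j. x) = |x|" for x using p by (simp add: nrm_def powr_powr powr_half_sqrt[symmetric])
	show ?thesis
	proof (intro exI[of _ "C*c'"] conjI allI impI, goal_cases)
		case (2 f g)
		note fg = 2
		have L: "Lc (%z. f z-g z)" and T: "T0 (%z. f z-g z) z = T0 f z-T0 g z" for z
			using Lc_lin[OF fg, of 1 "-1"] T0_lin[OF fg, of 1 "-1"] by simp_all
		have "np (bl k l) (%z. T0 f z-T0 g z) <= ennreal C*np (wt k l) (%z. f z-g z)"
			using C(2)[of "{()}" "%_ z. f z-g z" k l] L unfolding vn1 T by (simp add: np_def)
		also have "... <= ennreal C*(ennreal c'*np w0 (%z. f z-g z))"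
			using c' fg[THEN Lc_meas] by (intro mult_left_mono np_weight) auto
		finally show ?case
			using C(1) c'(1) by (simp add: ennreal_mult mult.assoc)
	qed (use C(1) c'(1) in simp)
	qed
qed

text \<open>Chosen so that \<open>(2 powr p)^n*eps n\<close> is \<open>(1/2)^n\<close>: the images
  of the approximants then converge almost everywhere, not only in norm.\<close>

definition eps :: "nat => real" where "eps n = (1/(2*2 powr p))^n"

definition ap :: "('a \<times> 'b => real) => nat => 'a \<times> 'b => real" where
	"ap f n = (SOME g. Lc g & np w0 (%z. f z-g z) < ennreal (eps n))"

lemma ap: assumes "X f" shows "Lc (ap f n)" "np w0 (%z. f z-ap f n z) <= ennreal (eps n)"
proof -
	have "EX g. Lc g & np w0 (%z. f z-g z) < ennreal (eps n)" using Ap_X[OF assms] unfolding Ap_def by (simp add: eps_def)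
	from someI_ex[OF this] show "Lc (ap f n)" "np w0 (%z. f z-ap f n z) <= ennreal (eps n)" by (auto simp: ap_def)
qed

lemma eps_lim: "(%n. ennreal (eps n)) ----> 0"
proof -
	have "1/(2*2 powr p) < 1" using p ge_one_powr_ge_zero[of 2 p] by simp
	then show ?thesis unfolding eps_def using tendsto_ennrealI[OF LIMSEQ_power_zero[of "1/(2*2 powr p)"]] by simp
qed

definition T :: "('a \<times> 'b => real) => 'a \<times> 'b => real" where
	"T f z = lim (%n. T0 (ap f n) z)"

lemma np_diff3:
	assumes [measurable]: "f \<in> BM" "g \<in> BM" "h \<in> BM"
	shows "np w0 (%z. g z-h z) <= ennreal (2 powr p)*(np w0 (%z. f z-g z) + np w0 (%z. f z-h z))"
proof -
	have "np w0 (%z. g z-h z) = np w0 (%z. (g z-f z) + (f z-h z))" by simp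
	also have "... <= ennreal (2 powr p)*(np w0 (%z. g z-f z) + np w0 (%z. f z-h z))" by (rule np_add) measurable
	also have "np w0 (%z. g z-f z) = np w0 (%z. f z-g z)" by (simp add: np_def abs_minus_commute)
	finally show ?thesis .
qed

lemma AE_blocks:
	assumes "!!k l. AE z in lborel. z \<in> S k \<times> S' l --> P z" shows "AE z in lborel. P z"
proof -
	have "AE z in lborel. ALL k l. z \<in> S k \<times> S' l --> P z" unfolding AE_all_countable using assms by blast
	with AE_off_axes show ?thesis
	proof eventually_elim
		case (elim z)
		then have "fst z \<in> (\<Union>k. S k)" "snd z \<in> (\<Union>k. S' k)" using S S' by (simp_all add: ann_def)
		then show ?case using elim(2) by (cases z) auto
	qed
qed

text \<open>On each block the differences of consecutive images, multiplied by \<open>2^n\<close>,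
  have summable p-th powers of norms. So almost everywhere they decay like \<open>(1/2)^n\<close>,
  and the telescoping series converges.\<close>

lemma T_lim:
	assumes f: "X f" shows "AE z in lborel. (%n. T0 (ap f n) z) ----> T f z"
proof (rule AE_blocks)
	fix k l
	let ?d = "%n z. T0 (ap f (Suc n)) z-T0 (ap f n) z"
	have m[measurable]: "T0 (ap f n) \<in> BM" "ap f n \<in> BM" "f \<in> BM" for n
		using T0_meas[OF ap(1)[OF f]] Lc_meas[OF ap(1)[OF f]] f by (auto simp: X_def)
	obtain C where C: "C > 0" "!!f g. Lc f ==> Lc g ==> np (bl k l) (%z. T0 f z-T0 g z) <= ennreal C*np w0 (%z. f z-g z)"
		using T0_diff_bound by blast
	have e: "eps (Suc n) <= eps n" "0 <= eps n" "(2 powr p)^n*eps n = (1/2)^n" for n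
	proof -
		have "1 <= 2 powr p" using p by (intro ge_one_powr_ge_zero) auto
		then show "eps (Suc n) <= eps n" unfolding eps_def by (intro power_decreasing) auto
	qed (simp_all add: eps_def power_divide power_mult_distrib)
	have le: "np (bl k l) (?d n) <= ennreal (2*C*2 powr p*eps n)" for n
	proof -
		have "np (bl k l) (?d n) <= ennreal C*(ennreal (2 powr p)*(ennreal (eps n) + ennreal (eps n)))"
			by (intro order_trans[OF C(2)[OF ap(1)[OF f] ap(1)[OF f]]] mult_left_mono order_trans[OF np_diff3[of f]] add_mono m
					order_trans[OF ap(2)[OF f]] ennreal_leI e) auto
		also have "... = ennreal (2*C*2 powr p*eps n)"
			using C(1) e(2) by (simp add: ennreal_mult[symmetric] ennreal_plus[symmetric] mult_ac del: ennreal_plus)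
		finally show ?thesis .
	qed
	\<comment> \<open>The factor \<open>(2 powr p)^n\<close> is the p-th power of \<open>2^n\<close>; a
	  finite sum of these terms gives the geometric bound on \<open>?d n z\<close>.\<close>
	let ?F = "%n z. ennreal (bl k l z)*ennreal ((2 powr p)^n*|?d n z| powr p)"
	have "(NN z. (\<Sum>n. ?F n z)) = (\<Sum>n. NN z. ?F n z)" by (rule nn_integral_suminf) measurable
	also have "... <= (\<Sum>n. ennreal (2*C*2 powr p*(1/2)^n))"
	proof (rule suminf_le)
		fix n
		have "(NN z. ?F n z) = ennreal ((2 powr p)^n)*np (bl k l) (?d n)"
			unfolding np_def by (subst nn_integral_cmult[symmetric], measurable) (auto intro!: nn_integral_cong simp: ennreal_mult mult_ac)
		also have "... <= ennreal ((2 powr p)^n)*ennreal (2*C*2 powr p*eps n)" by (intro mult_left_mono le) auto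
		also have "... = ennreal (2*C*2 powr p*((2 powr p)^n*eps n))" using C(1) e(2) by (simp add: ennreal_mult[symmetric] mult_ac)
		finally show "(NN z. ?F n z) <= ennreal (2*C*2 powr p*(1/2)^n)" by (simp only: e(3))
	qed auto
	also have "... < \<infinity>"
		using C(1) by (subst suminf_ennreal2) (auto intro!: summable_mult summable_geometric)
	finally have "AE z in lborel. (\<Sum>n. ?F n z) ~= \<infinity>" by (intro nn_integral_PInf_AE) auto
	then show "AE z in lborel. z \<in> S k \<times> S' l --> (%n. T0 (ap f n) z) ----> T f z"
	proof (eventually_elim, intro impI)
		fix z assume fin: "(\<Sum>n. ?F n z) ~= \<infinity>" and z: "z \<in> S k \<times> S' l"
		define h where "h n = ?F n z" for n
		obtain M where M: "(\<Sum>n. h n) = ennreal M" "0 <= M" using fin unfolding h_def[symmetric] by (cases "\<Sum>n. h n") auto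
		have "|?d n z| <= M powr (1/p)*(1/2)^n" for n
		proof -
			have "h n <= (\<Sum>n. h n)" using sum_le_suminf[of h "{n}"] by simp
			then have "(2 powr p)^n*|?d n z| powr p <= M" unfolding M(1) using z M(2) by (simp add: h_def ennreal_le_iff)
			then have "((2 powr p)^n*|?d n z| powr p) powr (1/p) <= M powr (1/p)" using p by (intro powr_mono2) auto
			moreover have "((2 powr p)^n*|?d n z| powr p) powr (1/p) = 2^n*|?d n z|"
				using p by (simp add: powr_mult powr_powr powr_power powr_realpow)
			ultimately show ?thesis by (simp add: field_simps power_one_over)
		qed
		then have nb: "norm (?d n z) <= M powr (1/p)*(1/2)^n" for n unfolding real_norm_def .
		have "summable (%n. M powr (1/p)*(1/2)^n)" by (intro summable_mult summable_geometric) simp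
		then have "summable (%n. ?d n z)" by (rule summable_comparison_test'[where N = 0]) (rule nb)
		then have "convergent (%n. \<Sum>i<n. ?d i z)" unfolding summable_iff_convergent .
		then have "convergent (%n. T0 (ap f n) z-T0 (ap f 0) z)" using sum_lessThan_telescope[of "%n. T0 (ap f n) z"] by simp
		then have "convergent (%n. T0 (ap f n) z)" unfolding convergent_diff_const_right_iff .
		then show "(%n. T0 (ap f n) z) ----> T f z" unfolding T_def by (rule convergent_LIMSEQ_iff[THEN iffD1])
	qed
qed

lemma T_meas: "X f ==> T f \<in> BM"
	unfolding T_def[abs_def] by (intro borel_measurable_lim_metric T0_meas ap)

text \<open>The chosen sequence \<open>ap f\<close> depends neither linearly on \<open>f\<close> nor
  only on its class. This lemma allows any other approximating sequence, and yields linearity,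
  invariance under equality almost everywhere, and agreement with \<open>T0\<close>.\<close>

lemma T_eq:
	assumes f: "X f" and g: "!!n. Lc (g n)" "(%n. np w0 (%z. f z-g n z)) ----> 0"
		and lim: "AE z in lborel. (%n. T0 (g n) z) ----> h z" and [measurable]: "h \<in> BM"
	shows "AE z in lborel. T f z = h z"
proof (rule AE_blocks)
	fix k l
	obtain C where C: "C > 0" "!!f g. Lc f ==> Lc g ==> np (bl k l) (%z. T0 f z-T0 g z) <= ennreal C*np w0 (%z. f z-g z)"
		using T0_diff_bound by blast
	have fm: "f \<in> BM" using f by (simp add: X_def)
	have "np (bl k l) (%z. T f z-h z) <= 0"
	proof (rule np_fatou[where u = "%n z. T0 (ap f n) z-T0 (g n) z"])
		show "AE z in lborel. bl k l z ~= 0 --> (%n. T0 (ap f n) z-T0 (g n) z) ----> T f z-h z"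
			using T_lim[OF f] lim by eventually_elim (auto intro: tendsto_diff)
		show "np (bl k l) (%z. T0 (ap f n) z-T0 (g n) z) <= ennreal C*(ennreal (2 powr p)*(ennreal (eps n) + np w0 (%z. f z-g n z)))" for n
			by (intro order_trans[OF C(2)[OF ap(1)[OF f] g(1)]] mult_left_mono order_trans[OF np_diff3[OF fm Lc_meas[OF ap(1)[OF f]] Lc_meas[OF g(1)]]]
					add_mono ap(2)[OF f] order_refl) auto
		have "(%n. ennreal C*(ennreal (2 powr p)*(ennreal (eps n) + np w0 (%z. f z-g n z)))) ----> ennreal C*(ennreal (2 powr p)*(0 + 0))"
			by (intro ennreal_tendsto_cmult tendsto_add eps_lim g) auto
		then show "(%n. ennreal C*(ennreal (2 powr p)*(ennreal (eps n) + np w0 (%z. f z-g n z)))) ----> 0" by simp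
	qed (use g(1) ap(1)[OF f] in \<open>auto intro!: borel_measurable_diff T0_meas bl_meas\<close>)
	then have "AE z in lborel. ennreal (bl k l z)*ennreal ( |T f z-h z| powr p) = 0"
		unfolding np_def using T_meas[OF f] by (subst (asm) le_zero_eq, subst (asm) nn_integral_0_iff_AE) auto
	then show "AE z in lborel. z \<in> S k \<times> S' l --> T f z = h z" by eventually_elim (auto simp: ennreal_mult[symmetric])
qed

lemma X_lin: assumes "X f" "X g" shows "X (%z. a*f z + b*g z)"
proof -
	have m[measurable]: "f \<in> BM" "g \<in> BM" using assms by (auto simp: X_def)
	have s: "np w0 (%z. a*u z) <= ennreal ( |a| powr p)*np w0 u" if "u \<in> BM" for a u
		unfolding np_def using that by (subst nn_integral_cmult[symmetric]) (auto intro!: nn_integral_mono simp: abs_mult powr_mult ennreal_mult mult_ac)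
	have "np w0 (%z. a*f z + b*g z) <= ennreal (2 powr p)*(ennreal ( |a| powr p)*np w0 f + ennreal ( |b| powr p)*np w0 g)"
		by (rule order_trans[OF np_add mult_left_mono[OF add_mono[OF s s]]]) auto
	also have "... < \<infinity>" using assms by (simp add: X_def ennreal_mult_less_top)
	finally show ?thesis by (simp add: X_def)
qed

lemma T_lin: assumes f: "X f" and g: "X g" shows "AE z in lborel. T (%z. a*f z + b*g z) z = a*T f z + b*T g z"
proof (rule T_eq[OF X_lin[OF f g]])
	have m: "f \<in> BM" "g \<in> BM" using f g by (auto simp: X_def)
	have am: "ap f n \<in> BM" "ap g n \<in> BM" for n using f g by (auto intro: Lc_meas ap)
	show "Lc (%z. a*ap f n z + b*ap g n z)" for n by (intro Lc_lin ap f g)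
	show "(%z. a*T f z + b*T g z) \<in> BM" using T_meas[OF f] T_meas[OF g] by measurable
	show "AE z in lborel. (%n. T0 (%z. a*ap f n z + b*ap g n z) z) ----> a*T f z + b*T g z"
		using T_lim[OF f] T_lim[OF g] by eventually_elim (simp add: T0_lin ap f g tendsto_add tendsto_mult_left)
	have s: "np w0 (%z. a*u z) <= ennreal ( |a| powr p)*np w0 u" if "u \<in> BM" for a u
		unfolding np_def using that by (subst nn_integral_cmult[symmetric]) (auto intro!: nn_integral_mono simp: abs_mult powr_mult ennreal_mult mult_ac)
	let ?B = "%n. ennreal (2 powr p)*(ennreal ( |a| powr p)*ennreal (eps n) + ennreal ( |b| powr p)*ennreal (eps n))"
	have le: "np w0 (%z. (a*f z + b*g z)-(a*ap f n z + b*ap g n z)) <= ?B n" for n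
	proof -
		have "np w0 (%z. (a*f z + b*g z)-(a*ap f n z + b*ap g n z)) = np w0 (%z. a*(f z-ap f n z) + b*(g z-ap g n z))"
			by (simp add: algebra_simps)
		also have "... <= ?B n"
			by (intro order_trans[OF np_add] mult_left_mono add_mono order_trans[OF s] ap f g) (use m am in auto)
		finally show ?thesis .
	qed
	have "?B ----> ennreal (2 powr p)*(ennreal ( |a| powr p)*0 + ennreal ( |b| powr p)*0)"
		by (intro ennreal_tendsto_cmult tendsto_add eps_lim) auto
	then show "(%n. np w0 (%z. (a*f z + b*g z)-(a*ap f n z + b*ap g n z))) ----> 0"
		by (intro ennreal_squeeze0[OF le]) simp
qed

lemma T_cong:
	assumes f: "X f" and g: "X g" and e: "AE z in lborel. f z = g z" shows "AE z in lborel. T f z = T g z"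
proof (rule T_eq[OF f ap(1)[OF g] _ T_lim[OF g] T_meas[OF g]])
	have "np w0 (%z. f z-ap g n z) <= np w0 (%z. g z-ap g n z)" for n
		by (rule np_mono, use e in eventually_elim) simp
	then show "(%n. np w0 (%z. f z-ap g n z)) ----> 0"
		by (rule ennreal_squeeze0[OF order_trans[OF _ ap(2)[OF g]] eps_lim])
qed

lemma T_pv: assumes f: "Lc f" shows "AE z in lborel.
		((%(e1, e2). LINT w:{w. norm (fst w) > e1 & norm (snd w) > e2}|lborel. f (z-w)*K (fst w) (snd w)) \<longlongrightarrow> T f z) (at_right 0 \<times>\<^sub>F at_right 0)"
proof -
	have "AE z in lborel. T f z = T0 f z"
		by (rule T_eq[where g = "%n. f"]) (use f p in \<open>auto simp: Lc_def np_def intro!: X_nice T0_meas\<close>)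
	then show ?thesis
	proof eventually_elim
		case (elim z)
		obtain L where L: "(%N. conv (KN K (- int N) (int N)) f z) ----> L"
			"((%(e1, e2). LINT w:{w. norm (fst w) > e1 & norm (snd w) > e2}|lborel. f (z-w)*K (fst w) (snd w)) \<longlongrightarrow> L) (at_right 0 \<times>\<^sub>F at_right 0)"
			using pv_limit[OF K f, of z] by blast
		have "T0 f z = L" by (rule LIMSEQ_unique[OF T0_lim[OF f] L(1)])
		then show ?case using L(2) elim by simp
	qed
qed

text \<open>Fatou's lemma along the approximants of all components. The error in the vector norm is
  at most the sum of the componentwise errors, which tend to zero for the weight \<open>w0\<close>
  and hence for \<open>wt k l\<close>.\<close>

theorem T_bound:
	"EX C>0. ALL (I::'i set) f k l. finite I --> (ALL j. X (f j)) -->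
		np (bl k l) (%z. vn r I (%j. T (f j) z)) <= ennreal C*np (wt k l) (%z. vn r I (%j. f j z))"
proof -
	show ?thesis
		using T0_bound[where 'i='i]
	proof (elim exE conjE, goal_cases)
	case (1 C)
	note C = 1(1,2)[rule_format]
	show ?thesis
	proof (intro exI[of _ "C*2 powr p"] conjI allI impI, goal_cases)
		case (2 I f k l)
		note I = 2(1) and f = 2(2)[rule_format]
		have [measurable]: "f j \<in> BM" "ap (f j) n \<in> BM" "T0 (ap (f j) n) \<in> BM" for j n
			using f[of j] by (auto simp: X_def intro: Lc_meas T0_meas ap f)
		obtain c' where c': "c' > 0" "!!z. wt k l z <= c'*w0 z" using wt_le by blast
		let ?v = "%z. vn r I (%j. f j z)" and ?u = "%n z. vn r I (%j. f j z-ap (f j) n z)"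
		have small: "(%n. np (wt k l) (?u n)) ----> 0"
		proof -
			have sums: "(%n. np w0 (%z. \<Sum>j\<in>F. |f j z-ap (f j) n z| )) ----> 0" if "finite F" for F using that
			proof induction
				case (insert j F)
				have le: "np w0 (%z. \<Sum>j\<in>insert j F. |f j z-ap (f j) n z| ) <= ennreal (2 powr p)*(ennreal (eps n) + np w0 (%z. \<Sum>j\<in>F. |f j z-ap (f j) n z| ))" for n
				proof -
					have "np w0 (%z. |f j z-ap (f j) n z| ) <= ennreal (eps n)" using ap(2)[OF f, of j n] by (simp add: np_def)
					then show ?thesis using insert(1,2) by (simp, intro order_trans[OF np_add] mult_left_mono add_mono) auto
				qed
				have "(%n. ennreal (2 powr p)*(ennreal (eps n) + np w0 (%z. \<Sum>j\<in>F. |f j z-ap (f j) n z| ))) ----> ennreal (2 powr p)*(0 + 0)"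
					by (intro ennreal_tendsto_cmult tendsto_add eps_lim insert) auto
				then show ?case by (intro ennreal_squeeze0[OF le]) simp
			qed (use p in \<open>simp add: np_def\<close>)
			have ule: "np (wt k l) (?u n) <= ennreal c'*np w0 (%z. \<Sum>j\<in>I. |f j z-ap (f j) n z| )" for n
			proof (rule order_trans[OF np_weight[OF c'(2)] mult_left_mono[OF np_mono]])
				show "AE z in lborel. |?u n z| <= |\<Sum>j\<in>I. |f j z-ap (f j) n z| |"
					using nrm_le_sum_abs[OF p(2) I, of "{()}"] by (intro AE_I2) (auto intro: order_trans[OF _ abs_ge_self])
			qed (use c' in auto)
			have "(%n. ennreal c'*np w0 (%z. \<Sum>j\<in>I. |f j z-ap (f j) n z| )) ----> ennreal c'*0"
				by (intro ennreal_tendsto_cmult sums I) auto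
			then show ?thesis by (intro ennreal_squeeze0[OF ule]) simp
		qed
		have "np (bl k l) (%z. vn r I (%j. T (f j) z)) <= ennreal C*(ennreal (2 powr p)*(np (wt k l) ?v + 0))"
		proof (rule np_fatou[where u = "%n z. vn r I (%j. T0 (ap (f j) n) z)"])
			have "AE z in lborel. \<forall>j\<in>I. (%n. T0 (ap (f j) n) z) ----> T (f j) z"
				using I T_lim[OF f] by (intro AE_finite_allI) auto
			then show "AE z in lborel. bl k l z ~= 0 --> (%n. vn r I (%j. T0 (ap (f j) n) z)) ----> vn r I (%j. T (f j) z)"
				by eventually_elim (use p in \<open>auto intro!: nrm_tendsto\<close>)
			show "np (bl k l) (%z. vn r I (%j. T0 (ap (f j) n) z)) <= ennreal C*(ennreal (2 powr p)*(np (wt k l) ?v + np (wt k l) (?u n)))" for n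
			proof (rule order_trans[OF C(2)[OF I ap(1)[OF f]]], intro mult_left_mono)
				have "np (wt k l) (%z. vn r I (%j. ap (f j) n z)) <= np (wt k l) (%z. ?v z + ?u n z)"
				proof (intro np_mono AE_I2)
					fix z
					have "vn r I (%j. f j z + (- 1)*(f j z-ap (f j) n z)) <= ?v z + vn r I (%j. (- 1)*(f j z-ap (f j) n z))"
						using p I by (intro nrm_triangle) auto
					also have "vn r I (%j. (- 1)*(f j z-ap (f j) n z)) = ?u n z" using p by (subst nrm_cmult) auto
					finally show "|vn r I (%j. ap (f j) n z)| <= |?v z + ?u n z|" by simp
				qed
				also have "... <= ennreal (2 powr p)*(np (wt k l) ?v + np (wt k l) (?u n))" by (rule np_add) auto
				finally show "np (wt k l) (%z. vn r I (%j. ap (f j) n z)) <= ennreal (2 powr p)*(np (wt k l) ?v + np (wt k l) (?u n))" .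
			qed simp
			show "(%n. ennreal C*(ennreal (2 powr p)*(np (wt k l) ?v + np (wt k l) (?u n)))) ----> ennreal C*(ennreal (2 powr p)*(np (wt k l) ?v + 0))"
				by (intro ennreal_tendsto_cmult tendsto_add tendsto_const small) auto
		qed (auto intro: bl_meas)
		then show ?case
			using C(1) by (simp add: ennreal_mult mult.assoc)
	qed (use C(1) in simp)
	qed
qed

end

section \<open>From weighted norms to conditions uniform over blocks\<close>

context bicz
begin

text \<open>The weight was designed for this: \<open>om tw de (a-b)*2 powr (tw*a)\<close> equals
  \<open>s^nat |a-b|*2 powr (tw*b)\<close>, so a condition of growth \<open>tw\<close> on the blocks
  is reproduced at the base block \<open>(k, l)\<close> up to a geometric series.\<close>

lemma wt_bound:
	"EX c1>0. ALL v D k l. v \<in> BM --> 0 <= D --> (ALL i j. np (bl i j) v <= ennreal (D*2 powr (tw * of_int (i + j))))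
		--> np (wt k l) v <= ennreal (c1*D*2 powr (tw * of_int (k + l)))"
proof -
	define s where "s = 2 powr (- de)"
	have s: "0 <= s" "s < 1" using de(1) by (auto simp: s_def powr_less_one)
	show ?thesis
	proof (intro exI[of _ "(2/(1-s))*(2/(1-s))"] conjI allI impI, goal_cases)
		case (2 v D k l)
		note v[measurable] = 2(1) and D = 2(2) and A = 2(3)
	let ?o = "%u. om tw de (fst u-k) * om tw de (snd u-l)" and ?r = "%u. s^nat |fst u-k| * s^nat |snd u-l|" and ?D = "%u. D*2 powr (tw * of_int (fst u + snd u))"
		let ?E = "D*2 powr (tw * of_int (k + l))"
		define F where "F n = {- int n..int n} \<times> {- int n..int n}" for n
		define h where "h u z = ennreal (?o u)*(ennreal (bl (fst u) (snd u) z)*ennreal ( |v z| powr p))" for u z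
		have "np (wt k l) v <= (NN z. liminf (%n. \<Sum>u\<in>F n. h u z))"
			unfolding np_def
		proof (rule nn_integral_mono_AE, rule AE_blocks, intro AE_I2 impI)
			fix i j z assume z: "z \<in> S i \<times> S' j"
			have "ennreal (wt k l z)*ennreal ( |v z| powr p) = h (i, j) z" using z by (simp add: h_def wt_block)
			also have "... <= liminf (%n. \<Sum>u\<in>F n. h u z)"
			proof (rule Liminf_bounded, rule eventually_sequentiallyI)
				fix n assume "nat (max |i| |j| ) <= n"
				then have "(i, j) \<in> F n" by (auto simp: F_def)
				then show "h (i, j) z <= (\<Sum>u\<in>F n. h u z)" by (intro member_le_sum) (auto simp: F_def)
			qed
			finally show "ennreal (wt k l z)*ennreal ( |v z| powr p) <= liminf (%n. \<Sum>u\<in>F n. h u z)" .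
		qed
		also have "... <= liminf (%n. NN z. (\<Sum>u\<in>F n. h u z))" unfolding h_def by (rule nn_integral_liminf) measurable
		also have "... <= ennreal ((2/(1-s))*(2/(1-s))*?E)"
		proof (intro Liminf_le always_eventually allI)
			fix n
			have t: "om tw de (a-b)*2 powr (tw*a) = s^nat |a-b|*2 powr (tw*b)" for a b
				by (simp add: om_def s_def powr_power powr_powr powr_add[symmetric] algebra_simps)
			have "(NN z. (\<Sum>u\<in>F n. h u z)) = (\<Sum>u\<in>F n. ennreal (?o u)*np (bl (fst u) (snd u)) v)"
				unfolding h_def np_def by (subst nn_integral_sum, measurable) (intro sum.cong refl nn_integral_cmult, measurable)
			also have "... <= (\<Sum>u\<in>F n. ennreal (?o u)*ennreal (?D u))"
				using A by (intro sum_mono mult_left_mono) auto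
			also have "... = (\<Sum>u\<in>F n. ennreal (?E*?r u))"
			proof (intro sum.cong refl)
				fix u
				have "?o u*(?D u)
					= D*((om tw de (fst u-k)*2 powr (tw*fst u))*(om tw de (snd u-l)*2 powr (tw * snd u)))"
					by (simp add: powr_add distrib_left mult_ac)
				also have "... = ?E*?r u" unfolding t by (simp add: powr_add distrib_left mult_ac)
				finally have r: "?o u*(?D u) = ?E*?r u" .
				show "ennreal (?o u)*ennreal (?D u) = ennreal (?E*?r u)"
					unfolding r[symmetric] using D by (intro ennreal_mult[symmetric]) auto
			qed
			also have "... = ennreal (?E*(\<Sum>u\<in>F n. ?r u))"
				unfolding sum_distrib_left by (rule sum_ennreal) (use D s in auto)
			also have "... <= ennreal (?E*((2/(1-s))*(2/(1-s))))"
				using D s by (intro ennreal_leI mult_left_mono geometric_int_sum2) (auto simp: F_def)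
			finally show "(NN z. (\<Sum>u\<in>F n. h u z)) <= ennreal ((2/(1-s))*(2/(1-s))*?E)" by (simp only: mult.commute[of ?E])
		qed simp
		finally show ?case by (simp only: mult.assoc)
	qed (use s in simp)
qed

lemma X_blocks:
	assumes "v \<in> BM" "0 <= D" "!!i j. np (bl i j) v <= ennreal (D*2 powr (tw * of_int (i + j)))" shows "X v"
proof -
	obtain c1 where "!!v D k l. v \<in> BM ==> 0 <= D ==> (!!i j. np (bl i j) v <= ennreal (D*2 powr (tw * of_int (i + j))))
		==> np (wt k l) v <= ennreal (c1*D*2 powr (tw * of_int (k + l)))" using wt_bound by blast
	from this[OF assms, of 0 0] show ?thesis using assms(1) by (simp add: X_def le_less_trans)
qed

lemma T_blocks:
	"EX C>0. ALL (I::'i set) f D k l. finite I --> (ALL m. X (f m)) --> 0 <= D --> (ALL i j. np (bl i j) (%z. vn r I (%m. f m z)) <= ennreal (D*2 powr (tw * of_int (i + j))))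
		--> np (bl k l) (%z. vn r I (%m. T (f m) z)) <= ennreal (C*D*2 powr (tw * of_int (k + l)))"
proof -
	show ?thesis
		using wt_bound T_bound[where 'i='i]
	proof (elim exE conjE, goal_cases)
	case (1 c1 C)
	note c1 = 1(1,2)[rule_format] and C = 1(3,4)[rule_format]
	show ?thesis
	proof (intro exI[of _ "C*c1"] conjI allI impI, goal_cases)
		case (2 I f D k l)
		note I = 2(1) and f = 2(2) and D = 2(3) and A = 2(4)
		have "np (bl k l) (%z. vn r I (%m. T (f m) z)) <= ennreal C*np (wt k l) (%z. vn r I (%m. f m z))" using C(2)[OF I] f by blast
		also have "... <= ennreal C*ennreal (c1*D*2 powr (tw * of_int (k + l)))"
			by (intro mult_left_mono c1(2) nrm_measurable D) (use f A in \<open>auto simp: X_def\<close>)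
		finally show ?case
			using C(1) c1(1) D by (simp add: ennreal_mult[symmetric] mult.assoc)
	qed (use C(1) c1(1) in simp)
	qed
qed

text \<open>The real or imaginary part of a complex combination of two functions is a real
  combination of their four parts, known here only almost everywhere.\<close>

lemma T_lin4:
	assumes X: "X f1" "X f2" "X f3" "X f4" and g: "g \<in> BM" and e: "AE z in lborel. g z = a1*f1 z + a2*f2 z + (a3*f3 z + a4*f4 z)"
	shows "AE z in lborel. T g z = a1*T f1 z + a2*T f2 z + (a3*T f3 z + a4*T f4 z)"
proof -
	let ?u = "%z. a1*f1 z + a2*f2 z" and ?v = "%z. a3*f3 z + a4*f4 z"
	have uv: "X ?u" "X ?v" using X by (auto intro: X_lin)
	have w: "X (%z. ?u z + ?v z)" using X_lin[OF uv, of 1 1] by simp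
	have "np w0 g <= np w0 (%z. ?u z + ?v z)" by (rule np_mono, use e in eventually_elim) simp
	then have "X g" using w g by (auto simp: X_def le_less_trans)
	from T_cong[OF this w e] T_lin[OF uv, of 1 1] T_lin[OF X(1,2), of a1 a2] T_lin[OF X(3,4), of a3 a4]
	show ?thesis by eventually_elim simp
qed

end

text \<open>Integrability is what allows the complex truncated integral to be split into four real
  ones.\<close>

lemma set_integrable_truncated:
	fixes K :: "'a::euclidean_space => 'b::euclidean_space => real"
	assumes K: "rk C0 et K" and f: "nice f" and e: "0 < e1" "0 < e2"
	shows "set_integrable lborel {w. norm (fst w) > e1 & norm (snd w) > e2} (%w. f (z-w)*K (fst w) (snd w))"
proof -
	obtain R where R: "!!z. f z ~= 0 ==> norm z <= R" using f by (metis niceE)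
	obtain J where J: "R + norm z < sc J" using sc_unbounded by blast
	let ?b = "%w. of_bool (norm (fst w) > e1 & norm (snd w) > e2)*cutK J K w"
	have C0: "0 < C0" using K by (simp add: rk_def)
	have m: "cutK J K \<in> BM" by (rule cutK_measurable[OF K])
	have "nice (%w. ?b w*f (z-w))"
	proof (rule nice_bmult[OF nice_reflect[OF f]])
		show "?b \<in> BM" using m by measurable
		show "|?b w| <= C0/e2^DIM('b)/e1^DIM('a)" for w
		proof (cases "?b w = 0")
			case False
			then have w: "e1 < norm (fst w)" "e2 < norm (snd w)" "fst w ~= 0" "snd w ~= 0" using e by auto
			let ?t = "zet (norm (fst w)/sc J)*zet (norm (snd w)/sc J)"
			have "?t*|K (fst w) (snd w)| <= 1*|K (fst w) (snd w)|" by (intro mult_right_mono mult_le_one zet_bounds) auto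
			then have "|?b w| <= |K (fst w) (snd w)|" using w zet_bounds(1) by (simp add: cutK_def abs_mult)
			also have "... <= C0/norm (snd w)^DIM('b)/norm (fst w)^DIM('a)" using K w unfolding rk_def by simp
			also have "... <= C0/e2^DIM('b)/e1^DIM('a)" using w e C0 by (intro frac_le divide_left_mono power_mono) auto
			finally show ?thesis .
		qed (use C0 e in auto)
	qed
	moreover have "?b w*f (z-w) = indicator {w. norm (fst w) > e1 & norm (snd w) > e2} w *\<^sub>R (f (z-w)*K (fst w) (snd w))" for w
	proof (cases "f (z-w) = 0")
		case False
		then have "norm w < sc J" using R[OF False] norm_triangle_ineq2[of w z] J by (simp add: norm_minus_commute)
		then have "norm (fst w) < sc J" "norm (snd w) < sc J" using norm_fst_le[of "fst w" "snd w"] norm_snd_le[of "snd w" "fst w"] by simp_all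
		then show ?thesis using e by (auto simp: cutK_def zet_def indicator_def)
	qed simp
	ultimately show ?thesis unfolding set_integrable_def by (simp add: nice_int)
qed

section \<open>Cubes, shells, and the real and imaginary parts of the kernel\<close>

lemma cube_sc: "cube k = {x. ALL l. |x $ l| <= sc (k-1)}"
proof -
	have "2 powi k/2 = sc (k-1)" by (simp add: sc_def powr_diff powr_real_of_int')
	then show ?thesis by (simp only: cube_def)
qed

lemma cube_iff:
	fixes x :: "real^'n"
	assumes "x ~= 0" shows "EX k\<^sub>0. ALL k. x \<in> cube k \<longleftrightarrow> k\<^sub>0 <= k"
proof (intro exI allI)
	fix k
	let ?M = "Max (range (%l. |x $ l| ))"
	obtain l where l: "x $ l ~= 0" using assms by (auto simp: vec_eq_iff)
	have "|x $ l| <= ?M" by (rule Max_ge) auto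
	then have M: "0 < ?M" using l by linarith
	have "x \<in> cube k \<longleftrightarrow> ?M <= sc (k-1)" by (auto simp: cube_sc)
	also have "... \<longleftrightarrow> log 2 ?M <= of_int (k-1)" using M by (simp add: sc_def log_le_iff)
	also have "... \<longleftrightarrow> \<lceil>log 2 ?M\<rceil> + 1 <= k" by linarith
	finally show "x \<in> cube k \<longleftrightarrow> \<lceil>log 2 ?M\<rceil> + 1 <= k" .
qed

lemma zero_in_cube: "0 \<in> cube k" by (simp add: cube_sc)

lemma cube_borel[measurable]: "(cube k :: (real^'n) set) \<in> sets borel"
proof -
	have "(cube k :: (real^'n) set) = (\<Inter>l. {x. |x $ l| <= sc (k-1)})" by (auto simp: cube_sc)
	then have "closed (cube k :: (real^'n) set)" by (auto intro!: closed_Collect_le continuous_intros)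
	then show ?thesis by simp
qed

text \<open>A point of the shell has a coordinate above \<open>sc (k-2)\<close>, whence
  \<open>2 <= c\<close>; its Euclidean norm is at most \<open>CARD('n) * sc k\<close>, whence the
  other bound on \<open>c\<close>.\<close>

lemma ann_shell:
	assumes c: "int CARD('n) <= c" "2 <= c" shows "ann c (shell :: int => (real^'n) set)"
	unfolding ann_def
proof (intro conjI allI ballI)
	fix k and x :: "real^'n" assume "x \<in> shell k"
	then have x: "x \<in> cube k" "x ~: cube (k-1)" by (auto simp: shell_def)
	then obtain l where "\<not> |x $ l| <= sc (k-1-1)" unfolding cube_sc by blast
	then have "sc (k-2) <= norm x" using component_le_norm_cart[of x l] by simp
	then show "sc (k-c) <= norm x" using sc_mono[of "k-c" "k-2"] c by simp
	have "norm x <= (\<Sum>l\<in>UNIV. |x $ l| )" by (rule norm_le_l1_cart)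
	also have "... <= (\<Sum>l\<in>(UNIV::'n set). sc (k-1))" using x by (intro sum_mono) (auto simp: cube_sc)
	also have "... <= CARD('n) * sc k" by (simp add: sc_1_2)
	also have "... <= sc c * sc k"
	proof (intro mult_right_mono)
		have "real CARD('n) <= 2^CARD('n)" using less_exp[of "CARD('n)"] by (metis less_imp_le numeral_power_le_of_nat_cancel_iff of_nat_le_iff of_nat_numeral of_nat_power)
		also have "... <= sc c" using c by (simp add: sc_def powr_realpow[symmetric])
		finally show "real CARD('n) <= sc c" .
	qed simp
	finally show "norm x <= sc (k + c)" by (simp add: sc_add mult.commute)
next
	show "disjoint_family (shell :: int => (real^'n) set)"
	proof (unfold disjoint_family_on_def, intro ballI impI equals0I)
		fix j k and x :: "real^'n" assume jk: "j ~= k" and x: "x \<in> shell j \<inter> shell k"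
		then have "x ~= 0" using zero_in_cube by (auto simp: shell_def)
		then obtain k0 where "!!k. x \<in> cube k \<longleftrightarrow> k0 <= k" using cube_iff by blast
		then show False using x jk by (auto simp: shell_def)
	qed
	show "(\<Union>k. shell k) = - {0 :: real^'n}"
	proof (intro equalityI subsetI)
		fix x :: "real^'n" assume "x \<in> - {0}"
		then obtain k0 where "!!k. x \<in> cube k \<longleftrightarrow> k0 <= k" using cube_iff by blast
		then have "x \<in> shell k0" by (simp add: shell_def)
		then show "x \<in> (\<Union>k. shell k)" by blast
	qed (use zero_in_cube in \<open>auto simp: shell_def\<close>)
qed (use c in \<open>auto simp: shell_def\<close>)

lemma set_lebesgue_integral_Complex:
	assumes "set_integrable M A u" "set_integrable M A v"
	shows "(LINT x:A|M. Complex (u x) (v x)) = Complex (LINT x:A|M. u x) (LINT x:A|M. v x)"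
proof -
	have "integrable M (%x. complex_of_real (indicator A x *\<^sub>R u x))" "integrable M (%x. \<i>*complex_of_real (indicator A x *\<^sub>R v x))"
		by (safe intro!: integrable_mult_right) (use assms in \<open>simp_all only: complex_of_real_integrable_eq set_integrable_def\<close>)
	note * = Bochner_Integration.integral_add[OF this]
	show ?thesis
		using * by (simp add: set_lebesgue_integral_def Complex_eq scaleR_conv_of_real distrib_left mult_ac integral_complex_of_real[symmetric] del: integral_complex_of_real)
qed

text \<open>All ratios in the regularity conditions are at most 1, so the exponent may be lowered to
  at most 1. Size and regularity of both parts come first, since they give the integrability needed
  to split the cancellation of the complex kernel.\<close>

lemma rk_Re_Im:
	fixes K :: "real^'n => real^'m => complex"
	assumes "bi_CZ_kernel K"
	shows "EX C et. rk C et (%x y. Re (K x y)) & rk C et (%x y. Im (K x y))"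
	using assms unfolding bi_CZ_kernel_def
proof (elim exE conjE, goal_cases)
	case (1 C1 et1)
	note cx = 1(1)[rule_format] and cy = 1(2)[rule_format] and k0 = 1(4)[rule_format] and k1 = 1(5)[rule_format] and k2 = 1(6)[rule_format] and k3 = 1(7)[rule_format]
	define C where "C = max C1 1"
	define et where "et = min et1 1"
	have C: "C1 <= C" "0 < C" and et: "0 < et" "et <= 1" "et <= et1" using 1(3) by (auto simp: C_def et_def)
	have r: "C1*t powr et1/(a^i*b^j) <= C*t powr et/(a^i*b^j)" if "0 <= t" "t <= 1" "0 <= a" "0 <= b" for t a b :: real and i j
		using that C et by (intro divide_right_mono mult_mono powr_mono') auto
	have q: "0 <= norm h/norm x" "norm h/norm x <= 1" if "norm x > 2*norm h" for h x :: "'z::real_normed_vector"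
		using that norm_ge_zero[of h] by (auto simp: divide_le_eq simp del: norm_ge_zero)
	let ?rk' = "%P. (ALL y. y ~= 0 --> hk (C/norm y^CARD('m)) et (%x. P (K x y))) & (ALL x. x ~= 0 --> hk (C/norm x^CARD('n)) et (%y. P (K x y)))
		& ((ALL y. y ~= 0 --> cn (%x. P (K x y))) --> (ALL x. x ~= 0 --> cn (%y. P (K x y))) --> rk C et (%x y. P (K x y)))"
	have part: "?rk' P" if P: "!!z. |P z| <= norm z" "!!z w. P z-P w = P (z-w)" for P :: "complex => real"
	proof -
		have 0: "|P (K x y)| <= C/norm y^CARD('m)/norm x^CARD('n)" if "x ~= 0" "y ~= 0" for x y
		proof -
			have "|P (K x y)| <= C1/(norm x^CARD('n)*norm y^CARD('m))" by (rule order_trans[OF P(1) k0[OF that]])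
			also have "... <= C/(norm x^CARD('n)*norm y^CARD('m))" using C by (intro divide_right_mono) auto
			finally show ?thesis by (simp add: mult.commute)
		qed
		have 1: "|P (K (x + h) y)-P (K x y)| <= C/norm y^CARD('m)*(norm h/norm x) powr et/norm x^CARD('n)" if "norm x > 2*norm h" "y ~= 0" for x h y
			using order_trans[OF order_trans[OF P(1) k1[OF that]] r[OF q[OF that(1)] norm_ge_zero norm_ge_zero]] by (simp add: P(2) mult.commute)
		have 2: "|P (K x (y + k))-P (K x y)| <= C/norm x^CARD('n)*(norm k/norm y) powr et/norm y^CARD('m)" if "norm y > 2*norm k" "x ~= 0" for x y k
			using order_trans[OF order_trans[OF P(1) k2[OF that]] r[OF q[OF that(1)] norm_ge_zero norm_ge_zero]] by (simp add: P(2) mult.commute)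
		have 3: "|(P (K (x + h) (y + k))-P (K x (y + k)))-(P (K (x + h) y)-P (K x y))|
			<= C*(norm h/norm x) powr et/norm x^CARD('n)*(norm k/norm y) powr et/norm y^CARD('m)" if "norm x > 2*norm h" "norm y > 2*norm k" for x h y k
			using order_trans[OF order_trans[OF P(1) k3[OF that]] r[OF mult_nonneg_nonneg[OF q(1)[OF that(1)] q(1)[OF that(2)]] mult_le_one[OF q(2)[OF that(1)] q(1,2)[OF that(2)]] norm_ge_zero norm_ge_zero]]
			unfolding P(2) powr_mult by (simp add: mult.assoc)
		show ?thesis using 0 1 2 3 C(2) et(1,2) unfolding hk_def rk_def by (simp add: divide_divide_eq_left mult.commute)
	qed
	have R: "?rk' Re" by (rule part) (auto simp: abs_Re_le_cmod)
	have I: "?rk' Im" by (rule part) (auto simp: abs_Im_le_cmod)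
	have si: "set_integrable lborel {x. a < norm x & norm x < b} v" if v: "hk V et v" "0 <= V" and a: "0 < a" for v :: "'z::euclidean_space => real" and V a b
	proof -
		have "nice (%x. of_bool (a < norm x & norm x < b) * v x)"
			using nice_cut[OF v(1) et(1) v(2), of "%s. of_bool (a < s & s < b)" a b] a by auto
		then have "integrable lborel (%x. of_bool (a < norm x & norm x < b) * v x)" by (rule nice_int)
		also have "(%x. of_bool (a < norm x & norm x < b) * v x) = (%x. indicator {x. a < norm x & norm x < b} x *\<^sub>R v x)" by (auto simp: indicator_def)
		finally show ?thesis unfolding set_integrable_def .
	qed
	have cp: "cn (%x. Re (u x)) & cn (%x. Im (u x))" if "hk V et (%x. Re (u x))" "hk V et (%x. Im (u x))" "0 <= V"
		"!!a b. 0 < a ==> a < b ==> (LINT x:{x. a < norm x & norm x < b}|lborel. u x) = 0" for u :: "'z::euclidean_space => complex" and V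
		using set_lebesgue_integral_Complex[OF si[OF that(1,3)] si[OF that(2,3)]] that(4) unfolding cn_def by (simp add: complex_eq_iff)
	have "cn (%x. Re (K x y)) & cn (%x. Im (K x y))" if "y ~= 0" for y
		by (rule cp[OF R[THEN conjunct1, rule_format, OF that] I[THEN conjunct1, rule_format, OF that] _ cx[OF that]]) (use C in auto)
	moreover have "cn (%y. Re (K x y)) & cn (%y. Im (K x y))" if "x ~= 0" for x
		by (rule cp[OF R[THEN conjunct2, THEN conjunct1, rule_format, OF that] I[THEN conjunct2, THEN conjunct1, rule_format, OF that] _ cy[OF that]]) (use C in auto)
	ultimately show ?thesis using R I by blast
qed

section \<open>Block estimates and the Morrey-Herz norm\<close>

lemma epowr_ennreal: "0 <= a ==> epowr (ennreal a) s = ennreal (a powr s)"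
	by (simp add: epowr_def)

lemma epowr_mono: assumes "0 <= s" "x <= y" shows "epowr x s <= epowr y s"
	using assms by (cases x; cases y) (auto simp: epowr_ennreal epowr_def top_unique intro!: ennreal_leI powr_mono2)

lemma epowr_epowr: "epowr (epowr x s) t = epowr x (s*t)"
	by (cases x) (simp_all add: epowr_def powr_powr)

lemma epowr_1: "epowr x 1 = x"
	by (cases x) (simp_all add: epowr_def)

lemma epowr_0[simp]: "epowr 0 s = 0"
	by (simp add: epowr_def)

lemma epowr_indicator: "epowr (x*indicator A z) s = epowr x s*indicator A z"
	by (simp split: split_indicator)

lemma epowr_SUP: assumes "0 < s" shows "epowr (SUP n. x n) s = (SUP n. epowr (x n) s)"
proof (rule antisym)
	have "x n <= epowr (SUP n. epowr (x n) s) (1/s)" for n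
	proof -
		have "x n = epowr (epowr (x n) s) (1/s)" using assms by (simp add: epowr_epowr epowr_1)
		also have "... <= epowr (SUP n. epowr (x n) s) (1/s)" using assms by (intro epowr_mono SUP_upper) auto
		finally show ?thesis .
	qed
	then have "epowr (SUP n. x n) s <= epowr (epowr (SUP n. epowr (x n) s) (1/s)) s" using assms by (intro epowr_mono SUP_least) auto
	then show "epowr (SUP n. x n) s <= (SUP n. epowr (x n) s)" using assms by (simp add: epowr_epowr epowr_1)
qed (use assms in \<open>intro SUP_least epowr_mono SUP_upper; simp\<close>)

definition blk :: "real => ((real^'n) \<times> (real^'m) => ennreal) => int => int => ennreal" where
	"blk p F i j = (NN z. epowr (F z) p*indicator (shell i \<times> shell j) z)"

lemma Lp_norm_blk: "Lp_norm p (%z. F z*indicator (shell i \<times> shell j) z) = epowr (blk p F i j) (1/p)"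
	by (simp add: Lp_norm_def blk_def epowr_indicator nn_integral_completion)

lemma blk_mono: assumes "0 <= p" "AE z in lborel. F z <= G z" shows "blk p F i j <= blk p G i j"
	unfolding blk_def by (rule nn_integral_mono_AE, use assms(2) in eventually_elim) (auto intro!: mult_right_mono epowr_mono assms(1))

lemma cube_mono: assumes "i <= j" shows "cube i \<subseteq> (cube j :: (real^'n) set)"
proof
	fix x :: "real^'n" assume x: "x \<in> cube i"
	have "sc (i-1) <= sc (j-1)" using assms by (intro sc_mono) simp
	with x show "x \<in> cube j" unfolding cube_sc mem_Collect_eq by (meson order_trans)
qed

lemma blk_cut:
	fixes F :: "(real^'n) \<times> (real^'m) => ennreal"
	shows "blk p (%z. F z*indicator (cube L \<times> cube L') z) i j = (if i <= L & j <= L' then blk p F i j else 0)"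
proof -
	have 1: "shell i \<subseteq> (cube L :: (real^'n) set)" "shell j \<subseteq> (cube L' :: (real^'m) set)" if "i <= L" "j <= L'"
		using cube_mono that by (auto simp: shell_def)
	have 2: "shell i \<inter> (cube L :: (real^'n) set) = {}" if "\<not> i <= L" using cube_mono[of L "i-1"] that by (auto simp: shell_def)
	have 3: "shell j \<inter> (cube L' :: (real^'m) set) = {}" if "\<not> j <= L'" using cube_mono[of L' "j-1"] that by (auto simp: shell_def)
	have "epowr (F z*indicator (cube L \<times> cube L') z) p*indicator (shell i \<times> shell j) z
		= (if i <= L & j <= L' then epowr (F z) p*indicator (shell i \<times> shell j) z else 0)" for z
		using 1 2 3 by (cases z) (auto split: split_indicator)
	then show ?thesis by (auto simp: blk_def)
qed

lemma herz_norm_blk: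
	"herz_norm \<alpha> p q F = epowr (\<Sum>\<^sub>\<infinity>u\<in>UNIV. ennreal (2 powr (real_of_int (fst u + snd u)*q*\<alpha>))*epowr (blk p F (fst u) (snd u)) (q/p)) (1/q)"
	by (simp add: herz_norm_def Lp_norm_blk epowr_epowr case_prod_beta')

lemma blk_le_morrey_herz:
	fixes F :: "(real^'n) \<times> (real^'m) => ennreal"
	assumes p: "0 < p" "0 < q" and M: "0 <= M" "morrey_herz_norm \<alpha> lam p q F <= ennreal M"
	shows "blk p F i j <= ennreal (M powr p*2 powr ((lam-\<alpha>)*p * of_int (i + j)))"
proof -
	let ?G = "%z. F z*indicator (cube i \<times> cube j) z"
	let ?x = "real_of_int (i + j)"
	let ?t = "%u. ennreal (2 powr (real_of_int (fst u + snd u)*q*\<alpha>))*epowr (blk p ?G (fst u) (snd u)) (q/p)"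
	\<comment> \<open>The box is the one with \<open>L1 = i\<close> and \<open>L2 = j\<close>, which
	  contains the block \<open>(i, j)\<close> entirely.\<close>
	have "?t (i, j) = sum ?t {(i, j)}" by simp
	also have "... <= (SUP U\<in>{U. finite U & U \<subseteq> UNIV}. sum ?t U)" by (rule SUP_upper) simp
	also have "... = infsum ?t UNIV" by (rule nonneg_infsum_complete[symmetric]) simp
	finally have "epowr (?t (i, j)) (1/q) <= herz_norm \<alpha> p q ?G" unfolding herz_norm_blk using p by (intro epowr_mono) auto
	then have "ennreal (2 powr (- (?x*lam)))*epowr (?t (i, j)) (1/q) <= ennreal (2 powr (- (?x*lam)))*herz_norm \<alpha> p q ?G"
		by (rule mult_left_mono) simp
	also have "... <= morrey_herz_norm \<alpha> lam p q F"
		unfolding morrey_herz_norm_def by (rule SUP_upper2[of "(i, j)"]) auto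
	also note M(2)
	finally have le: "ennreal (2 powr (- (?x*lam)))*epowr (ennreal (2 powr (?x*q*\<alpha>))*epowr (blk p F i j) (q/p)) (1/q) <= ennreal M"
		by (simp add: blk_cut)
	show ?thesis
	proof (cases "blk p F i j")
		case (real a)
		have e: "(2 powr (?x*q*\<alpha>)*a powr (q/p)) powr (1/q) = 2 powr (?x*\<alpha>)*a powr (1/p)"
			using p by (simp add: powr_mult powr_powr mult_ac)
		have "2 powr (- (?x*lam))*(2 powr (?x*\<alpha>)*a powr (1/p)) <= M"
			using le M(1) real by (simp add: epowr_ennreal ennreal_mult[symmetric] e del: of_int_add)
		then have "2 powr ((lam-\<alpha>) * of_int (i + j))*(2 powr (- (?x*lam))*(2 powr (?x*\<alpha>)*a powr (1/p))) <= 2 powr ((lam-\<alpha>) * of_int (i + j))*M"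
			by (rule mult_left_mono) simp
		also have "2 powr ((lam-\<alpha>) * of_int (i + j))*(2 powr (- (?x*lam))*(2 powr (?x*\<alpha>)*a powr (1/p))) = a powr (1/p)"
			unfolding mult.assoc[symmetric] powr_add[symmetric] by (simp add: algebra_simps)
		finally have "(a powr (1/p)) powr p <= (2 powr ((lam-\<alpha>) * of_int (i + j))*M) powr p" using p by (intro powr_mono2) auto
		then have "a <= M powr p*2 powr ((lam-\<alpha>)*p * of_int (i + j))" using p real(1) by (simp add: powr_powr powr_mult mult_ac)
		then show ?thesis using real by (simp add: ennreal_leI)
	qed (use le p in \<open>simp add: epowr_def ennreal_mult_eq_top_iff ennreal_mult_top top_unique\<close>)
qed

lemma morrey_herz_le_blk:
	fixes lam q :: real
	assumes lam: "0 < lam" and p: "0 < p" "0 < q"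
	shows "EX c>0. ALL (F :: (real^'n) \<times> (real^'m) => ennreal) D. 0 <= D --> (ALL i j. blk p F i j <= ennreal (D*2 powr ((lam-\<alpha>)*p * of_int (i + j))))
		--> morrey_herz_norm \<alpha> lam p q F <= ennreal (c*D powr (1/p))"
proof -
	\<comment> \<open>The ratio of the series over the blocks inside a box, summed downwards from its
	  corner; it is below 1 because \<open>lam > 0\<close>.\<close>
	define s where "s = 2 powr (- (q*lam))"
	have s: "0 < s" "s < 1" using lam p by (auto simp: s_def powr_less_one)
	let ?g = "2/(1-s)"
	show ?thesis
	proof (intro exI[of _ "(?g*?g) powr (1/q)"] conjI allI impI, goal_cases)
		case (2 F D)
		note D = 2(1) and A = 2(2)
		show ?case
			unfolding morrey_herz_norm_def
		proof (intro SUP_least, clarify)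
			fix L L' :: int
			let ?G = "%z. F z*indicator (cube L \<times> cube L') z"
			define E where "E = D powr (q/p)*2 powr (q*lam * of_int (L + L'))"
			have t: "ennreal (2 powr (real_of_int (i + j)*q*\<alpha>))*epowr (blk p ?G i j) (q/p) <= ennreal (E*(s^nat |i-L| * s^nat |j-L'| ))" for i j
			proof (cases "i <= L & j <= L'")
				case True
				have e: "(lam-\<alpha>)*p * of_int (i + j)*(q/p) = (lam-\<alpha>)*q * of_int (i + j)" using p by simp
				have "epowr (blk p ?G i j) (q/p) <= epowr (ennreal (D*2 powr ((lam-\<alpha>)*p * of_int (i + j)))) (q/p)"
					using A True p by (intro epowr_mono) (auto simp: blk_cut)
				then have "ennreal (2 powr (real_of_int (i + j)*q*\<alpha>))*epowr (blk p ?G i j) (q/p)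
					<= ennreal (2 powr (real_of_int (i + j)*q*\<alpha>))*ennreal ((D*2 powr ((lam-\<alpha>)*p * of_int (i + j))) powr (q/p))"
					using D by (intro mult_left_mono) (auto simp: epowr_ennreal)
				also have "... = ennreal (D powr (q/p)*2 powr (q*lam * of_int (i + j)))"
					unfolding powr_mult powr_powr e by (simp add: ennreal_mult[symmetric] powr_add[symmetric] algebra_simps)
				also have "2 powr (q*lam * of_int (i + j)) = 2 powr (q*lam * of_int (L + L'))*(s^nat |i-L| * s^nat |j-L'| )"
					using True unfolding s_def by (simp add: powr_power powr_add[symmetric] algebra_simps)
				finally show ?thesis by (simp add: E_def mult_ac)
			qed (auto simp: blk_cut)
			have "(\<Sum>\<^sub>\<infinity>u\<in>UNIV. ennreal (2 powr (real_of_int (fst u + snd u)*q*\<alpha>))*epowr (blk p ?G (fst u) (snd u)) (q/p)) <= ennreal (E*(?g*?g))"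
			proof (rule infsum_le_finite_sums)
				fix U :: "(int \<times> int) set" assume U: "finite U"
				have "(\<Sum>u\<in>U. ennreal (2 powr (real_of_int (fst u + snd u)*q*\<alpha>))*epowr (blk p ?G (fst u) (snd u)) (q/p))
					<= (\<Sum>u\<in>U. ennreal (E*(s^nat |fst u-L| * s^nat |snd u-L'| )))" by (intro sum_mono t)
				also have "... = ennreal (E*(\<Sum>u\<in>U. s^nat |fst u-L| * s^nat |snd u-L'| ))"
					unfolding sum_distrib_left using D s by (intro sum_ennreal) (auto simp: E_def)
				also have "... <= ennreal (E*(?g*?g))"
					using U D s by (intro ennreal_leI mult_left_mono geometric_int_sum2) (auto simp: E_def)
				finally show "(\<Sum>u\<in>U. ennreal (2 powr (real_of_int (fst u + snd u)*q*\<alpha>))*epowr (blk p ?G (fst u) (snd u)) (q/p)) <= ennreal (E*(?g*?g))" .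
			qed (auto intro: nonneg_summable_on_complete)
			then have "herz_norm \<alpha> p q ?G <= epowr (ennreal (E*(?g*?g))) (1/q)" unfolding herz_norm_blk using p by (intro epowr_mono) auto
			also have "... = ennreal (2 powr (real_of_int (L + L')*lam)*((?g*?g) powr (1/q)*D powr (1/p)))"
			proof -
				have "(E*(?g*?g)) powr (1/q) = 2 powr (real_of_int (L + L')*lam)*((?g*?g) powr (1/q)*D powr (1/p))"
					unfolding E_def powr_mult powr_powr using p by (simp add: mult_ac)
				then show ?thesis using D s by (subst epowr_ennreal) (auto simp: E_def)
			qed
			finally have "ennreal (2 powr (- (real_of_int (L + L')*lam)))*herz_norm \<alpha> p q ?G
				<= ennreal (2 powr (- (real_of_int (L + L')*lam)))*ennreal (2 powr (real_of_int (L + L')*lam)*((?g*?g) powr (1/q)*D powr (1/p)))"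
				by (rule mult_left_mono) simp
			also have "... = ennreal (2 powr (- (real_of_int (L + L')*lam))*2 powr (real_of_int (L + L')*lam)*((?g*?g) powr (1/q)*D powr (1/p)))"
				by (simp add: ennreal_mult[symmetric] mult.assoc)
			finally show "ennreal (2 powr (- (real_of_int (L + L')*lam)))*herz_norm \<alpha> p q ?G <= ennreal ((?g*?g) powr (1/q)*D powr (1/p))"
				by (simp add: powr_add[symmetric])
		qed
	qed (use s in simp)
qed

section \<open>Infinite sequences as monotone limits of finite ones\<close>

lemma lp_sum_SUP: "lp_sum r f z = (SUP n. epowr (\<Sum>i<n. ennreal (norm (f i z) powr r)) (1/r))" if "0 < r"
	using that by (simp add: lp_sum_def suminf_eq_SUP epowr_SUP)

lemma epowr_sum_vn:
	assumes "0 < r" shows "epowr (\<Sum>i<n. ennreal ( |v i| powr r)) (1/r) = ennreal (vn r {..<n} v)"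
proof -
	have e: "(v i)\<^sup>2 powr (r/2) = |v i| powr r" for i
	proof -
		have "(v i)\<^sup>2 = |v i| powr 2" by simp
		then have "(v i)\<^sup>2 powr (r/2) = |v i| powr (2*(r/2))" by (simp only: powr_powr)
		then show ?thesis by simp
	qed
	show ?thesis unfolding nrm_def using assms by (simp add: e epowr_ennreal sum_nonneg)
qed

lemma vn_le_lp_sum:
	assumes r: "0 < r" and "!!i. |v i| <= norm (f i z)" shows "ennreal (vn r {..<n} v) <= lp_sum r f z"
proof -
	have "ennreal (vn r {..<n} v) <= ennreal (vn r {..<n} (%i. norm (f i z)))" using assms by (intro ennreal_leI nrm_mono) auto
	also have "... = epowr (\<Sum>i<n. ennreal (norm (f i z) powr r)) (1/r)" using epowr_sum_vn[OF r, of "%i. norm (f i z)" n] by simp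
	also have "... <= lp_sum r f z" unfolding lp_sum_SUP[OF r] by (rule SUP_upper) simp
	finally show ?thesis .
qed

lemma blk_lp_sum_le:
	fixes f :: "nat => (real^'n) \<times> (real^'m) => complex"
	assumes r: "0 < r" "0 < p" and f[measurable]: "!!i. f i \<in> BM"
		and B: "!!n. blk p (%z. ennreal (vn r {..<n} (%i. norm (f i z)))) k l <= B"
	shows "blk p (lp_sum r f) k l <= B"
proof -
	let ?v = "%n z. vn r {..<n} (%i. norm (f i z))"
	have e: "lp_sum r f z = (SUP n. ennreal (?v n z))" for z
		unfolding lp_sum_SUP[OF r(1)] using epowr_sum_vn[OF r(1), of "%i. norm (f i z)"] by simp
	have inc: "ennreal (?v n z) <= ennreal (?v m z)" if "n <= m" for n m z
	proof -
		have "epowr (\<Sum>i<n. ennreal ( |norm (f i z)| powr r)) (1/r) <= epowr (\<Sum>i<m. ennreal ( |norm (f i z)| powr r)) (1/r)"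
			using r that by (intro epowr_mono sum_mono2) auto
		then show ?thesis unfolding epowr_sum_vn[OF r(1)] .
	qed
	have "blk p (lp_sum r f) k l = (NN z. (SUP n. epowr (ennreal (?v n z)) p*indicator (shell k \<times> shell l) z))"
		unfolding blk_def e epowr_SUP[OF r(2)] by (intro nn_integral_cong SUP_mult_right_ennreal)
	also have "... = (SUP n. blk p (%z. ennreal (?v n z)) k l)"
		unfolding blk_def
	proof (rule nn_integral_monotone_convergence_SUP)
		show "incseq (%n z. epowr (ennreal (?v n z)) p*indicator (shell k \<times> shell l) z)"
			using r inc by (intro monoI le_funI mult_right_mono epowr_mono) auto
		show "(%z. epowr (ennreal (?v n z)) p*indicator (shell k \<times> shell l) z) \<in> borel_measurable lborel" for n
		proof -
			have [measurable]: "shell k \<times> shell l \<in> sets (borel :: ((real^'n) \<times> (real^'m)) measure)" by (intro borel_Times) (auto simp: shell_def)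
			show ?thesis unfolding epowr_ennreal[OF nrm_nonneg] by measurable
		qed
	qed
	also have "... <= B" by (intro SUP_least B)
	finally show ?thesis .
qed

section \<open>Test functions and the complex operator\<close>

text \<open>Directional derivatives along basis vectors are continuous, hence bounded on the compact
  support, and they vanish off it; the sum of these bounds is a Lipschitz constant.\<close>

lemma smooth_compact_Lipschitz:
	fixes f :: "'a::euclidean_space => complex"
	assumes "smooth_compact f"
	obtains R L where "continuous_on UNIV f" "!!z. f z ~= 0 ==> norm z <= R" "0 <= L" "!!z w. norm (f z-f w) <= L*norm (z-w)"
proof -
	have ck: "Ck 0 f" "Ck (Suc 0) f" and cp: "compact (closure {x. f x ~= 0})" using assms by (auto simp only: smooth_compact_def)
	let ?S = "closure {x. f x ~= 0}" and ?D = "%x. frechet_derivative f (at x)"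
	have df: "(f has_derivative ?D x) (at x)" for x using ck(2) by (simp add: frechet_derivative_works)
	have zero: "?D x v = 0" if "x ~: ?S" for x v
	proof -
		have "((%x. 0) has_derivative (%v. 0)) (at x)" by simp
		then have "(f has_derivative (%v. 0)) (at x)"
			by (rule has_derivative_transform_within_open[of _ _ _ _ "- ?S"]) (use that closure_subset[of "{x. f x ~= 0}"] in auto)
		from frechet_derivative_at[OF this] show ?thesis by metis
	qed
	have "EX B. ALL x. norm (?D x b) <= B" for b
	proof -
		have "continuous_on ?S (%x. ?D x b)" using ck(2) by (auto intro: continuous_on_subset)
		then have "bounded ((%x. ?D x b) ` ?S)" using cp by (intro compact_imp_bounded compact_continuous_image)
		then obtain B where B: "!!x. x \<in> ?S ==> norm (?D x b) <= B" by (auto simp: bounded_iff)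
		have "norm (?D x b) <= max B 0" for x using B[of x] zero[of x b] by (cases "x \<in> ?S") auto
		then show ?thesis by blast
	qed
	then obtain B where B: "!!b x. norm (?D x b) <= B b" by metis
	define L where "L = (\<Sum>b\<in>Basis. B b)"
	have Db: "norm (?D x v) <= L*norm v" for x v
	proof -
		interpret D: linear "?D x" using df has_derivative_linear by blast
		have "?D x v = (\<Sum>b\<in>Basis. (v \<bullet> b) *\<^sub>R ?D x b)" by (subst euclidean_representation[of v, symmetric]) (simp add: D.sum D.scale del: euclidean_representation)
		also have "norm ... <= (\<Sum>b\<in>Basis. norm v * B b)"
			by (rule sum_norm_le) (auto intro!: mult_mono B Basis_le_norm)
		finally show ?thesis by (simp add: L_def sum_distrib_left mult.commute)
	qed
	have L0: "0 <= L" unfolding L_def using order_trans[OF norm_ge_zero B] by (intro sum_nonneg)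
	obtain R where R: "!!x. x \<in> ?S ==> norm x <= R" using compact_imp_bounded[OF cp] by (auto simp: bounded_iff)
	show thesis
	proof (rule that[of R L])
		show "continuous_on UNIV f" using ck(1) by simp
		show "norm z <= R" if "f z ~= 0" for z using R closure_subset[of "{x. f x ~= 0}"] that by auto
		show "norm (f z-f w) <= L*norm (z-w)" for z w
			by (rule differentiable_bound[of UNIV f ?D]) (use df Db L0 in \<open>auto intro!: onorm_bound\<close>)
	qed (rule L0)
qed

lemma Lc_Re_Im:
	fixes f :: "'a::euclidean_space => complex"
	assumes "smooth_compact f" shows "Lc (%z. Re (f z))" "Lc (%z. Im (f z))"
proof -
	obtain R L where f: "continuous_on UNIV f" "!!z. f z ~= 0 ==> norm z <= R" "0 <= L" "!!z w. norm (f z-f w) <= L*norm (z-w)"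
		using smooth_compact_Lipschitz[OF assms] by blast
	have "compact (f ` cball 0 R)" by (intro compact_continuous_image continuous_on_subset[OF f(1)]) auto
	then obtain B where B: "\<forall>z\<in>cball 0 R. norm (f z) <= B" by (auto simp: bounded_iff dest!: compact_imp_bounded)
	have b: "norm (f z) <= max B 0" for z using B[rule_format, of z] f(2)[of z] by (cases "f z = 0") auto
	have part: "Lc (%z. P (f z))" if P: "continuous_on UNIV P" "!!z. |P z| <= norm z" "!!z w. P z-P w = P (z-w)" for P :: "complex => real"
	proof -
		have "nice (%z. P (f z))"
		proof (rule niceI[of _ "max B 0" R])
			show "(%z. P (f z)) \<in> BM"
				by (intro borel_measurable_continuous_onI continuous_on_compose2[OF P(1) f(1)]) auto
			show "|P (f z)| <= max B 0" for z by (rule order_trans[OF P(2) b])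
			show "norm z <= R" if "P (f z) ~= 0" for z using P(2)[of "f z"] that f(2)[of z] by fastforce
		qed
		moreover have "|P (f z)-P (f w)| <= L*norm (z-w)" for z w unfolding P(3) by (rule order_trans[OF P(2) f(4)])
		ultimately show ?thesis using f(3) by (auto simp: Lc_def)
	qed
	show "Lc (%z. Re (f z))" "Lc (%z. Im (f z))"
		by (rule part; auto intro!: continuous_intros simp: abs_Re_le_cmod abs_Im_le_cmod)+
qed

text \<open>Elements of the space are Lebesgue measurable while the operator is built on Borel
  functions; this selects a Borel representative.\<close>

definition br :: "('a::euclidean_space => real) => 'a => real" where
	"br u = (SOME g. g \<in> BM & (AE z in lborel. g z = u z))"

lemma br:
	assumes "u \<in> borel_measurable lebesgue" shows "br u \<in> BM" "AE z in lborel. br u z = u z"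
proof -
	obtain g where "g \<in> borel_measurable lborel" "AE z in lborel. u z = g z" using completion_ex_borel_measurable_real[OF assms] by blast
	then have "EX g. g \<in> BM & (AE z in lborel. g z = u z)" by (auto intro!: exI[of _ g])
	from someI_ex[OF this] show "br u \<in> BM" "AE z in lborel. br u z = u z" unfolding br_def by blast+
qed

lemma ennreal_norm_le_lp_sum: assumes "0 < r" shows "ennreal (norm (f i z)) <= lp_sum r f z"
proof -
	have "norm (f i z) <= vn r {..<Suc i} (%i. norm (f i z))"
		using nrm_component[of r "{..<Suc i}" "{()}" i "()" "%i _. norm (f i z)"] assms by simp
	then have "ennreal (norm (f i z)) <= ennreal (vn r {..<Suc i} (%i. norm (f i z)))" by (rule ennreal_leI)
	also have "... <= lp_sum r f z" using assms by (intro vn_le_lp_sum) auto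
	finally show ?thesis .
qed

text \<open>The blocks, the weight, \<open>np\<close> and \<open>X\<close> do not involve the
  kernel, so both interpretations share them and facts stated with \<open>re\<close> serve the
  imaginary part too.\<close>

locale cz_pair = re: bicz "%x y. Re (K x y)" C0 et p r tw de c shell shell + im: bicz "%x y. Im (K x y)" C0 et p r tw de c shell shell
	for K :: "real^'n => real^'m => complex" and C0 et p r tw de c
begin

lemma np_blk: "AE z in lborel. ennreal |v z| <= F z ==> re.np (re.bl i j) v <= blk p F i j"
	unfolding re.np_def blk_def
proof (rule nn_integral_mono_AE, elim eventually_mono)
	fix z assume "ennreal |v z| <= F z"
	then have "epowr (ennreal |v z| ) p <= epowr (F z) p" using re.p by (intro epowr_mono) auto
	then show "ennreal (re.bl i j z)*ennreal ( |v z| powr p) <= epowr (F z) p*indicator (shell i \<times> shell j) z"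
		by (auto simp: epowr_ennreal split: split_indicator)
qed

lemma blk_np: "(!!z. 0 <= v z) ==> blk p (%z. ennreal (v z)) i j = re.np (re.bl i j) v"
	unfolding re.np_def blk_def by (intro nn_integral_cong) (auto simp: epowr_ennreal split: split_indicator)

definition Tc :: "((real^'n) \<times> (real^'m) => complex) => (real^'n) \<times> (real^'m) => complex" where
	"Tc f z = Complex (re.T (br (%z. Re (f z))) z-im.T (br (%z. Im (f z))) z) (im.T (br (%z. Re (f z))) z + re.T (br (%z. Im (f z))) z)"

definition Bd :: "((real^'n) \<times> (real^'m) => ennreal) => real => bool" where
	"Bd F D \<longleftrightarrow> 0 <= D & (ALL i j. blk p F i j <= ennreal (D*2 powr (tw * of_int (i + j))))"

definition Xc :: "((real^'n) \<times> (real^'m) => complex) => bool" where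
	"Xc f \<longleftrightarrow> f \<in> borel_measurable lebesgue & (EX D. Bd (%z. ennreal (norm (f z))) D)"

lemma np_Bd: "Bd F D ==> AE z in lborel. ennreal |v z| <= F z ==> re.np (re.bl i j) v <= ennreal (D*2 powr (tw * of_int (i + j)))"
	by (rule order_trans[OF np_blk]) (auto simp: Bd_def simp del: of_int_add)

lemma Bd_mono: "Bd G D ==> AE z in lborel. F z <= G z ==> Bd F D"
	unfolding Bd_def using re.p order_trans[OF blk_mono[of p F G]] by (auto simp del: of_int_add)

lemma br_Re_Im:
	assumes "f \<in> borel_measurable lebesgue"
	shows "br (%z. Re (f z)) \<in> BM" "AE z in lborel. br (%z. Re (f z)) z = Re (f z)"
		"br (%z. Im (f z)) \<in> BM" "AE z in lborel. br (%z. Im (f z)) z = Im (f z)"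
	using assms by (auto intro!: br)

lemma X_br: assumes "Xc f" shows "re.X (br (%z. Re (f z)))" "re.X (br (%z. Im (f z)))"
proof -
	obtain D where D: "Bd (%z. ennreal (norm (f z))) D" and f: "f \<in> borel_measurable lebesgue" using assms by (auto simp: Xc_def)
	note b = br_Re_Im[OF f]
	have "AE z in lborel. ennreal |br (%z. Re (f z)) z| <= ennreal (norm (f z))"
		using b(2) by eventually_elim (simp add: abs_Re_le_cmod ennreal_leI)
	from np_Bd[OF D this] show "re.X (br (%z. Re (f z)))" using D by (intro re.X_blocks[OF b(1)]) (auto simp: Bd_def)
	have "AE z in lborel. ennreal |br (%z. Im (f z)) z| <= ennreal (norm (f z))"
		using b(4) by eventually_elim (simp add: abs_Im_le_cmod ennreal_leI)
	from np_Bd[OF D this] show "re.X (br (%z. Im (f z)))" using D by (intro re.X_blocks[OF b(3)]) (auto simp: Bd_def)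
qed

lemma Tc_meas: assumes "Xc f" shows "Tc f \<in> BM"
proof -
	note [measurable] = re.T_meas[OF X_br(1)[OF assms]] re.T_meas[OF X_br(2)[OF assms]] im.T_meas[OF X_br(1)[OF assms]] im.T_meas[OF X_br(2)[OF assms]]
	show ?thesis unfolding borel_measurable_complex_iff Tc_def by simp
qed

lemma Xc_lp: assumes "!!i. f i \<in> borel_measurable lebesgue" "Bd (lp_sum r f) D" shows "Xc (f i)"
proof -
	have "Bd (%z. ennreal (norm (f i z))) D" using re.p by (intro Bd_mono[OF assms(2)] AE_I2 ennreal_norm_le_lp_sum) auto
	then show ?thesis using assms(1) by (auto simp: Xc_def)
qed

lemma Tc_bound: "EX C>0. ALL f D. (ALL i. f i \<in> borel_measurable lebesgue) --> Bd (lp_sum r f) D --> Bd (lp_sum r (%i. Tc (f i))) (C*D)"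
proof -
	show ?thesis
		using re.T_blocks[where 'i=nat] im.T_blocks[where 'i=nat]
	proof (elim exE conjE, goal_cases)
	case (1 C1 C2)
	note C1 = 1(1,2)[rule_format] and C2 = 1(3,4)[rule_format]
	define C where "C = max C1 C2"
	have C: "C > 0" "C1 <= C" "C2 <= C" using C1(1) by (auto simp: C_def)
	\<comment> \<open>Four real terms, each bounded with the constant \<open>C\<close>, are combined by
	  two levels of \<open>np_add\<close>, each costing \<open>2 powr p\<close>.\<close>
	define C' where "C' = 2 powr p*(2 powr p*(C + C) + 2 powr p*(C + C))"
	show ?thesis
	proof (intro exI[of _ C'] conjI allI impI)
		fix f D assume f: "ALL i. f i \<in> borel_measurable lebesgue" and D: "Bd (lp_sum r f) D"
		let ?a = "%i. br (%z. Re (f i z))" and ?b = "%i. br (%z. Im (f i z))"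
		have D0: "0 <= D" using D by (simp add: Bd_def)
		have Xf: "Xc (f i)" for i using Xc_lp f D by blast
		note X = X_br[OF Xf]
		have in_bd: "re.np (re.bl i j) (%z. vn r {..<n} (%q. g q z)) <= ennreal (D*2 powr (tw * of_int (i + j)))"
			if g: "!!q. AE z in lborel. |g q z| <= norm (f q z)" for g n i j
		proof -
			have "AE z in lborel. ALL q. |g q z| <= norm (f q z)" using g by (simp add: AE_all_countable)
			then have "AE z in lborel. ennreal |vn r {..<n} (%q. g q z)| <= lp_sum r f z"
				by eventually_elim (use re.p in \<open>simp add: vn_le_lp_sum\<close>)
			from np_Bd[OF D this] show ?thesis .
		qed
		have a: "re.np (re.bl i j) (%z. vn r {..<n} (%q. ?a q z)) <= ennreal (D*2 powr (tw * of_int (i + j)))" for n i j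
		proof (rule in_bd)
			fix q show "AE z in lborel. |?a q z| <= norm (f q z)"
				using br_Re_Im(2)[OF f[rule_format, of q]] by eventually_elim (simp add: abs_Re_le_cmod)
		qed
		have b: "re.np (re.bl i j) (%z. vn r {..<n} (%q. ?b q z)) <= ennreal (D*2 powr (tw * of_int (i + j)))" for n i j
		proof (rule in_bd)
			fix q show "AE z in lborel. |?b q z| <= norm (f q z)"
				using br_Re_Im(4)[OF f[rule_format, of q]] by eventually_elim (simp add: abs_Im_le_cmod)
		qed
		have "blk p (lp_sum r (%i. Tc (f i))) k l <= ennreal (C'*D*2 powr (tw * of_int (k + l)))" for k l
		proof (rule blk_lp_sum_le)
			fix n
			let ?E = "D*2 powr (tw * of_int (k + l))" and ?I = "{..<n} :: nat set"
			let ?u1 = "%z. vn r ?I (%i. re.T (?a i) z)" and ?u2 = "%z. vn r ?I (%i. im.T (?b i) z)"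
				and ?u3 = "%z. vn r ?I (%i. im.T (?a i) z)" and ?u4 = "%z. vn r ?I (%i. re.T (?b i) z)"
			have le1: "ennreal (C1*D*2 powr (tw * of_int (k + l))) <= ennreal (C*?E)" unfolding mult.assoc using C D0 by (intro ennreal_leI mult_right_mono) auto
			have le2: "ennreal (C2*D*2 powr (tw * of_int (k + l))) <= ennreal (C*?E)" unfolding mult.assoc using C D0 by (intro ennreal_leI mult_right_mono) auto
			have u: "re.np (re.bl k l) ?u1 <= ennreal (C*?E)" "re.np (re.bl k l) ?u4 <= ennreal (C*?E)"
				"re.np (re.bl k l) ?u2 <= ennreal (C*?E)" "re.np (re.bl k l) ?u3 <= ennreal (C*?E)"
				by (rule order_trans[OF C1(2) le1] order_trans[OF C2(2) le2]; use X D0 a b in simp)+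
			note [measurable] = re.T_meas[OF X(1)] re.T_meas[OF X(2)] im.T_meas[OF X(1)] im.T_meas[OF X(2)]
			have m[measurable]: "?u1 \<in> BM" "?u2 \<in> BM" "?u3 \<in> BM" "?u4 \<in> BM" by measurable
			have ab: "vn r ?I (%i. |v i| ) = vn r ?I v" for v by (simp add: nrm_def)
			have "vn r ?I (%i. norm (Tc (f i) z)) <= (?u1 z + ?u2 z) + (?u3 z + ?u4 z)" for z
			proof -
				have "vn r ?I (%i. norm (Tc (f i) z)) <= vn r ?I (%i. ( |re.T (?a i) z| + |im.T (?b i) z| ) + ( |im.T (?a i) z| + |re.T (?b i) z| ))"
				proof (rule nrm_mono)
					fix i
					have "norm (Tc (f i) z) <= |Re (Tc (f i) z)| + |Im (Tc (f i) z)|" by (rule cmod_le)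
					then show "|norm (Tc (f i) z)| <= |( |re.T (?a i) z| + |im.T (?b i) z| ) + ( |im.T (?a i) z| + |re.T (?b i) z| )|"
						by (simp add: Tc_def)
				qed (use re.p in simp)
				also have "... <= vn r ?I (%i. |re.T (?a i) z| + |im.T (?b i) z| ) + vn r ?I (%i. |im.T (?a i) z| + |re.T (?b i) z| )"
					using re.p by (intro nrm_triangle) auto
				also have "... <= (vn r ?I (%i. |re.T (?a i) z| ) + vn r ?I (%i. |im.T (?b i) z| )) + (vn r ?I (%i. |im.T (?a i) z| ) + vn r ?I (%i. |re.T (?b i) z| ))"
					using re.p by (intro add_mono nrm_triangle) auto
				finally show ?thesis unfolding ab .
			qed
			then have "re.np (re.bl k l) (%z. vn r ?I (%i. norm (Tc (f i) z))) <= re.np (re.bl k l) (%z. (?u1 z + ?u2 z) + (?u3 z + ?u4 z))"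
				by (intro re.np_mono AE_I2) (simp add: abs_of_nonneg)
			also have "... <= ennreal (2 powr p)*(ennreal (2 powr p)*(ennreal (C*?E) + ennreal (C*?E)) + ennreal (2 powr p)*(ennreal (C*?E) + ennreal (C*?E)))"
				by (intro order_trans[OF re.np_add] mult_left_mono add_mono u) (auto intro!: re.bl_meas)
			also have "... = ennreal (C'*?E)"
				using C D0 by (simp add: C'_def ennreal_mult[symmetric] ennreal_plus[symmetric] algebra_simps del: ennreal_plus)
			finally show "blk p (%z. ennreal (vn r {..<n} (%i. norm (Tc (f i) z)))) k l <= ennreal (C'*D*2 powr (tw * of_int (k + l)))"
				by (simp add: blk_np mult.assoc)
		qed (use re.p Tc_meas Xf in auto)
		then show "Bd (lp_sum r (%i. Tc (f i))) (C'*D)" using D0 C by (simp add: Bd_def C'_def)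
	qed (use C in \<open>auto simp: C'_def intro!: add_pos_pos\<close>)
	qed
qed

lemma Tc_bound1: "EX C>0. ALL f D. f \<in> borel_measurable lebesgue --> Bd (%z. ennreal (norm (f z))) D --> Bd (%z. ennreal (norm (Tc f z))) (C*D)"
proof -
	show ?thesis
		using Tc_bound
	proof (elim exE conjE, goal_cases)
	case (1 C)
	note C = 1(1,2)[rule_format]
	show ?thesis
	proof (intro exI[of _ C] conjI allI impI)
		fix f :: "(real^'n) \<times> (real^'m) => complex" and D assume f: "f \<in> borel_measurable lebesgue" and D: "Bd (%z. ennreal (norm (f z))) D"
		\<comment> \<open>A single function is a sequence with one nonzero entry, so the scalar bound is a
		  case of the vector-valued one.\<close>
		let ?f = "%i::nat. if i = 0 then f else (%_. 0)"
		have "lp_sum r ?f = (%z. ennreal (norm (f z)))"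
		proof
			fix z
			have "(\<Sum>i. ennreal (norm (?f i z) powr r)) = (\<Sum>i\<in>{0}. ennreal (norm (?f i z) powr r))" by (rule suminf_finite) auto
			then show "lp_sum r ?f z = ennreal (norm (f z))" using re.p by (simp add: lp_sum_def epowr_ennreal powr_powr)
		qed
		then have "Bd (lp_sum r (%i. Tc (?f i))) (C*D)" using C(2)[of ?f D] f D by simp
		then show "Bd (%z. ennreal (norm (Tc f z))) (C*D)"
			using re.p ennreal_norm_le_lp_sum[of r "%i. Tc (?f i)" 0] by (elim Bd_mono) auto
	qed (rule C(1))
	qed
qed

lemma Tc_cong:
	assumes f: "Xc f" and g: "Xc g" and e: "AE z in lborel. f z = g z" shows "AE z in lborel. Tc f z = Tc g z"
proof -
	note bf = br_Re_Im[OF f[unfolded Xc_def, THEN conjunct1]] and bg = br_Re_Im[OF g[unfolded Xc_def, THEN conjunct1]]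
	have 1: "AE z in lborel. br (%z. Re (f z)) z = br (%z. Re (g z)) z" using bf(2) bg(2) e by eventually_elim simp
	have 2: "AE z in lborel. br (%z. Im (f z)) z = br (%z. Im (g z)) z" using bf(4) bg(4) e by eventually_elim simp
	from re.T_cong[OF X_br(1)[OF f] X_br(1)[OF g] 1] im.T_cong[OF X_br(1)[OF f] X_br(1)[OF g] 1]
		re.T_cong[OF X_br(2)[OF f] X_br(2)[OF g] 2] im.T_cong[OF X_br(2)[OF f] X_br(2)[OF g] 2]
	show ?thesis by eventually_elim (simp add: Tc_def)
qed

lemma Tc_lin:
	assumes f: "Xc f" and g: "Xc g" shows "AE z in lborel. Tc (%z. a*f z + b*g z) z = a*Tc f z + b*Tc g z"
proof -
	let ?h = "%z. a*f z + b*g z"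
	have m: "f \<in> borel_measurable lebesgue" "g \<in> borel_measurable lebesgue" using f g by (auto simp: Xc_def)
	then have mh: "?h \<in> borel_measurable lebesgue" by measurable
	note bf = br_Re_Im[OF m(1)] and bg = br_Re_Im[OF m(2)] and bh = br_Re_Im[OF mh] and X = X_br[OF f] X_br[OF g]
	have 1: "AE z in lborel. br (%z. Re (?h z)) z = Re a*br (%z. Re (f z)) z + (- Im a)*br (%z. Im (f z)) z
			+ (Re b*br (%z. Re (g z)) z + (- Im b)*br (%z. Im (g z)) z)"
		using bf(2,4) bg(2,4) bh(2) by eventually_elim simp
	have 2: "AE z in lborel. br (%z. Im (?h z)) z = Im a*br (%z. Re (f z)) z + Re a*br (%z. Im (f z)) z
			+ (Im b*br (%z. Re (g z)) z + Re b*br (%z. Im (g z)) z)"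
		using bf(2,4) bg(2,4) bh(4) by eventually_elim simp
	from re.T_lin4[OF X bh(1) 1] im.T_lin4[OF X bh(1) 1] re.T_lin4[OF X bh(3) 2] im.T_lin4[OF X bh(3) 2]
	show ?thesis by eventually_elim (simp add: Tc_def complex_eq_iff algebra_simps)
qed

text \<open>A compact set off the axes is bounded and keeps a distance from both axes, so it meets
  finitely many blocks, on each of which the p-th power is integrable.\<close>

lemma Lp_loc_Tc: assumes f: "Xc f" shows "Tc f \<in> Lp_loc_off_axes p"
	unfolding Lp_loc_off_axes_def
proof (intro CollectI conjI allI impI)
	have Tm[measurable]: "Tc f \<in> BM" by (rule Tc_meas[OF f])
	show "Tc f \<in> borel_measurable lebesgue" using Tm by (intro measurable_completion) simp
	obtain D where D: "Bd (%z. ennreal (norm (Tc f z))) D" using Tc_bound1 f unfolding Xc_def by blast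
	fix S :: "((real^'n) \<times> (real^'m)) set" assume S: "compact S" "S \<subseteq> (- {0}) \<times> (- {0})"
	have rng: "EX N. \<forall>z\<in>S. ALL i. h z \<in> shell i --> i \<in> {- N..N}"
		if h: "continuous_on S h" "!!z. z \<in> S ==> h z ~= 0" and an: "ann c (shell :: int => (real^'k) set)" for h :: "_ => real^'k"
	proof -
		have cp: "compact (h ` S)" using S(1) h(1) by (intro compact_continuous_image)
		then obtain b where b: "\<forall>z\<in>S. norm (h z) <= b" by (auto simp: bounded_iff dest!: compact_imp_bounded)
		have "open (- (h ` S))" "0 \<in> - (h ` S)" using cp h(2) by (auto intro: compact_imp_closed)
		then obtain e where e: "e > 0" "ball 0 e \<subseteq> - (h ` S)" using openE by blast
		then have e': "e <= norm (h z)" if "z \<in> S" for z using that by (auto simp: subset_iff not_less)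
		obtain k1 where k1: "b < sc k1" using sc_unbounded by blast
		obtain k2 where k2: "1/e < sc k2" using sc_unbounded by blast
		then have k2': "sc (- k2) < e" using e(1) by (simp add: sc_def powr_minus field_simps)
		have "i \<in> {- ( |k1| + |k2| + c)..|k1| + |k2| + c}" if z: "z \<in> S" "h z \<in> shell i" for z i
		proof -
			have n: "sc (i-c) <= norm (h z)" "norm (h z) <= sc (i + c)" using an z(2) by (auto simp: ann_def)
			have "\<not> k1 <= i-c" using sc_mono[of k1 "i-c"] n(1) b[rule_format, OF z(1)] k1 by linarith
			moreover have "\<not> i + c <= - k2" using sc_mono[of "i + c" "- k2"] n(2) e'[OF z(1)] k2' by linarith
			ultimately show ?thesis by auto
		qed
		then show ?thesis by blast
	qed
	obtain N where N: "!!z i. z \<in> S ==> fst z \<in> shell i ==> i \<in> {- N..N}"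
		using rng[of fst, OF _ _ re.S] S(2) by (force intro: continuous_on_fst continuous_on_id)
	obtain M where M: "!!z i. z \<in> S ==> snd z \<in> shell i ==> i \<in> {- M..M}"
		using rng[of snd, OF _ _ re.S'] S(2) by (force intro: continuous_on_snd continuous_on_id)
	let ?F = "%z. epowr (ennreal (norm (Tc f z))) p"
	let ?G = "%z. \<Sum>u\<in>{- N..N} \<times> {- M..M}. ?F z*indicator (shell (fst u) \<times> shell (snd u)) z"
	have sm: "shell i \<times> shell j \<in> sets (borel :: ((real^'n) \<times> (real^'m)) measure)" for i j by (intro borel_Times) (auto simp: shell_def)
	have "(\<integral>\<^sup>+z. epowr (ennreal (norm (Tc f z))*indicator S z) p \<partial>lebesgue) <= (NN z. ?G z)"
		unfolding nn_integral_completion epowr_indicator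
	proof (rule nn_integral_mono)
		fix z
		show "?F z*indicator S z <= ?G z"
		proof (cases "z \<in> S")
			case True
			have "(\<Union>k. shell k) = - {0 :: real^'n}" "(\<Union>k. shell k) = - {0 :: real^'m}" using re.S re.S' by (simp_all add: ann_def)
			moreover have "fst z \<in> - {0}" "snd z \<in> - {0}" using S(2) True by auto
			ultimately obtain i j where ij: "fst z \<in> shell i" "snd z \<in> shell j" by blast
			have "?F z*indicator (shell (fst (i, j)) \<times> shell (snd (i, j))) z <= ?G z"
				by (rule member_le_sum) (use N[OF True ij(1)] M[OF True ij(2)] in auto)
			then show ?thesis using ij True by (cases z) auto
		qed simp
	qed
	also have "... = (\<Sum>u\<in>{- N..N} \<times> {- M..M}. blk p (%z. ennreal (norm (Tc f z))) (fst u) (snd u))"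
		unfolding blk_def by (subst nn_integral_sum) (use sm in \<open>auto simp: epowr_ennreal intro!: borel_measurable_times borel_measurable_indicator\<close>)
	also have "... < \<infinity>" using D le_less_trans[OF _ ennreal_less_top] unfolding Bd_def infinity_ennreal_def by (subst ennreal_sum_less_top) blast+
	finally show "Lp_norm p (%z. ennreal (norm (Tc f z))*indicator S z) < \<infinity>"
		by (auto simp: Lp_norm_def epowr_def less_top[symmetric])
qed

text \<open>The truncated integral splits into four real ones, whose limits are known for the
  Lipschitz functions \<open>Re\<close> and \<open>Im\<close> of \<open>f\<close>;
  \<open>T_cong\<close> passes to their Borel representatives.\<close>

lemma Tc_pv: "extends_pv Tc K"
	unfolding extends_pv_def AE_completion_iff
proof (intro allI impI)
	fix f :: "(real^'n) \<times> (real^'m) => complex" assume "smooth_compact f"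
	note L = Lc_Re_Im[OF this]
	then have n: "nice (%z. Re (f z))" "nice (%z. Im (f z))" by (auto simp: Lc_def)
	have m: "(%z. Re (f z)) \<in> borel_measurable lebesgue" "(%z. Im (f z)) \<in> borel_measurable lebesgue"
		using n[THEN nice_meas] by (auto intro!: measurable_completion)
	note b = br[OF m(1)] br[OF m(2)]
	have X: "re.X (%z. Re (f z))" "re.X (%z. Im (f z))" using n by (auto intro: re.X_nice)
	have "re.np re.w0 (br (%z. Re (f z))) <= re.np re.w0 (%z. Re (f z))" by (rule re.np_mono, use b(2) in eventually_elim) simp
	moreover have "re.np re.w0 (br (%z. Im (f z))) <= re.np re.w0 (%z. Im (f z))" by (rule re.np_mono, use b(4) in eventually_elim) simp
	ultimately have Xb: "re.X (br (%z. Re (f z)))" "re.X (br (%z. Im (f z)))" using X b by (auto simp: re.X_def le_less_trans)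
	let ?A = "%e1 e2. {w. norm (fst w) > e1 & norm (snd w) > e2} :: ((real^'n) \<times> (real^'m)) set"
	let ?I = "%P Q z e1 e2. LINT w:?A e1 e2|lborel. P (f (z-w))*Q (K (fst w) (snd w))"
	have tr: "truncated_conv K e1 e2 f z = Complex (?I Re Re z e1 e2-?I Im Im z e1 e2) (?I Re Im z e1 e2 + ?I Im Re z e1 e2)" if s: "0 < e1" "0 < e2" for e1 e2 z
	proof -
		note i = set_integrable_truncated[OF re.K n(1) s, of z] set_integrable_truncated[OF im.K n(1) s, of z]
			set_integrable_truncated[OF re.K n(2) s, of z] set_integrable_truncated[OF im.K n(2) s, of z]
		have "truncated_conv K e1 e2 f z = (LINT w:?A e1 e2|lborel. Complex (Re (f (z-w))*Re (K (fst w) (snd w))-Im (f (z-w))*Im (K (fst w) (snd w)))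
				(Re (f (z-w))*Im (K (fst w) (snd w)) + Im (f (z-w))*Re (K (fst w) (snd w))))"
			unfolding truncated_conv_def by (intro arg_cong[of _ _ "%g. LBINT w:_. g w"] ext) (simp add: complex_eq_iff)
		also have "... = Complex (?I Re Re z e1 e2-?I Im Im z e1 e2) (?I Re Im z e1 e2 + ?I Im Re z e1 e2)"
			using set_lebesgue_integral_Complex[OF set_integral_diff(1)[OF i(1,4)] set_integral_add(1)[OF i(2,3)]] set_integral_diff(2)[OF i(1,4)] set_integral_add(2)[OF i(2,3)] by simp
		finally show ?thesis .
	qed
	have ev: "\<forall>\<^sub>F e in at_right 0 \<times>\<^sub>F at_right 0. 0 < (fst e :: real) & 0 < (snd e :: real)"
		by (rule eventually_prodI[of "%x::real. 0 < x" _ "%x::real. 0 < x", simplified]) (auto simp: eventually_at_right_less)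
	from re.T_pv[OF L(1)] re.T_pv[OF L(2)] im.T_pv[OF L(1)] im.T_pv[OF L(2)]
		re.T_cong[OF Xb(1) X(1) b(2)] re.T_cong[OF Xb(2) X(2) b(4)] im.T_cong[OF Xb(1) X(1) b(2)] im.T_cong[OF Xb(2) X(2) b(4)]
	show "AE z in lborel. ((%(e1, e2). truncated_conv K e1 e2 f z) \<longlongrightarrow> Tc f z) (at_right 0 \<times>\<^sub>F at_right 0)"
	proof eventually_elim
		case (elim z)
		have "((%e. Complex (?I Re Re z (fst e) (snd e)-?I Im Im z (fst e) (snd e)) (?I Re Im z (fst e) (snd e) + ?I Im Re z (fst e) (snd e))) \<longlongrightarrow> Tc f z) (at_right 0 \<times>\<^sub>F at_right 0)"
			unfolding Tc_def elim(5-8) using elim(1-4) unfolding case_prod_beta' by (intro tendsto_Complex tendsto_add tendsto_diff)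
		then show ?case
			by (rule Lim_transform_eventually) (use ev in eventually_elim, simp add: tr case_prod_beta')
	qed
qed

end

theorem theorem5p5:
  fixes K :: "real^'n \<Rightarrow> real^'m \<Rightarrow> complex"
    and \<alpha> lam p\<^sub>0 p q :: real
  assumes "bi_CZ_kernel K"
    and "1 < p\<^sub>0" "p\<^sub>0 < p" "p\<^sub>0 < q"
    and "0 < lam" "lam < min (\<alpha> + CARD('n) / p) (\<alpha> + CARD('m) / p)"
    and "max (- (CARD('n) / p)) (- (CARD('m) / p)) < \<alpha>"
    and "\<alpha> < min (CARD('n) * (1 / p\<^sub>0 - 1 / p)) (CARD('m) * (1 / p\<^sub>0 - 1 / p))"
  shows "\<exists>T. extends_pv T K \<and> bounded_linear_operator_on_morrey_herz \<alpha> lam p q T \<and>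
           (\<exists>C::real. C > 0 \<and>
              (\<forall>f. (\<forall>i. f i \<in> morrey_herz \<alpha> lam p q) \<longrightarrow>
                 morrey_herz_norm \<alpha> lam p q (lp_sum p\<^sub>0 (\<lambda>i. T (f i)))
                   \<le> ennreal C * morrey_herz_norm \<alpha> lam p q (lp_sum p\<^sub>0 f)))"
proof -
	have p: "0 < p" "1 < p" "0 < q" using assms(2-4) by auto
	\<comment> \<open>The growth exponent that \<open>blk_le_morrey_herz\<close> gives for p-th powers
	  of block norms.\<close>
	define tw where "tw = (lam-\<alpha>)*p"
	\<comment> \<open>The first inequality is the upper bound on \<open>lam\<close>. The second uses
	  the upper bound on \<open>\<alpha>\<close> together with \<open>1/p\<^sub>0 < 1\<close> and
	  \<open>lam > 0\<close>.\<close>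
	have ts: "0 < n-tw" "0 < n*(p-1) + tw" if "lam < \<alpha> + n/p" "\<alpha> < n*(1/p\<^sub>0-1/p)" "0 < n" for n
	proof -
		have "lam-\<alpha> < n/p" using that(1) by linarith
		then show "0 < n-tw" using p(1) by (simp add: tw_def pos_less_divide_eq)
		have "n*(1/p\<^sub>0-1/p) < n*(1-1/p)" using that(3) assms(2) by (intro mult_strict_left_mono) auto
		then have "\<alpha>*p < n*(1-1/p)*p" using that(2) p(1) by (intro mult_strict_right_mono) auto
		moreover have "0 < lam*p" using assms(5) p(1) by simp
		ultimately show "0 < n*(p-1) + tw" using p(1) by (simp add: tw_def algebra_simps)
	qed
	note n = ts[of "real CARD('n)"] and m = ts[of "real CARD('m)"]
	\<comment> \<open>Half of the smallest of the four positive margins.\<close>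
	define de where "de = Min {CARD('n)-tw, CARD('n)*(p-1) + tw, CARD('m)-tw, CARD('m)*(p-1) + tw}/2"
	have de: "0 < de" unfolding de_def using n m assms(6,8) by simp
	have de2: "2*de <= CARD('n)-tw" "2*de <= CARD('n)*(p-1) + tw" "2*de <= CARD('m)-tw" "2*de <= CARD('m)*(p-1) + tw"
		by (simp_all add: de_def)
	define c where "c = int (max CARD('n) CARD('m)) + 2"
	obtain C0 et where K: "rk C0 et (%x y. Re (K x y))" "rk C0 et (%x y. Im (K x y))" using rk_Re_Im[OF assms(1)] by blast
	have an: "ann c (shell :: int => (real^'n) set)" "ann c (shell :: int => (real^'m) set)" by (auto intro!: ann_shell simp: c_def)
	interpret cz_pair K C0 et p p\<^sub>0 tw de c
		by (intro cz_pair.intro bicz.intro p(2) assms(2) K an de) (simp_all add: de2)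
	let ?N = "morrey_herz_norm \<alpha> lam p q :: ((real^'n) \<times> (real^'m) => ennreal) => ennreal"
	have "EX c>0. ALL (F :: (real^'n) \<times> (real^'m) => ennreal) D. Bd F D --> ?N F <= ennreal (c*D powr (1/p))"
		unfolding Bd_def imp_conjL unfolding tw_def by (rule morrey_herz_le_blk[OF assms(5) p(1,3)])
	then obtain c1 where c1: "c1 > 0" "!!(F :: (real^'n) \<times> (real^'m) => ennreal) D. Bd F D ==> ?N F <= ennreal (c1*D powr (1/p))" by blast
	let ?M = "morrey_herz \<alpha> lam p q :: ((real^'n) \<times> (real^'m) => complex) set"
	have Bd_N: "Bd F (M powr p)" if "?N F <= ennreal M" "0 <= M" for F M
		unfolding Bd_def unfolding tw_def using blk_le_morrey_herz[OF p(1,3) that(2,1)] by simp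
	\<comment> \<open>Transfers a block estimate to the norms by passing through \<open>Bd\<close> in
	  both directions. If the norm of \<open>F\<close> is infinite, the right-hand side is
	  infinite.\<close>
	have step: "?N G <= ennreal (c1*C powr (1/p))*?N F" if C: "C > 0" "!!D. Bd F D ==> Bd G (C*D)" for F G C
	proof (cases "?N F")
		case (real M)
		have "?N G <= ennreal (c1*(C*M powr p) powr (1/p))" using real by (intro c1 C Bd_N) auto
		also have "c1*(C*M powr p) powr (1/p) = c1*C powr (1/p)*M" using real(1) p(1) by (simp add: powr_mult powr_powr)
		finally show ?thesis using real c1(1) by (simp add: ennreal_mult)
	qed (use c1(1) C(1) in \<open>simp add: ennreal_mult_top\<close>)
	have Xc: "Xc f" if "f \<in> ?M" for f
	proof (cases "?N (%z. ennreal (norm (f z)))")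
		case (real M)
		then have "Bd (%z. ennreal (norm (f z))) (M powr p)" by (intro Bd_N) auto
		then show ?thesis using that by (auto simp: morrey_herz_def Lp_loc_off_axes_def Xc_def)
	qed (use that in \<open>simp add: morrey_herz_def\<close>)
	have meas: "f \<in> borel_measurable lebesgue" if "f \<in> ?M" for f using Xc[OF that] by (simp add: Xc_def)
	obtain C1 where C1: "C1 > 0" "!!f D. f \<in> borel_measurable lebesgue ==> Bd (%z. ennreal (norm (f z))) D ==> Bd (%z. ennreal (norm (Tc f z))) (C1*D)"
		using Tc_bound1 by blast
	obtain C2 where C2: "C2 > 0" "!!f D. (!!i. f i \<in> borel_measurable lebesgue) ==> Bd (lp_sum p\<^sub>0 f) D ==> Bd (lp_sum p\<^sub>0 (%i. Tc (f i))) (C2*D)"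
		using Tc_bound by blast
	have bd: "?N (%z. ennreal (norm (Tc f z))) <= ennreal (c1*C1 powr (1/p))*?N (%z. ennreal (norm (f z)))" if "f \<in> ?M" for f
		using C1 meas[OF that] by (intro step) auto
	have "bounded_linear_operator_on_morrey_herz \<alpha> lam p q Tc"
		unfolding bounded_linear_operator_on_morrey_herz_def AE_completion_iff
	proof (intro conjI ballI allI impI exI)
		fix f assume f: "f \<in> ?M"
		have "?N (%z. ennreal (norm (Tc f z))) < \<infinity>"
			using f by (intro le_less_trans[OF bd[OF f]]) (auto simp: morrey_herz_def ennreal_mult_less_top)
		then show "Tc f \<in> ?M" using Lp_loc_Tc[OF Xc[OF f]] by (simp add: morrey_herz_def)
	qed (use Tc_cong Tc_lin Xc bd in auto)
	moreover have "?N (lp_sum p\<^sub>0 (%i. Tc (f i))) <= ennreal (c1*C2 powr (1/p))*?N (lp_sum p\<^sub>0 f)" if "ALL i. f i \<in> ?M" for f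
		using C2 meas that by (intro step) auto
	moreover have "c1*C2 powr (1/p) > 0" using c1(1) C2(1) by simp
	ultimately show ?thesis using Tc_pv by blast
qed

end
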